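(* Let $n\in\mathbb N$ and let $T>0$, $M>0$ be deterministic. Let $u$ be the maximal solution of the unreflected problem described in the context. For $p\ge2$, the cut-off stochastic integral equation $$u_n(x,t)=\int_{\mathcal D}u_0(y)G(x,y,t)\,dy+\int_0^t\!\int_{\mathcal D}u_y(0,s)\,G_y(x,y,t-s)\,y\,T_n\big(y^{-1}u_n(y,s)\big)\,dy\,ds+\int_0^t\!\int_{\mathcal D}G(x,y,t-s)\sigma(y)\,W(dy,ds),$$ for $x\in\mathcal D$, $t\in[0,\min\{T,\tau_M\})$, $\omega\in\Omega_M$, has a unique solution $u_n\in L^p\big(\Omega_M;C([0,\min\{T,\tau_M\});\mathcal H)\big)$. In particular, $$\sup_{t\in[0,\min\{T,\tau_M\})}E\big(\|u_n(\cdot,t)\|_{L^\infty(\mathcal D)}^p\big)<+\infty.$$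
   Context: $\alpha>0$, $\lambda>0$ are constants, $\mathcal D=(0,\lambda)$, $\overline{\mathcal D}=[0,\lambda]$. $G$ is the Green's function of $v_t=\alpha v_{xx}$ on $[0,\lambda]$ with Dirichlet boundary conditions, $G(x,y,t-s)=\frac2\lambda\sum_{k\ge1}\sin(\tfrac{k\pi}{\lambda}y)\sin(\tfrac{k\pi}{\lambda}x)e^{-\alpha(\pi/\lambda)^2k^2(t-s)}$ for $s<t$; $G_y$ is its $y$-derivative. $\dot W$ is a space-time white noise on $\mathcal D\times[0,\infty)$. Standing assumptions: $\sigma\in C(\overline{\mathcal D})$ is real-valued, differentiable at $0$, $\sigma(0)=\sigma(\lambda)=0$; $u_0$ is deterministic, non-negative, in $C_c^\infty(\overline{\mathcal D})$ (smooth, compactly supported in $\mathcal D$). $\mathcal H=\{f\in C(\overline{\mathcal D}): f'(0)\text{ exists},\ f(0)=f(\lambda)=0\}$ with $\|f\|_{\mathcal H}=\sup_{x\in\mathcal D}|f(x)/x|$. Unreflected problem: $u$ is the maximal solution, with $u(\cdot,t)\in\mathcal H$, of $$u(x,t)=\int_{\mathcal D}u_0(y)G(x,y,t)dy+\int_0^t\!\int_{\mathcal D}u_y(0,s)G_y(x,y,t-s)u(y,s)dyds+\int_0^t\!\int_{\mathcal D}G(x,y,t-s)\sigma(y)W(dy,ds)$$ on $[0,\sup_{M>0}\tau_M)$, where $u_x(0,t)=u_x(0^+,t)=\lim_{x\to0^+}u(x,t)/x$ and $\tau_M=\inf\{S\ge0:\sup_{r\in[0,S)}|u_x(0^+,r)|\ge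 M\}$. In the cut-off equation, $u_y(0,s)$ is the derivative at $0$ of this $u$. $\Omega_M=\{\omega\in\Omega:\sup_{t\in[0,\min\{T,\tau_M\})}|u_x(0^+,t,\omega)|<M\}$, where $\Omega$ is the sample space; the paper works with $\Omega_M$ as the underlying sample space, so $P(\Omega_M)=1$ and $E$ is expectation over $\Omega_M$. Cut-off: $H_n:\mathbb R\to\mathbb R^+$ is a $C^1$ function with $0\le H_n\le1$, $|H_n'|\le2$, $H_n(v)=1$ for $|v|<n$, $H_n(v)=0$ for $|v|>n+1$; $T_n(v)=H_n(v)v$. The norm on $L^p(\Omega_M;C([0,\min\{T,\tau_M\});\mathcal H))$ is $\big(E\sup_{t\in[0,\min\{T,\tau_M\})}\|v(\cdot,t)\|_{\mathcal H}^p\big)^{1/p}$, the supremum being taken pathwise. When an expectation is taken at a fixed time, $t\in[0,\min\{T,\tau_M\})$ means a deterministic $t\ge0$ with $t<\min\{T,\tau_M\}$ almost surely on $\Omega_M$. *)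

theory Defs
  imports "HOL-Probability.Probability"
begin

text \<open>Throughout, the spatial domain is \<open>{0<..<L}\<close> (the length \<open>\<lambda>\<close> of the source is
  called \<open>L\<close>), \<open>P\<close> is a probability measure, and random fields are written
  \<open>u x t \<omega>\<close>. Random time intervals \<open>[0, \<zeta> \<omega>)\<close> have their right end point in \<open>ereal\<close>; the
  values of a field at times \<open>t \<ge> \<zeta> \<omega>\<close> are irrelevant.\<close>

section \<open>Dirichlet heat kernel\<close>

text \<open>The series starts at \<open>k = 1\<close>, hence the \<open>Suc k\<close>; \<open>r\<close> stands for \<open>t - s > 0\<close>.\<close>

definition heat_green :: "real \<Rightarrow> real \<Rightarrow> real \<Rightarrow> real \<Rightarrow> real \<Rightarrow> real" where
  "heat_green \<alpha> L x y r =
     2 / L * (\<Sum>k. sin (real (Suc k) * pi / L * y) * sin (real (Suc k) * pi / L * x)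
                    * exp (- \<alpha> * (pi / L)\<^sup>2 * (real (Suc k))\<^sup>2 * r))"

definition heat_green_y :: "real \<Rightarrow> real \<Rightarrow> real \<Rightarrow> real \<Rightarrow> real \<Rightarrow> real" where
  "heat_green_y \<alpha> L x y r = deriv (\<lambda>z. heat_green \<alpha> L x z r) y"

text \<open>At \<open>t = 0\<close> the kernel \<open>G(x,\<cdot>,0)\<close> is the Dirac mass at \<open>x\<close> (the series diverges),
  so the initial term is \<open>u0 x\<close>.\<close>

definition heat_initial :: "real \<Rightarrow> real \<Rightarrow> (real \<Rightarrow> real) \<Rightarrow> real \<Rightarrow> real \<Rightarrow> real" where
  "heat_initial \<alpha> L u0 x t =
     (if t = 0 then u0 x
      else set_lebesgue_integral lborel {0<..<L} (\<lambda>y. u0 y * heat_green \<alpha> L x y t))"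


section \<open>Space-time white noise and the Wiener integral\<close>

text \<open>Space-time points are pairs \<open>(y, s)\<close>. White noise is an independently scattered Gaussian
  random measure with Lebesgue measure as its control measure. The null-set case is separate since
  \<open>normal_density\<close> needs a positive standard deviation.\<close>

definition noise_sets :: "real \<Rightarrow> (real \<times> real) set set" where
  "noise_sets L = {A \<in> sets borel. A \<subseteq> {0<..<L} \<times> {0..} \<and> emeasure lborel A < \<infinity>}"

definition space_time_white_noise ::
    "'a measure \<Rightarrow> real \<Rightarrow> ((real \<times> real) set \<Rightarrow> 'a \<Rightarrow> real) \<Rightarrow> bool" where
  "space_time_white_noise P L W \<longleftrightarrow>
     (\<forall>A \<in> noise_sets L. W A \<in> borel_measurable P \<and>
        (if measure lborel A = 0 then (AE \<omega> in P. W A \<omega> = 0)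
         else distributed P lborel (W A)
                (\<lambda>z. ennreal (normal_density 0 (sqrt (measure lborel A)) z)))) \<and>
     (\<forall>\<A>. finite \<A> \<and> \<A> \<subseteq> noise_sets L \<and> disjoint \<A> \<longrightarrow>
        prob_space.indep_vars P (\<lambda>_. borel) W \<A>) \<and>
     (\<forall>A \<in> noise_sets L. \<forall>B \<in> noise_sets L. A \<inter> B = {} \<longrightarrow>
        (AE \<omega> in P. W (A \<union> B) \<omega> = W A \<omega> + W B \<omega>))"

text \<open>The integrands are deterministic, so the stochastic integral is the Wiener integral: the
  mean-square limit of the elementary integrals \<open>\<Sum>c. c * W {g = c}\<close> of simple functions \<open>g\<close>.
  It is determined up to a null set; \<open>wiener_integral\<close> picks a representative.\<close>

definition wiener_simple ::
    "((real \<times> real) set \<Rightarrow> 'a \<Rightarrow> real) \<Rightarrow> (real \<times> real \<Rightarrow> real) \<Rightarrow> 'a \<Rightarrow> real" where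
  "wiener_simple W g \<omega> = (\<Sum>c \<in> range g - {0}. c * W (g -` {c}) \<omega>)"

definition has_wiener_integral ::
    "'a measure \<Rightarrow> ((real \<times> real) set \<Rightarrow> 'a \<Rightarrow> real) \<Rightarrow> (real \<times> real) set
      \<Rightarrow> (real \<times> real \<Rightarrow> real) \<Rightarrow> ('a \<Rightarrow> real) \<Rightarrow> bool" where
  "has_wiener_integral P W S f X \<longleftrightarrow>
     X \<in> borel_measurable P \<and>
     (\<exists>g. (\<forall>k. simple_function borel (g k) \<and> (\<forall>z. z \<notin> S \<longrightarrow> g k z = 0)
               \<and> emeasure lborel {z. g k z \<noteq> 0} < \<infinity>) \<and>
          (\<lambda>k. \<integral>\<^sup>+ z\<in>S. ennreal ((g k z - f z)\<^sup>2) \<partial>lborel) \<longlonglongrightarrow> 0 \<and>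
          (\<lambda>k. \<integral>\<^sup>+ \<omega>. ennreal ((wiener_simple W (g k) \<omega> - X \<omega>)\<^sup>2) \<partial>P) \<longlonglongrightarrow> 0)"

definition wiener_integral ::
    "'a measure \<Rightarrow> ((real \<times> real) set \<Rightarrow> 'a \<Rightarrow> real) \<Rightarrow> (real \<times> real) set
      \<Rightarrow> (real \<times> real \<Rightarrow> real) \<Rightarrow> 'a \<Rightarrow> real" where
  "wiener_integral P W S f = (SOME X. has_wiener_integral P W S f X)"


section \<open>The space \<open>H\<close>, its norm, and \<open>H\<close>-valued random fields\<close>

definition H_space :: "real \<Rightarrow> (real \<Rightarrow> real) set" where
  "H_space L = {f. continuous_on {0..L} f \<and> f differentiable (at 0 within {0..L})
                   \<and> f 0 = 0 \<and> f L = 0}"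

definition H_norm :: "real \<Rightarrow> (real \<Rightarrow> real) \<Rightarrow> ennreal" where
  "H_norm L f = (SUP x \<in> {0<..<L}. ennreal \<bar>f x / x\<bar>)"

definition Linf_norm :: "real \<Rightarrow> (real \<Rightarrow> real) \<Rightarrow> ennreal" where
  "Linf_norm L f = esssup (restrict_space lborel {0<..<L}) (\<lambda>x. ennreal \<bar>f x\<bar>)"

text \<open>Real powers of extended non-negative numbers, for exponents \<open>p > 0\<close>.\<close>

definition ennpowr :: "ennreal \<Rightarrow> real \<Rightarrow> ennreal" where
  "ennpowr a p = (if a = \<infinity> then \<infinity> else ennreal (enn2real a powr p))"

text \<open>Paths in \<open>C([0,\<zeta>); H)\<close>.\<close>

definition H_paths :: "real \<Rightarrow> ereal \<Rightarrow> (real \<Rightarrow> real \<Rightarrow> real) set" where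
  "H_paths L \<zeta> = {v. \<forall>t. 0 \<le> t \<and> ereal t < \<zeta> \<longrightarrow>
      (\<lambda>x. v x t) \<in> H_space L \<and>
      ((\<lambda>s. H_norm L (\<lambda>x. v x s - v x t)) \<longlongrightarrow> 0) (at t within {s. 0 \<le> s \<and> ereal s < \<zeta>})}"

definition H_process ::
    "'a measure \<Rightarrow> real \<Rightarrow> ('a \<Rightarrow> ereal) \<Rightarrow> (real \<Rightarrow> real \<Rightarrow> 'a \<Rightarrow> real) \<Rightarrow> bool" where
  "H_process Q L \<zeta> v \<longleftrightarrow>
     (\<forall>x \<in> {0<..<L}. \<forall>t \<ge> 0.
        (\<lambda>\<omega>. if ereal t < \<zeta> \<omega> then v x t \<omega> else 0) \<in> borel_measurable Q) \<and>
     (AE \<omega> in Q. (\<lambda>x t. v x t \<omega>) \<in> H_paths L (\<zeta> \<omega>))"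

text \<open>Membership in \<open>L^p(\<Omega>; C([0,\<zeta>); H))\<close>, the expectation being taken under \<open>Q\<close>.\<close>

definition in_Lp_C_H ::
    "'a measure \<Rightarrow> real \<Rightarrow> real \<Rightarrow> ('a \<Rightarrow> ereal) \<Rightarrow> (real \<Rightarrow> real \<Rightarrow> 'a \<Rightarrow> real) \<Rightarrow> bool" where
  "in_Lp_C_H Q L p \<zeta> v \<longleftrightarrow>
     H_process Q L \<zeta> v \<and>
     (\<integral>\<^sup>+ \<omega>. (SUP t \<in> {t. 0 \<le> t \<and> ereal t < \<zeta> \<omega>}. ennpowr (H_norm L (\<lambda>x. v x t \<omega>)) p) \<partial>Q) < \<infinity>"


section \<open>Mild equations\<close>

text \<open>The field \<open>v\<close> satisfies, for all \<open>x\<close> and \<open>t\<close>, almost surely under \<open>Q\<close> on \<open>t < \<zeta>\<close>, the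
  integral equation whose drift is \<open>\<integral>\<integral> G_y(x,y,t-s) b(y,s) dy ds\<close>. The Wiener integral is formed
  under \<open>P\<close>, the measure for which \<open>W\<close> is a white noise.\<close>

definition mild_equation ::
    "'a measure \<Rightarrow> 'a measure \<Rightarrow> ((real \<times> real) set \<Rightarrow> 'a \<Rightarrow> real) \<Rightarrow> real \<Rightarrow> real
      \<Rightarrow> (real \<Rightarrow> real) \<Rightarrow> (real \<Rightarrow> real) \<Rightarrow> ('a \<Rightarrow> ereal)
      \<Rightarrow> (real \<Rightarrow> real \<Rightarrow> 'a \<Rightarrow> real) \<Rightarrow> (real \<Rightarrow> real \<Rightarrow> 'a \<Rightarrow> real) \<Rightarrow> bool" where
  "mild_equation Q P W \<alpha> L \<sigma> u0 \<zeta> b v \<longleftrightarrow>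
     (\<forall>x \<in> {0<..<L}. \<forall>t \<ge> 0. AE \<omega> in Q. ereal t < \<zeta> \<omega> \<longrightarrow>
        set_integrable lborel ({0<..<L} \<times> {0..<t})
          (\<lambda>(y, s). heat_green_y \<alpha> L x y (t - s) * b y s \<omega>) \<and>
        v x t \<omega> = heat_initial \<alpha> L u0 x t
          + set_lebesgue_integral lborel ({0<..<L} \<times> {0..<t})
              (\<lambda>(y, s). heat_green_y \<alpha> L x y (t - s) * b y s \<omega>)
          + wiener_integral P W ({0<..<L} \<times> {0..<t})
              (\<lambda>(y, s). heat_green \<alpha> L x y (t - s) * \<sigma> y) \<omega>)"

definition ux0 :: "(real \<Rightarrow> real \<Rightarrow> 'a \<Rightarrow> real) \<Rightarrow> real \<Rightarrow> 'a \<Rightarrow> real" where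
  "ux0 u t \<omega> = Lim (at_right 0) (\<lambda>x. u x t \<omega> / x)"

text \<open>\<open>sup_ux0 u \<zeta> S \<omega>\<close> is the supremum of \<open>|u_x(0+,r)|\<close> over \<open>r \<in> [0,S)\<close> with \<open>r < \<zeta> \<omega>\<close>,
  where \<open>[0, \<zeta> \<omega>)\<close> is the interval on which \<open>u\<close> lives; \<open>exit_time\<close> is \<open>\<tau>_M\<close>.\<close>

definition sup_ux0 ::
    "(real \<Rightarrow> real \<Rightarrow> 'a \<Rightarrow> real) \<Rightarrow> ('a \<Rightarrow> ereal) \<Rightarrow> ereal \<Rightarrow> 'a \<Rightarrow> ereal" where
  "sup_ux0 u \<zeta> S \<omega> = (SUP r \<in> {r. 0 \<le> r \<and> ereal r < S \<and> ereal r < \<zeta> \<omega>}. ereal \<bar>ux0 u r \<omega>\<bar>)"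

definition exit_time ::
    "(real \<Rightarrow> real \<Rightarrow> 'a \<Rightarrow> real) \<Rightarrow> ('a \<Rightarrow> ereal) \<Rightarrow> real \<Rightarrow> 'a \<Rightarrow> ereal" where
  "exit_time u \<zeta> M \<omega> = Inf {ereal S | S. 0 \<le> S \<and> ereal M \<le> sup_ux0 u \<zeta> (ereal S) \<omega>}"

text \<open>The interval of existence is \<open>[0, sup_M \<tau>_M)\<close>. Since \<open>\<tau>_M\<close> only sees \<open>u\<close> before \<open>\<zeta>\<close>, the
  identity \<open>\<zeta> = sup_M \<tau>_M\<close> says that \<open>|u_x(0+,\<cdot>)|\<close> is locally bounded on \<open>[0,\<zeta>)\<close> and, if
  \<open>\<zeta> < \<infinity>\<close>, unbounded on it: \<open>u\<close> cannot be continued past \<open>\<zeta>\<close>.\<close>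

definition maximal_solution ::
    "'a measure \<Rightarrow> ((real \<times> real) set \<Rightarrow> 'a \<Rightarrow> real) \<Rightarrow> real \<Rightarrow> real
      \<Rightarrow> (real \<Rightarrow> real) \<Rightarrow> (real \<Rightarrow> real) \<Rightarrow> ('a \<Rightarrow> ereal)
      \<Rightarrow> (real \<Rightarrow> real \<Rightarrow> 'a \<Rightarrow> real) \<Rightarrow> bool" where
  "maximal_solution P W \<alpha> L \<sigma> u0 \<zeta> u \<longleftrightarrow>
     H_process P L \<zeta> u \<and>
     (AE \<omega> in P. \<zeta> \<omega> = (SUP M \<in> {0<..}. exit_time u \<zeta> M \<omega>)) \<and>
     mild_equation P P W \<alpha> L \<sigma> u0 \<zeta> (\<lambda>y s \<omega>. ux0 u s \<omega> * u y s \<omega>) u"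

definition stopped_time ::
    "(real \<Rightarrow> real \<Rightarrow> 'a \<Rightarrow> real) \<Rightarrow> ('a \<Rightarrow> ereal) \<Rightarrow> real \<Rightarrow> real \<Rightarrow> 'a \<Rightarrow> ereal" where
  "stopped_time u \<zeta> T M \<omega> = min (ereal T) (exit_time u \<zeta> M \<omega>)"

definition Omega_M ::
    "'a measure \<Rightarrow> (real \<Rightarrow> real \<Rightarrow> 'a \<Rightarrow> real) \<Rightarrow> ('a \<Rightarrow> ereal) \<Rightarrow> real \<Rightarrow> real \<Rightarrow> 'a set" where
  "Omega_M P u \<zeta> T M = {\<omega> \<in> space P. sup_ux0 u \<zeta> (stopped_time u \<zeta> T M \<omega>) \<omega> < ereal M}"

text \<open>\<open>\<Omega>_M\<close> as a probability space in its own right: \<open>P\<close> conditioned on \<open>\<Omega>_M\<close>. It gives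
  \<open>\<Omega>_M\<close> full measure, and it is \<open>P\<close> itself if \<open>\<Omega>_M\<close> has probability one under \<open>P\<close>.\<close>

definition P_M ::
    "'a measure \<Rightarrow> (real \<Rightarrow> real \<Rightarrow> 'a \<Rightarrow> real) \<Rightarrow> ('a \<Rightarrow> ereal) \<Rightarrow> real \<Rightarrow> real \<Rightarrow> 'a measure" where
  "P_M P u \<zeta> T M = uniform_measure P (Omega_M P u \<zeta> T M)"


section \<open>The cut-off problem and the data\<close>

definition cutoff_function :: "nat \<Rightarrow> (real \<Rightarrow> real) \<Rightarrow> bool" where
  "cutoff_function n H \<longleftrightarrow>
     H C1_differentiable_on UNIV \<and> (\<forall>v. 0 \<le> H v \<and> H v \<le> 1 \<and> \<bar>deriv H v\<bar> \<le> 2) \<and>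
     (\<forall>v. \<bar>v\<bar> < real n \<longrightarrow> H v = 1) \<and> (\<forall>v. \<bar>v\<bar> > real n + 1 \<longrightarrow> H v = 0)"

definition cutoff_T :: "(real \<Rightarrow> real) \<Rightarrow> real \<Rightarrow> real" where
  "cutoff_T H v = H v * v"

definition cutoff_solution ::
    "'a measure \<Rightarrow> ((real \<times> real) set \<Rightarrow> 'a \<Rightarrow> real) \<Rightarrow> real \<Rightarrow> real
      \<Rightarrow> (real \<Rightarrow> real) \<Rightarrow> (real \<Rightarrow> real) \<Rightarrow> ('a \<Rightarrow> ereal) \<Rightarrow> (real \<Rightarrow> real \<Rightarrow> 'a \<Rightarrow> real)
      \<Rightarrow> real \<Rightarrow> real \<Rightarrow> (real \<Rightarrow> real) \<Rightarrow> real \<Rightarrow> (real \<Rightarrow> real \<Rightarrow> 'a \<Rightarrow> real) \<Rightarrow> bool" where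
  "cutoff_solution P W \<alpha> L \<sigma> u0 \<zeta> u T M H p v \<longleftrightarrow>
     in_Lp_C_H (P_M P u \<zeta> T M) L p (stopped_time u \<zeta> T M) v \<and>
     mild_equation (P_M P u \<zeta> T M) P W \<alpha> L \<sigma> u0 (stopped_time u \<zeta> T M)
       (\<lambda>y s \<omega>. ux0 u s \<omega> * y * cutoff_T H (v y s \<omega> / y)) v"

definition admissible_noise_coeff :: "real \<Rightarrow> (real \<Rightarrow> real) \<Rightarrow> bool" where
  "admissible_noise_coeff L \<sigma> \<longleftrightarrow>
     continuous_on {0..L} \<sigma> \<and> \<sigma> differentiable (at 0 within {0..L}) \<and> \<sigma> 0 = 0 \<and> \<sigma> L = 0"

definition admissible_initial :: "real \<Rightarrow> (real \<Rightarrow> real) \<Rightarrow> bool" where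
  "admissible_initial L u0 \<longleftrightarrow>
     (\<forall>x \<in> {0..L}. 0 \<le> u0 x) \<and>
     (\<forall>k. \<forall>x \<in> {0<..<L}. ((deriv ^^ k) u0) differentiable (at x)) \<and>
     (\<exists>K. compact K \<and> K \<subseteq> {0<..<L} \<and> (\<forall>x \<in> {0..L} - K. u0 x = 0))"

end

(* Write w = v/x. Subtracting the equation of u from the cut-off equation removes the stochastic
   integral, and U = u/x turns it, path by path, into w = U + D[a (T_n(w) - U)] with a = u_x(0,.),
   where D integrates against y G_y(x,y,r)/x. On Omega_M the interval is all of [0,T], a is bounded
   by M, and U is continuous on the closed rectangle. The integral of |y G_y(x,y,r)/x| over y is
   O(r^(-7/8)): multiplying the cosine series by sin(pi y/(2L)), which is comparable to y, makes it
   telescope into an orthogonal series, and Cauchy-Schwarz applies. Hence the equation contracts in a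
   weighted supremum norm, which gives existence and uniqueness. For the moments,
   w = (U - D[a U]) + D[a T_n(w)] with a bounded second term; the first is the sum of a deterministic
   and a Gaussian field whose supremum is finite with positive probability, so Fernique's theorem
   (through rotation invariance of two independent copies) gives all moments of the supremum. *)

theory Submission
  imports Defs "HOL-Probability.Probability"
begin

section \<open>Uniqueness of joint laws\<close>

text \<open>No regularity of the stochastic convolution is proved from scratch: continuity in space
  and time is inherited from the given \<open>u\<close>. The price is that this information lives on
  \<open>Omega_M\<close>, an event about whose probability only positivity is known, whereas
  Fernique's argument has to start from a box of probability at least 7/8. Rotating two independent
  copies by many small angles closes this gap: it produces disjoint events of equal probability, and
  their number forces the tails down. Gaussian laws are handled through characteristic functions,
  and only rectangles of finitely many coordinates are ever compared, with bounds uniform in their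
  number. The mild equations hold almost surely at each single point. They are imposed at countably
  many dense points simultaneously and then extended along continuous paths. Division by
  \<open>x\<close> turns the \<open>H\<close> norm into a supremum norm and the slope at 0 into a
  boundary value. The solution is an explicit Picard limit, so that it is measurable in the sample
  point.\<close>

lemma weighted_distr_integral:
  fixes \<phi> :: "real \<Rightarrow> 'b :: {banach, second_countable_topology}"
  assumes [measurable]: "X \<in> borel_measurable N" "h \<in> borel_measurable N" "\<phi> \<in> borel_measurable borel"
    and h: "\<And>w. 0 \<le> h w" and m: "0 < (m::real)"
  shows "integral\<^sup>L (distr (density N (\<lambda>w. ennreal (h w / m))) borel X) \<phi>
    = inverse m *\<^sub>R (\<integral>w. h w *\<^sub>R \<phi> (X w) \<partial>N)"
proof -
  have "integral\<^sup>L (distr (density N (\<lambda>w. ennreal (h w / m))) borel X) \<phi>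
      = (\<integral>w. \<phi> (X w) \<partial>density N (\<lambda>w. ennreal (h w / m)))"
    by (rule integral_distr) simp_all
  also have "\<dots> = (\<integral>w. (h w / m) *\<^sub>R \<phi> (X w) \<partial>N)"
    by (rule integral_density) (use h m in auto)
  also have "\<dots> = (\<integral>w. inverse m *\<^sub>R (h w *\<^sub>R \<phi> (X w)) \<partial>N)"
    by (simp add: divide_inverse mult.commute)
  also have "\<dots> = inverse m *\<^sub>R (\<integral>w. h w *\<^sub>R \<phi> (X w) \<partial>N)"
    by (rule Bochner_Integration.integral_scaleR_right)
  finally show ?thesis .
qed

text \<open>The hypothesis at \<open>t = 0\<close> says that both weights have the same total mass.
  If it is positive, the weights divided by it are probability densities under which
  \<open>X\<close> and \<open>X'\<close> have equal characteristic functions, and Levy's uniqueness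
  theorem applies. If it is zero, both weights vanish almost everywhere.\<close>

lemma weighted_law_unique:
  fixes X :: "'a \<Rightarrow> real" and X' :: "'b \<Rightarrow> real"
  assumes "finite_measure N" "finite_measure N'"
    and X[measurable]: "X \<in> borel_measurable N" and X'[measurable]: "X' \<in> borel_measurable N'"
    and h[measurable]: "h \<in> borel_measurable N" and h'[measurable]: "h' \<in> borel_measurable N'"
    and hb: "\<And>w. 0 \<le> h w \<and> h w \<le> (B::real)" and hb': "\<And>w. 0 \<le> h' w \<and> h' w \<le> B"
    and eq: "\<And>t. (\<integral>w. h w *\<^sub>R iexp (t * X w) \<partial>N) = (\<integral>w. h' w *\<^sub>R iexp (t * X' w) \<partial>N')"
    and A[measurable]: "A \<in> sets borel"
  shows "(\<integral>w. h w * indicator A (X w) \<partial>N) = (\<integral>w. h' w * indicator A (X' w) \<partial>N')"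
proof -
  interpret N: finite_measure N by fact
  interpret N': finite_measure N' by fact
  have int: "integrable N h" "integrable N' h'"
    using hb hb' by (auto intro!: N.integrable_const_bound[where B=B] N'.integrable_const_bound[where B=B])
  define m where "m = (\<integral>w. h w \<partial>N)"
  have m': "m = (\<integral>w. h' w \<partial>N')"
  proof -
    have "complex_of_real (\<integral>w. h w \<partial>N) = complex_of_real (\<integral>w. h' w \<partial>N')"
      using eq[of 0] by (simp add: scaleR_conv_of_real integral_complex_of_real)
    then show ?thesis unfolding m_def by (simp only: of_real_eq_iff)
  qed
  have m0: "m \<ge> 0" unfolding m_def using hb by (intro integral_nonneg_AE) auto
  show ?thesis
  proof (cases "m = 0")
    case True
    have "AE w in N. h w = 0" using True hb int unfolding m_def
      by (subst (asm) integral_nonneg_eq_0_iff_AE) auto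
    moreover have "AE w in N'. h' w = 0" using True hb' int unfolding m'
      by (subst (asm) integral_nonneg_eq_0_iff_AE) auto
    ultimately have "(\<integral>w. h w * indicator A (X w) \<partial>N) = 0" "(\<integral>w. h' w * indicator A (X' w) \<partial>N') = 0"
      by (auto intro!: integral_eq_zero_AE)
    then show ?thesis by simp
  next
    case False
    with m0 have mp: "m > 0" by simp
    define D where "D = density N (\<lambda>w. ennreal (h w / m))"
    define D' where "D' = density N' (\<lambda>w. ennreal (h' w / m))"
    have pD: "prob_space D"
    proof
      show "emeasure D (space D) = 1" unfolding D_def
        using mp hb int by (auto simp: emeasure_density nn_integral_eq_integral m_def cong: nn_integral_cong)
    qed
    have pD': "prob_space D'"
    proof
      show "emeasure D' (space D') = 1" unfolding D'_def
        using mp hb' int by (auto simp: emeasure_density nn_integral_eq_integral m' cong: nn_integral_cong)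
    qed
    have [measurable]: "X \<in> borel_measurable D" "X' \<in> borel_measurable D'" 
      by (auto simp: D_def D'_def)
    interpret D: prob_space D by fact
    interpret D': prob_space D' by fact
    have [measurable]: "(\<lambda>x. iexp (t * x)) \<in> borel_measurable borel" for t by measurable
    have h0: "\<And>w. 0 \<le> h w" "\<And>w. 0 \<le> h' w" using hb hb' by auto
    have e: "distr D borel X = distr D' borel X'"
    proof (rule Levy_uniqueness)
      show "char (distr D borel X) = char (distr D' borel X')"
        unfolding char_def D_def D'_def
        by (rule ext) (simp only: weighted_distr_integral[OF X h _ h0(1) mp] weighted_distr_integral[OF X' h' _ h0(2) mp]
            \<open>\<And>t. (\<lambda>x. iexp (t * x)) \<in> borel_measurable borel\<close> eq)
    qed simp_all
    have [measurable]: "(indicator A :: real \<Rightarrow> real) \<in> borel_measurable borel" by measurable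
    have "integral\<^sup>L (distr D borel X) (indicator A :: real \<Rightarrow> real) = inverse m *\<^sub>R (\<integral>w. h w *\<^sub>R indicator A (X w) \<partial>N)"
      unfolding D_def by (rule weighted_distr_integral[OF X h _ h0(1) mp]) measurable
    moreover have "integral\<^sup>L (distr D' borel X') (indicator A :: real \<Rightarrow> real) = inverse m *\<^sub>R (\<integral>w. h' w *\<^sub>R indicator A (X' w) \<partial>N')"
      unfolding D'_def by (rule weighted_distr_integral[OF X' h' _ h0(2) mp]) measurable
    ultimately show ?thesis using e mp by simp
  qed
qed

text \<open>Euler's formula for the cosine: a nonnegative trigonometric weight in other coordinates
  amounts to shifting the Fourier argument, so weighted integrals are known as soon as
  characteristic functions are.\<close>

lemma iexp_cos_shift:
  "(1 + cos (S + c)) *\<^sub>R iexp x = iexp x + (iexp c / 2) * iexp (x + S) + (iexp (-c) / 2) * iexp (x - S)"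
proof -
  have c: "complex_of_real (cos y) = (cis y + cis (-y)) / 2" for y
    by (simp add: complex_eq_iff)
  have "(1 + cos (S + c)) *\<^sub>R cis x = cis x + ((cis (S + c) + cis (-(S + c))) / 2) * cis x"
    by (simp only: scaleR_conv_of_real of_real_add c of_real_1 distrib_right mult_1)
  also have "\<dots> = cis x + (cis c / 2) * cis (x + S) + (cis (-c) / 2) * cis (x - S)"
    by (simp add: cis_mult add_divide_distrib distrib_right) (simp add: algebra_simps)
  finally show ?thesis by (simp only: cis_conv_exp)
qed

lemma (in finite_measure) cos_weight_integral:
  assumes [measurable]: "J \<in> borel_measurable M" "S \<in> borel_measurable M" "Z \<in> borel_measurable M"
    and J: "\<And>w. \<bar>J w\<bar> \<le> (1::real)"
  shows "(\<integral>w. (J w * (1 + cos (S w + c))) *\<^sub>R iexp (Z w) \<partial>M)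
    = (\<integral>w. J w *\<^sub>R iexp (Z w) \<partial>M) + (iexp c / 2) * (\<integral>w. J w *\<^sub>R iexp (Z w + S w) \<partial>M)
      + (iexp (-c) / 2) * (\<integral>w. J w *\<^sub>R iexp (Z w - S w) \<partial>M)"
proof -
  have i: "integrable M (\<lambda>w. J w *\<^sub>R iexp (f w))" if [measurable]: "f \<in> borel_measurable M" for f
    by (rule integrable_const_bound[where B=1]) (use J in auto)
  have "(J w * (1 + cos (S w + c))) *\<^sub>R iexp (Z w) = J w *\<^sub>R iexp (Z w)
      + (iexp c / 2) * (J w *\<^sub>R iexp (Z w + S w)) + (iexp (-c) / 2) * (J w *\<^sub>R iexp (Z w - S w))" for w
    unfolding scaleR_scaleR[symmetric] iexp_cos_shift[of "S w" c "Z w"]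
    by (simp only: scaleR_add_right mult_scaleR_right)
  moreover have "integrable M (\<lambda>w. (iexp c / 2) * (J w *\<^sub>R iexp (Z w + S w)))"
    "integrable M (\<lambda>w. (iexp (-c) / 2) * (J w *\<^sub>R iexp (Z w - S w)))"
    by (intro integrable_mult_right i, measurable)+
  ultimately show ?thesis using i[OF assms(3)]
    by (simp only: Bochner_Integration.integral_add Bochner_Integration.integrable_add integral_mult_right_zero)
qed

lemma (in finite_measure) iexp_weight_integral:
  assumes [measurable]: "I \<in> borel_measurable M" "S \<in> borel_measurable M"
    and I: "\<And>w. \<bar>I w\<bar> \<le> (1::real)"
  shows "(\<integral>w. I w *\<^sub>R iexp (S w) \<partial>M)
    = complex_of_real (\<integral>w. I w * cos (S w) \<partial>M) + \<i> * complex_of_real (\<integral>w. I w * sin (S w) \<partial>M)"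
proof -
  have "integrable M (\<lambda>w. I w * cos (S w))" "integrable M (\<lambda>w. I w * sin (S w))"
    by (rule integrable_const_bound[where B=1]; use I in \<open>auto simp: abs_mult intro!: mult_le_one AE_I2\<close>)+
  then have a: "integrable M (\<lambda>w. complex_of_real (I w * cos (S w)))" "integrable M (\<lambda>w. \<i> * complex_of_real (I w * sin (S w)))"
    by (simp_all del: of_real_mult)
  have "I w *\<^sub>R iexp (S w) = complex_of_real (I w * cos (S w)) + \<i> * complex_of_real (I w * sin (S w))" for w
    by (simp add: cis_conv_exp[symmetric] complex_eq_iff)
  then show ?thesis using a
    by (simp only: Bochner_Integration.integral_add integral_mult_right_zero integral_complex_of_real)
qed

text \<open>One coordinate at a time is turned from a Fourier variable into a Borel constraint; the
  nonnegative weights \<open>1 + cos (S + c)\<close>, where \<open>S\<close> is a combination of the remaining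
  coordinates, make the one-dimensional uniqueness theorem applicable.\<close>

lemma char_cylinder:
  fixes X :: "nat \<Rightarrow> 'a \<Rightarrow> real" and X' :: "nat \<Rightarrow> 'b \<Rightarrow> real"
  assumes N: "finite_measure N" "finite_measure N'"
    and X[measurable]: "\<And>i. X i \<in> borel_measurable N" and X'[measurable]: "\<And>i. X' i \<in> borel_measurable N'"
    and A[measurable]: "\<And>i. A i \<in> sets borel"
    and eq: "\<And>t. (\<integral>w. iexp (\<Sum>i<n. t i * X i w) \<partial>N) = (\<integral>w. iexp (\<Sum>i<n. t i * X' i w) \<partial>N')"
  shows "k \<le> n \<Longrightarrow> (\<integral>w. (\<Prod>i<k. indicator (A i) (X i w)) *\<^sub>R iexp (\<Sum>i\<in>{k..<n}. t i * X i w) \<partial>N)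
     = (\<integral>w. (\<Prod>i<k. indicator (A i) (X' i w)) *\<^sub>R iexp (\<Sum>i\<in>{k..<n}. t i * X' i w) \<partial>N')"
proof (induction k arbitrary: t)
  case 0
  then show ?case using eq[of t] by (simp add: atLeast0LessThan)
next
  case (Suc k)
  interpret N: finite_measure N by fact
  interpret N': finite_measure N' by fact
  define J where "J = (\<lambda>w. \<Prod>i<k. indicator (A i) (X i w) :: real)"
  define J' where "J' = (\<lambda>w. \<Prod>i<k. indicator (A i) (X' i w) :: real)"
  have [measurable]: "J \<in> borel_measurable N" "J' \<in> borel_measurable N'"
    unfolding J_def J'_def by measurable
  have J: "0 \<le> J w" "J w \<le> 1" for w unfolding J_def by (auto intro!: prod_nonneg prod_le_1)
  have J': "0 \<le> J' w" "J' w \<le> 1" for w unfolding J'_def by (auto intro!: prod_nonneg prod_le_1)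
  define S where "S = (\<lambda>t w. \<Sum>i\<in>{Suc k..<n}. t i * X i w)"
  define S' where "S' = (\<lambda>t w. \<Sum>i\<in>{Suc k..<n}. t i * X' i w)"
  have [measurable]: "S t \<in> borel_measurable N" "S' t \<in> borel_measurable N'" for t
    unfolding S_def S'_def by measurable
  \<comment> \<open>Coordinate \<open>k\<close> gets its own Fourier variable \<open>s\<close>,
    separated from the coordinates after it.\<close>
  have IH: "(\<integral>w. J w *\<^sub>R iexp (s * X k w + S t w) \<partial>N) = (\<integral>w. J' w *\<^sub>R iexp (s * X' k w + S' t w) \<partial>N')" for s t
  proof -
    have "(\<Sum>i\<in>{k..<n}. (t(k:=s)) i * X i w) = s * X k w + S t w" for w
      using Suc.prems by (simp add: S_def sum.atLeast_Suc_lessThan)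
    moreover have "(\<Sum>i\<in>{k..<n}. (t(k:=s)) i * X' i w) = s * X' k w + S' t w" for w
      using Suc.prems by (simp add: S'_def sum.atLeast_Suc_lessThan)
    ultimately show ?thesis using Suc.IH[of "t(k:=s)"] Suc.prems by (simp add: J_def J'_def)
  qed
  have Sm: "S (\<lambda>i. - t i) w = - S t w" "S' (\<lambda>i. - t i) w' = - S' t w'" "S (\<lambda>i. 0) w = 0" "S' (\<lambda>i. 0) w' = 0" for t w w'
    by (auto simp: S_def S'_def sum_negf)
  have Jb: "\<bar>J w\<bar> \<le> 1" "\<bar>J' w'\<bar> \<le> 1" for w w' using J[of w] J'[of w'] by auto
  \<comment> \<open>The three exponentials of the weight correspond to the induction hypothesis with
    the coefficients of \<open>S\<close> equal to 0, \<open>t\<close> and \<open>-t\<close>.\<close>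
  have w1: "(\<integral>w. (J w * (1 + cos (S t w + c))) *\<^sub>R iexp (s * X k w) \<partial>N)
     = (\<integral>w. (J' w * (1 + cos (S' t w + c))) *\<^sub>R iexp (s * X' k w) \<partial>N')" for t c s
  proof -
    have "(\<integral>w. J w *\<^sub>R iexp (s * X k w) \<partial>N) = (\<integral>w. J' w *\<^sub>R iexp (s * X' k w) \<partial>N')"
      using IH[of s "\<lambda>_. 0"] by (simp only: Sm add_0_right)
    moreover have "(\<integral>w. J w *\<^sub>R iexp (s * X k w - S t w) \<partial>N) = (\<integral>w. J' w *\<^sub>R iexp (s * X' k w - S' t w) \<partial>N')"
      using IH[of s "\<lambda>i. - t i"] by (simp only: Sm diff_conv_add_uminus)
    moreover have "(\<lambda>w. s * X k w) \<in> borel_measurable N" "(\<lambda>w. s * X' k w) \<in> borel_measurable N'" by measurable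
    ultimately show ?thesis
      using IH[of s t] Jb
      by (simp only: N.cos_weight_integral[of J "S t" "\<lambda>w. s * X k w"] N'.cos_weight_integral[of J' "S' t" "\<lambda>w. s * X' k w"]
        \<open>\<And>t. S t \<in> borel_measurable N\<close> \<open>\<And>t. S' t \<in> borel_measurable N'\<close> \<open>J \<in> borel_measurable N\<close> \<open>J' \<in> borel_measurable N'\<close>)
  qed
  have cosb: "0 \<le> 1 + cos (x::real)" "1 + cos x \<le> 2" for x
    using cos_ge_minus_one[of x] cos_le_one[of x] by linarith+
  have key: "(\<integral>w. J w * (1 + cos (S t w + c)) * indicator (A k) (X k w) \<partial>N)
     = (\<integral>w. J' w * (1 + cos (S' t w + c)) * indicator (A k) (X' k w) \<partial>N')" for t c
  proof (rule weighted_law_unique[OF N X X' _ _ _ _ _ A, where B=2])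
    have "0 \<le> J w * (1 + cos (S t w + c)) \<and> J w * (1 + cos (S t w + c)) \<le> 1 * 2" for w
      using J[of w] cosb by (intro conjI mult_nonneg_nonneg mult_mono) auto
    then show "0 \<le> J w * (1 + cos (S t w + c)) \<and> J w * (1 + cos (S t w + c)) \<le> 2" for w by simp
    have "0 \<le> J' w * (1 + cos (S' t w + c)) \<and> J' w * (1 + cos (S' t w + c)) \<le> 1 * 2" for w
      using J'[of w] cosb by (intro conjI mult_nonneg_nonneg mult_mono) auto
    then show "0 \<le> J' w * (1 + cos (S' t w + c)) \<and> J' w * (1 + cos (S' t w + c)) \<le> 2" for w by simp
  qed (use w1 in auto)
  define I where "I = (\<lambda>w. J w * indicator (A k) (X k w))"
  define I' where "I' = (\<lambda>w. J' w * indicator (A k) (X' k w))"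
  have [measurable]: "I \<in> borel_measurable N" "I' \<in> borel_measurable N'"
    unfolding I_def I'_def by measurable
  have Ib: "\<bar>I w\<bar> \<le> 1" "\<bar>I' w'\<bar> \<le> 1" for w w'
    using J[of w] J'[of w'] by (auto simp: I_def I'_def indicator_def)
  have ii: "integrable N (\<lambda>w. I w * f w)" if [measurable]: "f \<in> borel_measurable N" and "\<And>w. \<bar>f w\<bar> \<le> 1" for f
    by (rule N.integrable_const_bound[where B=1]) (use Ib that in \<open>auto simp: abs_mult intro!: mult_le_one\<close>)
  have ii': "integrable N' (\<lambda>w. I' w * f w)" if [measurable]: "f \<in> borel_measurable N'" and "\<And>w. \<bar>f w\<bar> \<le> 1" for f
    by (rule N'.integrable_const_bound[where B=1]) (use Ib that in \<open>auto simp: abs_mult intro!: mult_le_one\<close>)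
  have iI: "integrable N I" "integrable N' I'" using ii[of "\<lambda>_. 1"] ii'[of "\<lambda>_. 1"] by auto
  have "(\<integral>w. J w * (1 + cos (S t w + c)) * indicator (A k) (X k w) \<partial>N) = (\<integral>w. I w \<partial>N) + (\<integral>w. I w * cos (S t w + c) \<partial>N)" for t c
  proof -
    have "J w * (1 + cos (S t w + c)) * indicator (A k) (X k w) = I w + I w * cos (S t w + c)" for w
      by (simp add: I_def algebra_simps)
    then show ?thesis using iI ii[of "\<lambda>w. cos (S t w + c)"] by simp
  qed
  moreover have "(\<integral>w. J' w * (1 + cos (S' t w + c)) * indicator (A k) (X' k w) \<partial>N') = (\<integral>w. I' w \<partial>N') + (\<integral>w. I' w * cos (S' t w + c) \<partial>N')" for t c
  proof -
    have "J' w * (1 + cos (S' t w + c)) * indicator (A k) (X' k w) = I' w + I' w * cos (S' t w + c)" for w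
      by (simp add: I'_def algebra_simps)
    then show ?thesis using iI ii'[of "\<lambda>w. cos (S' t w + c)"] by simp
  qed
  ultimately have k2: "(\<integral>w. I w \<partial>N) + (\<integral>w. I w * cos (S t w + c) \<partial>N) = (\<integral>w. I' w \<partial>N') + (\<integral>w. I' w * cos (S' t w + c) \<partial>N')" for t c
    using key[of t c] by simp
  \<comment> \<open>With all coefficients and the phase equal to 0 the cosine is 1, so the identity
    reads twice the unweighted one.\<close>
  have k3: "(\<integral>w. I w \<partial>N) = (\<integral>w. I' w \<partial>N')" using k2[of "\<lambda>_. 0" 0] by (simp add: Sm)
  have kc: "(\<integral>w. I w * cos (S t w) \<partial>N) = (\<integral>w. I' w * cos (S' t w) \<partial>N')" using k2[of t 0] k3 by simp
  \<comment> \<open>The phase \<open>-pi/2\<close> turns the cosine into a sine; cosine and sine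
    parts together recover the complex exponential.\<close>
  have ks: "(\<integral>w. I w * sin (S t w) \<partial>N) = (\<integral>w. I' w * sin (S' t w) \<partial>N')"
    using k2[of t "-pi/2"] k3 by (simp add: cos_diff)
  have "(\<integral>w. I w *\<^sub>R iexp (S t w) \<partial>N) = (\<integral>w. I' w *\<^sub>R iexp (S' t w) \<partial>N')"
    by (simp only: N.iexp_weight_integral[of I "S t", OF _ _ Ib(1)] N'.iexp_weight_integral[of I' "S' t", OF _ _ Ib(2)] kc ks
        \<open>\<And>t. S t \<in> borel_measurable N\<close> \<open>\<And>t. S' t \<in> borel_measurable N'\<close> \<open>I \<in> borel_measurable N\<close> \<open>I' \<in> borel_measurable N'\<close>)
  then show ?case by (simp only: I_def I'_def J_def J'_def S_def S'_def prod.lessThan_Suc)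
qed

text \<open>The case \<open>k = n\<close> of \<open>char_cylinder\<close>: all Fourier variables
  have been traded for Borel constraints and the remaining exponential is 1.\<close>

lemma rectangle_law_unique:
  fixes X :: "nat \<Rightarrow> 'a \<Rightarrow> real" and X' :: "nat \<Rightarrow> 'b \<Rightarrow> real"
  assumes N: "finite_measure N" "finite_measure N'"
    and X[measurable]: "\<And>i. X i \<in> borel_measurable N" and X'[measurable]: "\<And>i. X' i \<in> borel_measurable N'"
    and A[measurable]: "\<And>i. A i \<in> sets borel"
    and eq: "\<And>t. (\<integral>w. iexp (\<Sum>i<n. t i * X i w) \<partial>N) = (\<integral>w. iexp (\<Sum>i<n. t i * X' i w) \<partial>N')"
  shows "measure N {w\<in>space N. \<forall>i<n. X i w \<in> A i} = measure N' {w\<in>space N'. \<forall>i<n. X' i w \<in> A i}"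
proof -
  interpret N: finite_measure N by fact
  interpret N': finite_measure N' by fact
  have p: "(\<Prod>i<n. indicator (A i) (Z i) :: real) = indicator {z. \<forall>i<n. z i \<in> A i} Z" for Z
  proof (cases "\<forall>i<n. Z i \<in> A i")
    case True
    then have "(\<Prod>i<n. indicator (A i) (Z i) :: real) = 1" by (intro prod.neutral) simp
    with True show ?thesis by simp
  next
    case False
    then obtain i where "i < n" "Z i \<notin> A i" by blast
    then have "\<exists>i\<in>{..<n}. indicator (A i) (Z i) = (0::real)" by (intro bexI[of _ i]) simp_all
    then have "(\<Prod>i<n. indicator (A i) (Z i) :: real) = 0" by (intro prod_zero) simp_all
    with False show ?thesis by simp
  qed
  have 1: "complex_of_real (measure N {w\<in>space N. \<forall>i<n. X i w \<in> A i})
     = (\<integral>w. (\<Prod>i<n. indicator (A i) (X i w)) *\<^sub>R iexp (\<Sum>i\<in>{n..<n}. 0 * X i w) \<partial>N)"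
  proof -
    have "(\<integral>w. (\<Prod>i<n. indicator (A i) (X i w)) *\<^sub>R iexp (\<Sum>i\<in>{n..<n}. 0 * X i w) \<partial>N)
       = (\<integral>w. complex_of_real (indicator {w\<in>space N. \<forall>i<n. X i w \<in> A i} w) \<partial>N)"
      unfolding p by (intro Bochner_Integration.integral_cong) (auto simp: indicator_def)
    then show ?thesis by (simp add: integral_complex_of_real)
  qed
  have 2: "complex_of_real (measure N' {w\<in>space N'. \<forall>i<n. X' i w \<in> A i})
     = (\<integral>w. (\<Prod>i<n. indicator (A i) (X' i w)) *\<^sub>R iexp (\<Sum>i\<in>{n..<n}. 0 * X' i w) \<partial>N')"
  proof -
    have "(\<integral>w. (\<Prod>i<n. indicator (A i) (X' i w)) *\<^sub>R iexp (\<Sum>i\<in>{n..<n}. 0 * X' i w) \<partial>N')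
       = (\<integral>w. complex_of_real (indicator {w\<in>space N'. \<forall>i<n. X' i w \<in> A i} w) \<partial>N')"
      unfolding p by (intro Bochner_Integration.integral_cong) (auto simp: indicator_def)
    then show ?thesis by (simp add: integral_complex_of_real)
  qed
  have "complex_of_real (measure N {w\<in>space N. \<forall>i<n. X i w \<in> A i}) = complex_of_real (measure N' {w\<in>space N'. \<forall>i<n. X' i w \<in> A i})"
    unfolding 1 2 by (rule char_cylinder[OF N X X' A eq order_refl])
  then show ?thesis by (simp only: of_real_eq_iff)
qed

section \<open>Moments of suprema of Gaussian families\<close>

lemma sum_lessThan_add: "(\<Sum>i<n+m. f i) = (\<Sum>i<n. f i) + (\<Sum>i<(m::nat). f (n + i) :: 'b :: comm_monoid_add)"
  by (induction m) (auto simp: add.assoc)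

text \<open>A centred Gaussian sequence with covariance \<open>C\<close>. Encoding it by
  characteristic functions of finite linear combinations reduces rotation invariance to an identity
  between quadratic forms.\<close>

locale gaussian_family = prob_space P for P :: "'a measure" +
  fixes g :: "nat \<Rightarrow> 'a \<Rightarrow> real" and C :: "nat \<Rightarrow> nat \<Rightarrow> real"
  assumes g_meas[measurable]: "\<And>i. g i \<in> borel_measurable P"
    and joint_char: "\<And>n t. (\<integral>w. iexp (\<Sum>i<n. t i * g i w) \<partial>P)
      = complex_of_real (exp (- (\<Sum>i<n. \<Sum>j<n. t i * t j * C i j) / 2))"
begin

lemma pair: "prob_space (P \<Otimes>\<^sub>M P)" "pair_prob_space P P"
proof -
  show *: "pair_prob_space P P" by unfold_locales
  interpret pair_prob_space P P by fact
  show "prob_space (P \<Otimes>\<^sub>M P)" by unfold_locales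
qed

lemma pair_measure_times:
  "A \<in> sets P \<Longrightarrow> B \<in> sets P \<Longrightarrow> measure (P \<Otimes>\<^sub>M P) (A \<times> B) = prob A * prob B"
  by (simp add: measure_def emeasure_pair_measure_Times enn2real_mult)

lemma pair_char:
  "(\<integral>z. iexp ((\<Sum>i<n. a i * g i (fst z)) + (\<Sum>i<n. b i * g i (snd z))) \<partial>(P \<Otimes>\<^sub>M P))
   = complex_of_real (exp (- ((\<Sum>i<n. \<Sum>j<n. a i * a j * C i j) + (\<Sum>i<n. \<Sum>j<n. b i * b j * C i j)) / 2))"
proof -
  interpret PP: pair_prob_space P P by (rule pair)
  define f where "f = (\<lambda>z. iexp ((\<Sum>i<n. a i * g i (fst z)) + (\<Sum>i<n. b i * g i (snd z))))"
  have fm[measurable]: "f \<in> borel_measurable (P \<Otimes>\<^sub>M P)" unfolding f_def by measurable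
  have i: "integrable (P \<Otimes>\<^sub>M P) f"
    by (rule PP.P.integrable_const_bound[where B=1]) (auto simp: f_def simp del: of_real_sum of_real_add of_real_mult)
  have f2: "f (x, y) = iexp (\<Sum>i<n. a i * g i x) * iexp (\<Sum>i<n. b i * g i y)" for x y
    by (simp add: f_def exp_add[symmetric] algebra_simps)
  have "(\<integral>z. f z \<partial>(P \<Otimes>\<^sub>M P)) = (\<integral>x. \<integral>y. f (x, y) \<partial>P \<partial>P)"
    by (rule PP.integral_fst'[OF i, symmetric])
  also have "\<dots> = (\<integral>x. iexp (\<Sum>i<n. a i * g i x) \<partial>P) * (\<integral>y. iexp (\<Sum>i<n. b i * g i y) \<partial>P)"
    unfolding f2 by (simp only: integral_mult_right_zero integral_mult_left_zero)
  also have "\<dots> = complex_of_real (exp (- ((\<Sum>i<n. \<Sum>j<n. a i * a j * C i j) + (\<Sum>i<n. \<Sum>j<n. b i * b j * C i j)) / 2))"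
    unfolding joint_char of_real_mult[symmetric] exp_add[symmetric] by (simp add: add_divide_distrib)
  finally show ?thesis unfolding f_def .
qed

text \<open>For two independent copies, rotating the pair changes the coefficients
  \<open>(t, t')\<close> of a linear combination by a rotation as well. The sum of the two quadratic
  forms is invariant because \<open>c^2 + s^2 = 1\<close>, hence the joint characteristic function
  is unchanged.\<close>

lemma rotation:
  assumes cs: "c\<^sup>2 + s\<^sup>2 = (1::real)" and A[measurable]: "A \<in> sets borel" and B[measurable]: "B \<in> sets borel"
  shows "measure (P \<Otimes>\<^sub>M P) {z\<in>space (P \<Otimes>\<^sub>M P). (\<forall>i<n. c * g i (fst z) + s * g i (snd z) \<in> A)
      \<and> (\<forall>i<n. c * g i (snd z) - s * g i (fst z) \<in> B)}
    = prob {w\<in>space P. \<forall>i<n. g i w \<in> A} * prob {w\<in>space P. \<forall>i<n. g i w \<in> B}"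
proof -
  interpret PP: pair_prob_space P P by (rule pair)
  \<comment> \<open>One sequence of length \<open>n + n\<close> carries both copies: the indices
    below \<open>n\<close> hold the first rotated component, the next \<open>n\<close> the
    second.\<close>
  define X where "X = (\<lambda>i z. if i < n then c * g i (fst z) + s * g i (snd z)
     else c * g (i - n) (snd z) - s * g (i - n) (fst z))"
  define X' where "X' = (\<lambda>i z. if i < n then g i (fst z) else g (i - n) (snd z))"
  have eq: "(\<integral>z. iexp (\<Sum>i<n+n. t i * X i z) \<partial>(P \<Otimes>\<^sub>M P)) = (\<integral>z. iexp (\<Sum>i<n+n. t i * X' i z) \<partial>(P \<Otimes>\<^sub>M P))" for t
  proof -
    define a where "a = (\<lambda>i. t i * c - t (n+i) * s)"
    define b where "b = (\<lambda>i. t i * s + t (n+i) * c)"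
    have 1: "(\<Sum>i<n+n. t i * X i z) = (\<Sum>i<n. a i * g i (fst z)) + (\<Sum>i<n. b i * g i (snd z))" for z
      by (simp add: sum_lessThan_add X_def a_def b_def sum.distrib[symmetric] algebra_simps)
    have 2: "(\<Sum>i<n+n. t i * X' i z) = (\<Sum>i<n. t i * g i (fst z)) + (\<Sum>i<n. t (n+i) * g i (snd z))" for z
      by (simp add: sum_lessThan_add X'_def)
    have 3: "a i * a j * C i j + b i * b j * C i j = t i * t j * C i j + t (n+i) * t (n+j) * C i j" for i j
    proof -
      have "a i * a j + b i * b j = (c\<^sup>2 + s\<^sup>2) * (t i * t j + t (n+i) * t (n+j))"
        by (simp add: a_def b_def power2_eq_square algebra_simps)
      then show ?thesis using cs by (simp add: distrib_right[symmetric])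
    qed
    show ?thesis unfolding 1 2 pair_char by (simp only: sum.distrib[symmetric] 3)
  qed
  have "measure (P \<Otimes>\<^sub>M P) {z\<in>space (P \<Otimes>\<^sub>M P). \<forall>i<n+n. X i z \<in> (if i < n then A else B)}
      = measure (P \<Otimes>\<^sub>M P) {z\<in>space (P \<Otimes>\<^sub>M P). \<forall>i<n+n. X' i z \<in> (if i < n then A else B)}"
    by (rule rectangle_law_unique[OF _ _ _ _ _ eq]) (auto simp: X_def X'_def intro: PP.finite_measure)
  moreover have "(\<forall>i<n+n. Z i \<in> (if i < n then A else B)) \<longleftrightarrow> (\<forall>i<n. Z i \<in> A) \<and> (\<forall>i<n. Z (n+i) \<in> B)" for Z :: "nat \<Rightarrow> real"
  proof (intro iffI conjI allI impI)
    fix i assume *: "(\<forall>i<n. Z i \<in> A) \<and> (\<forall>i<n. Z (n+i) \<in> B)" "i < n + n"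
    then have "n + (i - n) = i" if "\<not> i < n" using that by simp
    moreover have "i - n < n" if "\<not> i < n" using that * by simp
    ultimately show "Z i \<in> (if i < n then A else B)" using * by (metis (full_types))
  next
    fix i assume *: "\<forall>i<n+n. Z i \<in> (if i < n then A else B)" "i < n"
    show "Z i \<in> A" using *(1)[rule_format, of i] *(2) by simp
    show "Z (n+i) \<in> B" using *(1)[rule_format, of "n+i"] *(2) by simp
  qed
  ultimately have "measure (P \<Otimes>\<^sub>M P) {z\<in>space (P \<Otimes>\<^sub>M P). (\<forall>i<n. c * g i (fst z) + s * g i (snd z) \<in> A)
      \<and> (\<forall>i<n. c * g i (snd z) - s * g i (fst z) \<in> B)}
    = measure (P \<Otimes>\<^sub>M P) {z\<in>space (P \<Otimes>\<^sub>M P). (\<forall>i<n. g i (fst z) \<in> A) \<and> (\<forall>i<n. g i (snd z) \<in> B)}"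
    by (simp add: X_def X'_def)
  also have "{z\<in>space (P \<Otimes>\<^sub>M P). (\<forall>i<n. g i (fst z) \<in> A) \<and> (\<forall>i<n. g i (snd z) \<in> B)}
    = {w\<in>space P. \<forall>i<n. g i w \<in> A} \<times> {w\<in>space P. \<forall>i<n. g i w \<in> B}"
    by (auto simp: space_pair_measure)
  also have "measure (P \<Otimes>\<^sub>M P) \<dots> = prob {w\<in>space P. \<forall>i<n. g i w \<in> A} * prob {w\<in>space P. \<forall>i<n. g i w \<in> B}"
    by (rule pair_measure_times) measurable
  finally show ?thesis .
qed

section \<open>Tails of the supremum from rotated copies\<close>

definition box :: "nat \<Rightarrow> real \<Rightarrow> real" where
  "box n a = prob {w\<in>space P. \<forall>i<n. \<bar>g i w\<bar> \<le> a}"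

lemma box_le_1: "box n a \<le> 1" and box_nonneg: "0 \<le> box n a"
  by (auto simp: box_def)

lemma box_mono: "a \<le> b \<Longrightarrow> box n a \<le> box n b"
  unfolding box_def by (intro finite_measure_mono) (force, measurable)

text \<open>The two rotated components are independent with the original law, so the probability
  factors. The second factor is obtained by complement, since \<open>rotation\<close> speaks of
  rectangles only.\<close>

lemma rotation_tail:
  assumes cs: "c\<^sup>2 + s\<^sup>2 = (1::real)"
  shows "measure (P \<Otimes>\<^sub>M P) {z\<in>space (P \<Otimes>\<^sub>M P). (\<forall>i<n. \<bar>c * g i (fst z) + s * g i (snd z)\<bar> \<le> a)
      \<and> \<not> (\<forall>i<n. \<bar>c * g i (snd z) - s * g i (fst z)\<bar> \<le> b)} = box n a * (1 - box n b)"
proof -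
  interpret PP: pair_prob_space P P by (rule pair)
  have ab: "x \<in> {-a..a} \<longleftrightarrow> \<bar>x\<bar> \<le> a" for x a :: real by auto
  let ?E = "{z\<in>space (P \<Otimes>\<^sub>M P). (\<forall>i<n. \<bar>c * g i (fst z) + s * g i (snd z)\<bar> \<le> a)}"
  let ?F = "{z\<in>space (P \<Otimes>\<^sub>M P). (\<forall>i<n. \<bar>c * g i (fst z) + s * g i (snd z)\<bar> \<le> a)
      \<and> (\<forall>i<n. \<bar>c * g i (snd z) - s * g i (fst z)\<bar> \<le> b)}"
  have 1: "measure (P \<Otimes>\<^sub>M P) ?E = box n a"
    using rotation[OF cs atLeastAtMost_borel[of "-a" a] sets.top[of borel, unfolded space_borel], of n, unfolded ab]
    unfolding box_def by (simp only: UNIV_I simp_thms Collect_mem_eq prob_space mult_1_right)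
  have 2: "measure (P \<Otimes>\<^sub>M P) ?F = box n a * box n b"
    unfolding box_def by (rule rotation[OF cs atLeastAtMost_borel[of "-a" a] atLeastAtMost_borel[of "-b" b], of n, unfolded ab])
  have E: "{z\<in>space (P \<Otimes>\<^sub>M P). (\<forall>i<n. \<bar>c * g i (fst z) + s * g i (snd z)\<bar> \<le> a)
      \<and> \<not> (\<forall>i<n. \<bar>c * g i (snd z) - s * g i (fst z)\<bar> \<le> b)} = ?E - ?F" by auto
  have "measure (P \<Otimes>\<^sub>M P) (?E - ?F) = measure (P \<Otimes>\<^sub>M P) ?E - measure (P \<Otimes>\<^sub>M P) ?F"
  proof (rule PP.P.finite_measure_Diff)
    have [measurable]: "(\<lambda>z. g i (fst z)) \<in> borel_measurable (P \<Otimes>\<^sub>M P)"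
      "(\<lambda>z. g i (snd z)) \<in> borel_measurable (P \<Otimes>\<^sub>M P)" for i by measurable
    show "?F \<subseteq> ?E" by (intro Collect_mono) simp
    show "?E \<in> sets (P \<Otimes>\<^sub>M P)" by measurable
    show "?F \<in> sets (P \<Otimes>\<^sub>M P)" by measurable
  qed
  then show ?thesis by (simp only: E 1 2 right_diff_distrib mult_1_right)
qed

text \<open>Rotating by the angles \<open>j / m\<close> gives \<open>m\<close> equiprobable disjoint events.\<close>

lemma box_separation:
  assumes m: "m \<ge> 1" and s: "0 \<le> s"
  shows "real m * (box n s * (1 - box n (2 * s / sin (1 / real m)))) \<le> 1"
proof -
  interpret PP: pair_prob_space P P by (rule pair)
  define b where "b = 2 * s / sin (1 / real m)"
  define E where "E = (\<lambda>j::nat. {z\<in>space (P \<Otimes>\<^sub>M P).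
      (\<forall>i<n. \<bar>cos (real j / m) * g i (fst z) + sin (real j / m) * g i (snd z)\<bar> \<le> s)
      \<and> \<not> (\<forall>i<n. \<bar>cos (real j / m) * g i (snd z) - sin (real j / m) * g i (fst z)\<bar> \<le> b)})"
  have E[measurable]: "E j \<in> sets (P \<Otimes>\<^sub>M P)" for j unfolding E_def by measurable
  have pE: "measure (P \<Otimes>\<^sub>M P) (E j) = box n s * (1 - box n b)" for j
    unfolding E_def by (rule rotation_tail) simp
  have m1: "0 < 1 / real m" "1 / real m \<le> 1" using m by (auto simp: divide_simps)
  have p1: "(1::real) < pi/2" using pi_gt3 by simp
  have sp: "0 < sin (1 / real m)" using m1 p1 by (intro sin_gt_zero; linarith)
  \<comment> \<open>If the first components at the two angles are both at most \<open>s\<close>,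
    then the second component at the smaller angle, multiplied by the sine of the difference, is at
    most \<open>2 * s\<close>. The difference lies between \<open>1/m\<close> and 1, below a quarter
    turn, so that sine is at least \<open>sin (1/m)\<close>; this contradicts the excess over
    \<open>b\<close>.\<close>
  have dis: "E j \<inter> E k = {}" if jk: "j < k" "k < m" for j k
  proof (rule ccontr)
    assume "E j \<inter> E k \<noteq> {}"
    then obtain z where z: "z \<in> E j" "z \<in> E k" by auto
    define \<theta> where "\<theta> = real j / m"
    define \<phi> where "\<phi> = real k / m"
    have d: "1 / real m \<le> \<phi> - \<theta>" "\<phi> - \<theta> \<le> 1"
      using jk m by (auto simp: \<theta>_def \<phi>_def field_simps)
    have sn: "sin (1 / real m) \<le> sin (\<phi> - \<theta>)"
      using d p1 m1 by (intro sin_monotone_2pi_le; linarith)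
    have "\<bar>cos \<theta> * g i (snd z) - sin \<theta> * g i (fst z)\<bar> \<le> b" if i: "i < n" for i
    proof -
      let ?x = "g i (fst z)" and ?y = "g i (snd z)"
      let ?X = "cos \<theta> * ?x + sin \<theta> * ?y" and ?Y = "cos \<theta> * ?y - sin \<theta> * ?x"
      have X: "\<bar>?X\<bar> \<le> s" using z i by (auto simp: E_def \<theta>_def)
      have X2: "\<bar>cos \<phi> * ?x + sin \<phi> * ?y\<bar> \<le> s" using z i by (auto simp: E_def \<phi>_def)
      \<comment> \<open>The rotation by the larger angle is the rotation by the smaller one followed
        by the rotation by their difference.\<close>
      have "cos \<phi> * ?x + sin \<phi> * ?y = ((sin \<theta>)\<^sup>2 + (cos \<theta>)\<^sup>2) * (cos \<phi> * ?x + sin \<phi> * ?y)" by simp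
      also have "\<dots> = cos (\<phi> - \<theta>) * ?X + sin (\<phi> - \<theta>) * ?Y"
        by (simp only: cos_diff sin_diff power2_eq_square) (simp only: algebra_simps)
      finally have "sin (\<phi> - \<theta>) * ?Y = (cos \<phi> * ?x + sin \<phi> * ?y) - cos (\<phi> - \<theta>) * ?X" by simp
      then have "\<bar>sin (\<phi> - \<theta>) * ?Y\<bar> \<le> \<bar>cos \<phi> * ?x + sin \<phi> * ?y\<bar> + \<bar>cos (\<phi> - \<theta>) * ?X\<bar>"
        by (metis abs_triangle_ineq4)
      also have "\<dots> \<le> s + 1 * s" unfolding abs_mult
        by (intro add_mono mult_mono X X2 abs_cos_le_one) auto
      finally have "\<bar>sin (\<phi> - \<theta>)\<bar> * \<bar>?Y\<bar> \<le> 2 * s" by (simp add: abs_mult)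
      moreover have "sin (1 / real m) * \<bar>?Y\<bar> \<le> \<bar>sin (\<phi> - \<theta>)\<bar> * \<bar>?Y\<bar>"
        using sn by (intro mult_right_mono) auto
      ultimately show ?thesis using sp by (simp add: b_def pos_le_divide_eq mult.commute)
    qed
    then show False using z(1) by (auto simp: E_def \<theta>_def)
  qed
  have "disjoint_family_on E {..<m}"
    unfolding disjoint_family_on_def using dis by (metis inf_commute lessThan_iff linorder_neqE_nat)
  then have "measure (P \<Otimes>\<^sub>M P) (\<Union>j<m. E j) = (\<Sum>j<m. measure (P \<Otimes>\<^sub>M P) (E j))"
    by (intro PP.P.finite_measure_finite_Union) auto
  also have "\<dots> = real m * (box n s * (1 - box n b))" by (simp add: pE)
  finally show ?thesis using PP.P.prob_le_1[of "\<Union>j<m. E j"] by (simp add: b_def)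
qed

text \<open>Rotation by 45 degrees. If the normalised sum is at most \<open>s\<close> while the
  normalised difference exceeds \<open>s + sqrt 2 * t\<close> at the same index, then both copies
  exceed \<open>t\<close> there. Independence of the copies produces the square on the
  right.\<close>

lemma box_fernique:
  "box n s * (1 - box n (s + sqrt 2 * t)) \<le> (1 - box n t)\<^sup>2"
proof -
  interpret PP: pair_prob_space P P by (rule pair)
  let ?c = "1 / sqrt 2"
  have "(?c)\<^sup>2 + (?c)\<^sup>2 = (1::real)" by (simp add: power_divide)
  from rotation_tail[OF this, of n s "s + sqrt 2 * t"]
  have "box n s * (1 - box n (s + sqrt 2 * t)) = measure (P \<Otimes>\<^sub>M P) {z\<in>space (P \<Otimes>\<^sub>M P).
     (\<forall>i<n. \<bar>?c * g i (fst z) + ?c * g i (snd z)\<bar> \<le> s)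
      \<and> \<not> (\<forall>i<n. \<bar>?c * g i (snd z) - ?c * g i (fst z)\<bar> \<le> s + sqrt 2 * t)}" ..
  also have "\<dots> \<le> measure (P \<Otimes>\<^sub>M P) ({w\<in>space P. \<not> (\<forall>i<n. \<bar>g i w\<bar> \<le> t)} \<times> {w\<in>space P. \<not> (\<forall>i<n. \<bar>g i w\<bar> \<le> t)})"
  proof (rule PP.P.finite_measure_mono)
    show "{z\<in>space (P \<Otimes>\<^sub>M P).
     (\<forall>i<n. \<bar>?c * g i (fst z) + ?c * g i (snd z)\<bar> \<le> s)
      \<and> \<not> (\<forall>i<n. \<bar>?c * g i (snd z) - ?c * g i (fst z)\<bar> \<le> s + sqrt 2 * t)}
      \<subseteq> {w\<in>space P. \<not> (\<forall>i<n. \<bar>g i w\<bar> \<le> t)} \<times> {w\<in>space P. \<not> (\<forall>i<n. \<bar>g i w\<bar> \<le> t)}"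
    proof
      fix z assume z: "z \<in> {z\<in>space (P \<Otimes>\<^sub>M P).
     (\<forall>i<n. \<bar>?c * g i (fst z) + ?c * g i (snd z)\<bar> \<le> s)
      \<and> \<not> (\<forall>i<n. \<bar>?c * g i (snd z) - ?c * g i (fst z)\<bar> \<le> s + sqrt 2 * t)}"
      obtain x y where zxy: "z = (x, y)" by (cases z)
      have xy: "(x, y) \<in> space (P \<Otimes>\<^sub>M P)" using z by (simp add: zxy)
      obtain i where i: "i < n" and 2: "\<not> \<bar>?c * g i y - ?c * g i x\<bar> \<le> s + sqrt 2 * t"
        using z by (auto simp: zxy)
      have 1: "\<forall>i<n. \<bar>?c * g i x + ?c * g i y\<bar> \<le> s" using z by (simp add: zxy)
      have 1: "\<bar>?c * g i x + ?c * g i y\<bar> \<le> s" using 1 i by simp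
      have e: "u = ?c * u * sqrt 2" for u by simp
      have "(?c * g i x + ?c * g i y) - (?c * g i y - ?c * g i x) = sqrt 2 * g i x"
        "(?c * g i x + ?c * g i y) + (?c * g i y - ?c * g i x) = sqrt 2 * g i y"
        by (simp_all add: field_simps)
      then have "sqrt 2 * t < \<bar>sqrt 2 * g i x\<bar>" "sqrt 2 * t < \<bar>sqrt 2 * g i y\<bar>" using 1 2 by auto
      then have "t < \<bar>g i x\<bar>" "t < \<bar>g i y\<bar>" by (auto simp: abs_mult)
      then have "\<not> \<bar>g i x\<bar> \<le> t" "\<not> \<bar>g i y\<bar> \<le> t" by auto
      then show "z \<in> {w\<in>space P. \<not> (\<forall>i<n. \<bar>g i w\<bar> \<le> t)} \<times> {w\<in>space P. \<not> (\<forall>i<n. \<bar>g i w\<bar> \<le> t)}"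
        using xy i zxy by (auto simp: space_pair_measure)
    qed
  qed measurable
  also have "\<dots> = prob {w\<in>space P. \<not> (\<forall>i<n. \<bar>g i w\<bar> \<le> t)} * prob {w\<in>space P. \<not> (\<forall>i<n. \<bar>g i w\<bar> \<le> t)}"
    by (rule pair_measure_times) measurable
  also have "prob {w\<in>space P. \<not> (\<forall>i<n. \<bar>g i w\<bar> \<le> t)} = 1 - box n t"
    unfolding box_def by (rule prob_neg) measurable
  finally show ?thesis by (simp add: power2_eq_square)
qed

text \<open>Let \<open>q k\<close> be the tail at level \<open>3^k * s\<close>. Since
  \<open>s + sqrt 2 * 3^k * s\<close> is at most \<open>3^(k+1) * s\<close>, Fernique's inequality
  gives \<open>7/8 * q (k+1) <= (q k)^2\<close>. Thus \<open>8/7 * q k\<close> is at worst squared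
  whenever the level triples, starting from at most \<open>8/7 * 1/8 = 1/7\<close>.\<close>

lemma box_tail:
  assumes "box n s \<ge> 7/8" "s > 0"
  shows "1 - box n (3 ^ k * s) \<le> 7/8 * (1/7) ^ (2 ^ k)"
proof (induction k)
  case 0
  then show ?case using assms by simp
next
  case (Suc k)
  have "s + sqrt 2 * (3 ^ k * s) \<le> 3 ^ k * s + 2 * (3 ^ k * s)"
    using assms by (intro add_mono mult_right_mono) (auto simp: real_le_lsqrt)
  then have "1 - box n (3 ^ Suc k * s) \<le> 1 - box n (s + sqrt 2 * (3 ^ k * s))"
    by (intro diff_left_mono box_mono) (simp add: algebra_simps)
  then have "7/8 * (1 - box n (3 ^ Suc k * s)) \<le> box n s * (1 - box n (s + sqrt 2 * (3 ^ k * s)))"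
    using assms box_le_1 by (intro mult_mono) (auto simp: box_nonneg)
  also have "\<dots> \<le> (1 - box n (3 ^ k * s))\<^sup>2" by (rule box_fernique)
  also have "\<dots> \<le> (7/8 * (1/7) ^ (2 ^ k))\<^sup>2"
    using Suc box_le_1 by (intro power_mono) auto
  also have "\<dots> = 7/8 * (7/8 * (1/7) ^ (2 ^ Suc k))"
    by (simp add: power_mult_distrib power2_eq_square power_add[symmetric] mult_2)
  finally show ?case by (rule mult_left_le_imp_le) simp
qed

text \<open>Ratio test: consecutive terms have ratio \<open>3 powr p * (1/7)^(2^k)\<close>, which
  eventually drops below 1/2.\<close>

lemma summable_doubly_exponential: "summable (\<lambda>k. (3 ^ Suc k * s) powr p * (7/8 * (1/7) ^ (2 ^ k)))"
  if s: "(s::real) > 0"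
proof -
  have "(\<lambda>k. (1/7::real) ^ k) \<longlonglongrightarrow> 0" by (rule LIMSEQ_realpow_zero) auto
  then have "eventually (\<lambda>k. (1/7::real) ^ k < 1 / (2 * 3 powr p :: real)) sequentially"
    by (rule order_tendstoD) auto
  then obtain N where N: "\<And>k. k \<ge> N \<Longrightarrow> (1/7::real) ^ k < 1 / (2 * 3 powr p :: real)"
    by (auto simp: eventually_sequentially)
  show ?thesis
  proof (rule summable_ratio_test[where c="1/2" and N=N])
    fix k assume k: "N \<le> k"
    have "(1/7::real) ^ (2 ^ k) \<le> (1/7) ^ k" by (intro power_decreasing) auto
    then have "3 powr p * (1/7::real) ^ (2 ^ k) \<le> 3 powr p * (1 / (2 * 3 powr p))"
      using N[OF k] by (intro mult_left_mono powr_ge_zero; linarith)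
    then have *: "3 powr p * (1/7::real) ^ (2 ^ k) \<le> 1/2" by simp
    have "norm ((3 ^ Suc (Suc k) * s) powr p * (7/8 * (1/7) ^ (2 ^ Suc k)))
      = (3 powr p * (1/7::real) ^ (2 ^ k)) * norm ((3 ^ Suc k * s) powr p * (7/8 * (1/7) ^ (2 ^ k)))"
    proof -
      have "(3 * X) powr p = 3 powr p * X powr p" if "X \<ge> 0" for X :: real using that by (simp add: powr_mult)
      from this[of "3 ^ Suc k * s"]
      have "(3 ^ Suc (Suc k) * s) powr p = 3 powr p * (3 ^ Suc k * s) powr p" using s by (simp add: mult.assoc)
      moreover have "(1/7::real) ^ (2 ^ Suc k) = (1/7) ^ (2 ^ k) * (1/7) ^ (2 ^ k)"
        by (simp only: power_add[symmetric] power_Suc mult_2)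
      ultimately show ?thesis by (simp only: abs_mult real_norm_def) simp
    qed
    also have "\<dots> \<le> 1/2 * norm ((3 ^ Suc k * s) powr p * (7/8 * (1/7) ^ (2 ^ k)))"
      by (intro mult_right_mono *) auto
    finally show "norm ((3 ^ Suc (Suc k) * s) powr p * (7/8 * (1/7) ^ (2 ^ Suc k)))
      \<le> 1/2 * norm ((3 ^ Suc k * s) powr p * (7/8 * (1/7) ^ (2 ^ k)))" .
  qed simp
qed

text \<open>Layer-cake estimate along the levels \<open>3^k * s\<close>: the event
  \<open>B k\<close> that level \<open>k\<close> is exceeded has doubly exponentially small
  probability, uniformly in the number of variables, while it contributes only a power of
  \<open>3^(k+1)\<close>.\<close>

lemma moments_of_box:
  assumes box: "\<And>n. box n s \<ge> 7/8" and s: "s > 0" and p: "p > 0"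
  shows "(\<integral>\<^sup>+w. (SUP i. ennreal (\<bar>g i w\<bar> powr p)) \<partial>P) < \<infinity>"
proof -
  define B where "B = (\<lambda>k. {w\<in>space P. \<exists>i. \<bar>g i w\<bar> > 3 ^ k * s})"
  have [measurable]: "B k \<in> sets P" for k unfolding B_def by measurable
  have pB: "prob (B k) \<le> 7/8 * (1/7) ^ (2 ^ k)" for k
  proof -
    let ?A = "\<lambda>n. {w\<in>space P. \<not> (\<forall>i<n. \<bar>g i w\<bar> \<le> 3 ^ k * s)}"
    have "(\<lambda>n. prob (?A n)) \<longlonglongrightarrow> prob (\<Union>n. ?A n)"
      by (rule finite_Lim_measure_incseq) (auto simp: incseq_def intro: less_le_trans)
    moreover have "prob (?A n) = 1 - box n (3 ^ k * s)" for n
      unfolding box_def by (rule prob_neg) measurable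
    ultimately have "(\<lambda>n. 1 - box n (3 ^ k * s)) \<longlonglongrightarrow> prob (\<Union>n. ?A n)" by simp
    then have "prob (\<Union>n. ?A n) \<le> 7/8 * (1/7) ^ (2 ^ k)"
      by (rule LIMSEQ_le_const2) (intro exI[of _ 0] allI impI box_tail box s)
    also have "(\<Union>n. ?A n) = B k" by (force simp: B_def not_le)
    finally show ?thesis .
  qed
  have bound: "(SUP i. ennreal (\<bar>g i w\<bar> powr p)) \<le> ennreal (s powr p) + (\<Sum>k. ennreal ((3 ^ Suc k * s) powr p) * indicator (B k) w)"
    if w: "w \<in> space P" for w
  proof (cases "\<exists>k. w \<notin> B k")
    \<comment> \<open>If every level is exceeded, each summand is at least
      \<open>s powr p > 0\<close>, so the right-hand side is infinite.\<close>
    case False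
    have "(\<Sum>k. ennreal (s powr p)) \<le> (\<Sum>k. ennreal ((3 ^ Suc k * s) powr p) * indicator (B k) w)"
    proof (rule suminf_le)
      fix k
      have "1 * s \<le> 3 ^ Suc k * s" using s by (intro mult_right_mono one_le_power) simp_all
      then show "ennreal (s powr p) \<le> ennreal ((3 ^ Suc k * s) powr p) * indicator (B k) w"
        using False s p by (auto intro!: ennreal_leI powr_mono2)
    qed auto
    moreover have "(\<Sum>k::nat. ennreal (s powr p)) = top"
    proof (rule ccontr)
      assume "(\<Sum>k::nat. ennreal (s powr p)) \<noteq> top"
      then have "summable (\<lambda>k::nat. s powr p)" by (intro summable_suminf_not_top) simp
      then have "(\<lambda>k::nat. s powr p) \<longlonglongrightarrow> 0" by (rule summable_LIMSEQ_zero)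
      then show False using s by (simp add: LIMSEQ_const_iff)
    qed
    ultimately show ?thesis by (simp add: top_unique)
  next
    case True
    \<comment> \<open>At the first level that is not exceeded, the single summand of the preceding
      level already dominates the supremum.\<close>
    define K where "K = (LEAST k. w \<notin> B k)"
    have K: "w \<notin> B K" unfolding K_def using True by (rule LeastI_ex)
    have le: "\<bar>g i w\<bar> \<le> 3 ^ K * s" for i using K w by (auto simp: B_def not_less)
    show ?thesis
    proof (cases K)
      case 0
      have "(SUP i. ennreal (\<bar>g i w\<bar> powr p)) \<le> ennreal (s powr p)"
        using le p 0 by (intro SUP_least ennreal_leI powr_mono2) auto
      then show ?thesis by (simp add: add_increasing2)
    next
      case (Suc k)
      then have "w \<in> B k" using not_less_Least[of k "\<lambda>k. w \<notin> B k"] by (auto simp: K_def)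
      have "(SUP i. ennreal (\<bar>g i w\<bar> powr p)) \<le> ennreal ((3 ^ Suc k * s) powr p) * indicator (B k) w"
        using le p Suc \<open>w \<in> B k\<close> by (auto intro!: SUP_least ennreal_leI powr_mono2)
      also have "\<dots> = (\<Sum>j\<in>{k}. ennreal ((3 ^ Suc j * s) powr p) * indicator (B j) w)"
        by (subst sum.insert) (simp_all only: sum.empty add_0_right finite.emptyI empty_iff not_False_eq_True)
      also have "\<dots> \<le> (\<Sum>k. ennreal ((3 ^ Suc k * s) powr p) * indicator (B k) w)"
        by (intro sum_le_suminf) auto
      finally show ?thesis by (simp add: add_increasing)
    qed
  qed
  have "(\<integral>\<^sup>+w. (SUP i. ennreal (\<bar>g i w\<bar> powr p)) \<partial>P)
    \<le> (\<integral>\<^sup>+w. ennreal (s powr p) + (\<Sum>k. ennreal ((3 ^ Suc k * s) powr p) * indicator (B k) w) \<partial>P)"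
    by (intro nn_integral_mono bound)
  also have "\<dots> = ennreal (s powr p) + (\<Sum>k. ennreal ((3 ^ Suc k * s) powr p) * emeasure P (B k))"
    by (simp add: nn_integral_add nn_integral_suminf nn_integral_cmult_indicator emeasure_space_1)
  finally have le: "(\<integral>\<^sup>+w. (SUP i. ennreal (\<bar>g i w\<bar> powr p)) \<partial>P)
    \<le> ennreal (s powr p) + (\<Sum>k. ennreal ((3 ^ Suc k * s) powr p) * emeasure P (B k))" .
  have "(\<Sum>k. ennreal ((3 ^ Suc k * s) powr p) * emeasure P (B k))
     \<le> (\<Sum>k. ennreal ((3 ^ Suc k * s) powr p * (7/8 * (1/7) ^ (2 ^ k))))"
  proof (intro suminf_le allI)
    fix k
    have "ennreal ((3 ^ Suc k * s) powr p) * emeasure P (B k) = ennreal ((3 ^ Suc k * s) powr p * prob (B k))"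
      by (simp only: emeasure_eq_measure ennreal_mult''[symmetric] measure_nonneg)
    also have "\<dots> \<le> ennreal ((3 ^ Suc k * s) powr p * (7/8 * (1/7) ^ (2 ^ k)))"
      by (intro ennreal_leI mult_left_mono pB powr_ge_zero)
    finally show "ennreal ((3 ^ Suc k * s) powr p) * emeasure P (B k) \<le> ennreal ((3 ^ Suc k * s) powr p * (7/8 * (1/7) ^ (2 ^ k)))" .
  qed simp_all
  also have "\<dots> < top"
    by (intro less_top[THEN iffD1] ennreal_suminf_neq_top summable_doubly_exponential s) simp
  finally have "ennreal (s powr p) + (\<Sum>k. ennreal ((3 ^ Suc k * s) powr p) * emeasure P (B k)) < \<infinity>" by simp
  with le show ?thesis by (rule order.strict_trans1)
qed

text \<open>A substitute for a zero-one law. With \<open>m >= 8/c\<close> rotations,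
  \<open>box_separation\<close> gives \<open>8 * (1 - box n b) <= 1\<close> at the enlarged level
  \<open>b = 2 * a / sin (1/m)\<close>, which does not depend on \<open>n\<close>.\<close>

lemma box_eventually:
  assumes c: "c > 0" and a: "a > 0" and box: "\<And>n. box n a \<ge> c"
  obtains s where "s > 0" "\<And>n. box n s \<ge> 7/8"
proof -
  obtain m :: nat where m: "real m \<ge> 8 / c" "m \<ge> 1"
    by (metis max.bounded_iff real_nat_ceiling_ge of_nat_max max.cobounded1 max.cobounded2 order_trans)
  have m1: "0 < 1 / real m" "1 / real m \<le> 1" using m by (auto simp: divide_simps)
  have p1: "(1::real) < pi" using pi_gt3 by simp
  have sp: "0 < sin (1 / real m)" using m1 p1 by (intro sin_gt_zero; linarith)
  have "box n (2 * a / sin (1 / real m)) \<ge> 7/8" for n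
  proof -
    have eight: "8 * (1 - x) \<le> 1 \<Longrightarrow> 7/8 \<le> (x::real)" for x by simp
    have "8 * (1 - box n (2 * a / sin (1 / real m))) \<le> (real m * box n a) * (1 - box n (2 * a / sin (1 / real m)))"
    proof (rule mult_right_mono)
      have "8 = 8 / c * c" using c by simp
      also have "\<dots> \<le> real m * box n a" using m box c by (intro mult_mono) auto
      finally show "8 \<le> real m * box n a" .
    qed (use box_le_1 in simp)
    also have "\<dots> \<le> 1" using box_separation[of m a n] m a by (simp add: mult.assoc)
    finally show ?thesis by (rule eight)
  qed
  then show thesis using that[of "2 * a / sin (1 / real m)"] sp a by auto
qed

text \<open>Symmetrisation removes the unknown shift: on two independent copies in
  \<open>D K\<close> the shift cancels in the difference, and the normalised difference has the law
  of \<open>g\<close>. So \<open>g\<close> has a box of probability at least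
  \<open>prob (D K)\<close> squared, hence all moments. One sample point in \<open>D K\<close> with
  finite supremum then bounds \<open>m\<close> itself. The conclusion holds under the whole of
  \<open>P\<close>, not merely on \<open>A\<close>.\<close>

theorem shifted_moments:
  assumes A[measurable]: "A \<in> sets P" and pA: "prob A > 0" and p: "p > 0"
    and bd: "\<And>w. w \<in> A \<Longrightarrow> \<exists>K. \<forall>i. \<bar>m i + g i w\<bar> \<le> K"
  shows "(\<integral>\<^sup>+w. (SUP i. ennreal (\<bar>m i + g i w\<bar> powr p)) \<partial>P) < \<infinity>"
proof -
  interpret PP: pair_prob_space P P by (rule pair)
  define D where "D = (\<lambda>K::nat. {w\<in>space P. \<forall>i. \<bar>m i + g i w\<bar> \<le> real K})"
  have D[measurable]: "D K \<in> sets P" for K unfolding D_def by measurable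
  have "A \<subseteq> (\<Union>K. D K)"
  proof
    fix w assume w: "w \<in> A"
    with bd obtain K where "\<forall>i. \<bar>m i + g i w\<bar> \<le> K" by blast
    moreover obtain k :: nat where "K \<le> real k" using real_arch_simple by blast
    ultimately have "\<forall>i. \<bar>m i + g i w\<bar> \<le> real k" by (blast intro: order_trans)
    moreover have "w \<in> space P" using w sets.sets_into_space[OF A] by blast
    ultimately have "w \<in> D k" by (simp only: D_def mem_Collect_eq simp_thms)
    then show "w \<in> (\<Union>K. D K)" by blast
  qed
  then have "prob A \<le> prob (\<Union>K. D K)" by (intro finite_measure_mono) auto
  moreover have "prob (\<Union>K. D K) = 0" if "\<And>K. prob (D K) = 0"
  proof -
    have "emeasure P (\<Union>K. D K) = 0" using that by (intro emeasure_UN_eq_0) (auto simp: emeasure_eq_measure)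
    then show ?thesis by (simp add: emeasure_eq_measure)
  qed
  ultimately obtain K where "prob (D K) \<noteq> 0" using pA by (metis not_less)
  then have K: "prob (D K) > 0" by (simp add: zero_less_measure_iff)
  \<comment> \<open>The difference of two values bounded by \<open>K\<close> is at most
    \<open>2 * K\<close>; the extra 1 keeps the level positive when \<open>K = 0\<close>.\<close>
  define a where "a = 2 * (real K + 1)"
  have "box n a \<ge> prob (D K) * prob (D K)" for n
  proof -
    let ?c = "1 / sqrt 2"
    have "(?c)\<^sup>2 + (?c)\<^sup>2 = (1::real)" by (simp add: power_divide)
    from rotation[OF this, of UNIV "{-a..a}" n]
    have "box n a = measure (P \<Otimes>\<^sub>M P) {z\<in>space (P \<Otimes>\<^sub>M P). \<forall>i<n. ?c * g i (snd z) - ?c * g i (fst z) \<in> {-a..a}}"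
      by (simp add: box_def abs_le_iff prob_space minus_le_iff conj_commute)
    moreover have "measure (P \<Otimes>\<^sub>M P) (D K \<times> D K) \<le> \<dots>"
    proof (rule PP.P.finite_measure_mono)
      show "D K \<times> D K \<subseteq> {z\<in>space (P \<Otimes>\<^sub>M P). \<forall>i<n. ?c * g i (snd z) - ?c * g i (fst z) \<in> {-a..a}}"
      proof
        fix z assume "z \<in> D K \<times> D K"
        then obtain x y where zxy: "z = (x, y)" and xy: "x \<in> D K" "y \<in> D K" by blast
        have "\<bar>?c * g i y - ?c * g i x\<bar> \<le> a" for i
        proof -
          have "\<bar>?c * g i y - ?c * g i x\<bar> = ?c * \<bar>(m i + g i y) - (m i + g i x)\<bar>"
            by (simp add: abs_mult[symmetric] right_diff_distrib[symmetric] diff_divide_distrib[symmetric])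
          also have "\<dots> \<le> 1 * a"
            using xy by (intro mult_mono) (auto simp: D_def a_def intro: order_trans[OF abs_triangle_ineq4] dest!: spec[of _ i])
          finally show ?thesis by simp
        qed
        then have "?c * g i y - ?c * g i x \<in> {-a..a}" for i by (auto simp only: abs_le_iff atLeastAtMost_iff minus_le_iff)
        moreover have "z \<in> space (P \<Otimes>\<^sub>M P)" using xy by (simp add: zxy space_pair_measure D_def)
        ultimately show "z \<in> {z\<in>space (P \<Otimes>\<^sub>M P). \<forall>i<n. ?c * g i (snd z) - ?c * g i (fst z) \<in> {-a..a}}"
          by (simp add: zxy)
      qed
    qed measurable
    moreover have "measure (P \<Otimes>\<^sub>M P) (D K \<times> D K) = prob (D K) * prob (D K)"
      by (rule pair_measure_times) auto
    ultimately show ?thesis by simp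
  qed
  then obtain s where s: "s > 0" "\<And>n. box n s \<ge> 7/8"
    using box_eventually[of "prob (D K) * prob (D K)" a] K by (auto simp: a_def)
  have mom: "(\<integral>\<^sup>+w. (SUP i. ennreal (\<bar>g i w\<bar> powr p)) \<partial>P) < \<infinity>"
    by (rule moments_of_box[OF s(2,1) p])
  then have "AE w in P. (SUP i. ennreal (\<bar>g i w\<bar> powr p)) \<noteq> \<infinity>"
    by (intro nn_integral_PInf_AE) auto
  then have ae: "AE w in P. (SUP i. ennreal (\<bar>g i w\<bar> powr p)) \<noteq> \<infinity>" .
  \<comment> \<open>A common point of a set of positive probability and an almost sure event: there
    both \<open>m + g\<close> and \<open>g\<close> are bounded.\<close>
  have "\<exists>w\<in>D K. (SUP i. ennreal (\<bar>g i w\<bar> powr p)) \<noteq> \<infinity>"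
  proof (rule ccontr)
    assume n: "\<not> (\<exists>w\<in>D K. (SUP i. ennreal (\<bar>g i w\<bar> powr p)) \<noteq> \<infinity>)"
    have "AE w in P. w \<notin> D K" using ae by (rule eventually_mono) (use n in blast)
    with K prob_eq_0[OF D[of K]] show False by simp
  qed
  then obtain w where w: "w \<in> D K" "(SUP i. ennreal (\<bar>g i w\<bar> powr p)) \<noteq> \<infinity>" by blast
  obtain q where q: "(SUP i. ennreal (\<bar>g i w\<bar> powr p)) = ennreal q" "q \<ge> 0"
    using w(2) by (cases "(SUP i. ennreal (\<bar>g i w\<bar> powr p))") auto
  define R where "R = real K + q powr (1/p)"
  have R: "\<bar>m i\<bar> \<le> R" for i
  proof -
    have "ennreal (\<bar>g i w\<bar> powr p) \<le> ennreal q" unfolding q(1)[symmetric] by (rule SUP_upper) simp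
    then have "\<bar>g i w\<bar> powr p \<le> q" using q by simp
    then have "(\<bar>g i w\<bar> powr p) powr (1/p) \<le> q powr (1/p)" using p by (intro powr_mono2) auto
    then have "\<bar>g i w\<bar> \<le> q powr (1/p)" using p by (simp add: powr_powr)
    moreover have "\<bar>m i + g i w\<bar> \<le> real K" using w(1) by (auto simp: D_def)
    ultimately show ?thesis unfolding R_def by linarith
  qed
  have "(\<integral>\<^sup>+w. (SUP i. ennreal (\<bar>m i + g i w\<bar> powr p)) \<partial>P)
    \<le> (\<integral>\<^sup>+w. ennreal ((2 * R) powr p) + ennreal (2 powr p) * (SUP i. ennreal (\<bar>g i w\<bar> powr p)) \<partial>P)"
  proof (intro nn_integral_mono SUP_least)
    fix w i
    have "\<bar>m i + g i w\<bar> powr p \<le> (2 * R) powr p + 2 powr p * \<bar>g i w\<bar> powr p"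
    proof (cases "\<bar>g i w\<bar> \<le> R")
      case True
      then have "\<bar>m i + g i w\<bar> powr p \<le> (2 * R) powr p" using R[of i] p by (intro powr_mono2) auto
      then show ?thesis by (simp add: add_increasing2)
    next
      case False
      then have "\<bar>m i + g i w\<bar> powr p \<le> (2 * \<bar>g i w\<bar>) powr p" using R[of i] p by (intro powr_mono2) auto
      then show ?thesis by (simp add: powr_mult add_increasing)
    qed
    then have "ennreal (\<bar>m i + g i w\<bar> powr p) \<le> ennreal ((2 * R) powr p) + ennreal (2 powr p) * ennreal (\<bar>g i w\<bar> powr p)"
      by (simp add: ennreal_mult'[symmetric] ennreal_plus[symmetric] del: ennreal_plus)
    also have "\<dots> \<le> ennreal ((2 * R) powr p) + ennreal (2 powr p) * (SUP i. ennreal (\<bar>g i w\<bar> powr p))"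
      by (intro add_left_mono mult_left_mono SUP_upper) auto
    finally show "ennreal (\<bar>m i + g i w\<bar> powr p) \<le> ennreal ((2 * R) powr p) + ennreal (2 powr p) * (SUP i. ennreal (\<bar>g i w\<bar> powr p))" .
  qed
  also have "\<dots> = ennreal ((2 * R) powr p) + ennreal (2 powr p) * (\<integral>\<^sup>+w. (SUP i. ennreal (\<bar>g i w\<bar> powr p)) \<partial>P)"
    by (simp add: nn_integral_add nn_integral_cmult emeasure_space_1)
  also have "\<dots> < \<infinity>" using mom by (simp add: ennreal_mult_less_top)
  finally show ?thesis .
qed

end

section \<open>The Wiener integral\<close>

lemma square_add_le: "(x + y)\<^sup>2 \<le> 2 * x\<^sup>2 + 2 * (y::real)\<^sup>2"
  using sum_squares_bound[of x y] by (simp add: power2_sum)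

lemma sum_delta_range:
  assumes "finite R" and "y \<noteq> 0 \<Longrightarrow> y \<in> R" and "0 \<notin> R" and "F 0 = (0::'b::comm_monoid_add)"
  shows "(\<Sum>c\<in>R. if y = c then F c else 0) = F y"
  using assms by (cases "y \<in> R") (auto simp: sum.delta')

definition elementary :: "real \<Rightarrow> (real \<times> real \<Rightarrow> real) \<Rightarrow> bool" where
  "elementary L g \<longleftrightarrow> simple_function borel g \<and> (\<forall>z. z \<notin> {0<..<L} \<times> {0..} \<longrightarrow> g z = 0)
     \<and> emeasure lborel {z. g z \<noteq> 0} < \<infinity>"

lemma elementary_simple: "elementary L g \<Longrightarrow> simple_function borel g" by (simp add: elementary_def)

lemma elementary_finite: "elementary L g \<Longrightarrow> finite (range g)"
  by (auto dest: elementary_simple simp: simple_function_def)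

lemma elementary_measurable: "elementary L g \<Longrightarrow> g \<in> borel_measurable borel"
  by (intro borel_measurable_simple_function elementary_simple)

lemma elementary_vimage: "elementary L g \<Longrightarrow> g -` {c} \<in> sets borel"
  using measurable_sets[OF elementary_measurable, of L g "{c}"] by simp

lemma elementary_lincomb:
  assumes "elementary L g" "elementary L h"
  shows "elementary L (\<lambda>z. a * g z + b * h z)"
proof -
  have [measurable]: "g \<in> borel_measurable borel" "h \<in> borel_measurable borel"
    using assms elementary_measurable by auto
  have "emeasure lborel {z. a * g z + b * h z \<noteq> 0} \<le> emeasure lborel ({z. g z \<noteq> 0} \<union> {z. h z \<noteq> 0})"
    by (intro emeasure_mono) (auto simp: sets_lborel)
  also have "\<dots> \<le> emeasure lborel {z. g z \<noteq> 0} + emeasure lborel {z. h z \<noteq> 0}"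
    by (intro emeasure_subadditive) (auto simp: sets_lborel)
  also have "\<dots> < \<infinity>" using assms by (simp add: elementary_def)
  finally have fin: "emeasure lborel {z. a * g z + b * h z \<noteq> 0} < \<infinity>" .
  have "simple_function borel (\<lambda>z. a * g z + b * h z)"
    using assms elementary_simple by (intro simple_function_add simple_function_mult simple_function_const) auto
  with fin show ?thesis using assms unfolding elementary_def by simp
qed

lemma elementary_square_integral:
  assumes g: "elementary L g"
  shows "(\<integral>\<^sup>+z. ennreal ((g z)\<^sup>2) \<partial>lborel) = ennreal (\<Sum>c\<in>range g - {0}. c\<^sup>2 * measure lborel (g -` {c}))"
    and "c \<noteq> 0 \<Longrightarrow> emeasure lborel (g -` {c}) < \<infinity>"
proof -
  have fin: "c \<noteq> 0 \<Longrightarrow> emeasure lborel (g -` {c}) < \<infinity>" for c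
  proof -
    assume "c \<noteq> 0"
    then have "emeasure lborel (g -` {c}) \<le> emeasure lborel {z. g z \<noteq> 0}"
      using elementary_measurable[OF g] by (intro emeasure_mono) (auto simp: sets_lborel)
    then show ?thesis using g by (auto simp: elementary_def intro: le_less_trans)
  qed
  then show "c \<noteq> 0 \<Longrightarrow> emeasure lborel (g -` {c}) < \<infinity>" .
  have f: "finite (range g - {0})" using elementary_finite[OF g] by simp
  have m: "g -` {c} \<in> sets lborel" for c using elementary_vimage[OF g] by simp
  have "ennreal ((g z)\<^sup>2) = (\<Sum>c\<in>range g - {0}. ennreal (c\<^sup>2) * indicator (g -` {c}) z)" for z
  proof -
    have "(\<Sum>c\<in>range g - {0}. ennreal (c\<^sup>2) * indicator (g -` {c}) z) = (\<Sum>c\<in>range g - {0}. if g z = c then ennreal (c\<^sup>2) else 0)"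
      by (intro sum.cong refl) (simp add: indicator_def)
    also have "\<dots> = ennreal ((g z)\<^sup>2)" by (rule sum_delta_range) (use f in simp_all)
    finally show ?thesis ..
  qed
  then have "(\<integral>\<^sup>+z. ennreal ((g z)\<^sup>2) \<partial>lborel) = (\<Sum>c\<in>range g - {0}. ennreal (c\<^sup>2) * emeasure lborel (g -` {c}))"
    using m by (simp add: nn_integral_sum nn_integral_cmult_indicator)
  also have "\<dots> = (\<Sum>c\<in>range g - {0}. ennreal (c\<^sup>2 * measure lborel (g -` {c})))"
  proof (intro sum.cong refl)
    fix c assume "c \<in> range g - {0}"
    then have "emeasure lborel (g -` {c}) = ennreal (measure lborel (g -` {c}))"
      using fin[of c] by (intro emeasure_eq_ennreal_measure) auto
    then show "ennreal (c\<^sup>2) * emeasure lborel (g -` {c}) = ennreal (c\<^sup>2 * measure lborel (g -` {c}))"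
      by (simp add: ennreal_mult)
  qed
  also have "\<dots> = ennreal (\<Sum>c\<in>range g - {0}. c\<^sup>2 * measure lborel (g -` {c}))"
    by (intro sum_ennreal) simp
  finally show "(\<integral>\<^sup>+z. ennreal ((g z)\<^sup>2) \<partial>lborel) = ennreal (\<Sum>c\<in>range g - {0}. c\<^sup>2 * measure lborel (g -` {c}))" .
qed

lemma (in prob_space) normal_char:
  assumes s: "s > 0" and X: "distributed M lborel X (\<lambda>z. ennreal (normal_density 0 s z))"
  shows "(\<integral>w. iexp (X w) \<partial>M) = complex_of_real (exp (- s\<^sup>2 / 2))"
    and "(\<integral>\<^sup>+w. ennreal ((X w)\<^sup>2) \<partial>M) = ennreal (s\<^sup>2)"
proof -
  have "distributed M lborel (\<lambda>x. (X x - 0) / s) std_normal_density"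
    using X normal_standard_normal_convert[OF s, of X 0] by simp
  then have d: "distr M lborel (\<lambda>x. X x / s) = std_normal_distribution" and Xm: "(\<lambda>x. X x / s) \<in> measurable M lborel"
    by (auto simp: distributed_def)
  have [measurable]: "(\<lambda>x. X x / s) \<in> borel_measurable M" using Xm by simp
  have "(\<integral>w. iexp (X w) \<partial>M) = (\<integral>w. iexp (s * (X w / s)) \<partial>M)" using s by simp
  also have "\<dots> = (\<integral>x. iexp (s * x) \<partial>distr M lborel (\<lambda>x. X x / s))"
    by (rule integral_distr[symmetric, OF Xm]) measurable
  also have "\<dots> = char std_normal_distribution s" unfolding d char_def ..
  also have "\<dots> = complex_of_real (exp (- s\<^sup>2 / 2))" by (simp add: char_std_normal_distribution)
  finally show "(\<integral>w. iexp (X w) \<partial>M) = complex_of_real (exp (- s\<^sup>2 / 2))" .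
  have "(\<integral>\<^sup>+w. ennreal ((X w)\<^sup>2) \<partial>M) = (\<integral>\<^sup>+w. ennreal (s\<^sup>2 * (X w / s)\<^sup>2) \<partial>M)" using s by (simp add: power_divide)
  also have "\<dots> = (\<integral>\<^sup>+x. ennreal (s\<^sup>2 * x\<^sup>2) \<partial>distr M lborel (\<lambda>x. X x / s))"
    by (rule nn_integral_distr[symmetric, OF Xm]) measurable
  also have "\<dots> = ennreal (\<integral>x. s\<^sup>2 * x\<^sup>2 \<partial>std_normal_distribution)"
    unfolding d using integrable_std_normal_distribution_moment[of 2] by (intro nn_integral_eq_integral) auto
  also have "(\<integral>x. s\<^sup>2 * x\<^sup>2 \<partial>std_normal_distribution) = s\<^sup>2"
    using std_normal_distribution_even_moments(1)[of 1] by simp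
  finally show "(\<integral>\<^sup>+w. ennreal ((X w)\<^sup>2) \<partial>M) = ennreal (s\<^sup>2)" .
qed

section \<open>Law of the elementary stochastic integrals\<close>

locale white_noise = prob_space P for P :: "'a measure" +
  fixes L :: real and W :: "(real \<times> real) set \<Rightarrow> 'a \<Rightarrow> real"
  assumes white_noise: "space_time_white_noise P L W"
begin

lemma noise_measurable: "A \<in> noise_sets L \<Longrightarrow> W A \<in> borel_measurable P"
  and noise_null: "A \<in> noise_sets L \<Longrightarrow> measure lborel A = 0 \<Longrightarrow> AE w in P. W A w = 0"
  and noise_normal: "A \<in> noise_sets L \<Longrightarrow> measure lborel A \<noteq> 0 \<Longrightarrow>
    distributed P lborel (W A) (\<lambda>z. ennreal (normal_density 0 (sqrt (measure lborel A)) z))"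
  and noise_indep: "finite \<A> \<Longrightarrow> \<A> \<subseteq> noise_sets L \<Longrightarrow> disjoint \<A> \<Longrightarrow> indep_vars (\<lambda>_. borel) W \<A>"
  and noise_add: "A \<in> noise_sets L \<Longrightarrow> B \<in> noise_sets L \<Longrightarrow> A \<inter> B = {} \<Longrightarrow> AE w in P. W (A \<union> B) w = W A w + W B w"
  using white_noise unfolding space_time_white_noise_def by (auto simp: Let_def split: if_splits)

lemma noise_empty: "{} \<in> noise_sets L" by (simp add: noise_sets_def)

lemma noise_Un: "A \<in> noise_sets L \<Longrightarrow> B \<in> noise_sets L \<Longrightarrow> A \<union> B \<in> noise_sets L"
  using emeasure_subadditive[of A lborel B] by (auto simp: noise_sets_def intro: le_less_trans)

lemma noise_finite_add:
  assumes "finite I" "\<And>i. i \<in> I \<Longrightarrow> B i \<in> noise_sets L" "disjoint_family_on B I"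
  shows "(\<Union>i\<in>I. B i) \<in> noise_sets L \<and> (AE w in P. W (\<Union>i\<in>I. B i) w = (\<Sum>i\<in>I. W (B i) w))"
  using assms
proof (induction I)
  case empty
  then show ?case using noise_null[OF noise_empty] noise_empty by simp
next
  case (insert i I)
  then have IH: "(\<Union>i\<in>I. B i) \<in> noise_sets L" "AE w in P. W (\<Union>i\<in>I. B i) w = (\<Sum>i\<in>I. W (B i) w)"
    by (auto simp: disjoint_family_on_def)
  have d: "B i \<inter> (\<Union>i\<in>I. B i) = {}"
    using insert.prems(2) insert.hyps(2) by (fastforce simp: disjoint_family_on_def)
  have "AE w in P. W (B i \<union> (\<Union>i\<in>I. B i)) w = W (B i) w + W (\<Union>i\<in>I. B i) w"
    by (rule noise_add) (use insert.prems IH d in auto)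
  with IH(2) have "AE w in P. W (B i \<union> (\<Union>i\<in>I. B i)) w = W (B i) w + (\<Sum>i\<in>I. W (B i) w)" by eventually_elim simp
  then show ?case using noise_Un[OF insert.prems(1)[of i] IH(1)] insert.hyps by simp
qed

lemma elementary_noise_set:
  assumes g: "elementary L g" and B: "B \<in> sets borel" "\<And>z. z \<in> B \<Longrightarrow> g z \<noteq> 0"
  shows "B \<in> noise_sets L"
proof -
  have "{z. g z \<noteq> 0} \<in> sets borel" using elementary_measurable[OF g] by measurable
  then have "emeasure lborel B \<le> emeasure lborel {z. g z \<noteq> 0}"
    using B by (intro emeasure_mono) (auto simp: sets_lborel)
  then show ?thesis using g B unfolding noise_sets_def elementary_def by (blast intro: le_less_trans)
qed

text \<open>The elementary integral can be computed on any finite refinement of the level sets.\<close>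

lemma wiener_simple_refine:
  assumes g: "elementary L g" and h: "\<And>z. g z = \<phi> (h z)"
    and hm: "\<And>v. h -` {v} \<in> sets borel" and R: "finite R" "\<And>v. v \<in> range h \<Longrightarrow> \<phi> v \<noteq> 0 \<Longrightarrow> v \<in> R" "R \<subseteq> range h"
  shows "AE w in P. wiener_simple W g w = (\<Sum>v\<in>R. \<phi> v * W (h -` {v}) w)"
proof -
  define R' where "R' = {v\<in>R. \<phi> v \<noteq> 0}"
  have R': "finite R'" using R by (simp add: R'_def)
  have im: "\<phi> ` R' = range g - {0}"
    using R by (auto simp: R'_def h image_iff subset_iff) metis
  have ns: "h -` {v} \<in> noise_sets L" if "v \<in> R'" for v
    by (rule elementary_noise_set[OF g hm]) (use that in \<open>auto simp: R'_def h\<close>)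
  have "AE w in P. W (g -` {c}) w = (\<Sum>v\<in>{v\<in>R'. \<phi> v = c}. W (h -` {v}) w)" if c: "c \<in> \<phi> ` R'" for c
  proof -
    have "g -` {c} = (\<Union>v\<in>{v\<in>R'. \<phi> v = c}. h -` {v})"
      using c R(2) by (auto simp: R'_def h)
    then show ?thesis
      using noise_finite_add[of "{v\<in>R'. \<phi> v = c}" "\<lambda>v. h -` {v}"] ns R' by (auto simp: disjoint_family_on_def)
  qed
  then have "AE w in P. \<forall>c\<in>\<phi> ` R'. W (g -` {c}) w = (\<Sum>v\<in>{v\<in>R'. \<phi> v = c}. W (h -` {v}) w)"
    using R' by (intro AE_finite_allI) auto
  then show ?thesis
  proof eventually_elim
    case (elim w)
    have "wiener_simple W g w = (\<Sum>c\<in>\<phi> ` R'. c * W (g -` {c}) w)"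
      by (simp add: wiener_simple_def im)
    also have "\<dots> = (\<Sum>c\<in>\<phi> ` R'. \<Sum>v\<in>{v\<in>R'. \<phi> v = c}. \<phi> v * W (h -` {v}) w)"
      using elim by (intro sum.cong refl) (auto simp: sum_distrib_left)
    also have "\<dots> = (\<Sum>v\<in>R'. \<phi> v * W (h -` {v}) w)"
      by (rule sum.image_gen[symmetric]) fact
    also have "\<dots> = (\<Sum>v\<in>R. \<phi> v * W (h -` {v}) w)"
      using R by (intro sum.mono_neutral_left) (auto simp: R'_def)
    finally show ?case .
  qed
qed

text \<open>The level sets of the pair \<open>(g, g')\<close> refine those of \<open>g\<close>, of
  \<open>g'\<close> and of every linear combination. On this common refinement all three integrals
  are finite sums over the same cells.\<close>

lemma wiener_simple_lincomb:
  assumes g: "elementary L g" and g': "elementary L g'"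
  shows "AE w in P. wiener_simple W (\<lambda>z. a * g z + b * g' z) w = a * wiener_simple W g w + b * wiener_simple W g' w"
proof -
  define h where "h = (\<lambda>z. (g z, g' z))"
  define R where "R = range h"
  have "range h \<subseteq> range g \<times> range g'" by (auto simp: h_def)
  then have R: "finite R" unfolding R_def
    using elementary_finite[OF g] elementary_finite[OF g'] by (meson finite_SigmaI finite_subset)
  have hm: "h -` {v} \<in> sets borel" for v
  proof -
    have "h -` {v} = g -` {fst v} \<inter> g' -` {snd v}" by (auto simp: h_def)
    then show ?thesis using elementary_vimage[OF g] elementary_vimage[OF g'] by auto
  qed
  have "AE w in P. wiener_simple W (\<lambda>z. a * g z + b * g' z) w = (\<Sum>v\<in>R. (a * fst v + b * snd v) * W (h -` {v}) w)"
    by (rule wiener_simple_refine[OF elementary_lincomb[OF g g'] _ hm R]) (auto simp: h_def R_def)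
  moreover have "AE w in P. wiener_simple W g w = (\<Sum>v\<in>R. fst v * W (h -` {v}) w)"
    by (rule wiener_simple_refine[OF g _ hm R]) (auto simp: h_def R_def)
  moreover have "AE w in P. wiener_simple W g' w = (\<Sum>v\<in>R. snd v * W (h -` {v}) w)"
    by (rule wiener_simple_refine[OF g' _ hm R]) (auto simp: h_def R_def)
  ultimately show ?thesis
    by eventually_elim (simp add: sum_distrib_left sum.distrib[symmetric] algebra_simps)
qed

lemma wiener_simple_measurable:
  assumes g: "elementary L g" shows "wiener_simple W g \<in> borel_measurable P"
proof -
  have [measurable]: "W (g -` {c}) \<in> borel_measurable P" if "c \<in> range g - {0}" for c
    using that by (intro noise_measurable elementary_noise_set[OF g elementary_vimage[OF g]]) auto
  show ?thesis unfolding wiener_simple_def[abs_def] by measurable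
qed

text \<open>Distinct level sets are disjoint, so the integral is a sum of independent centred
  normals whose variances add up to \<open>V\<close>. Level sets of measure zero are dropped first,
  because their noise has no density.\<close>

lemma wiener_simple_law:
  assumes g: "elementary L g"
  defines "V \<equiv> \<Sum>c\<in>range g - {0}. c\<^sup>2 * measure lborel (g -` {c})"
  shows "(\<integral>w. iexp (wiener_simple W g w) \<partial>P) = complex_of_real (exp (- V / 2))"
    and "(\<integral>\<^sup>+w. ennreal ((wiener_simple W g w)\<^sup>2) \<partial>P) = ennreal V"
proof -
  define I where "I = {c\<in>range g - {0}. measure lborel (g -` {c}) \<noteq> 0}"
  have fin: "finite (range g - {0})" using elementary_finite[OF g] by simp
  have fI: "finite I" using fin by (simp add: I_def)
  have ns: "g -` {c} \<in> noise_sets L" if "c \<noteq> 0" for c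
    by (rule elementary_noise_set[OF g elementary_vimage[OF g]]) (use that in auto)
  have "AE w in P. \<forall>c\<in>range g - {0} - I. W (g -` {c}) w = 0"
    using fin by (intro AE_finite_allI) (auto simp: I_def intro!: noise_null ns)
  then have ae: "AE w in P. wiener_simple W g w = (\<Sum>c\<in>I. c * W (g -` {c}) w)"
  proof eventually_elim
    case (elim w)
    show ?case unfolding wiener_simple_def
      by (rule sum.mono_neutral_right) (use fin elim in \<open>auto simp: I_def\<close>)
  qed
  have V: "V = (\<Sum>c\<in>I. c\<^sup>2 * measure lborel (g -` {c}))" unfolding V_def
    by (rule sum.mono_neutral_right) (use fin in \<open>auto simp: I_def\<close>)
  note [measurable] = wiener_simple_measurable[OF g]
  have wm[measurable]: "W (g -` {c}) \<in> borel_measurable P" if "c \<in> I" for c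
    using that by (intro noise_measurable ns) (auto simp: I_def)
  have Ym[measurable]: "(\<lambda>w. \<Sum>c\<in>I. c * W (g -` {c}) w) \<in> borel_measurable P" by measurable
  have e1: "(\<integral>w. iexp (wiener_simple W g w) \<partial>P) = (\<integral>w. iexp (\<Sum>c\<in>I. c * W (g -` {c}) w) \<partial>P)"
    by (rule integral_cong_AE) (measurable, use ae in eventually_elim, simp)
  have e2: "(\<integral>\<^sup>+w. ennreal ((wiener_simple W g w)\<^sup>2) \<partial>P) = (\<integral>\<^sup>+w. ennreal ((\<Sum>c\<in>I. c * W (g -` {c}) w)\<^sup>2) \<partial>P)"
    by (rule nn_integral_cong_AE) (use ae in eventually_elim, simp)
  have "(\<integral>w. iexp (\<Sum>c\<in>I. c * W (g -` {c}) w) \<partial>P) = complex_of_real (exp (- V / 2))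
     \<and> (\<integral>\<^sup>+w. ennreal ((\<Sum>c\<in>I. c * W (g -` {c}) w)\<^sup>2) \<partial>P) = ennreal V"
  proof (cases "I = {}")
    case True
    then show ?thesis by (simp add: V prob_space)
  next
    case False
    define \<A> where "\<A> = (\<lambda>c. g -` {c}) ` I"
    \<comment> \<open>Independence is available for a family indexed by the sets themselves, so the
      coefficient has to be read off from the level set.\<close>
    define val where "val = (\<lambda>B. g (SOME z. z \<in> B))"
    have val: "val (g -` {c}) = c" if "c \<in> I" for c
    proof -
      have "\<exists>z. z \<in> g -` {c}" using that by (auto simp: I_def)
      then have "(SOME z. z \<in> g -` {c}) \<in> g -` {c}" by (rule someI_ex)
      then show ?thesis by (simp add: val_def)
    qed
    have inj: "inj_on (\<lambda>c. g -` {c}) I" by (rule inj_on_inverseI[of I val]) (use val in auto)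
    define s where "s = (\<lambda>B. \<bar>val B\<bar> * sqrt (measure lborel B))"
    have ind: "indep_vars (\<lambda>_. borel) (\<lambda>B w. val B * W B w) \<A>"
    proof (rule indep_vars_compose2[OF noise_indep])
      show "\<A> \<subseteq> noise_sets L" using ns by (auto simp: \<A>_def I_def)
      show "disjoint \<A>" by (auto simp: \<A>_def disjoint_def)
    qed (use fI in \<open>auto simp: \<A>_def\<close>)
    have B: "val B \<noteq> 0" "B \<in> noise_sets L" "measure lborel B \<noteq> 0" if "B \<in> \<A>" for B
      using that val ns by (auto simp: \<A>_def I_def)
    have mp: "measure lborel B > 0" if "B \<in> \<A>" for B using B(3)[OF that] by (simp add: zero_less_measure_iff)
    have sp: "s B > 0" if "B \<in> \<A>" for B using B(1)[OF that] mp[OF that] by (simp add: s_def)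
    have "distributed P lborel (\<lambda>w. \<Sum>B\<in>\<A>. val B * W B w) (normal_density (\<Sum>B\<in>\<A>. 0) (sqrt (\<Sum>B\<in>\<A>. (s B)\<^sup>2)))"
    proof (rule sum_indep_normal)
      fix B assume BA: "B \<in> \<A>"
      have "distributed P lborel (\<lambda>x. 0 + val B * W B x) (normal_density (0 + val B * 0) (\<bar>val B\<bar> * sqrt (measure lborel B)))"
        by (rule normal_density_affine) (use B[OF BA] mp[OF BA] noise_normal in auto)
      then show "distributed P lborel (\<lambda>w. val B * W B w) (normal_density 0 (s B))" by (simp add: s_def)
    qed (use fI False ind sp in \<open>auto simp: \<A>_def\<close>)
    moreover have "(\<Sum>B\<in>\<A>. val B * W B w) = (\<Sum>c\<in>I. c * W (g -` {c}) w)" for w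
      unfolding \<A>_def using val by (simp add: sum.reindex[OF inj])
    moreover have "(\<Sum>B\<in>\<A>. (s B)\<^sup>2) = V"
      unfolding \<A>_def V using val by (simp add: sum.reindex[OF inj] s_def power_mult_distrib)
    ultimately have d: "distributed P lborel (\<lambda>w. \<Sum>c\<in>I. c * W (g -` {c}) w) (normal_density 0 (sqrt V))" by simp
    have Vp: "V > 0"
    proof -
      have "(\<Sum>B\<in>\<A>. (s B)\<^sup>2) > 0"
      proof (rule sum_pos)
        fix B assume "B \<in> \<A>"
        then show "0 < (s B)\<^sup>2" using sp[of B] by simp
      qed (use fI False in \<open>auto simp: \<A>_def\<close>)
      then show ?thesis by (simp add: \<open>(\<Sum>B\<in>\<A>. (s B)\<^sup>2) = V\<close>)
    qed
    show ?thesis using normal_char[OF _ d] Vp by simp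
  qed
  with e1 e2 show "(\<integral>w. iexp (wiener_simple W g w) \<partial>P) = complex_of_real (exp (- V / 2))"
    and "(\<integral>\<^sup>+w. ennreal ((wiener_simple W g w)\<^sup>2) \<partial>P) = ennreal V" by simp_all
qed

lemma wiener_simple_isometry:
  "elementary L g \<Longrightarrow> (\<integral>\<^sup>+w. ennreal ((wiener_simple W g w)\<^sup>2) \<partial>P) = (\<integral>\<^sup>+z. ennreal ((g z)\<^sup>2) \<partial>lborel)"
  by (simp only: wiener_simple_law(2) elementary_square_integral(1))

lemma wiener_simple_char:
  "elementary L g \<Longrightarrow> (\<integral>w. iexp (wiener_simple W g w) \<partial>P)
    = complex_of_real (exp (- enn2real (\<integral>\<^sup>+z. ennreal ((g z)\<^sup>2) \<partial>lborel) / 2))"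
  by (simp add: wiener_simple_law(1) elementary_square_integral(1) sum_nonneg)

end

lemma ennreal_squeeze:
  fixes f b :: "nat \<Rightarrow> ennreal"
  assumes "\<And>k. f k \<le> b k" "b \<longlonglongrightarrow> 0" shows "f \<longlonglongrightarrow> 0"
  by (rule tendsto_sandwich[OF always_eventually always_eventually tendsto_const assms(2)]) (use assms(1) in simp_all)

text \<open>Young's inequality with a free parameter takes the place of Cauchy-Schwarz: estimates of
  this shape avoid square roots of extended reals. The choice \<open>e = r / (2 * (A + 1))\<close>
  pays half of \<open>r\<close> for the first term, and \<open>d\<close> pays the other half
  eventually.\<close>

lemma tendsto_zero_interpolation:
  fixes a :: "nat \<Rightarrow> real" and d :: "nat \<Rightarrow> ennreal"
  assumes d: "d \<longlonglongrightarrow> 0" and a: "\<And>k. 0 \<le> a k" and A: "0 \<le> A"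
    and le: "\<And>e k. e > 0 \<Longrightarrow> ennreal (a k) \<le> ennreal (e * A) + ennreal (1 + 1 / e) * d k"
  shows "a \<longlonglongrightarrow> 0"
proof (rule order_tendstoI)
  fix r :: real assume "r < 0"
  then show "eventually (\<lambda>k. r < a k) sequentially" by (intro always_eventually allI less_le_trans[OF _ a])
next
  fix r :: real assume r: "0 < r"
  define e where "e = r / (2 * (A + 1))"
  have e: "e > 0" using r A by (simp add: e_def)
  have "e * A \<le> r / 2" using r A by (simp add: e_def field_simps)
  have "(\<lambda>k. ennreal (1 + 1 / e) * d k) \<longlonglongrightarrow> ennreal (1 + 1 / e) * 0"
    by (intro ennreal_tendsto_cmult d) simp
  then have "eventually (\<lambda>k. ennreal (1 + 1 / e) * d k < ennreal (r / 2)) sequentially"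
    by (rule order_tendstoD) (use r in simp)
  then show "eventually (\<lambda>k. a k < r) sequentially"
  proof eventually_elim
    case (elim k)
    have "ennreal (a k) \<le> ennreal (e * A) + ennreal (1 + 1 / e) * d k" by (rule le[OF e])
    also have "\<dots> \<le> ennreal (r / 2) + ennreal (1 + 1 / e) * d k"
      using \<open>e * A \<le> r / 2\<close> by (intro add_right_mono ennreal_leI)
    also have "\<dots> < ennreal (r / 2) + ennreal (r / 2)"
      using elim by (intro ennreal_add_left_cancel_less[THEN iffD2]) auto
    also have "\<dots> = ennreal r" using r by (simp add: ennreal_plus[symmetric] del: ennreal_plus)
    finally show ?case using r by (simp add: ennreal_less_iff a)
  qed
qed

lemma nn_integral_square_lincomb:
  fixes u v :: "'b \<Rightarrow> real"
  assumes [measurable]: "u \<in> borel_measurable M" "v \<in> borel_measurable M"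
  shows "(\<integral>\<^sup>+x. ennreal ((a * u x + b * v x)\<^sup>2) \<partial>M)
    \<le> ennreal (2 * a\<^sup>2) * (\<integral>\<^sup>+x. ennreal ((u x)\<^sup>2) \<partial>M) + ennreal (2 * b\<^sup>2) * (\<integral>\<^sup>+x. ennreal ((v x)\<^sup>2) \<partial>M)"
proof -
  have "(\<integral>\<^sup>+x. ennreal ((a * u x + b * v x)\<^sup>2) \<partial>M)
     \<le> (\<integral>\<^sup>+x. ennreal (2 * a\<^sup>2) * ennreal ((u x)\<^sup>2) + ennreal (2 * b\<^sup>2) * ennreal ((v x)\<^sup>2) \<partial>M)"
  proof (rule nn_integral_mono)
    fix x
    have "(a * u x + b * v x)\<^sup>2 \<le> 2 * a\<^sup>2 * (u x)\<^sup>2 + 2 * b\<^sup>2 * (v x)\<^sup>2"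
      using square_add_le[of "a * u x" "b * v x"] by (simp add: power_mult_distrib)
    then show "ennreal ((a * u x + b * v x)\<^sup>2) \<le> ennreal (2 * a\<^sup>2) * ennreal ((u x)\<^sup>2) + ennreal (2 * b\<^sup>2) * ennreal ((v x)\<^sup>2)"
      by (simp add: ennreal_mult[symmetric] ennreal_plus[symmetric] ennreal_leI del: ennreal_plus)
  qed
  also have "\<dots> = ennreal (2 * a\<^sup>2) * (\<integral>\<^sup>+x. ennreal ((u x)\<^sup>2) \<partial>M) + ennreal (2 * b\<^sup>2) * (\<integral>\<^sup>+x. ennreal ((v x)\<^sup>2) \<partial>M)"
    by (simp add: nn_integral_add nn_integral_cmult)
  finally show ?thesis .
qed

section \<open>Extension to square-integrable integrands\<close>

context white_noise
begin

text \<open>Completeness of \<open>L\<^sup>2(P)\<close> for a rapidly Cauchy sequence: almost sure convergence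
  through summability of the increments, then Fatou.\<close>

lemma L2_complete:
  fixes X :: "nat \<Rightarrow> 'a \<Rightarrow> real"
  assumes [measurable]: "\<And>k. X k \<in> borel_measurable P"
    and C: "\<And>k l. k \<le> l \<Longrightarrow> (\<integral>\<^sup>+w. ennreal ((X k w - X l w)\<^sup>2) \<partial>P) \<le> ennreal ((1/4) ^ Suc k)"
  obtains Y where "Y \<in> borel_measurable P" "(\<lambda>k. \<integral>\<^sup>+w. ennreal ((X k w - Y w)\<^sup>2) \<partial>P) \<longlonglongrightarrow> 0"
proof -
  define Y where "Y = (\<lambda>w. lim (\<lambda>k. X k w))"
  have Y[measurable]: "Y \<in> borel_measurable P" unfolding Y_def by measurable
  have inc: "(\<integral>\<^sup>+w. ennreal \<bar>X (Suc k) w - X k w\<bar> \<partial>P) \<le> ennreal ((1/2) ^ k)" for k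
  proof -
    have "(\<integral>\<^sup>+w. ennreal \<bar>X (Suc k) w - X k w\<bar> \<partial>P)
       \<le> (\<integral>\<^sup>+w. ennreal (2 ^ k) * ennreal ((X k w - X (Suc k) w)\<^sup>2) + ennreal ((1/2) ^ k / 4) \<partial>P)"
    proof (rule nn_integral_mono)
      fix w
      let ?y = "\<bar>X (Suc k) w - X k w\<bar>" and ?q = "(2::real) ^ k"
      \<comment> \<open>Young's inequality with the factor \<open>2^k\<close> balances the two
        terms: the second moment \<open>(1/4)^(k+1)\<close> and the remainder each contribute
        \<open>(1/2)^k / 4\<close>, which is summable.\<close>
      have "0 \<le> (2 * ?q * ?y - 1)\<^sup>2" by simp
      then have "4 * ?q * ?y \<le> 4 * ?q * (?q * ?y\<^sup>2 + (1/2) ^ k / 4)"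
        by (simp add: power2_eq_square algebra_simps power_one_over)
      then have "?y \<le> ?q * ?y\<^sup>2 + (1/2) ^ k / 4" by (rule mult_left_le_imp_le) simp
      moreover have "?y\<^sup>2 = (X k w - X (Suc k) w)\<^sup>2" by (simp add: power2_commute)
      ultimately have "?y \<le> ?q * (X k w - X (Suc k) w)\<^sup>2 + (1/2) ^ k / 4" by simp
      then show "ennreal ?y \<le> ennreal ?q * ennreal ((X k w - X (Suc k) w)\<^sup>2) + ennreal ((1/2) ^ k / 4)"
        by (simp add: ennreal_mult[symmetric] ennreal_plus[symmetric] ennreal_leI del: ennreal_plus)
    qed
    also have "\<dots> = ennreal (2 ^ k) * (\<integral>\<^sup>+w. ennreal ((X k w - X (Suc k) w)\<^sup>2) \<partial>P) + ennreal ((1/2) ^ k / 4)"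
      by (simp add: nn_integral_add nn_integral_cmult emeasure_space_1)
    also have "\<dots> \<le> ennreal (2 ^ k) * ennreal ((1/4) ^ Suc k) + ennreal ((1/2) ^ k / 4)"
      by (intro add_right_mono mult_left_mono C) auto
    also have "\<dots> = ennreal (2 ^ k * (1/4) ^ Suc k + (1/2) ^ k / 4)"
      by (simp add: ennreal_mult[symmetric] ennreal_plus[symmetric] del: ennreal_plus)
    also have "\<dots> \<le> ennreal ((1/2) ^ k)"
    proof (rule ennreal_leI)
      have "(2::real) ^ k * (1/4) ^ Suc k = (1/2) ^ k / 4" by (simp add: power_mult_distrib[symmetric])
      then show "(2::real) ^ k * (1/4) ^ Suc k + (1/2) ^ k / 4 \<le> (1/2) ^ k" by simp
    qed
    finally show ?thesis .
  qed
  have "(\<integral>\<^sup>+w. (\<Sum>k. ennreal \<bar>X (Suc k) w - X k w\<bar>) \<partial>P) \<le> (\<Sum>k. ennreal ((1/2) ^ k))"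
    by (simp add: nn_integral_suminf suminf_le inc)
  also have "\<dots> < top"
    by (intro less_top[THEN iffD1] ennreal_suminf_neq_top summable_geometric) auto
  finally have "AE w in P. (\<Sum>k. ennreal \<bar>X (Suc k) w - X k w\<bar>) \<noteq> \<infinity>"
    by (intro nn_integral_PInf_AE) auto
  then have conv: "AE w in P. (\<lambda>k. X k w) \<longlonglongrightarrow> Y w"
  proof eventually_elim
    case (elim w)
    then have "summable (\<lambda>k. \<bar>X (Suc k) w - X k w\<bar>)" by (intro summable_suminf_not_top) auto
    then have "summable (\<lambda>k. X (Suc k) w - X k w)" by (rule summable_rabs_cancel)
    then have "convergent (\<lambda>n. \<Sum>k<n. X (Suc k) w - X k w)" by (simp add: summable_iff_convergent)
    then have "convergent (\<lambda>n. X n w - X 0 w)" using sum_lessThan_telescope[of "\<lambda>k. X k w"] by (simp only:)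
    then have "convergent (\<lambda>n. (X n w - X 0 w) + X 0 w)" by (intro convergent_add convergent_const)
    then show ?case by (simp add: Y_def convergent_LIMSEQ_iff)
  qed
  have bnd: "(\<integral>\<^sup>+w. ennreal ((X k w - Y w)\<^sup>2) \<partial>P) \<le> ennreal ((1/4) ^ Suc k)" for k
  proof -
    have "AE w in P. ennreal ((X k w - Y w)\<^sup>2) = liminf (\<lambda>l. ennreal ((X k w - X l w)\<^sup>2))"
      using conv
    proof eventually_elim
      case (elim w)
      have "(\<lambda>l. ennreal ((X k w - X l w)\<^sup>2)) \<longlonglongrightarrow> ennreal ((X k w - Y w)\<^sup>2)"
        by (intro tendsto_ennrealI tendsto_intros elim)
      then show ?case by (intro lim_imp_Liminf[symmetric]) auto
    qed
    then have "(\<integral>\<^sup>+w. ennreal ((X k w - Y w)\<^sup>2) \<partial>P) = (\<integral>\<^sup>+w. liminf (\<lambda>l. ennreal ((X k w - X l w)\<^sup>2)) \<partial>P)"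
      by (rule nn_integral_cong_AE)
    also have "\<dots> \<le> liminf (\<lambda>l. \<integral>\<^sup>+w. ennreal ((X k w - X l w)\<^sup>2) \<partial>P)"
      by (rule nn_integral_liminf) measurable
    also have "\<dots> \<le> liminf (\<lambda>l. ennreal ((1/4) ^ Suc k))"
      by (rule Liminf_mono) (use C in \<open>auto simp: eventually_sequentially\<close>)
    also have "\<dots> = ennreal ((1/4) ^ Suc k)" by (simp add: Liminf_const)
    finally show ?thesis .
  qed
  have "(\<lambda>k. ennreal ((1/4) ^ Suc k)) \<longlonglongrightarrow> ennreal 0"
    by (intro tendsto_ennrealI LIMSEQ_Suc LIMSEQ_realpow_zero) auto
  then have "(\<lambda>k. ennreal ((1/4) ^ Suc k)) \<longlonglongrightarrow> 0" by (simp only: ennreal_0)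
  then have "(\<lambda>k. \<integral>\<^sup>+w. ennreal ((X k w - Y w)\<^sup>2) \<partial>P) \<longlonglongrightarrow> 0"
    by (rule ennreal_squeeze[OF bnd])
  with Y show thesis by (rule that)
qed

text \<open>Simple functions with \<open>|F| <= 2 * |f|\<close>, restricted to \<open>S\<close>,
  converge to \<open>f\<close> in mean square by dominated convergence, with majorant
  \<open>9 * f^2\<close> because \<open>|F - f| <= 3 * |f|\<close>. The isometry carries a rapidly
  convergent subsequence over to random variables, and \<open>L2_complete\<close> supplies the
  limit.\<close>

lemma wiener_integral_exists:
  assumes S[measurable]: "S \<in> sets borel" and SQ: "S \<subseteq> {0<..<L} \<times> {0..}" "emeasure lborel S < \<infinity>"
    and f[measurable]: "f \<in> borel_measurable borel" and L2: "(\<integral>\<^sup>+z\<in>S. ennreal ((f z)\<^sup>2) \<partial>lborel) < \<infinity>"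
  shows "\<exists>X. has_wiener_integral P W S f X"
proof -
  obtain F where F: "\<And>i. simple_function borel (F i)" "\<And>z. (\<lambda>i. F i z) \<longlonglongrightarrow> f z" "\<And>i z. \<bar>F i z\<bar> \<le> 2 * \<bar>f z\<bar>"
    using borel_measurable_implies_sequence_metric[OF f, of 0] by auto
  define g where "g = (\<lambda>i z. F i z * indicator S z)"
  have [measurable]: "F i \<in> borel_measurable borel" for i using F(1) by (rule borel_measurable_simple_function)
  have gm[measurable]: "g i \<in> borel_measurable borel" for i unfolding g_def by measurable
  have gs: "simple_function borel (g i)" for i
    unfolding g_def using F(1) by (intro simple_function_mult simple_function_indicator) auto
  have fin: "emeasure lborel {z. g i z \<noteq> 0} < \<infinity>" for i
  proof -
    have "emeasure lborel {z. g i z \<noteq> 0} \<le> emeasure lborel S"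
      by (intro emeasure_mono) (auto simp: g_def indicator_def sets_lborel)
    then show ?thesis using SQ(2) by (rule le_less_trans)
  qed
  have g0: "z \<notin> S \<Longrightarrow> g i z = 0" for i z by (simp add: g_def)
  have el: "elementary L (g i)" for i
    unfolding elementary_def using gs fin g0 SQ(1) by blast
  define e where "e = (\<lambda>i. \<integral>\<^sup>+z\<in>S. ennreal ((g i z - f z)\<^sup>2) \<partial>lborel)"
  have "(\<lambda>i. \<integral>\<^sup>+z. ennreal ((g i z - f z)\<^sup>2) * indicator S z \<partial>lborel) \<longlonglongrightarrow> (\<integral>\<^sup>+z. 0 \<partial>(lborel::(real\<times>real) measure))"
  proof (rule nn_integral_dominated_convergence[where w="\<lambda>z. ennreal 9 * (ennreal ((f z)\<^sup>2) * indicator S z)"])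
    have "(\<integral>\<^sup>+z. ennreal 9 * (ennreal ((f z)\<^sup>2) * indicator S z) \<partial>lborel) = ennreal 9 * (\<integral>\<^sup>+z\<in>S. ennreal ((f z)\<^sup>2) \<partial>lborel)"
      by (rule nn_integral_cmult) measurable
    then show "(\<integral>\<^sup>+z. ennreal 9 * (ennreal ((f z)\<^sup>2) * indicator S z) \<partial>lborel) < \<infinity>"
      using L2 by (simp add: ennreal_mult_less_top)
    show "AE z in lborel. ennreal ((g j z - f z)\<^sup>2) * indicator S z \<le> ennreal 9 * (ennreal ((f z)\<^sup>2) * indicator S z)" for j
    proof (rule AE_I2)
      fix z
      show "ennreal ((g j z - f z)\<^sup>2) * indicator S z \<le> ennreal 9 * (ennreal ((f z)\<^sup>2) * indicator S z)"
      proof (cases "z \<in> S")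
        case True
        have "\<bar>F j z - f z\<bar> \<le> 3 * \<bar>f z\<bar>" using F(3)[of j z] by linarith
        then have "(F j z - f z)\<^sup>2 \<le> (3 * \<bar>f z\<bar>)\<^sup>2" by (metis abs_ge_zero power2_abs power_mono)
        then have "(F j z - f z)\<^sup>2 \<le> 9 * (f z)\<^sup>2" by (simp add: power_mult_distrib)
        then show ?thesis using True
          by (simp add: g_def ennreal_mult'[symmetric] ennreal_leI del: ennreal_numeral)
      qed simp
    qed
    show "AE z in lborel. (\<lambda>i. ennreal ((g i z - f z)\<^sup>2) * indicator S z) \<longlonglongrightarrow> 0"
    proof (rule AE_I2)
      fix z
      show "(\<lambda>i. ennreal ((g i z - f z)\<^sup>2) * indicator S z) \<longlonglongrightarrow> 0"
      proof (cases "z \<in> S")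
        case True
        have "(\<lambda>i. ennreal ((F i z - f z)\<^sup>2)) \<longlonglongrightarrow> ennreal ((f z - f z)\<^sup>2)"
          by (intro tendsto_ennrealI tendsto_intros F)
        then show ?thesis using True by (simp add: g_def)
      qed simp
    qed
  qed (measurable)
  then have e0: "e \<longlonglongrightarrow> 0" by (simp add: e_def)
  \<comment> \<open>The exponent \<open>k + 2\<close> leaves room for the crude bound of a squared
    difference: twice the sum of two such errors is at most \<open>(1/4)^(k+1)\<close>.\<close>
  have "\<exists>i. e i < ennreal ((1/4) ^ (k+2))" for k :: nat
  proof -
    have "eventually (\<lambda>i. e i < ennreal ((1/4) ^ (k+2))) sequentially"
      by (rule order_tendstoD[OF e0]) simp
    then show ?thesis by (rule eventually_happens'[rotated]) simp
  qed
  then obtain r where r: "\<And>k. e (r k) < ennreal ((1/4) ^ (k+2))" by metis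
  define X where "X = (\<lambda>k. wiener_simple W (g (r k)))"
  have Xm[measurable]: "X k \<in> borel_measurable P" for k unfolding X_def by (rule wiener_simple_measurable[OF el])
  have C: "(\<integral>\<^sup>+w. ennreal ((X k w - X l w)\<^sup>2) \<partial>P) \<le> ennreal ((1/4) ^ Suc k)" if kl: "k \<le> l" for k l
  proof -
    have "AE w in P. wiener_simple W (\<lambda>z. 1 * g (r k) z + (-1) * g (r l) z) w = 1 * wiener_simple W (g (r k)) w + (-1) * wiener_simple W (g (r l)) w"
      by (rule wiener_simple_lincomb[OF el el])
    then have "(\<integral>\<^sup>+w. ennreal ((X k w - X l w)\<^sup>2) \<partial>P) = (\<integral>\<^sup>+w. ennreal ((wiener_simple W (\<lambda>z. 1 * g (r k) z + (-1) * g (r l) z) w)\<^sup>2) \<partial>P)"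
      by (intro nn_integral_cong_AE) (auto elim!: eventually_mono simp: X_def)
    also have "\<dots> = (\<integral>\<^sup>+z. ennreal ((1 * g (r k) z + (-1) * g (r l) z)\<^sup>2) \<partial>lborel)"
      by (rule wiener_simple_isometry[OF elementary_lincomb[OF el el]])
    also have "\<dots> = (\<integral>\<^sup>+z. ennreal ((1 * ((g (r k) z - f z) * indicator S z) + (-1) * ((g (r l) z - f z) * indicator S z))\<^sup>2) \<partial>lborel)"
      by (intro nn_integral_cong) (auto simp: g_def indicator_def)
    also have "\<dots> \<le> ennreal (2 * 1\<^sup>2) * (\<integral>\<^sup>+z. ennreal (((g (r k) z - f z) * indicator S z)\<^sup>2) \<partial>lborel)
        + ennreal (2 * (-1)\<^sup>2) * (\<integral>\<^sup>+z. ennreal (((g (r l) z - f z) * indicator S z)\<^sup>2) \<partial>lborel)"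
      by (rule nn_integral_square_lincomb) measurable
    also have "(\<lambda>i. \<integral>\<^sup>+z. ennreal (((g i z - f z) * indicator S z)\<^sup>2) \<partial>lborel) = e"
      unfolding e_def by (intro ext nn_integral_cong) (auto simp: indicator_def)
    then have "ennreal (2 * 1\<^sup>2) * (\<integral>\<^sup>+z. ennreal (((g (r k) z - f z) * indicator S z)\<^sup>2) \<partial>lborel)
        + ennreal (2 * (-1)\<^sup>2) * (\<integral>\<^sup>+z. ennreal (((g (r l) z - f z) * indicator S z)\<^sup>2) \<partial>lborel)
       = ennreal 2 * e (r k) + ennreal 2 * e (r l)" by (simp add: fun_eq_iff)
    also have "\<dots> \<le> ennreal 2 * ennreal ((1/4) ^ (k+2)) + ennreal 2 * ennreal ((1/4) ^ (l+2))"
      by (intro add_mono mult_left_mono less_imp_le[OF r]) auto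
    also have "\<dots> = ennreal (2 * (1/4) ^ (k+2) + 2 * (1/4) ^ (l+2))"
      by (subst ennreal_plus) (simp_all only: ennreal_mult zero_le_numeral zero_le_power zero_le_divide_1_iff mult_nonneg_nonneg)
    also have "\<dots> \<le> ennreal ((1/4) ^ Suc k)"
    proof (rule ennreal_leI)
      have "(1/4::real) ^ (l+2) \<le> (1/4) ^ (k+2)" using kl by (intro power_decreasing) auto
      moreover have "(1/4::real) ^ Suc k = 4 * (1/4) ^ (k+2)" by simp
      ultimately show "2 * (1/4) ^ (k+2) + 2 * (1/4) ^ (l+2) \<le> (1/4::real) ^ Suc k" by linarith
    qed
    finally show ?thesis .
  qed
  obtain Y where Y: "Y \<in> borel_measurable P" "(\<lambda>k. \<integral>\<^sup>+w. ennreal ((X k w - Y w)\<^sup>2) \<partial>P) \<longlonglongrightarrow> 0"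
    using L2_complete[OF Xm C] by blast
  have "(\<lambda>k. ennreal ((1/4) ^ (k+2))) \<longlonglongrightarrow> ennreal 0"
    by (intro tendsto_ennrealI LIMSEQ_ignore_initial_segment LIMSEQ_realpow_zero) auto
  then have "(\<lambda>k. ennreal ((1/4) ^ (k+2))) \<longlonglongrightarrow> 0" by (simp only: ennreal_0)
  then have "(\<lambda>k. e (r k)) \<longlonglongrightarrow> 0" by (rule ennreal_squeeze[OF less_imp_le[OF r]])
  then have "has_wiener_integral P W S f Y"
    unfolding has_wiener_integral_def using Y gs fin g0
    by (intro conjI exI[of _ "\<lambda>k. g (r k)"]) (auto simp: X_def e_def)
  then show ?thesis by (intro exI)
qed

lemma wiener_integral_has:
  assumes "S \<in> sets borel" "S \<subseteq> {0<..<L} \<times> {0..}" "emeasure lborel S < \<infinity>"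
    and "f \<in> borel_measurable borel" "(\<integral>\<^sup>+z\<in>S. ennreal ((f z)\<^sup>2) \<partial>lborel) < \<infinity>"
  shows "has_wiener_integral P W S f (wiener_integral P W S f)"
  unfolding wiener_integral_def by (rule someI_ex[OF wiener_integral_exists[OF assms]])

lemma has_wiener_integral_approx:
  assumes "has_wiener_integral P W S f X" and SQ: "S \<subseteq> {0<..<L} \<times> {0..}"
  obtains g where "\<And>k. elementary L (g k)"
    "(\<lambda>k. \<integral>\<^sup>+z. ennreal ((g k z - indicator S z * f z)\<^sup>2) \<partial>lborel) \<longlonglongrightarrow> 0"
    "(\<lambda>k. \<integral>\<^sup>+w. ennreal ((wiener_simple W (g k) w - X w)\<^sup>2) \<partial>P) \<longlonglongrightarrow> 0" "X \<in> borel_measurable P"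
proof -
  obtain g where g: "\<And>k. simple_function borel (g k)" "\<And>k z. z \<notin> S \<Longrightarrow> g k z = 0"
    "\<And>k. emeasure lborel {z. g k z \<noteq> 0} < \<infinity>"
    "(\<lambda>k. \<integral>\<^sup>+z\<in>S. ennreal ((g k z - f z)\<^sup>2) \<partial>lborel) \<longlonglongrightarrow> 0"
    "(\<lambda>k. \<integral>\<^sup>+w. ennreal ((wiener_simple W (g k) w - X w)\<^sup>2) \<partial>P) \<longlonglongrightarrow> 0" "X \<in> borel_measurable P"
    using assms(1) unfolding has_wiener_integral_def by blast
  have "elementary L (g k)" for k unfolding elementary_def using g(1-3) SQ by blast
  moreover have "(\<integral>\<^sup>+z\<in>S. ennreal ((g k z - f z)\<^sup>2) \<partial>lborel) = (\<integral>\<^sup>+z. ennreal ((g k z - indicator S z * f z)\<^sup>2) \<partial>lborel)" for k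
    by (intro nn_integral_cong) (auto simp: indicator_def g(2))
  ultimately show thesis using g that[of g] by simp
qed

text \<open>Mean-square limits of elementary integrals, as a linear relation between integrands on the
  whole plane and random variables.\<close>

definition L2_limit :: "(real \<times> real \<Rightarrow> real) \<Rightarrow> ('a \<Rightarrow> real) \<Rightarrow> bool" where
  "L2_limit f X \<longleftrightarrow> X \<in> borel_measurable P \<and> f \<in> borel_measurable borel \<and>
    (\<exists>g. (\<forall>k. elementary L (g k)) \<and> (\<lambda>k. \<integral>\<^sup>+z. ennreal ((g k z - f z)\<^sup>2) \<partial>lborel) \<longlonglongrightarrow> 0 \<and>
    (\<lambda>k. \<integral>\<^sup>+w. ennreal ((wiener_simple W (g k) w - X w)\<^sup>2) \<partial>P) \<longlonglongrightarrow> 0)"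

lemma L2_limit_lincomb:
  assumes "L2_limit f X" "L2_limit f' X'"
  shows "L2_limit (\<lambda>z. a * f z + b * f' z) (\<lambda>w. a * X w + b * X' w)"
proof -
  obtain g where [measurable]: "X \<in> borel_measurable P" "f \<in> borel_measurable borel" and g: "\<And>k. elementary L (g k)"
    and g1: "(\<lambda>k. \<integral>\<^sup>+z. ennreal ((g k z - f z)\<^sup>2) \<partial>lborel) \<longlonglongrightarrow> 0"
    and g2: "(\<lambda>k. \<integral>\<^sup>+w. ennreal ((wiener_simple W (g k) w - X w)\<^sup>2) \<partial>P) \<longlonglongrightarrow> 0"
    using assms(1) unfolding L2_limit_def by blast
  obtain g' where [measurable]: "X' \<in> borel_measurable P" "f' \<in> borel_measurable borel" and g': "\<And>k. elementary L (g' k)"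
    and g1': "(\<lambda>k. \<integral>\<^sup>+z. ennreal ((g' k z - f' z)\<^sup>2) \<partial>lborel) \<longlonglongrightarrow> 0"
    and g2': "(\<lambda>k. \<integral>\<^sup>+w. ennreal ((wiener_simple W (g' k) w - X' w)\<^sup>2) \<partial>P) \<longlonglongrightarrow> 0"
    using assms(2) unfolding L2_limit_def by blast
  have [measurable]: "g k \<in> borel_measurable borel" "g' k \<in> borel_measurable borel"
    "wiener_simple W (g k) \<in> borel_measurable P" "wiener_simple W (g' k) \<in> borel_measurable P" for k
    using g g' elementary_measurable wiener_simple_measurable by auto
  define G where "G = (\<lambda>k z. a * g k z + b * g' k z)"
  have lim: "(\<lambda>k. ennreal (2 * a\<^sup>2) * d k + ennreal (2 * b\<^sup>2) * d' k) \<longlonglongrightarrow> 0"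
    if "d \<longlonglongrightarrow> 0" "d' \<longlonglongrightarrow> 0" for d d' :: "nat \<Rightarrow> ennreal"
  proof -
    have "(\<lambda>k. ennreal (2 * a\<^sup>2) * d k + ennreal (2 * b\<^sup>2) * d' k) \<longlonglongrightarrow> ennreal (2 * a\<^sup>2) * 0 + ennreal (2 * b\<^sup>2) * 0"
      by (intro tendsto_add ennreal_tendsto_cmult that) auto
    then show ?thesis by simp
  qed
  have "(\<integral>\<^sup>+z. ennreal ((G k z - (a * f z + b * f' z))\<^sup>2) \<partial>lborel)
     \<le> ennreal (2 * a\<^sup>2) * (\<integral>\<^sup>+z. ennreal ((g k z - f z)\<^sup>2) \<partial>lborel) + ennreal (2 * b\<^sup>2) * (\<integral>\<^sup>+z. ennreal ((g' k z - f' z)\<^sup>2) \<partial>lborel)" for k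
  proof -
    have "G k z - (a * f z + b * f' z) = a * (g k z - f z) + b * (g' k z - f' z)" for z
      by (simp add: G_def algebra_simps)
    then show ?thesis by (simp only:) (rule nn_integral_square_lincomb; measurable)
  qed
  then have 1: "(\<lambda>k. \<integral>\<^sup>+z. ennreal ((G k z - (a * f z + b * f' z))\<^sup>2) \<partial>lborel) \<longlonglongrightarrow> 0"
    by (rule ennreal_squeeze[OF _ lim[OF g1 g1']])
  have "(\<integral>\<^sup>+w. ennreal ((wiener_simple W (G k) w - (a * X w + b * X' w))\<^sup>2) \<partial>P)
     \<le> ennreal (2 * a\<^sup>2) * (\<integral>\<^sup>+w. ennreal ((wiener_simple W (g k) w - X w)\<^sup>2) \<partial>P) + ennreal (2 * b\<^sup>2) * (\<integral>\<^sup>+w. ennreal ((wiener_simple W (g' k) w - X' w)\<^sup>2) \<partial>P)" for k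
  proof -
    have ae: "AE w in P. wiener_simple W (G k) w = a * wiener_simple W (g k) w + b * wiener_simple W (g' k) w"
      unfolding G_def by (rule wiener_simple_lincomb[OF g g'])
    have "(\<integral>\<^sup>+w. ennreal ((wiener_simple W (G k) w - (a * X w + b * X' w))\<^sup>2) \<partial>P)
        = (\<integral>\<^sup>+w. ennreal ((a * (wiener_simple W (g k) w - X w) + b * (wiener_simple W (g' k) w - X' w))\<^sup>2) \<partial>P)"
      by (rule nn_integral_cong_AE) (use ae in \<open>eventually_elim, simp add: algebra_simps\<close>)
    then show ?thesis by (simp only:) (rule nn_integral_square_lincomb; measurable)
  qed
  then have 2: "(\<lambda>k. \<integral>\<^sup>+w. ennreal ((wiener_simple W (G k) w - (a * X w + b * X' w))\<^sup>2) \<partial>P) \<longlonglongrightarrow> 0"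
    by (rule ennreal_squeeze[OF _ lim[OF g2 g2']])
  have "\<And>k. elementary L (G k)" unfolding G_def by (rule elementary_lincomb[OF g g'])
  then show ?thesis unfolding L2_limit_def using 1 2 by (intro conjI exI[of _ G]) auto
qed

lemma L2_limit_zero: "L2_limit (\<lambda>_. 0) (\<lambda>_. 0)"
proof -
  have "elementary L (\<lambda>_. 0)" by (simp add: elementary_def)
  moreover have "wiener_simple W (\<lambda>_. 0) w = 0" for w by (simp add: wiener_simple_def)
  ultimately show ?thesis unfolding L2_limit_def by (intro conjI exI[of _ "\<lambda>_ _. 0"]) auto
qed

lemma L2_limit_sum:
  assumes "\<And>i. i < n \<Longrightarrow> L2_limit (f i) (X i)"
  shows "L2_limit (\<lambda>z. \<Sum>i<n. t i * f i z) (\<lambda>w. \<Sum>i<(n::nat). t i * X i w)"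
  using assms
proof (induction n)
  case 0 then show ?case using L2_limit_zero by simp
next
  case (Suc n)
  then show ?case using L2_limit_lincomb[of _ _ "f n" "X n" 1 "t n"] by simp
qed

text \<open>Both sides of the formula for elementary integrals pass to the limit. The variances
  converge because the integrands do in mean square, and the characteristic functions converge
  because \<open>iexp\<close> is 1-Lipschitz.\<close>

lemma L2_limit_char:
  assumes "L2_limit f X" and f2: "integrable lborel (\<lambda>z. (f z)\<^sup>2)"
  shows "(\<integral>w. iexp (X w) \<partial>P) = complex_of_real (exp (- (\<integral>z. (f z)\<^sup>2 \<partial>lborel) / 2))"
proof -
  obtain g where X[measurable]: "X \<in> borel_measurable P" and f[measurable]: "f \<in> borel_measurable borel" and g: "\<And>k. elementary L (g k)"
    and g1: "(\<lambda>k. \<integral>\<^sup>+z. ennreal ((g k z - f z)\<^sup>2) \<partial>lborel) \<longlonglongrightarrow> 0"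
    and g2: "(\<lambda>k. \<integral>\<^sup>+w. ennreal ((wiener_simple W (g k) w - X w)\<^sup>2) \<partial>P) \<longlonglongrightarrow> 0"
    using assms(1) unfolding L2_limit_def by blast
  have [measurable]: "g k \<in> borel_measurable borel" 
    "wiener_simple W (g k) \<in> borel_measurable P" for k
    using g elementary_measurable wiener_simple_measurable by auto
  define V where "V = (\<lambda>k. enn2real (\<integral>\<^sup>+z. ennreal ((g k z)\<^sup>2) \<partial>lborel))"
  have gi: "integrable lborel (\<lambda>z. (g k z)\<^sup>2)" for k
    by (rule integrableI_nonneg) (auto simp: elementary_square_integral(1)[OF g])
  have V: "V k = (\<integral>z. (g k z)\<^sup>2 \<partial>lborel)" for k
    unfolding V_def by (rule integral_eq_nn_integral[symmetric]) auto
  have "(\<lambda>k. \<bar>V k - (\<integral>z. (f z)\<^sup>2 \<partial>lborel)\<bar>) \<longlonglongrightarrow> 0"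
  proof (rule tendsto_zero_interpolation[OF g1])
    show "0 \<le> (\<integral>z. (f z)\<^sup>2 \<partial>lborel)" by simp
    fix e :: real and k assume e: "e > 0"
    have "V k - (\<integral>z. (f z)\<^sup>2 \<partial>lborel) = (\<integral>z. (g k z)\<^sup>2 - (f z)\<^sup>2 \<partial>lborel)"
      using gi f2 by (simp add: V)
    then have "ennreal \<bar>V k - (\<integral>z. (f z)\<^sup>2 \<partial>lborel)\<bar> \<le> (\<integral>\<^sup>+z. ennreal (norm ((g k z)\<^sup>2 - (f z)\<^sup>2)) \<partial>lborel)"
      using integral_norm_bound_ennreal[of lborel "\<lambda>z. (g k z)\<^sup>2 - (f z)\<^sup>2"] gi f2 by simp
    also have "\<dots> \<le> (\<integral>\<^sup>+z. ennreal e * ennreal ((f z)\<^sup>2) + ennreal (1 + 1/e) * ennreal ((g k z - f z)\<^sup>2) \<partial>lborel)"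
    proof (rule nn_integral_mono)
      fix z
      let ?d = "g k z - f z"
      have "0 \<le> (e * \<bar>f z\<bar> - \<bar>?d\<bar>)\<^sup>2 / e" using e by simp
      then have "2 * \<bar>f z\<bar> * \<bar>?d\<bar> \<le> e * (f z)\<^sup>2 + ?d\<^sup>2 / e"
      proof -
        have "(e * a - b)\<^sup>2 / e = e * a\<^sup>2 - 2 * a * b + b\<^sup>2 / e" for a b :: real
          using e by (simp add: power2_eq_square field_simps)
        from this[of "\<bar>f z\<bar>" "\<bar>?d\<bar>"] \<open>0 \<le> (e * \<bar>f z\<bar> - \<bar>?d\<bar>)\<^sup>2 / e\<close> show ?thesis by simp
      qed
      moreover have "(g k z)\<^sup>2 - (f z)\<^sup>2 = 2 * f z * ?d + ?d\<^sup>2" by (simp add: power2_eq_square algebra_simps)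
      then have "norm ((g k z)\<^sup>2 - (f z)\<^sup>2) \<le> 2 * \<bar>f z\<bar> * \<bar>?d\<bar> + ?d\<^sup>2"
        using abs_triangle_ineq[of "2 * f z * ?d" "?d\<^sup>2"] by (simp add: abs_mult)
      ultimately have "norm ((g k z)\<^sup>2 - (f z)\<^sup>2) \<le> e * (f z)\<^sup>2 + (1 + 1/e) * ?d\<^sup>2"
        by (simp add: distrib_right)
      then show "ennreal (norm ((g k z)\<^sup>2 - (f z)\<^sup>2)) \<le> ennreal e * ennreal ((f z)\<^sup>2) + ennreal (1 + 1/e) * ennreal (?d\<^sup>2)"
        using e by (simp add: ennreal_mult[symmetric] ennreal_plus[symmetric] ennreal_leI del: ennreal_plus)
    qed
    also have "\<dots> = ennreal e * (\<integral>\<^sup>+z. ennreal ((f z)\<^sup>2) \<partial>lborel) + ennreal (1 + 1/e) * (\<integral>\<^sup>+z. ennreal ((g k z - f z)\<^sup>2) \<partial>lborel)"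
      by (subst nn_integral_add) (simp_all add: nn_integral_cmult)
    also have "(\<integral>\<^sup>+z. ennreal ((f z)\<^sup>2) \<partial>lborel) = ennreal (\<integral>z. (f z)\<^sup>2 \<partial>lborel)"
      using f2 by (intro nn_integral_eq_integral) auto
    finally show "ennreal \<bar>V k - (\<integral>z. (f z)\<^sup>2 \<partial>lborel)\<bar> \<le> ennreal (e * (\<integral>z. (f z)\<^sup>2 \<partial>lborel))
      + ennreal (1 + 1 / e) * (\<integral>\<^sup>+z. ennreal ((g k z - f z)\<^sup>2) \<partial>lborel)"
      using e by (simp add: ennreal_mult)
  qed simp
  then have Vlim: "V \<longlonglongrightarrow> (\<integral>z. (f z)\<^sup>2 \<partial>lborel)"
    by (simp add: tendsto_rabs_zero_iff LIM_zero_iff)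
  have "(\<lambda>k. norm ((\<integral>w. iexp (wiener_simple W (g k) w) \<partial>P) - (\<integral>w. iexp (X w) \<partial>P))) \<longlonglongrightarrow> 0"
  proof (rule tendsto_zero_interpolation[OF g2, where A=1])
    fix e :: real and k assume e: "e > 0"
    let ?Z = "wiener_simple W (g k)"
    have i: "integrable P (\<lambda>w. iexp (?Z w))" "integrable P (\<lambda>w. iexp (X w))"
      by (auto intro!: integrable_const_bound[where B=1])
    have "ennreal (norm ((\<integral>w. iexp (?Z w) \<partial>P) - (\<integral>w. iexp (X w) \<partial>P))) = ennreal (norm (\<integral>w. iexp (?Z w) - iexp (X w) \<partial>P))"
      using i by simp
    also have "\<dots> \<le> (\<integral>\<^sup>+w. ennreal (norm (iexp (?Z w) - iexp (X w))) \<partial>P)"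
      by (rule integral_norm_bound_ennreal) (use i in auto)
    also have "\<dots> \<le> (\<integral>\<^sup>+w. ennreal e + ennreal (1 + 1/e) * ennreal ((?Z w - X w)\<^sup>2) \<partial>P)"
    proof (rule nn_integral_mono)
      fix w
      let ?d = "?Z w - X w"
      have "iexp (?Z w) - iexp (X w) = iexp (X w) * (iexp ?d - 1)"
        by (simp add: exp_diff right_diff_distrib)
      then have "norm (iexp (?Z w) - iexp (X w)) = norm (iexp ?d - 1)" by (simp add: norm_mult)
      also have "\<dots> \<le> \<bar>?d\<bar>" using iexp_approx1[of ?d 0] by simp
      \<comment> \<open>Either the increment is at most \<open>e\<close>, or
        \<open>e * |d| <= d^2\<close>.\<close>
      also have "\<bar>?d\<bar> \<le> e + (1 + 1/e) * ?d\<^sup>2"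
      proof (cases "\<bar>?d\<bar> \<le> e")
        case True then show ?thesis using e by (simp add: add_increasing2)
      next
        case False
        then have "e * \<bar>?d\<bar> \<le> \<bar>?d\<bar> * \<bar>?d\<bar>" by (intro mult_right_mono) auto
        then have "\<bar>?d\<bar> \<le> (1/e) * ?d\<^sup>2" using e by (simp add: field_simps power2_eq_square)
        also have "\<dots> \<le> e + (1 + 1/e) * ?d\<^sup>2" using e by (simp add: distrib_right)
        finally show ?thesis .
      qed
      finally have "norm (iexp (?Z w) - iexp (X w)) \<le> e + (1 + 1/e) * ?d\<^sup>2" .
      then show "ennreal (norm (iexp (?Z w) - iexp (X w))) \<le> ennreal e + ennreal (1 + 1/e) * ennreal (?d\<^sup>2)"
        using e by (simp add: ennreal_mult[symmetric] ennreal_plus[symmetric] ennreal_leI del: ennreal_plus)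
    qed
    also have "\<dots> = ennreal e + ennreal (1 + 1/e) * (\<integral>\<^sup>+w. ennreal ((?Z w - X w)\<^sup>2) \<partial>P)"
      by (subst nn_integral_add) (simp_all add: nn_integral_cmult emeasure_space_1)
    finally show "ennreal (norm ((\<integral>w. iexp (?Z w) \<partial>P) - (\<integral>w. iexp (X w) \<partial>P))) \<le> ennreal (e * 1) + ennreal (1 + 1 / e) * (\<integral>\<^sup>+w. ennreal ((?Z w - X w)\<^sup>2) \<partial>P)"
      by simp
  qed simp_all
  then have "(\<lambda>k. \<integral>w. iexp (wiener_simple W (g k) w) \<partial>P) \<longlonglongrightarrow> (\<integral>w. iexp (X w) \<partial>P)"
    by (simp add: tendsto_norm_zero_iff LIM_zero_iff)
  moreover have "(\<integral>w. iexp (wiener_simple W (g k) w) \<partial>P) = complex_of_real (exp (- V k / 2))" for k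
    unfolding V_def by (rule wiener_simple_char[OF g])
  ultimately have l1: "(\<lambda>k. complex_of_real (exp (- V k / 2))) \<longlonglongrightarrow> (\<integral>w. iexp (X w) \<partial>P)" by (simp only:)
  have "(\<lambda>k. complex_of_real (exp (- V k / 2))) \<longlonglongrightarrow> complex_of_real (exp (- (\<integral>z. (f z)\<^sup>2 \<partial>lborel) / 2))"
    by (intro tendsto_intros Vlim) simp
  from l1 this show ?thesis by (rule LIMSEQ_unique)
qed

lemma wiener_integral_L2_limit:
  assumes S[measurable]: "S \<in> sets borel" and SQ: "S \<subseteq> {0<..<L} \<times> {0..}" "emeasure lborel S < \<infinity>"
    and f[measurable]: "f \<in> borel_measurable borel" and L2: "(\<integral>\<^sup>+z\<in>S. ennreal ((f z)\<^sup>2) \<partial>lborel) < \<infinity>"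
  shows "L2_limit (\<lambda>z. indicator S z * f z) (wiener_integral P W S f)"
proof -
  obtain g where "\<And>k. elementary L (g k)"
    "(\<lambda>k. \<integral>\<^sup>+z. ennreal ((g k z - indicator S z * f z)\<^sup>2) \<partial>lborel) \<longlonglongrightarrow> 0"
    "(\<lambda>k. \<integral>\<^sup>+w. ennreal ((wiener_simple W (g k) w - wiener_integral P W S f w)\<^sup>2) \<partial>P) \<longlonglongrightarrow> 0"
    "wiener_integral P W S f \<in> borel_measurable P"
    using has_wiener_integral_approx[OF wiener_integral_has[OF assms] SQ(1)] by blast
  then show ?thesis unfolding L2_limit_def by (intro conjI exI[of _ g]) auto
qed

text \<open>A linear combination of the integrals is a mean-square limit for the same combination of
  the integrands, extended by zero to the plane. Its variance, the integral of the squared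
  combination, expands into the quadratic form of \<open>C\<close>. The factors \<open>c i\<close>
  make room for the division by \<open>x\<close>.\<close>

lemma wiener_integral_gaussian_family:
  fixes S :: "nat \<Rightarrow> (real \<times> real) set" and f :: "nat \<Rightarrow> real \<times> real \<Rightarrow> real" and c :: "nat \<Rightarrow> real"
  assumes S[measurable]: "\<And>i. S i \<in> sets borel" and SQ: "\<And>i. S i \<subseteq> {0<..<L} \<times> {0..}" "\<And>i. emeasure lborel (S i) < \<infinity>"
    and f[measurable]: "\<And>i. f i \<in> borel_measurable borel"
    and L2: "\<And>i. (\<integral>\<^sup>+z\<in>S i. ennreal ((f i z)\<^sup>2) \<partial>lborel) < \<infinity>"
  shows "gaussian_family P (\<lambda>i w. c i * wiener_integral P W (S i) (f i) w)
    (\<lambda>i j. c i * c j * (\<integral>z. (indicator (S i) z * f i z) * (indicator (S j) z * f j z) \<partial>lborel))"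
proof (intro gaussian_family.intro gaussian_family_axioms.intro)
  show "prob_space P" by unfold_locales
  define F where "F = (\<lambda>i z. indicator (S i) z * f i z)"
  have F[measurable]: "F i \<in> borel_measurable borel" for i unfolding F_def by measurable
  have lim: "L2_limit (F i) (wiener_integral P W (S i) (f i))" for i
    unfolding F_def by (rule wiener_integral_L2_limit[OF S SQ f L2])
  then have m: "wiener_integral P W (S i) (f i) \<in> borel_measurable P" for i by (simp add: L2_limit_def)
  then show "(\<lambda>w. c i * wiener_integral P W (S i) (f i) w) \<in> borel_measurable P" for i by measurable
  have F2: "integrable lborel (\<lambda>z. (F i z)\<^sup>2)" for i
  proof (rule integrableI_nonneg)
    have "(\<integral>\<^sup>+z. ennreal ((F i z)\<^sup>2) \<partial>lborel) = (\<integral>\<^sup>+z\<in>S i. ennreal ((f i z)\<^sup>2) \<partial>lborel)"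
      by (intro nn_integral_cong) (auto simp: F_def indicator_def)
    then show "(\<integral>\<^sup>+z. ennreal ((F i z)\<^sup>2) \<partial>lborel) < \<infinity>" using L2[of i] by simp
  qed auto
  have FF: "integrable lborel (\<lambda>z. F i z * F j z)" for i j
  proof (rule Bochner_Integration.integrable_bound[OF Bochner_Integration.integrable_add[OF F2[of i] F2[of j]]])
    have "norm (F i z * F j z) \<le> norm ((F i z)\<^sup>2 + (F j z)\<^sup>2)" for z
    proof -
      have "0 \<le> \<bar>F i z\<bar> * \<bar>F j z\<bar>" by simp
      with sum_squares_bound[of "\<bar>F i z\<bar>" "\<bar>F j z\<bar>"] have "\<bar>F i z\<bar> * \<bar>F j z\<bar> \<le> (F i z)\<^sup>2 + (F j z)\<^sup>2"
        by (simp only: power2_abs)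
      then show ?thesis by (simp add: abs_mult)
    qed
    then show "AE z in lborel. norm (F i z * F j z) \<le> norm ((F i z)\<^sup>2 + (F j z)\<^sup>2)" by simp
  qed measurable
  fix n :: nat and t :: "nat \<Rightarrow> real"
  define G where "G = (\<lambda>z. \<Sum>i<n. (t i * c i) * F i z)"
  have sq: "(G z)\<^sup>2 = (\<Sum>i<n. \<Sum>j<n. ((t i * c i) * (t j * c j)) * (F i z * F j z))" for z
    by (simp add: G_def power2_eq_square sum_product algebra_simps)
  have G2: "integrable lborel (\<lambda>z. (G z)\<^sup>2)"
    unfolding sq by (intro Bochner_Integration.integrable_sum integrable_mult_right FF)
  have val: "(\<integral>z. (G z)\<^sup>2 \<partial>lborel) = (\<Sum>i<n. \<Sum>j<n. t i * t j * (c i * c j * (\<integral>z. F i z * F j z \<partial>lborel)))"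
  proof -
    have "(\<integral>z. (G z)\<^sup>2 \<partial>lborel) = (\<Sum>i<n. \<integral>z. (\<Sum>j<n. ((t i * c i) * (t j * c j)) * (F i z * F j z)) \<partial>lborel)"
      unfolding sq by (intro Bochner_Integration.integral_sum Bochner_Integration.integrable_sum integrable_mult_right FF)
    also have "\<dots> = (\<Sum>i<n. \<Sum>j<n. \<integral>z. ((t i * c i) * (t j * c j)) * (F i z * F j z) \<partial>lborel)"
      by (intro sum.cong refl Bochner_Integration.integral_sum integrable_mult_right FF)
    also have "\<dots> = (\<Sum>i<n. \<Sum>j<n. t i * t j * (c i * c j * (\<integral>z. F i z * F j z \<partial>lborel)))"
      by (intro sum.cong refl) (simp only: integral_mult_right_zero mult_ac)
    finally show ?thesis .
  qed
  have "L2_limit G (\<lambda>w. \<Sum>i<n. (t i * c i) * wiener_integral P W (S i) (f i) w)"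
    unfolding G_def by (rule L2_limit_sum[OF lim])
  from L2_limit_char[OF this G2]
  show "(\<integral>w. iexp (\<Sum>i<n. t i * (c i * wiener_integral P W (S i) (f i) w)) \<partial>P)
    = complex_of_real (exp (- (\<Sum>i<n. \<Sum>j<n. t i * t j * (c i * c j *
        (\<integral>z. (indicator (S i) z * f i z) * (indicator (S j) z * f j z) \<partial>lborel))) / 2))"
    unfolding val F_def by (simp only: mult.assoc)
qed

text \<open>For the equation at time 0. \<open>wiener_integral\<close> is only some representative,
  but over the empty region every approximating simple function vanishes identically, which forces
  the limit to be zero almost surely.\<close>

lemma wiener_integral_empty: "AE w in P. wiener_integral P W {} f w = 0"
proof -
  have "has_wiener_integral P W {} f (\<lambda>_. 0)"
    unfolding has_wiener_integral_def by (intro conjI exI[of _ "\<lambda>_ _. 0"]) (auto simp: wiener_simple_def)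
  then have "has_wiener_integral P W {} f (wiener_integral P W {} f)"
    unfolding wiener_integral_def by (rule someI[of "has_wiener_integral P W {} f"])
  then obtain g where m: "wiener_integral P W {} f \<in> borel_measurable P" and g0: "\<And>k z. g k z = (0::real)"
    and l: "(\<lambda>k. \<integral>\<^sup>+ w. ennreal ((wiener_simple W (g k) w - wiener_integral P W {} f w)\<^sup>2) \<partial>P) \<longlonglongrightarrow> 0"
    unfolding has_wiener_integral_def by blast
  have "wiener_simple W (g k) w = 0" for k w
    using g0 by (simp add: wiener_simple_def)
  then have "(\<lambda>k::nat. \<integral>\<^sup>+ w. ennreal ((wiener_integral P W {} f w)\<^sup>2) \<partial>P) \<longlonglongrightarrow> 0" using l by simp
  then have "(\<integral>\<^sup>+ w. ennreal ((wiener_integral P W {} f w)\<^sup>2) \<partial>P) = 0" by (simp add: LIMSEQ_const_iff)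
  then show ?thesis using m by (subst (asm) nn_integral_0_iff_AE) auto
qed

end

section \<open>The Dirichlet heat kernel\<close>

text \<open>The exponent 7/4 is the midpoint of the admissible range from 3/2 to 2. Above 3/2 the
  squared differences of the kernel coefficients are summable in the frequency; below 2 the square
  root of the resulting power of \<open>r\<close> is integrable at \<open>r = 0\<close>.\<close>

lemma exp_minus_le_powr: "exp (- z) \<le> 2 * z powr (-(7/4))" if z: "z > 0" for z :: real
proof -
  have "z powr (7/4) \<le> 1 + z\<^sup>2"
  proof (cases "z \<le> 1")
    case True
    then have "z powr (7/4) \<le> 1 powr (7/4)" using z by (intro powr_mono2) auto
    then show ?thesis by (simp add: add_increasing2)
  next
    case False
    then have "z powr (7/4) \<le> z powr 2" by (intro powr_mono) auto
    then show ?thesis using z by simp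
  qed
  also have "\<dots> \<le> 2 * (1 + z + z\<^sup>2 / 2)" using z by simp
  also have "\<dots> \<le> 2 * exp z" using exp_lower_Taylor_quadratic[of z] z by simp
  finally show ?thesis using z by (simp add: powr_minus exp_minus field_simps)
qed

lemma exp_minus_le_square: "exp (- z) \<le> 2 / z\<^sup>2" if z: "z > 0" for z :: real
proof -
  have "z\<^sup>2 \<le> 2 * exp z" using exp_lower_Taylor_quadratic[of z] z by simp
  then show ?thesis using z by (simp add: exp_minus field_simps)
qed

lemma mult_exp_minus_le: "z * exp (- z) \<le> exp (- z / 2)" if z: "z \<ge> 0" for z :: real
proof -
  have "0 \<le> (z - 2)\<^sup>2" by simp
  then have "z \<le> 1 + z / 2 + (z / 2)\<^sup>2 / 2" by (simp add: power2_eq_square algebra_simps)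
  also have "\<dots> \<le> exp (z / 2)" using exp_lower_Taylor_quadratic[of "z / 2"] z by simp
  finally have "z * exp (- z) \<le> exp (z / 2) * exp (- z)" by (intro mult_right_mono) auto
  then show ?thesis by (simp add: exp_add[symmetric])
qed

text \<open>Up to \<open>pi/3\<close> the difference \<open>sin z - z/2\<close> is nondecreasing,
  since the cosine is at least 1/2. Beyond it, \<open>sin z\<close> is at least
  \<open>sin (pi/3) >= 0.85\<close>, while \<open>z/2\<close> is at most
  \<open>pi/4 <= 0.8\<close>.\<close>

lemma half_le_sin: "z / 2 \<le> sin z" if z: "0 \<le> z" "z \<le> pi / 2" for z :: real
proof (cases "z \<le> pi / 3")
  case True
  have "sin 0 - 0 / 2 \<le> sin z - z / 2"
  proof (rule DERIV_nonneg_imp_nondecreasing[OF z(1)])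
    fix y assume y: "0 \<le> y" "y \<le> z"
    have "cos (pi / 3) \<le> cos y" using y True by (intro cos_monotone_0_pi_le) auto
    then have "0 \<le> cos y - 1 / 2" by (simp add: cos_60)
    moreover have "((\<lambda>z. sin z - z / 2) has_real_derivative cos y - 1 / 2) (at y)"
      by (auto intro!: derivative_eq_intros)
    ultimately show "\<exists>d. ((\<lambda>z. sin z - z / 2) has_real_derivative d) (at y) \<and> 0 \<le> d" by blast
  qed
  then show ?thesis by simp
next
  case False
  have "sin (pi / 3) \<le> sin z" using False z by (intro sin_monotone_2pi_le) auto
  moreover have "17 / 10 \<le> sqrt 3" by (rule real_le_rsqrt) (simp add: power2_eq_square)
  moreover have "pi \<le> 32 / 10" using pi_approx by simp
  ultimately show ?thesis using z by (simp add: sin_60)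
qed

lemma abs_sin_diff_le: "\<bar>sin a - sin b\<bar> \<le> \<bar>a - b\<bar>" for a b :: real
proof -
  have "sin a - sin b = 2 * sin ((a - b) / 2) * cos ((a + b) / 2)" by (rule sin_diff_sin)
  then have "\<bar>sin a - sin b\<bar> = 2 * \<bar>sin ((a - b) / 2)\<bar> * \<bar>cos ((a + b) / 2)\<bar>" by (simp add: abs_mult)
  also have "\<dots> \<le> 2 * \<bar>(a - b) / 2\<bar> * 1"
    by (intro mult_mono abs_sin_x_le_abs_x abs_cos_le_one) auto
  finally show ?thesis by simp
qed

locale dirichlet_heat =
  fixes \<alpha> L :: real
  assumes alpha: "\<alpha> > 0" and L: "L > 0"
begin

definition mu :: real where "mu = pi / L"
definition rate :: real where "rate = \<alpha> * mu\<^sup>2"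
definition decay :: "nat \<Rightarrow> real \<Rightarrow> real" where "decay j r = exp (- rate * (real j)\<^sup>2 * r)"
text \<open>The value at 0 is the limit of the quotient, so that kernel bounds hold up to the
  boundary point where the slope is read off.\<close>

definition quot :: "nat \<Rightarrow> real \<Rightarrow> real" where
  "quot j x = (if x = 0 then real j * mu else sin (real j * mu * x) / x)"
definition coef :: "nat \<Rightarrow> real \<Rightarrow> real \<Rightarrow> real" where
  "coef j x r = real j * mu * decay j r * quot j x"

text \<open>The kernel \<open>G\<^sub>y(x,y,r) / x\<close>, continuously extended to \<open>x = 0\<close>.\<close>

definition kap :: "real \<Rightarrow> real \<Rightarrow> real \<Rightarrow> real" where
  "kap x y r = 2 / L * (\<Sum>k. coef (Suc k) x r * cos (real (Suc k) * mu * y))"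

lemma mu_pos: "mu > 0" and rate_pos: "rate > 0"
  using alpha L by (auto simp: mu_def rate_def)

lemma decay_pos: "decay j r > 0" by (simp add: decay_def)

lemma decay_le: "0 < r0 \<Longrightarrow> r0 \<le> r \<Longrightarrow> decay (Suc k) r \<le> 2 / (rate * r0)\<^sup>2 * inverse (real (Suc k) ^ 4)"
proof -
  assume r: "0 < r0" "r0 \<le> r"
  define z where "z = rate * (real (Suc k))\<^sup>2 * r0"
  have z: "z > 0" using r rate_pos by (simp add: z_def)
  have "decay (Suc k) r \<le> exp (- z)"
    unfolding decay_def z_def using r rate_pos by (simp add: mult_left_mono)
  also have "\<dots> \<le> 2 / z\<^sup>2" by (rule exp_minus_le_square[OF z])
  also have "\<dots> = 2 / (rate * r0)\<^sup>2 * inverse (real (Suc k) ^ 4)"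
    by (simp add: z_def power_mult_distrib divide_inverse flip: power_mult)
  finally show ?thesis .
qed

lemma quot_bound: "\<bar>quot j x\<bar> \<le> real j * mu"
proof (cases "x = 0")
  case False
  have "\<bar>sin (real j * mu * x)\<bar> \<le> real j * mu * \<bar>x\<bar>"
    using abs_sin_x_le_abs_x[of "real j * mu * x"] mu_pos by (simp add: abs_mult)
  then show ?thesis using False by (simp add: quot_def pos_divide_le_eq)
qed (use mu_pos in \<open>simp add: quot_def\<close>)

text \<open>The sine is 1-Lipschitz and the factor \<open>x\<close> cancels. Compared with
  \<open>quot_bound\<close>, a difference of neighbouring frequencies gains a full power of
  \<open>j\<close>; the telescoped series owes its better convergence to this gain.\<close>

lemma quot_diff_bound: "\<bar>quot (Suc j) x - quot j x\<bar> \<le> mu"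
proof (cases "x = 0")
  case True then show ?thesis using mu_pos by (simp add: quot_def algebra_simps)
next
  case False
  have "\<bar>sin (real (Suc j) * mu * x) - sin (real j * mu * x)\<bar> \<le> \<bar>real (Suc j) * mu * x - real j * mu * x\<bar>"
    by (rule abs_sin_diff_le)
  also have "\<dots> = mu * \<bar>x\<bar>" using mu_pos by (simp add: algebra_simps abs_mult)
  finally show ?thesis using False
    by (simp add: quot_def diff_divide_distrib[symmetric] pos_divide_le_eq)
qed

lemma quot_mult: "x * quot j x = sin (real j * mu * x)" by (simp add: quot_def)

lemma quot_continuous: "continuous_on UNIV (quot j)"
proof -
  have "isCont (quot j) x" for x
  proof (cases "x = 0")
    case True
    have "((\<lambda>x. sin (real j * mu * x)) has_real_derivative real j * mu) (at 0)"
      by (auto intro!: derivative_eq_intros)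
    then have "((\<lambda>h. sin (real j * mu * h) / h) \<longlongrightarrow> real j * mu) (at 0)" by (simp add: DERIV_def)
    then have "(quot j \<longlongrightarrow> real j * mu) (at 0)"
      by (rule Lim_transform_eventually) (auto simp: eventually_at_filter quot_def)
    then show ?thesis using True by (simp add: isCont_def quot_def)
  next
    case False
    have "isCont (\<lambda>x. sin (real j * mu * x) / x) x" using False by (intro continuous_intros) auto
    moreover have "eventually (\<lambda>y. quot j y = sin (real j * mu * y) / y) (nhds x)"
      using t1_space_nhds[OF False] by eventually_elim (simp add: quot_def)
    ultimately show ?thesis by (simp cong: isCont_cong)
  qed
  then show ?thesis by (simp add: continuous_on_eq_continuous_at)
qed

lemma coef_bound:
  assumes "0 < r0" "r0 \<le> r"
  shows "\<bar>coef (Suc k) x r\<bar> \<le> 2 * mu\<^sup>2 / (rate * r0)\<^sup>2 * inverse (real (Suc k) ^ 2)"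
proof -
  let ?j = "real (Suc k)"
  have "\<bar>coef (Suc k) x r\<bar> = (?j * mu) * decay (Suc k) r * \<bar>quot (Suc k) x\<bar>"
    using mu_pos by (simp add: coef_def abs_mult decay_def)
  also have "\<dots> \<le> (?j * mu) * (2 / (rate * r0)\<^sup>2 * inverse (?j ^ 4)) * (?j * mu)"
    by (intro mult_mono order_refl decay_le[OF assms] quot_bound) (use mu_pos rate_pos in \<open>auto simp: decay_def\<close>)
  also have "\<dots> = 2 * mu\<^sup>2 / (rate * r0)\<^sup>2 * (?j\<^sup>2 * inverse (?j ^ 4))" by (simp add: power2_eq_square)
  also have "?j\<^sup>2 * inverse (?j ^ 4) = inverse (?j\<^sup>2)"
    by (simp add: field_simps del: of_nat_Suc flip: power_add)
  finally show ?thesis .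
qed

lemma summable_inverse_Suc_square: "summable (\<lambda>k. inverse (real (Suc k) ^ 2))"
  using inverse_power_summable[of 2] by (subst summable_Suc_iff) simp

lemma kap_uniform:
  assumes r0: "0 < r0"
  shows "uniform_limit {z. r0 \<le> snd (snd z)} (\<lambda>n z. \<Sum>k<n. coef (Suc k) (fst z) (snd (snd z)) * cos (real (Suc k) * mu * fst (snd z)))
    (\<lambda>z. \<Sum>k. coef (Suc k) (fst z) (snd (snd z)) * cos (real (Suc k) * mu * fst (snd z))) sequentially"
proof (rule Weierstrass_m_test[where M="\<lambda>k. 2 * mu\<^sup>2 / (rate * r0)\<^sup>2 * inverse (real (Suc k) ^ 2)"])
  fix k and z :: "real \<times> real \<times> real" assume z: "z \<in> {z. r0 \<le> snd (snd z)}"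
  have "norm (coef (Suc k) (fst z) (snd (snd z)) * cos (real (Suc k) * mu * fst (snd z))) \<le> \<bar>coef (Suc k) (fst z) (snd (snd z))\<bar> * 1"
    unfolding real_norm_def abs_mult by (intro mult_left_mono abs_cos_le_one) auto
  also have "\<dots> \<le> 2 * mu\<^sup>2 / (rate * r0)\<^sup>2 * inverse (real (Suc k) ^ 2)"
    using coef_bound[OF r0, of "snd (snd z)" k "fst z"] z by simp
  finally show "norm (coef (Suc k) (fst z) (snd (snd z)) * cos (real (Suc k) * mu * fst (snd z)))
    \<le> 2 * mu\<^sup>2 / (rate * r0)\<^sup>2 * inverse (real (Suc k) ^ 2)" .
qed (intro summable_mult summable_inverse_Suc_square)

text \<open>The series converges uniformly only for \<open>r\<close> bounded away from 0, but each
  point with \<open>r > 0\<close> has an open neighbourhood in such a region.\<close>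

lemma kap_continuous: "continuous_on {z. 0 < snd (snd z)} (\<lambda>z. kap (fst z) (fst (snd z)) (snd (snd z)))"
proof -
  have c: "continuous_on {z. r0 \<le> snd (snd z)} (\<lambda>z. kap (fst z) (fst (snd z)) (snd (snd z)))" if r0: "0 < r0" for r0
    unfolding kap_def
  proof (intro continuous_on_mult continuous_on_const uniform_limit_theorem[OF _ kap_uniform[OF r0]])
    show "\<forall>\<^sub>F n in sequentially. continuous_on {z. r0 \<le> snd (snd z)}
       (\<lambda>z. \<Sum>k<n. coef (Suc k) (fst z) (snd (snd z)) * cos (real (Suc k) * mu * fst (snd z)))"
      unfolding coef_def decay_def
      by (intro always_eventually allI continuous_intros continuous_on_compose2[OF quot_continuous]) auto
  qed simp
  have "isCont (\<lambda>z. kap (fst z) (fst (snd z)) (snd (snd z))) z" if z: "0 < snd (snd z)" for z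
  proof -
    have op: "open {w :: real \<times> real \<times> real. snd (snd z) / 2 < snd (snd w)}"
      by (intro open_Collect_less continuous_intros)
    have "continuous_on {w. snd (snd z) / 2 < snd (snd w)} (\<lambda>z. kap (fst z) (fst (snd z)) (snd (snd z)))"
      by (rule continuous_on_subset[OF c[of "snd (snd z) / 2"]]) (use z in auto)
    moreover have "z \<in> {w. snd (snd z) / 2 < snd (snd w)}" using z by simp
    ultimately show ?thesis using continuous_on_eq_continuous_at[OF op] by blast
  qed
  then show ?thesis by (intro continuous_at_imp_continuous_on) auto
qed

text \<open>Termwise differentiation, legitimate because the differentiated series converges
  uniformly for fixed \<open>r > 0\<close>. The factor \<open>x\<close> appears by writing
  \<open>sin (j mu x)\<close> as \<open>x * quot j x\<close>.\<close>

lemma heat_green_y_eq: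
  assumes r: "r > 0" shows "heat_green_y \<alpha> L x y r = x * kap x y r"
proof -
  define f where "f = (\<lambda>k y. sin (real (Suc k) * mu * y) * sin (real (Suc k) * mu * x) * decay (Suc k) r)"
  define f' where "f' = (\<lambda>k y. x * (coef (Suc k) x r * cos (real (Suc k) * mu * y)))"
  have d: "(f k has_field_derivative f' k y) (at y within UNIV)" for k y
    unfolding f_def f'_def coef_def quot_mult[of x "Suc k", symmetric]
    by (auto intro!: derivative_eq_intros)
  have u: "uniformly_convergent_on UNIV (\<lambda>n y. \<Sum>i<n. f' i y)"
  proof (rule Weierstrass_m_test')
    fix k y
    have "norm (f' k y) = \<bar>x\<bar> * (\<bar>coef (Suc k) x r\<bar> * \<bar>cos (real (Suc k) * mu * y)\<bar>)"
      by (simp add: f'_def abs_mult)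
    also have "\<dots> \<le> \<bar>x\<bar> * (2 * mu\<^sup>2 / (rate * r)\<^sup>2 * inverse (real (Suc k) ^ 2) * 1)"
      by (intro mult_left_mono mult_mono coef_bound r abs_cos_le_one order_refl) auto
    finally show "norm (f' k y) \<le> \<bar>x\<bar> * (2 * mu\<^sup>2 / (rate * r)\<^sup>2 * inverse (real (Suc k) ^ 2))" by simp
  qed (intro summable_mult summable_inverse_Suc_square)
  have "((\<lambda>y. \<Sum>k. f k y) has_field_derivative (\<Sum>k. f' k y)) (at y)"
    by (rule has_field_derivative_series'(2)[OF convex_UNIV d u, of 0]) (auto simp: f_def)
  then have "((\<lambda>y. 2 / L * (\<Sum>k. f k y)) has_field_derivative 2 / L * (\<Sum>k. f' k y)) (at y)"
    by (rule DERIV_cmult)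
  moreover have "(\<lambda>z. heat_green \<alpha> L x z r) = (\<lambda>y. 2 / L * (\<Sum>k. f k y))"
    by (simp add: heat_green_def f_def mu_def decay_def rate_def mult.assoc)
  moreover have "(\<Sum>k. f' k y) = x * (\<Sum>k. coef (Suc k) x r * cos (real (Suc k) * mu * y))"
  proof -
    have "summable (\<lambda>k. coef (Suc k) x r * cos (real (Suc k) * mu * y))"
    proof (rule summable_comparison_test[OF exI[of _ 0]])
      show "\<forall>n\<ge>0. norm (coef (Suc n) x r * cos (real (Suc n) * mu * y)) \<le> 2 * mu\<^sup>2 / (rate * r)\<^sup>2 * inverse (real (Suc n) ^ 2)"
      proof (intro allI impI)
        fix k
        have "norm (coef (Suc k) x r * cos (real (Suc k) * mu * y)) \<le> 2 * mu\<^sup>2 / (rate * r)\<^sup>2 * inverse (real (Suc k) ^ 2) * 1"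
          unfolding real_norm_def abs_mult by (intro mult_mono coef_bound r abs_cos_le_one order_refl) auto
        then show "norm (coef (Suc k) x r * cos (real (Suc k) * mu * y)) \<le> 2 * mu\<^sup>2 / (rate * r)\<^sup>2 * inverse (real (Suc k) ^ 2)" by simp
      qed
    qed (intro summable_mult summable_inverse_Suc_square)
    then show ?thesis unfolding f'_def by (rule suminf_mult)
  qed
  ultimately show ?thesis unfolding heat_green_y_def kap_def
    by (simp add: DERIV_imp_deriv)
qed

section \<open>Orthogonality and the integral bound for the differentiated kernel\<close>

lemma integral_cos_multiple:
  assumes "n > 0"
  shows "has_bochner_integral lborel (\<lambda>y. cos (real n * mu * y) * indicator {0..L} y) 0"
proof -
  have "has_bochner_integral lborel (\<lambda>y. cos (real n * mu * y) * indicator {0..L} y)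
     (sin (real n * mu * L) / (real n * mu) - sin (real n * mu * 0) / (real n * mu))"
    by (rule has_bochner_integral_FTC_Icc_real) (use L mu_pos assms in \<open>auto intro!: derivative_eq_intros continuous_intros\<close>)
  moreover have "sin (real n * mu * L) = 0" using L by (simp add: mu_def)
  ultimately show ?thesis by simp
qed

text \<open>The shift \<open>m\<close> covers two systems at once: \<open>m = 1\<close> gives the
  half-integer frequencies of the telescoped series, \<open>m = 2\<close> the ordinary sines of the
  Green's function. In both cases sums and differences of frequencies are integer multiples of
  \<open>mu\<close>, whose cosines integrate to 0 over \<open>[0,L]\<close> unless the multiple is
  0.\<close>

lemma sin_orthogonal:
  fixes m :: nat assumes m: "m > 0"
  defines "p \<equiv> \<lambda>k::nat. (real k + real m / 2) * mu"
  shows "has_bochner_integral lborel (\<lambda>y. sin (p j * y) * sin (p k * y) * indicator {0..L} y) (if j = k then L / 2 else 0)"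
proof -
  define d :: nat where "d = (if j \<le> k then k - j else j - k)"
  have c1: "cos (p j * y - p k * y) = cos (real d * mu * y)" for y
  proof (cases "j \<le> k")
    case True
    then have "p j * y - p k * y = - (real d * mu * y)" by (simp add: p_def d_def algebra_simps of_nat_diff)
    then show ?thesis by simp
  next
    case False
    then have "p j * y - p k * y = real d * mu * y" by (simp add: p_def d_def algebra_simps of_nat_diff)
    then show ?thesis by simp
  qed
  have c2: "cos (p j * y + p k * y) = cos (real (j + k + m) * mu * y)" for y
  proof -
    have "p j * y + p k * y = real (j + k + m) * mu * y" by (simp add: p_def algebra_simps)
    then show ?thesis by simp
  qed
  have "has_bochner_integral lborel (\<lambda>y. cos (real d * mu * y) * indicator {0..L} y) (if j = k then L else 0)"
  proof (cases "j = k")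
    case True
    have "has_bochner_integral lborel (indicator {0..L} :: real \<Rightarrow> real) L"
      using L has_bochner_integral_real_indicator[of "{0..L}" lborel] by simp
    then show ?thesis using True by (simp add: d_def)
  next
    case False
    then have "d > 0" by (auto simp: d_def)
    then show ?thesis using integral_cos_multiple[of d] False by simp
  qed
  from has_bochner_integral_diff[OF this integral_cos_multiple[of "j + k + m"]]
  have "has_bochner_integral lborel (\<lambda>y. (cos (real d * mu * y) * indicator {0..L} y - cos (real (j + k + m) * mu * y) * indicator {0..L} y) / 2)
     ((if j = k then L else 0) / 2)" using m by (intro has_bochner_integral_divide_zero) auto
  moreover have "sin (p j * y) * sin (p k * y) * indicator {0..L} y
     = (cos (real d * mu * y) * indicator {0..L} y - cos (real (j + k + m) * mu * y) * indicator {0..L} y) / 2" for y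
    unfolding sin_times_sin c1 c2 by (simp add: algebra_simps diff_divide_distrib)
  moreover have "(if j = k then L else 0) / 2 = (if j = k then L / 2 else 0)" by simp
  ultimately show ?thesis by (simp only:)
qed

lemma sin_parseval:
  fixes m :: nat and a :: "nat \<Rightarrow> real" assumes m: "m > 0"
  shows "(\<integral>\<^sup>+y. ennreal ((\<Sum>k<N. a k * sin ((real k + real m / 2) * mu * y))\<^sup>2) * indicator {0..L} y \<partial>lborel)
    = ennreal (L / 2 * (\<Sum>k<N. (a k)\<^sup>2))"
proof -
  define s where "s = (\<lambda>k y. sin ((real k + real m / 2) * mu * y))"
  have b: "has_bochner_integral lborel (\<lambda>y. \<Sum>j<N. \<Sum>k<N. (a j * a k) * (s j y * s k y * indicator {0..L} y))
     (\<Sum>j<N. \<Sum>k<N. (a j * a k) * (if j = k then L / 2 else 0))"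
    unfolding s_def by (intro has_bochner_integral_sum has_bochner_integral_mult_right sin_orthogonal m)
  have e: "(\<Sum>k<N. a k * s k y)\<^sup>2 * indicator {0..L} y = (\<Sum>j<N. \<Sum>k<N. (a j * a k) * (s j y * s k y * indicator {0..L} y))" for y
  proof -
    have "(\<Sum>j<N. \<Sum>k<N. (a j * a k) * (s j y * s k y * indicator {0..L} y))
        = (\<Sum>j<N. \<Sum>k<N. (a j * s j y) * (a k * s k y) * indicator {0..L} y)"
      by (intro sum.cong refl) (simp only: mult_ac)
    then show ?thesis by (simp only: power2_eq_square sum_product) (simp only: sum_distrib_right)
  qed
  have v: "(\<Sum>j<N. \<Sum>k<N. (a j * a k) * (if j = k then L / 2 else 0)) = L / 2 * (\<Sum>k<N. (a k)\<^sup>2)"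
    by (simp add: if_distrib sum.delta cong: if_cong) (simp add: sum_distrib_left power2_eq_square mult_ac sum_divide_distrib)
  have "has_bochner_integral lborel (\<lambda>y. (\<Sum>k<N. a k * s k y)\<^sup>2 * indicator {0..L} y) (L / 2 * (\<Sum>k<N. (a k)\<^sup>2))"
    using b unfolding e v .
  then have i: "integrable lborel (\<lambda>y. (\<Sum>k<N. a k * s k y)\<^sup>2 * indicator {0..L} y)"
    and I: "(\<integral>y. (\<Sum>k<N. a k * s k y)\<^sup>2 * indicator {0..L} y \<partial>lborel) = L / 2 * (\<Sum>k<N. (a k)\<^sup>2)"
    by (simp_all only: has_bochner_integral_iff)
  have "(\<integral>\<^sup>+y. ennreal ((\<Sum>k<N. a k * s k y)\<^sup>2 * indicator {0..L} y) \<partial>lborel) = ennreal (L / 2 * (\<Sum>k<N. (a k)\<^sup>2))"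
    unfolding I[symmetric] by (rule nn_integral_eq_integral[OF i]) simp
  moreover have "ennreal ((\<Sum>k<N. a k * s k y)\<^sup>2 * indicator {0..L} y) = ennreal ((\<Sum>k<N. a k * s k y)\<^sup>2) * indicator {0..L} y" for y
    by (simp add: indicator_def)
  ultimately show ?thesis by (simp only: s_def)
qed

lemma decay_diff: "decay j r - decay (Suc j) r \<le> decay j r * (rate * (2 * real j + 1) * r)"
proof -
  have "decay (Suc j) r = decay j r * exp (- (rate * (2 * real j + 1) * r))"
    by (simp add: decay_def exp_add[symmetric] power2_eq_square algebra_simps)
  moreover have "1 - exp (- w) \<le> w" for w :: real using exp_ge_add_one_self[of "- w"] by linarith
  ultimately show ?thesis using decay_pos[of j r]
    by (simp add: mult_left_mono flip: right_diff_distrib[where a="decay j r" and b=1, simplified])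
qed

text \<open>A discrete product rule. The coefficients themselves grow like \<open>j^2\<close> times
  the decay; the difference of neighbours grows only like \<open>j\<close>. The factor
  \<open>j^2 * r\<close> produced by differencing the exponential is absorbed by giving up half of
  its exponent, as in \<open>mult_exp_minus_le\<close>.\<close>

lemma coef_diff_bound:
  assumes r: "r > 0"
  shows "\<bar>coef j x r - coef (Suc j) x r\<bar> \<le> 5 * mu\<^sup>2 * (real j + 1) * exp (- rate * (real j)\<^sup>2 * r / 2)"
proof -
  define E where "E = exp (- rate * (real j)\<^sup>2 * r / 2)"
  have rp: "0 \<le> rate * (real j)\<^sup>2 * r" using rate_pos r by simp
  have dE: "decay j r \<le> E" unfolding decay_def E_def using rp by (simp add: mult.commute mult.left_commute)
  have dS: "decay (Suc j) r \<le> decay j r" unfolding decay_def using rate_pos r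
    by (simp add: mult_right_mono mult_left_mono power_mono)
  have z: "rate * (real j)\<^sup>2 * r * decay j r \<le> E"
    using mult_exp_minus_le[OF rp] unfolding decay_def E_def by simp
  \<comment> \<open>The first summand contains the increment of \<open>quot\<close>; the second
    contains the increment of \<open>j * decay j r\<close>, written so that only the nonnegative
    drop of the decay occurs.\<close>
  have "coef (Suc j) x r - coef j x r = mu * ((real (Suc j) * decay (Suc j) r) * (quot (Suc j) x - quot j x)
     + quot j x * (decay (Suc j) r - real j * (decay j r - decay (Suc j) r)))"
    by (simp add: coef_def algebra_simps)
  then have "\<bar>coef j x r - coef (Suc j) x r\<bar> = mu * \<bar>(real (Suc j) * decay (Suc j) r) * (quot (Suc j) x - quot j x)
     + quot j x * (decay (Suc j) r - real j * (decay j r - decay (Suc j) r))\<bar>"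
    using mu_pos by (simp add: abs_mult abs_minus_commute[of "coef j x r"])
  also have "\<dots> \<le> mu * (real (Suc j) * E * mu + (real j * mu) * (4 * E))"
  proof (intro mult_left_mono)
    have "\<bar>decay (Suc j) r - real j * (decay j r - decay (Suc j) r)\<bar> \<le> decay (Suc j) r + real j * (decay j r - decay (Suc j) r)"
      using decay_pos[of "Suc j" r] dS by (intro order_trans[OF abs_triangle_ineq4]) (simp add: abs_mult)
    also have "\<dots> \<le> E + 3 * E"
    proof (intro add_mono)
      have "real j * (decay j r - decay (Suc j) r) \<le> real j * (decay j r * (rate * (2 * real j + 1) * r))"
        by (intro mult_left_mono decay_diff) simp
      also have "\<dots> = (real j * (2 * real j + 1)) * (rate * r * decay j r)" by (simp add: mult_ac)
      also have "\<dots> \<le> (3 * (real j)\<^sup>2) * (rate * r * decay j r)"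
      proof (intro mult_right_mono)
        show "real j * (2 * real j + 1) \<le> 3 * (real j)\<^sup>2"
          by (cases j) (auto simp: power2_eq_square algebra_simps)
      qed (use rate_pos r decay_pos[of j r] in simp)
      also have "\<dots> = 3 * (rate * (real j)\<^sup>2 * r * decay j r)" by (simp add: mult_ac)
      also have "\<dots> \<le> 3 * E" using z by simp
      finally show "real j * (decay j r - decay (Suc j) r) \<le> 3 * E" .
    qed (use dS dE in linarith)
    finally have b: "\<bar>decay (Suc j) r - real j * (decay j r - decay (Suc j) r)\<bar> \<le> 4 * E" by simp
    have "\<bar>(real (Suc j) * decay (Suc j) r) * (quot (Suc j) x - quot j x)\<bar> \<le> real (Suc j) * E * mu"
      unfolding abs_mult using decay_pos[of "Suc j" r] dS dE
      by (intro mult_mono quot_diff_bound) auto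
    moreover have "\<bar>quot j x * (decay (Suc j) r - real j * (decay j r - decay (Suc j) r))\<bar> \<le> (real j * mu) * (4 * E)"
      unfolding abs_mult using mu_pos by (intro mult_mono quot_bound b) auto
    ultimately show "\<bar>(real (Suc j) * decay (Suc j) r) * (quot (Suc j) x - quot j x)
     + quot j x * (decay (Suc j) r - real j * (decay j r - decay (Suc j) r))\<bar> \<le> real (Suc j) * E * mu + (real j * mu) * (4 * E)"
      by (meson abs_triangle_ineq add_mono order_trans)
  qed (use mu_pos in simp)
  also have "\<dots> = mu\<^sup>2 * (5 * real j + 1) * E" by (simp add: power2_eq_square algebra_simps)
  also have "\<dots> \<le> mu\<^sup>2 * (5 * (real j + 1)) * E" by (intro mult_right_mono mult_left_mono) (auto simp: E_def)
  finally show ?thesis by (simp only: E_def mult_ac)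
qed

text \<open>Inserting \<open>exp (- z) <= 2 * z powr (-7/4)\<close> at
  \<open>z = rate * j^2 * r\<close> turns \<open>(j+1)^2 * decay j r\<close> into
  \<open>r powr (-7/4)\<close> times the summable \<open>j powr (-3/2)\<close>.\<close>

lemma coef_diff_square_sum:
  obtains K where "K > 0" "\<And>r N x. 0 < r \<Longrightarrow> r \<le> T \<Longrightarrow> (\<Sum>j<N. (coef j x r - coef (Suc j) x r)\<^sup>2) \<le> K * r powr (-(7/4))"
proof -
  have sZ: "summable (\<lambda>j. real j powr (-(3/2)))" by (subst summable_real_powr_iff) simp
  define Z where "Z = (\<Sum>j. real j powr (-(3/2)))"
  \<comment> \<open>The first part pays for the frequency \<open>j = 0\<close>, where there is no
    decay: that constant is absorbed into the power of \<open>r\<close> because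
    \<open>r <= T\<close>. In the second part, \<open>200 = 25 * 4 * 2\<close> collects the
    coefficient bound, \<open>(j+1)^2 <= (2j)^2\<close> and the factor 2 of the exponential
    bound.\<close>
  define K where "K = 25 * mu ^ 4 * (1 + \<bar>T\<bar> powr (7/4)) + 200 * mu ^ 4 * rate powr (-(7/4)) * Z"
  have Z0: "Z \<ge> 0" unfolding Z_def by (rule suminf_nonneg[OF sZ]) simp
  have K: "K > 0" unfolding K_def using mu_pos rate_pos Z0
    by (intro add_pos_nonneg mult_pos_pos mult_nonneg_nonneg) (auto simp: add_pos_nonneg)
  have "(\<Sum>j<N. (coef j x r - coef (Suc j) x r)\<^sup>2) \<le> K * r powr (-(7/4))" if r: "0 < r" "r \<le> T" for r N x
  proof -
    define B where "B = 200 * mu ^ 4 * rate powr (-(7/4)) * r powr (-(7/4))"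
    have sq: "(coef j x r - coef (Suc j) x r)\<^sup>2 \<le> 25 * mu ^ 4 * (real j + 1)\<^sup>2 * decay j r" for j
    proof -
      have "(coef j x r - coef (Suc j) x r)\<^sup>2 \<le> (5 * mu\<^sup>2 * (real j + 1) * exp (- rate * (real j)\<^sup>2 * r / 2))\<^sup>2"
        using coef_diff_bound[OF r(1), of j x] by (metis abs_ge_zero power2_abs power_mono)
      also have "\<dots> = 25 * mu ^ 4 * (real j + 1)\<^sup>2 * decay j r"
        by (simp add: power_mult_distrib decay_def exp_double[symmetric] flip: power_mult)
      finally show ?thesis .
    qed
    have trm: "(coef j x r - coef (Suc j) x r)\<^sup>2 \<le> (if j = 0 then 25 * mu ^ 4 else 0) + B * real j powr (-(3/2))" for j
    proof (cases "j = 0")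
      case True
      then show ?thesis using sq[of 0] by (simp add: decay_def)
    next
      case False
      define z where "z = rate * (real j)\<^sup>2 * r"
      have z: "z > 0" using False rate_pos r by (simp add: z_def)
      have zp: "z powr (-(7/4)) = rate powr (-(7/4)) * r powr (-(7/4)) * real j powr (-(7/2))"
      proof -
        have "(real j)\<^sup>2 powr (-(7/4)) = real j powr (-(7/2))"
          using False powr_powr[of "real j" 2 "-(7/4)"] by simp
        then show ?thesis using False rate_pos r by (simp add: z_def powr_mult mult_ac)
      qed
      have jp: "(real j)\<^sup>2 * real j powr (-(7/2)) = real j powr (-(3/2))"
      proof -
        have "(real j)\<^sup>2 * real j powr (-(7/2)) = real j powr 2 * real j powr (-(7/2))" using False by simp
        then show ?thesis by (simp only: powr_add[symmetric]) simp
      qed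
      have "25 * mu ^ 4 * (real j + 1)\<^sup>2 * decay j r \<le> 25 * mu ^ 4 * (2 * real j)\<^sup>2 * (2 * z powr (-(7/4)))"
      proof (intro mult_mono order_refl)
        show "(real j + 1)\<^sup>2 \<le> (2 * real j)\<^sup>2" using False by (intro power_mono) auto
        show "decay j r \<le> 2 * z powr (-(7/4))" using exp_minus_le_powr[OF z] by (simp add: decay_def z_def)
      qed (use mu_pos in \<open>auto simp: decay_def\<close>)
      also have "\<dots> = B * ((real j)\<^sup>2 * real j powr (-(7/2)))"
        unfolding zp B_def by (simp add: power_mult_distrib mult_ac)
      also have "\<dots> = B * real j powr (-(3/2))" unfolding jp ..
      finally show ?thesis using sq[of j] False by simp
    qed
    have B0: "B \<ge> 0" unfolding B_def using mu_pos by simp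
    have "(\<Sum>j<N. (coef j x r - coef (Suc j) x r)\<^sup>2) \<le> (\<Sum>j<N. (if j = 0 then 25 * mu ^ 4 else 0) + B * real j powr (-(3/2)))"
      by (intro sum_mono trm)
    also have "\<dots> = (\<Sum>j<N. (if j = 0 then 25 * mu ^ 4 else 0)) + B * (\<Sum>j<N. real j powr (-(3/2)))"
      by (simp add: sum.distrib sum_distrib_left)
    also have "\<dots> \<le> 25 * mu ^ 4 + B * Z"
      unfolding Z_def by (intro add_mono mult_left_mono sum_le_suminf sZ B0) (auto simp: sum.delta)
    also have "25 * mu ^ 4 \<le> 25 * mu ^ 4 * (1 + \<bar>T\<bar> powr (7/4)) * r powr (-(7/4))"
    proof -
      have "r powr (7/4) \<le> \<bar>T\<bar> powr (7/4)" using r by (intro powr_mono2) auto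
      then have "1 \<le> (1 + \<bar>T\<bar> powr (7/4)) * r powr (-(7/4))" using r by (simp add: powr_minus field_simps)
      then have "25 * mu ^ 4 * 1 \<le> 25 * mu ^ 4 * ((1 + \<bar>T\<bar> powr (7/4)) * r powr (-(7/4)))"
        by (intro mult_left_mono) auto
      then show ?thesis by (simp add: mult_ac)
    qed
    finally show ?thesis by (simp add: K_def B_def algebra_simps)
  qed
  with K show thesis by (rule that)
qed

text \<open>Multiplication by \<open>2 sin (mu y / 2)\<close>, which is comparable to \<open>y\<close>, telescopes the cosine series
  into a series in the orthogonal system \<open>sin ((j + 1/2) mu y)\<close>.\<close>

lemma telescoped_partial_sum:
  "(\<Sum>j<N. (coef j x r - coef (Suc j) x r) * sin ((real j + 1 / 2) * mu * y))
   = 2 * sin (mu * y / 2) * (\<Sum>k<N. coef (Suc k) x r * cos (real (Suc k) * mu * y))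
     - coef N x r * sin ((real N + 1 / 2) * mu * y)"
proof (induction N)
  \<comment> \<open>The coefficient of frequency 0 vanishes, so telescoping leaves no boundary term
    at the lower end.\<close>
  case 0 then show ?case by (simp add: coef_def)
next
  case (Suc N)
  have "sin ((real (Suc N) + 1 / 2) * mu * y) - sin ((real N + 1 / 2) * mu * y) = 2 * sin (mu * y / 2) * cos (real (Suc N) * mu * y)"
    unfolding sin_diff_sin by (simp add: algebra_simps add_divide_distrib diff_divide_distrib)
  then have "sin ((real (Suc N) + 1 / 2) * mu * y) = sin ((real N + 1 / 2) * mu * y) + 2 * sin (mu * y / 2) * cos (real (Suc N) * mu * y)"
    by linarith
  then show ?case by (simp only: sum.lessThan_Suc Suc) (simp only: algebra_simps)
qed

text \<open>For fixed \<open>r > 0\<close> the coefficients are summable, hence the boundary term at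
  the upper end tends to 0. The factor \<open>L\<close> compensates the normalisation
  \<open>2 / L\<close> of \<open>kap\<close>.\<close>

lemma kap_series:
  assumes r: "r > 0"
  shows "(\<lambda>N. \<Sum>j<N. (coef j x r - coef (Suc j) x r) * sin ((real j + 1 / 2) * mu * y)) \<longlonglongrightarrow> L * sin (mu * y / 2) * kap x y r"
proof -
  have lim: "(\<lambda>N. \<Sum>k<N. coef (Suc k) x r * cos (real (Suc k) * mu * y)) \<longlonglongrightarrow> (\<Sum>k. coef (Suc k) x r * cos (real (Suc k) * mu * y))"
    using tendsto_uniform_limitI[OF kap_uniform[OF r], of "(x, y, r)"] by simp
  have sb: "summable (\<lambda>k. 2 * mu\<^sup>2 / (rate * r)\<^sup>2 * inverse (real (Suc k) ^ 2))"
    by (intro summable_mult summable_inverse_Suc_square)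
  have "summable (\<lambda>k. coef (Suc k) x r)"
    by (rule summable_comparison_test[OF exI[of _ 0] sb]) (use coef_bound[OF r order_refl] in simp)
  then have "(\<lambda>k. coef (Suc k) x r) \<longlonglongrightarrow> 0" by (rule summable_LIMSEQ_zero)
  then have c0: "(\<lambda>N. coef N x r) \<longlonglongrightarrow> 0" by (rule LIMSEQ_imp_Suc)
  have "(\<lambda>N. coef N x r * sin ((real N + 1 / 2) * mu * y)) \<longlonglongrightarrow> 0"
    by (rule Lim_null_comparison[OF _ tendsto_rabs_zero[OF c0]])
      (auto intro!: always_eventually simp: abs_mult mult_left_le)
  then have "(\<lambda>N. 2 * sin (mu * y / 2) * (\<Sum>k<N. coef (Suc k) x r * cos (real (Suc k) * mu * y)) - coef N x r * sin ((real N + 1 / 2) * mu * y))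
    \<longlonglongrightarrow> 2 * sin (mu * y / 2) * (\<Sum>k. coef (Suc k) x r * cos (real (Suc k) * mu * y)) - 0"
    by (intro tendsto_diff tendsto_mult tendsto_const lim)
  moreover have "L * sin (mu * y / 2) * kap x y r = 2 * sin (mu * y / 2) * (\<Sum>k. coef (Suc k) x r * cos (real (Suc k) * mu * y))"
    using L by (simp add: kap_def)
  ultimately show ?thesis unfolding telescoped_partial_sum by (simp only: diff_zero)
qed

end

lemma ennreal_plus_mult:
  "0 \<le> a \<Longrightarrow> 0 \<le> b \<Longrightarrow> 0 \<le> c \<Longrightarrow> ennreal (a + b * c) = ennreal a + ennreal b * ennreal c"
  by (simp add: ennreal_mult)

context dirichlet_heat
begin

lemma kap_measurable[measurable (raw)]:
  assumes [measurable]: "f \<in> borel_measurable M" "g \<in> borel_measurable M" "h \<in> borel_measurable M"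
  shows "(\<lambda>w. kap (f w) (g w) (h w)) \<in> borel_measurable M"
proof -
  have [measurable]: "quot j \<in> borel_measurable borel" for j
    by (rule borel_measurable_continuous_onI[OF quot_continuous])
  show ?thesis unfolding kap_def coef_def decay_def by measurable
qed

lemma heat_green_measurable[measurable (raw)]:
  assumes [measurable]: "g \<in> borel_measurable M" "h \<in> borel_measurable M"
  shows "(\<lambda>w. heat_green \<alpha> L x (g w) (h w)) \<in> borel_measurable M"
  unfolding heat_green_def by measurable

text \<open>On \<open>[0,L]\<close> the argument \<open>mu * y / 2\<close> stays within a quarter
  turn, so its sine is bounded below by a multiple of \<open>y\<close>.\<close>

lemma kap_abs_le:
  assumes y: "0 \<le> y" "y \<le> L"
  shows "\<bar>y * kap x y r\<bar> \<le> 4 / (mu * L) * \<bar>L * sin (mu * y / 2) * kap x y r\<bar>"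
proof -
  have "mu * y / 2 \<le> mu * L / 2" using y mu_pos by simp
  also have "\<dots> = pi / 2" using L by (simp add: mu_def)
  finally have "mu * y / 2 / 2 \<le> sin (mu * y / 2)" using y mu_pos by (intro half_le_sin) auto
  then have "y \<le> 4 / mu * sin (mu * y / 2)" using mu_pos by (simp add: field_simps)
  then have "\<bar>y\<bar> \<le> 4 / mu * \<bar>sin (mu * y / 2)\<bar>" using y mu_pos
    by (smt (verit) mult_left_mono divide_nonneg_nonneg)
  then have "\<bar>y\<bar> * \<bar>kap x y r\<bar> \<le> 4 / mu * \<bar>sin (mu * y / 2)\<bar> * \<bar>kap x y r\<bar>" by (rule mult_right_mono) simp
  then show ?thesis using L by (simp add: abs_mult)
qed

text \<open>Parseval holds for the partial sums, and Fatou transfers the uniform bound to their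
  pointwise limit; convergence in mean square is never established.\<close>

lemma kap_L2:
  assumes r: "r > 0" and B: "\<And>N. (\<Sum>j<N. (coef j x r - coef (Suc j) x r)\<^sup>2) \<le> B"
  shows "(\<integral>\<^sup>+y. ennreal ((L * sin (mu * y / 2) * kap x y r)\<^sup>2) * indicator {0..L} y \<partial>lborel) \<le> ennreal (L / 2 * B)"
proof -
  define F where "F = (\<lambda>N y. \<Sum>j<N. (coef j x r - coef (Suc j) x r) * sin ((real j + 1 / 2) * mu * y))"
  have Fm[measurable]: "F N \<in> borel_measurable borel" for N unfolding F_def by measurable
  have "(\<integral>\<^sup>+y. ennreal ((L * sin (mu * y / 2) * kap x y r)\<^sup>2) * indicator {0..L} y \<partial>lborel)
     = (\<integral>\<^sup>+y. liminf (\<lambda>N. ennreal ((F N y)\<^sup>2) * indicator {0..L} y) \<partial>lborel)"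
  proof (rule nn_integral_cong)
    fix y
    have "(\<lambda>N. ennreal ((F N y)\<^sup>2)) \<longlonglongrightarrow> ennreal ((L * sin (mu * y / 2) * kap x y r)\<^sup>2)"
      unfolding F_def by (intro tendsto_ennrealI tendsto_power kap_series r)
    then have "(\<lambda>N. ennreal ((F N y)\<^sup>2) * indicator {0..L} y) \<longlonglongrightarrow> ennreal ((L * sin (mu * y / 2) * kap x y r)\<^sup>2) * indicator {0..L} y"
      by (cases "y \<in> {0..L}") auto
    then show "ennreal ((L * sin (mu * y / 2) * kap x y r)\<^sup>2) * indicator {0..L} y = liminf (\<lambda>N. ennreal ((F N y)\<^sup>2) * indicator {0..L} y)"
      by (intro lim_imp_Liminf[symmetric]) auto
  qed
  also have "\<dots> \<le> liminf (\<lambda>N. \<integral>\<^sup>+y. ennreal ((F N y)\<^sup>2) * indicator {0..L} y \<partial>lborel)"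
    by (rule nn_integral_liminf) measurable
  also have "\<dots> \<le> liminf (\<lambda>N::nat. ennreal (L / 2 * B))"
  proof (rule Liminf_mono, rule always_eventually, rule allI)
    fix N
    have "(\<integral>\<^sup>+y. ennreal ((F N y)\<^sup>2) * indicator {0..L} y \<partial>lborel) = ennreal (L / 2 * (\<Sum>j<N. (coef j x r - coef (Suc j) x r)\<^sup>2))"
      unfolding F_def using sin_parseval[where m=1 and N=N and a="\<lambda>j. coef j x r - coef (Suc j) x r"] by simp
    also have "\<dots> \<le> ennreal (L / 2 * B)" using L B by (intro ennreal_leI mult_left_mono) auto
    finally show "(\<integral>\<^sup>+y. ennreal ((F N y)\<^sup>2) * indicator {0..L} y \<partial>lborel) \<le> ennreal (L / 2 * B)" .
  qed
  also have "\<dots> = ennreal (L / 2 * B)" by (simp add: Liminf_const)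
  finally show ?thesis .
qed

text \<open>Cauchy-Schwarz in the form of Young's inequality: the parameter \<open>q\<close> is the
  size of the mean-square bound, which balances the two terms. They contribute
  \<open>a * L * q / 2\<close> and \<open>a * L * q / 4\<close> with \<open>a * L = 4 / mu\<close>,
  whence the constant 3 in \<open>K\<close>. The power \<open>7/8 < 1\<close> keeps the bound
  integrable in time.\<close>

lemma kap_L1:
  obtains K where "K > 0" "\<And>r x. 0 < r \<Longrightarrow> r \<le> T \<Longrightarrow>
    (\<integral>\<^sup>+y. ennreal \<bar>y * kap x y r\<bar> * indicator {0..L} y \<partial>lborel) \<le> ennreal (K * r powr (-(7/8)))"
proof -
  obtain K0 where K0: "K0 > 0" "\<And>r N x. 0 < r \<Longrightarrow> r \<le> T \<Longrightarrow> (\<Sum>j<N. (coef j x r - coef (Suc j) x r)\<^sup>2) \<le> K0 * r powr (-(7/4))"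
    using coef_diff_square_sum[of T] by blast
  define K where "K = 3 * sqrt K0 / mu"
  have "(\<integral>\<^sup>+y. ennreal \<bar>y * kap x y r\<bar> * indicator {0..L} y \<partial>lborel) \<le> ennreal (K * r powr (-(7/8)))"
    if r: "0 < r" "r \<le> T" for r x
  proof -
    define q where "q = sqrt K0 * r powr (-(7/8))"
    have q: "q > 0" using K0 r by (simp add: q_def)
    have q2: "q\<^sup>2 = K0 * r powr (-(7/4))" using K0 r
      by (simp add: q_def power_mult_distrib powr_power)
    define H where "H = (\<lambda>y. L * sin (mu * y / 2) * kap x y r)"
    have [measurable]: "H \<in> borel_measurable borel" unfolding H_def by measurable
    define a where "a = 4 / (mu * L)"
    have a: "a > 0" using mu_pos L by (simp add: a_def)
    have "(\<integral>\<^sup>+y. ennreal \<bar>y * kap x y r\<bar> * indicator {0..L} y \<partial>lborel)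
       \<le> (\<integral>\<^sup>+y. ennreal (a * q / 2) * indicator {0..L} y + ennreal (a / (2 * q)) * (ennreal ((H y)\<^sup>2) * indicator {0..L} y) \<partial>lborel)"
    proof (rule nn_integral_mono)
      fix y
      show "ennreal \<bar>y * kap x y r\<bar> * indicator {0..L} y \<le> ennreal (a * q / 2) * indicator {0..L} y + ennreal (a / (2 * q)) * (ennreal ((H y)\<^sup>2) * indicator {0..L} y)"
      proof (cases "y \<in> {0..L}")
        case True
        have "0 \<le> (q - \<bar>H y\<bar>)\<^sup>2" by simp
        then have "2 * q * \<bar>H y\<bar> \<le> q\<^sup>2 + (H y)\<^sup>2" by (simp add: power2_diff)
        then have "\<bar>H y\<bar> \<le> q / 2 + (H y)\<^sup>2 / (2 * q)" using q by (simp add: field_simps power2_eq_square)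
        then have "a * \<bar>H y\<bar> \<le> a * (q / 2 + (H y)\<^sup>2 / (2 * q))" using a by (intro mult_left_mono) auto
        moreover have "\<bar>y * kap x y r\<bar> \<le> a * \<bar>H y\<bar>" unfolding a_def H_def using kap_abs_le True by simp
        ultimately have "\<bar>y * kap x y r\<bar> \<le> a * q / 2 + a / (2 * q) * (H y)\<^sup>2" by (simp add: distrib_left)
        then have "ennreal \<bar>y * kap x y r\<bar> \<le> ennreal (a * q / 2 + a / (2 * q) * (H y)\<^sup>2)" by (rule ennreal_leI)
        also have "\<dots> = ennreal (a * q / 2) + ennreal (a / (2 * q)) * ennreal ((H y)\<^sup>2)"
          by (rule ennreal_plus_mult) (use a q in simp_all)
        finally show ?thesis using True by simp
      qed simp
    qed
    also have "\<dots> = ennreal (a * q / 2) * ennreal L + ennreal (a / (2 * q)) * (\<integral>\<^sup>+y. ennreal ((H y)\<^sup>2) * indicator {0..L} y \<partial>lborel)"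
      using L by (subst nn_integral_add) (simp_all add: nn_integral_cmult nn_integral_cmult_indicator)
    also have "\<dots> \<le> ennreal (a * q / 2) * ennreal L + ennreal (a / (2 * q)) * ennreal (L / 2 * q\<^sup>2)"
      unfolding H_def using K0(2)[OF r] by (intro add_left_mono mult_left_mono kap_L2 r(1)) (auto simp: q2)
    also have "\<dots> = ennreal (a * q / 2 * L + a / (2 * q) * (L / 2 * q\<^sup>2))"
      using a q L by (subst ennreal_plus_mult) (simp_all add: ennreal_mult[symmetric])
    also have "a * q / 2 * L + a / (2 * q) * (L / 2 * q\<^sup>2) = K * r powr (-(7/8))"
    proof -
      have e1: "a * q / 2 * L = (a * L) * q / 2" by simp
      have e2: "a / (2 * q) * (L / 2 * q\<^sup>2) = (a * L) * q / 4" using q by (simp add: power2_eq_square)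
      have e3: "a * L = 4 / mu" using L by (simp add: a_def)
      have e4: "K * r powr (-(7/8)) = 3 * q / mu" by (simp add: K_def q_def)
      show ?thesis unfolding e1 e2 e3 e4 using mu_pos by (simp add: field_simps)
    qed
    finally show ?thesis .
  qed
  moreover have "K > 0" using K0 mu_pos by (simp add: K_def)
  ultimately show thesis using that by blast
qed

text \<open>Parseval for the ordinary sines, again with Fatou. The sines in \<open>x\<close> are
  bounded by 1, and squaring the decay doubles its time argument.\<close>

lemma heat_green_slice_L2:
  assumes r: "r > 0"
  shows "(\<integral>\<^sup>+y. ennreal ((heat_green \<alpha> L x y r)\<^sup>2) * indicator {0..L} y \<partial>lborel) \<le> (\<Sum>k. ennreal (2 / L * decay (Suc k) (2 * r)))"
proof -
  define b where "b = (\<lambda>k. sin (real (Suc k) * mu * x) * decay (Suc k) r)"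
  define F where "F = (\<lambda>N y. \<Sum>k<N. (2 / L * b k) * sin ((real k + real 2 / 2) * mu * y))"
  have Fm[measurable]: "F N \<in> borel_measurable borel" for N unfolding F_def by measurable
  have lim: "(\<lambda>N. F N y) \<longlonglongrightarrow> heat_green \<alpha> L x y r" for y
  proof -
    have sb: "summable (\<lambda>k. 2 / (rate * r)\<^sup>2 * inverse (real (Suc k) ^ 2))"
      by (intro summable_mult summable_inverse_Suc_square)
    have s: "summable (\<lambda>k. sin (real (Suc k) * mu * y) * sin (real (Suc k) * mu * x) * decay (Suc k) r)"
    proof (rule summable_comparison_test[OF exI[of _ 0] sb], intro allI impI)
      fix k
      have "norm (sin (real (Suc k) * mu * y) * sin (real (Suc k) * mu * x) * decay (Suc k) r) \<le> 1 * 1 * decay (Suc k) r"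
        unfolding norm_mult using decay_pos[of "Suc k" r]
        by (intro mult_mono) (auto intro: less_imp_le)
      also have "\<dots> \<le> 2 / (rate * r)\<^sup>2 * inverse (real (Suc k) ^ 4)" using decay_le[OF r order_refl, of k] by simp
      also have "\<dots> \<le> 2 / (rate * r)\<^sup>2 * inverse (real (Suc k) ^ 2)"
        by (intro mult_left_mono le_imp_inverse_le power_increasing) auto
      finally show "norm (sin (real (Suc k) * mu * y) * sin (real (Suc k) * mu * x) * decay (Suc k) r) \<le> 2 / (rate * r)\<^sup>2 * inverse (real (Suc k) ^ 2)" .
    qed
    have "(\<lambda>N. 2 / L * (\<Sum>k<N. sin (real (Suc k) * mu * y) * sin (real (Suc k) * mu * x) * decay (Suc k) r))
       \<longlonglongrightarrow> 2 / L * (\<Sum>k. sin (real (Suc k) * mu * y) * sin (real (Suc k) * mu * x) * decay (Suc k) r)"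
      by (intro tendsto_mult tendsto_const summable_LIMSEQ s)
    moreover have "F N y = 2 / L * (\<Sum>k<N. sin (real (Suc k) * mu * y) * sin (real (Suc k) * mu * x) * decay (Suc k) r)" for N
      unfolding F_def sum_distrib_left by (intro sum.cong refl) (simp add: b_def add.commute)
    moreover have "heat_green \<alpha> L x y r = 2 / L * (\<Sum>k. sin (real (Suc k) * mu * y) * sin (real (Suc k) * mu * x) * decay (Suc k) r)"
      by (simp add: heat_green_def mu_def decay_def rate_def mult.assoc)
    ultimately show ?thesis by (simp only:)
  qed
  have "(\<integral>\<^sup>+y. ennreal ((heat_green \<alpha> L x y r)\<^sup>2) * indicator {0..L} y \<partial>lborel)
     = (\<integral>\<^sup>+y. liminf (\<lambda>N. ennreal ((F N y)\<^sup>2) * indicator {0..L} y) \<partial>lborel)"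
  proof (rule nn_integral_cong)
    fix y
    have "(\<lambda>N. ennreal ((F N y)\<^sup>2)) \<longlonglongrightarrow> ennreal ((heat_green \<alpha> L x y r)\<^sup>2)"
      by (intro tendsto_ennrealI tendsto_power lim)
    then have "(\<lambda>N. ennreal ((F N y)\<^sup>2) * indicator {0..L} y) \<longlonglongrightarrow> ennreal ((heat_green \<alpha> L x y r)\<^sup>2) * indicator {0..L} y"
      by (cases "y \<in> {0..L}") auto
    then show "ennreal ((heat_green \<alpha> L x y r)\<^sup>2) * indicator {0..L} y = liminf (\<lambda>N. ennreal ((F N y)\<^sup>2) * indicator {0..L} y)"
      by (intro lim_imp_Liminf[symmetric]) auto
  qed
  also have "\<dots> \<le> liminf (\<lambda>N. \<integral>\<^sup>+y. ennreal ((F N y)\<^sup>2) * indicator {0..L} y \<partial>lborel)"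
    by (rule nn_integral_liminf) measurable
  also have "\<dots> \<le> liminf (\<lambda>N::nat. \<Sum>k. ennreal (2 / L * decay (Suc k) (2 * r)))"
  proof (rule Liminf_mono, rule always_eventually, rule allI)
    fix N
    have "(\<integral>\<^sup>+y. ennreal ((F N y)\<^sup>2) * indicator {0..L} y \<partial>lborel) = ennreal (L / 2 * (\<Sum>k<N. (2 / L * b k)\<^sup>2))"
      unfolding F_def by (rule sin_parseval) simp
    also have "L / 2 * (\<Sum>k<N. (2 / L * b k)\<^sup>2) = (\<Sum>k<N. 2 / L * (b k)\<^sup>2)"
      unfolding sum_distrib_left using L by (intro sum.cong refl) (simp add: power2_eq_square)
    also have "ennreal (\<Sum>k<N. 2 / L * (b k)\<^sup>2) \<le> ennreal (\<Sum>k<N. 2 / L * decay (Suc k) (2 * r))"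
    proof (intro ennreal_leI sum_mono mult_left_mono)
      fix k
      have "(b k)\<^sup>2 \<le> 1 * (decay (Suc k) r)\<^sup>2"
        unfolding b_def power_mult_distrib by (intro mult_right_mono) (auto simp: abs_square_le_1)
      also have "\<dots> = decay (Suc k) (2 * r)"
        by (simp add: decay_def power2_eq_square exp_add[symmetric])
      finally show "(b k)\<^sup>2 \<le> decay (Suc k) (2 * r)" .
    qed (use L in simp)
    also have "\<dots> = (\<Sum>k<N. ennreal (2 / L * decay (Suc k) (2 * r)))"
      using L decay_pos by (intro sum_ennreal[symmetric]) (auto intro: less_imp_le)
    also have "\<dots> \<le> (\<Sum>k. ennreal (2 / L * decay (Suc k) (2 * r)))"
      by (intro sum_le_suminf) auto
    finally show "(\<integral>\<^sup>+y. ennreal ((F N y)\<^sup>2) * indicator {0..L} y \<partial>lborel) \<le> (\<Sum>k. ennreal (2 / L * decay (Suc k) (2 * r)))" .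
  qed
  also have "\<dots> = (\<Sum>k. ennreal (2 / L * decay (Suc k) (2 * r)))" by (simp add: Liminf_const)
  finally show ?thesis .
qed

lemma decay_time_integral:
  assumes t: "t \<ge> 0"
  shows "(\<integral>\<^sup>+s. ennreal (2 / L * decay (Suc k) (2 * (t - s))) * indicator {0..t} s \<partial>lborel) \<le> ennreal (1 / (L * rate) * inverse (real (Suc k) ^ 2))"
proof -
  define a where "a = 2 * rate * (real (Suc k))\<^sup>2"
  have a: "a > 0" using rate_pos by (simp add: a_def)
  have d: "decay (Suc k) (2 * (t - s)) = exp (- a * (t - s))" for s by (simp add: decay_def a_def)
  have "(\<integral>\<^sup>+s. ennreal (2 / L * decay (Suc k) (2 * (t - s))) * indicator {0..t} s \<partial>lborel)
     = ennreal (2 / L * (exp (- a * (t - t)) / a) - 2 / L * (exp (- a * (t - 0)) / a))"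
    unfolding d by (rule nn_integral_FTC_Icc) (use a L t in \<open>auto intro!: derivative_eq_intros\<close>)
  also have "\<dots> \<le> ennreal (2 / L * (1 / a))" using L a by (intro ennreal_leI) simp
  also have "2 / L * (1 / a) = 1 / (L * rate) * inverse (real (Suc k) ^ 2)"
    using L rate_pos by (simp add: a_def field_simps)
  finally show ?thesis .
qed

text \<open>With this bound the stochastic integrand is square integrable in space and time: after
  Tonelli, the time integral of mode \<open>k\<close> is of order \<open>1 / k^2\<close>, which is
  summable.\<close>

lemma heat_green_L2:
  assumes t: "t \<ge> 0"
  shows "(\<integral>\<^sup>+z\<in>{0<..<L} \<times> {0..<t}. ennreal ((heat_green \<alpha> L x (fst z) (t - snd z))\<^sup>2) \<partial>lborel) < \<infinity>"
proof -
  let ?f = "\<lambda>z. ennreal ((heat_green \<alpha> L x (fst z) (t - snd z))\<^sup>2) * indicator ({0<..<L} \<times> {0..<t}) z"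
  have S[measurable]: "{0<..<L} \<times> {0..<t} \<in> sets (borel :: (real \<times> real) measure)" by (intro borel_Times) auto
  have [measurable]: "{0<..<L} \<times> {0..<t} \<in> sets (lborel \<Otimes>\<^sub>M lborel)" by (intro pair_measureI) auto
  have fm: "?f \<in> borel_measurable (lborel \<Otimes>\<^sub>M lborel)" by measurable
  have "(\<integral>\<^sup>+z. ?f z \<partial>lborel) = (\<integral>\<^sup>+s. \<integral>\<^sup>+y. ?f (y, s) \<partial>lborel \<partial>lborel)"
    using lborel_pair.nn_integral_snd[OF fm] by (simp add: lborel_prod)
  also have "\<dots> \<le> (\<integral>\<^sup>+s. (\<Sum>k. ennreal (2 / L * decay (Suc k) (2 * (t - s))) * indicator {0..t} s) \<partial>lborel)"
  proof (rule nn_integral_mono)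
    fix s
    show "(\<integral>\<^sup>+y. ?f (y, s) \<partial>lborel) \<le> (\<Sum>k. ennreal (2 / L * decay (Suc k) (2 * (t - s))) * indicator {0..t} s)"
    proof (cases "s \<in> {0..<t}")
      case True
      have "(\<integral>\<^sup>+y. ?f (y, s) \<partial>lborel) \<le> (\<integral>\<^sup>+y. ennreal ((heat_green \<alpha> L x y (t - s))\<^sup>2) * indicator {0..L} y \<partial>lborel)"
        by (intro nn_integral_mono) (auto simp: indicator_def)
      also have "\<dots> \<le> (\<Sum>k. ennreal (2 / L * decay (Suc k) (2 * (t - s))))"
        by (rule heat_green_slice_L2) (use True in simp)
      finally show ?thesis using True by simp
    qed simp
  qed
  also have "\<dots> = (\<Sum>k. \<integral>\<^sup>+s. ennreal (2 / L * decay (Suc k) (2 * (t - s))) * indicator {0..t} s \<partial>lborel)"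
    unfolding decay_def by (rule nn_integral_suminf) measurable
  also have "\<dots> \<le> (\<Sum>k. ennreal (1 / (L * rate) * inverse (real (Suc k) ^ 2)))"
    by (intro suminf_le decay_time_integral t) auto
  also have "\<dots> < top"
    by (intro less_top[THEN iffD1] ennreal_suminf_neq_top summable_mult summable_inverse_Suc_square)
      (use L rate_pos in simp)
  finally show ?thesis by simp
qed

end

section \<open>The drift operator and its fixed points\<close>

locale heat_horizon = dirichlet_heat +
  fixes T :: real
  assumes T: "T > 0"
begin

definition kap_const :: real where
  "kap_const = (SOME K. K > 0 \<and> (\<forall>r x. 0 < r \<longrightarrow> r \<le> T \<longrightarrow>
    (\<integral>\<^sup>+y. ennreal \<bar>y * kap x y r\<bar> * indicator {0..L} y \<partial>lborel) \<le> ennreal (K * r powr (-(7/8)))))"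

lemma kap_const: "kap_const > 0" "0 < r \<Longrightarrow> r \<le> T \<Longrightarrow>
    (\<integral>\<^sup>+y. ennreal \<bar>y * kap x y r\<bar> * indicator {0..L} y \<partial>lborel) \<le> ennreal (kap_const * r powr (-(7/8)))"
proof -
  have "\<exists>K. K > 0 \<and> (\<forall>r x. 0 < r \<longrightarrow> r \<le> T \<longrightarrow>
    (\<integral>\<^sup>+y. ennreal \<bar>y * kap x y r\<bar> * indicator {0..L} y \<partial>lborel) \<le> ennreal (K * r powr (-(7/8))))"
    by (rule kap_L1[of T]) blast
  from someI_ex[OF this, folded kap_const_def]
  show "kap_const > 0" "0 < r \<Longrightarrow> r \<le> T \<Longrightarrow>
    (\<integral>\<^sup>+y. ennreal \<bar>y * kap x y r\<bar> * indicator {0..L} y \<partial>lborel) \<le> ennreal (kap_const * r powr (-(7/8)))"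
    by blast+
qed

text \<open>Time is reversed, \<open>r = t - s\<close>: the singularity of the kernel then stays at
  \<open>r = 0\<close> for every \<open>t\<close>, and one majorant serves all times in dominated
  convergence.\<close>

definition slice :: "(real \<times> real \<Rightarrow> real) \<Rightarrow> real \<Rightarrow> real \<Rightarrow> real \<Rightarrow> real" where
  "slice F x t r = (\<integral>y. indicator {0..L} y * (y * kap x y r * F (y, t - r)) \<partial>lborel)"

definition drift :: "(real \<times> real \<Rightarrow> real) \<Rightarrow> real \<Rightarrow> real \<Rightarrow> real" where
  "drift F x t = (\<integral>r. indicator {0<..t} r * slice F x t r \<partial>lborel)"

lemma slice_nn_bound:
  assumes [measurable]: "F \<in> borel_measurable borel" and A: "0 \<le> A"
    and F: "\<And>y. y \<in> {0..L} \<Longrightarrow> \<bar>F (y, t - r)\<bar> \<le> A" and r: "0 < r" "r \<le> T"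
  shows "(\<integral>\<^sup>+y. ennreal \<bar>indicator {0..L} y * (y * kap x y r * F (y, t - r))\<bar> \<partial>lborel) \<le> ennreal (A * (kap_const * r powr (-(7/8))))"
proof -
  have "(\<integral>\<^sup>+y. ennreal \<bar>indicator {0..L} y * (y * kap x y r * F (y, t - r))\<bar> \<partial>lborel)
     \<le> (\<integral>\<^sup>+y. ennreal A * (ennreal \<bar>y * kap x y r\<bar> * indicator {0..L} y) \<partial>lborel)"
  proof (rule nn_integral_mono)
    fix y
    show "ennreal \<bar>indicator {0..L} y * (y * kap x y r * F (y, t - r))\<bar> \<le> ennreal A * (ennreal \<bar>y * kap x y r\<bar> * indicator {0..L} y)"
    proof (cases "y \<in> {0..L}")
      case True
      have "\<bar>y * kap x y r\<bar> * \<bar>F (y, t - r)\<bar> \<le> \<bar>y * kap x y r\<bar> * A" by (intro mult_left_mono F True) simp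
      then show ?thesis using True A by (simp add: abs_mult ennreal_mult[symmetric] ennreal_leI mult_ac)
    qed simp
  qed
  also have "\<dots> = ennreal A * (\<integral>\<^sup>+y. ennreal \<bar>y * kap x y r\<bar> * indicator {0..L} y \<partial>lborel)"
    by (rule nn_integral_cmult) measurable
  also have "\<dots> \<le> ennreal A * ennreal (kap_const * r powr (-(7/8)))" by (intro mult_left_mono kap_const r) simp
  also have "\<dots> = ennreal (A * (kap_const * r powr (-(7/8))))" using A kap_const(1) by (simp add: ennreal_mult)
  finally show ?thesis .
qed

lemma slice_integrable:
  assumes [measurable]: "F \<in> borel_measurable borel"
    and F: "\<And>y. y \<in> {0..L} \<Longrightarrow> \<bar>F (y, t - r)\<bar> \<le> A" and r: "0 < r" "r \<le> T"
  shows "integrable lborel (\<lambda>y. indicator {0..L} y * (y * kap x y r * F (y, t - r)))"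
proof (rule integrableI_bounded)
  have "0 \<le> A" using F[of 0] L by simp
  then show "(\<integral>\<^sup>+y. ennreal (norm (indicator {0..L} y * (y * kap x y r * F (y, t - r)))) \<partial>lborel) < \<infinity>"
    using slice_nn_bound[of F A t r x] F r by (auto intro: le_less_trans)
qed measurable

lemma slice_bound:
  assumes [measurable]: "F \<in> borel_measurable borel"
    and F: "\<And>y. y \<in> {0..L} \<Longrightarrow> \<bar>F (y, t - r)\<bar> \<le> A" and r: "0 < r" "r \<le> T"
  shows "\<bar>slice F x t r\<bar> \<le> A * (kap_const * r powr (-(7/8)))"
proof -
  have A: "0 \<le> A" using F[of 0] L by simp
  have "ennreal \<bar>slice F x t r\<bar> \<le> (\<integral>\<^sup>+y. ennreal (norm (indicator {0..L} y * (y * kap x y r * F (y, t - r)))) \<partial>lborel)"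
    unfolding slice_def real_norm_def[symmetric]
    by (rule integral_norm_bound_ennreal[OF slice_integrable[OF assms]])
  also have "\<dots> \<le> ennreal (A * (kap_const * r powr (-(7/8))))"
    using slice_nn_bound[of F A t r x] A F r by simp
  finally show ?thesis using A kap_const(1) by simp
qed

lemma slice_measurable[measurable]:
  assumes [measurable]: "F \<in> borel_measurable borel"
  shows "slice F x t \<in> borel_measurable borel"
proof -
  have "(\<lambda>r. \<integral>y. indicator {0..L} y * (y * kap x y r * F (y, t - r)) \<partial>lborel) \<in> borel_measurable borel"
    by (rule lborel.borel_measurable_lebesgue_integral) measurable
  then show ?thesis by (simp add: slice_def[abs_def])
qed

lemma powr_integrable: "integrable lborel (\<lambda>r. indicator {0<..T} r * r powr (-(7/8)))"
proof (rule integrableI_nonneg)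
  have "((\<lambda>r. r powr (-(7/8))) has_integral (T powr (-(7/8) + 1) / (-(7/8) + 1))) {0..T}"
    using T by (intro has_integral_powr_from_0) auto
  moreover have "(\<lambda>r. indicator {0<..T} r * r powr (-(7/8))) = (\<lambda>r. if r \<in> {0..T} then r powr (-(7/8)) else 0)"
    by (auto simp: fun_eq_iff indicator_def)
  ultimately have "((\<lambda>r. indicator {0<..T} r * r powr (-(7/8))) has_integral (T powr (-(7/8) + 1) / (-(7/8) + 1))) UNIV"
    by (simp only: has_integral_restrict_UNIV)
  then show "(\<integral>\<^sup>+r. ennreal (indicator {0<..T} r * r powr (-(7/8))) \<partial>lborel) < \<infinity>"
    by (subst nn_integral_has_integral_lborel) auto
qed auto

text \<open>Laplace transform of the kernel bound; it dominates the norm of the drift operator in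
  the supremum norm weighted by \<open>exp (- l * t)\<close>.\<close>

definition weight :: "real \<Rightarrow> real" where
  "weight l = (\<integral>r. indicator {0<..T} r * (kap_const * r powr (-(7/8)) * exp (- l * r)) \<partial>lborel)"

lemma weight_integrable:
  assumes "l \<ge> 0" shows "integrable lborel (\<lambda>r. indicator {0<..T} r * (kap_const * r powr (-(7/8)) * exp (- l * r)))"
proof (rule Bochner_Integration.integrable_bound[OF integrable_mult_right[of kap_const, OF powr_integrable]])
  show "AE r in lborel. norm (indicator {0<..T} r * (kap_const * r powr (-(7/8)) * exp (- l * r))) \<le> norm (kap_const * (indicator {0<..T} r * r powr (-(7/8))))"
  proof (rule AE_I2)
    fix r
    show "norm (indicator {0<..T} r * (kap_const * r powr (-(7/8)) * exp (- l * r))) \<le> norm (kap_const * (indicator {0<..T} r * r powr (-(7/8))))"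
    proof (cases "r \<in> {0<..T}")
      case True
      then have "exp (- l * r) \<le> 1" using assms by simp
      then have "(kap_const * r powr (-(7/8))) * exp (- l * r) \<le> (kap_const * r powr (-(7/8))) * 1"
        using kap_const(1) by (intro mult_left_mono) auto
      then show ?thesis using True kap_const(1) by (simp add: abs_mult)
    qed simp
  qed
qed measurable

text \<open>The Laplace transform of an integrable function tends to 0 at infinity. This is the
  source of the contraction on a time interval of arbitrary length.\<close>

lemma weight_small:
  assumes e: "e > 0" obtains l where "l \<ge> 0" "weight l < e"
proof -
  have "(\<lambda>n. weight (real n)) \<longlonglongrightarrow> (\<integral>r. 0 \<partial>(lborel :: real measure))"
    unfolding weight_def
  proof (rule integral_dominated_convergence)
    show "integrable lborel (\<lambda>r. indicator {0<..T} r * (kap_const * r powr (-(7/8)) * exp (- 0 * r)))"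
      by (rule weight_integrable) simp
    show "AE r in lborel. norm (indicator {0<..T} r * (kap_const * r powr (-(7/8)) * exp (- real n * r))) \<le> indicator {0<..T} r * (kap_const * r powr (-(7/8)) * exp (- 0 * r))" for n
    proof (rule AE_I2)
      fix r
      show "norm (indicator {0<..T} r * (kap_const * r powr (-(7/8)) * exp (- real n * r))) \<le> indicator {0<..T} r * (kap_const * r powr (-(7/8)) * exp (- 0 * r))"
      proof (cases "r \<in> {0<..T}")
        case True
        then have "exp (- real n * r) \<le> 1" by simp
        then have "(kap_const * r powr (-(7/8))) * exp (- real n * r) \<le> (kap_const * r powr (-(7/8))) * 1"
          using kap_const(1) by (intro mult_left_mono) auto
        then show ?thesis using True kap_const(1) by (simp add: abs_mult)
      qed simp
    qed
    show "AE r in lborel. (\<lambda>n. indicator {0<..T} r * (kap_const * r powr (-(7/8)) * exp (- real n * r))) \<longlonglongrightarrow> 0"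
    proof (rule AE_I2)
      fix r
      show "(\<lambda>n. indicator {0<..T} r * (kap_const * r powr (-(7/8)) * exp (- real n * r))) \<longlonglongrightarrow> 0"
      proof (cases "r \<in> {0<..T}")
        case True
        have "(\<lambda>n. exp (- r) ^ n) \<longlonglongrightarrow> 0" using True by (intro LIMSEQ_realpow_zero) auto
        then have "(\<lambda>n. exp (- real n * r)) \<longlonglongrightarrow> 0" by (simp add: exp_of_nat_mult[symmetric])
        then have "(\<lambda>n. (kap_const * r powr (-(7/8))) * exp (- real n * r)) \<longlonglongrightarrow> (kap_const * r powr (-(7/8))) * 0"
          by (intro tendsto_mult tendsto_const)
        then show ?thesis using True by simp
      qed simp
    qed
  qed measurable
  then have "eventually (\<lambda>n. weight (real n) < e) sequentially" using e by (auto intro: order_tendstoD)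
  then obtain n where "weight (real n) < e" by (auto simp: eventually_sequentially)
  then show thesis using that[of "real n"] by simp
qed

lemma drift_integrable:
  assumes [measurable]: "F \<in> borel_measurable borel" and t: "t \<le> T"
    and F: "\<And>y s. y \<in> {0..L} \<Longrightarrow> s \<in> {0..t} \<Longrightarrow> \<bar>F (y, s)\<bar> \<le> A"
  shows "integrable lborel (\<lambda>r. indicator {0<..t} r * slice F x t r)"
proof (rule Bochner_Integration.integrable_bound[OF integrable_mult_right[of "A * kap_const", OF powr_integrable]])
  show "AE r in lborel. norm (indicator {0<..t} r * slice F x t r) \<le> norm (A * kap_const * (indicator {0<..T} r * r powr (-(7/8))))"
  proof (rule AE_I2)
    fix r
    show "norm (indicator {0<..t} r * slice F x t r) \<le> norm (A * kap_const * (indicator {0<..T} r * r powr (-(7/8))))"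
    proof (cases "r \<in> {0<..t}")
      case True
      then have "\<bar>slice F x t r\<bar> \<le> A * (kap_const * r powr (-(7/8)))"
        using F t by (intro slice_bound) auto
      also have "\<dots> = A * kap_const * (indicator {0<..T} r * r powr (-(7/8)))" using True t by simp
      also have "\<dots> \<le> \<bar>\<dots>\<bar>" by (rule abs_ge_self)
      finally show ?thesis using True by (simp only: real_norm_def indicator_simps mult_1)
    qed simp
  qed
qed measurable

text \<open>The growth \<open>exp (l * (t - r))\<close> of the integrand splits into
  \<open>exp (l * t)\<close> and the factor \<open>exp (- l * r)\<close> that enters
  \<open>weight l\<close>. The case \<open>l = 0\<close> is the plain supremum bound.\<close>

lemma drift_bound:
  assumes [measurable]: "F \<in> borel_measurable borel" and t: "t \<le> T" and l: "l \<ge> 0" and A: "A \<ge> 0"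
    and F: "\<And>y s. y \<in> {0..L} \<Longrightarrow> s \<in> {0..t} \<Longrightarrow> \<bar>F (y, s)\<bar> \<le> A * exp (l * s)"
  shows "\<bar>drift F x t\<bar> \<le> A * exp (l * t) * weight l"
proof -
  have F': "\<bar>F (y, s)\<bar> \<le> A * exp (l * t)" if "y \<in> {0..L}" "s \<in> {0..t}" for y s
  proof -
    have "\<bar>F (y, s)\<bar> \<le> A * exp (l * s)" by (rule F[OF that])
    also have "\<dots> \<le> A * exp (l * t)" using that l A by (intro mult_left_mono) (auto intro: mult_left_mono)
    finally show ?thesis .
  qed
  have "\<bar>drift F x t\<bar> \<le> (\<integral>r. \<bar>indicator {0<..t} r * slice F x t r\<bar> \<partial>lborel)"
    unfolding drift_def by (rule integral_abs_bound)
  also have "\<dots> \<le> (\<integral>r. (A * exp (l * t)) * (indicator {0<..T} r * (kap_const * r powr (-(7/8)) * exp (- l * r))) \<partial>lborel)"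
  proof (rule integral_mono)
    show "integrable lborel (\<lambda>r. \<bar>indicator {0<..t} r * slice F x t r\<bar>)"
      by (rule integrable_abs[OF drift_integrable[OF assms(1) t F']])
    show "integrable lborel (\<lambda>r. (A * exp (l * t)) * (indicator {0<..T} r * (kap_const * r powr (-(7/8)) * exp (- l * r))))"
      by (rule integrable_mult_right[OF weight_integrable[OF l]])
    fix r
    show "\<bar>indicator {0<..t} r * slice F x t r\<bar> \<le> (A * exp (l * t)) * (indicator {0<..T} r * (kap_const * r powr (-(7/8)) * exp (- l * r)))"
    proof (cases "r \<in> {0<..t}")
      case True
      then have "\<bar>slice F x t r\<bar> \<le> (A * exp (l * (t - r))) * (kap_const * r powr (-(7/8)))"
        using F t by (intro slice_bound) auto
      also have "exp (l * (t - r)) = exp (l * t) * exp (- l * r)"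
        by (simp add: exp_add[symmetric] algebra_simps)
      finally show ?thesis using True t by (simp add: mult_ac)
    next
      case False
      then show ?thesis using A kap_const(1) by (simp add: indicator_def)
    qed
  qed
  also have "\<dots> = A * exp (l * t) * weight l" by (simp add: weight_def)
  finally show ?thesis .
qed

lemma drift_diff:
  assumes [measurable]: "F \<in> borel_measurable borel" "G \<in> borel_measurable borel" and t: "t \<le> T"
    and F: "\<And>y s. y \<in> {0..L} \<Longrightarrow> s \<in> {0..t} \<Longrightarrow> \<bar>F (y, s)\<bar> \<le> A"
    and G: "\<And>y s. y \<in> {0..L} \<Longrightarrow> s \<in> {0..t} \<Longrightarrow> \<bar>G (y, s)\<bar> \<le> B"
  shows "drift (\<lambda>z. F z - G z) x t = drift F x t - drift G x t"
proof -
  have "indicator {0<..t} r * slice (\<lambda>z. F z - G z) x t r = indicator {0<..t} r * slice F x t r - indicator {0<..t} r * slice G x t r" for r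
  proof (cases "r \<in> {0<..t}")
    case True
    have "slice (\<lambda>z. F z - G z) x t r = slice F x t r - slice G x t r"
      unfolding slice_def right_diff_distrib
      by (rule Bochner_Integration.integral_diff[OF slice_integrable[where A=A] slice_integrable[where A=B]]) (use True t F G in auto)
    then show ?thesis by (simp add: right_diff_distrib)
  qed simp
  moreover have "integrable lborel (\<lambda>r. indicator {0<..t} r * slice F x t r)"
    by (rule drift_integrable[OF assms(1) t F])
  moreover have "integrable lborel (\<lambda>r. indicator {0<..t} r * slice G x t r)"
    by (rule drift_integrable[OF assms(2) t G])
  ultimately show ?thesis unfolding drift_def by simp
qed

lemma kap_sup:
  assumes r: "r > 0" obtains C where "\<And>x y. \<bar>kap x y r\<bar> \<le> C"
proof -
  define b where "b = (\<lambda>k. 2 * mu\<^sup>2 / (rate * r)\<^sup>2 * inverse (real (Suc k) ^ 2))"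
  have b: "summable b" unfolding b_def by (intro summable_mult summable_inverse_Suc_square)
  have "\<bar>kap x y r\<bar> \<le> 2 / L * suminf b" for x y
  proof -
    have t: "norm (coef (Suc k) x r * cos (real (Suc k) * mu * y)) \<le> b k" for k
    proof -
      have "norm (coef (Suc k) x r * cos (real (Suc k) * mu * y)) \<le> b k * 1"
        unfolding real_norm_def abs_mult b_def by (intro mult_mono coef_bound r abs_cos_le_one order_refl) auto
      then show ?thesis by simp
    qed
    have "norm (\<Sum>k. coef (Suc k) x r * cos (real (Suc k) * mu * y)) \<le> suminf b"
      by (rule norm_suminf_le[OF t b])
    then show ?thesis using L unfolding kap_def abs_mult by (simp add: divide_right_mono)
  qed
  then show thesis by (rule that)
qed

lemma slice_tendsto:
  assumes F: "continuous_on UNIV F" "\<And>z. \<bar>F z\<bar> \<le> B" and r: "r > 0"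
    and x: "xs \<longlonglongrightarrow> x" and t: "ts \<longlonglongrightarrow> t"
  shows "(\<lambda>n. slice F (xs n) (ts n) r) \<longlonglongrightarrow> slice F x t r"
proof -
  have [measurable]: "F \<in> borel_measurable borel" by (rule borel_measurable_continuous_onI[OF F(1)])
  obtain C where C: "\<And>x y. \<bar>kap x y r\<bar> \<le> C" using kap_sup[OF r] by blast
  show ?thesis unfolding slice_def
  proof (rule integral_dominated_convergence[where w="\<lambda>y. (L * C * B) * indicator {0..L} y"])
    show "integrable lborel (\<lambda>y. L * C * B * indicator {0..L} y)"
      by (intro integrable_mult_right integrable_real_indicator) (use L in auto)
    show "AE y in lborel. norm (indicator {0..L} y * (y * kap (xs n) y r * F (y, ts n - r))) \<le> L * C * B * indicator {0..L} y" for n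
    proof (rule AE_I2)
      fix y
      show "norm (indicator {0..L} y * (y * kap (xs n) y r * F (y, ts n - r))) \<le> L * C * B * indicator {0..L} y"
      proof (cases "y \<in> {0..L}")
        case True
        have "\<bar>y\<bar> * \<bar>kap (xs n) y r\<bar> * \<bar>F (y, ts n - r)\<bar> \<le> L * C * B"
          using True C[of "xs n" y] L by (intro mult_mono C F(2)) auto
        then show ?thesis using True by (simp add: abs_mult)
      qed simp
    qed
    show "AE y in lborel. (\<lambda>n. indicator {0..L} y * (y * kap (xs n) y r * F (y, ts n - r))) \<longlonglongrightarrow> indicator {0..L} y * (y * kap x y r * F (y, t - r))"
    proof (rule AE_I2)
      fix y
      have "(\<lambda>n. kap (fst (xs n, y, r)) (fst (snd (xs n, y, r))) (snd (snd (xs n, y, r)))) \<longlonglongrightarrow> kap (fst (x, y, r)) (fst (snd (x, y, r))) (snd (snd (x, y, r)))"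
        by (rule continuous_on_tendsto_compose[OF kap_continuous]) (use r in \<open>auto intro!: tendsto_intros x\<close>)
      then have 1: "(\<lambda>n. kap (xs n) y r) \<longlonglongrightarrow> kap x y r" by simp
      have 2: "(\<lambda>n. F (y, ts n - r)) \<longlonglongrightarrow> F (y, t - r)"
        by (rule continuous_on_tendsto_compose[OF F(1)]) (auto intro!: tendsto_intros t)
      show "(\<lambda>n. indicator {0..L} y * (y * kap (xs n) y r * F (y, ts n - r))) \<longlonglongrightarrow> indicator {0..L} y * (y * kap x y r * F (y, t - r))"
        by (intro tendsto_mult tendsto_const 1 2)
    qed
  qed measurable
qed

text \<open>Dominated convergence in \<open>r\<close>, with the kernel bound on
  \<open>{0<..T}\<close> as majorant for all times up to \<open>T\<close>; for fixed
  \<open>r > 0\<close> the slices converge by continuity of the kernel.\<close>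

lemma drift_continuous:
  assumes F: "continuous_on UNIV F" "\<And>z. \<bar>F z\<bar> \<le> B"
  shows "continuous_on {z. snd z \<le> T} (\<lambda>z. drift F (fst z) (snd z))"
proof (rule continuous_on_sequentiallyI)
  fix zs and z :: "real \<times> real"
  assume zs: "\<forall>n. zs n \<in> {z. snd z \<le> T}" and z: "z \<in> {z. snd z \<le> T}" and lim: "zs \<longlonglongrightarrow> z"
  define xs ts where "xs = (\<lambda>n. fst (zs n))" and "ts = (\<lambda>n. snd (zs n))"
  have x: "xs \<longlonglongrightarrow> fst z" and t: "ts \<longlonglongrightarrow> snd z" using lim by (auto simp: xs_def ts_def intro: tendsto_intros)
  have tT: "ts n \<le> T" "snd z \<le> T" for n using zs z by (auto simp: ts_def)
  have [measurable]: "F \<in> borel_measurable borel" by (rule borel_measurable_continuous_onI[OF F(1)])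
  have "(\<lambda>n. drift F (xs n) (ts n)) \<longlonglongrightarrow> drift F (fst z) (snd z)" unfolding drift_def
  proof (rule integral_dominated_convergence[where w="\<lambda>r. (B * kap_const) * (indicator {0<..T} r * r powr (-(7/8)))"])
    show "integrable lborel (\<lambda>r. (B * kap_const) * (indicator {0<..T} r * r powr (-(7/8))))"
      by (rule integrable_mult_right[OF powr_integrable])
    show "AE r in lborel. norm (indicator {0<..ts n} r * slice F (xs n) (ts n) r) \<le> (B * kap_const) * (indicator {0<..T} r * r powr (-(7/8)))" for n
    proof (rule AE_I2)
      fix r
      have B: "0 \<le> B" using F(2)[of 0] by linarith
      show "norm (indicator {0<..ts n} r * slice F (xs n) (ts n) r) \<le> (B * kap_const) * (indicator {0<..T} r * r powr (-(7/8)))"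
      proof (cases "r \<in> {0<..ts n}")
        case True
        have "\<bar>slice F (xs n) (ts n) r\<bar> \<le> B * (kap_const * r powr (-(7/8)))"
          using True tT(1)[of n] by (intro slice_bound F) auto
        then show ?thesis using True tT(1)[of n] by simp
      next
        case False
        then show ?thesis using B kap_const(1) by (simp add: indicator_def)
      qed
    qed
    \<comment> \<open>The indicators of \<open>{0<..ts n}\<close> may fail to converge at the
      limiting end point, a single value of \<open>r\<close>.\<close>
    have "AE r in lborel. r \<noteq> snd z" by (rule AE_lborel_singleton)
    then show "AE r in lborel. (\<lambda>n. indicator {0<..ts n} r * slice F (xs n) (ts n) r) \<longlonglongrightarrow> indicator {0<..snd z} r * slice F (fst z) (snd z) r"
    proof eventually_elim
      case (elim r)
      show ?case
      proof (cases "r > 0")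
        case True
        have "(\<lambda>n. indicator {0<..ts n} r :: real) \<longlonglongrightarrow> indicator {0<..snd z} r"
        proof (rule tendsto_eventually)
          consider "r < snd z" | "snd z < r" using elim by linarith
          then show "\<forall>\<^sub>F n in sequentially. indicator {0<..ts n} r = (indicator {0<..snd z} r :: real)"
          proof cases
            case 1
            then have "\<forall>\<^sub>F n in sequentially. r < ts n" by (rule order_tendstoD(1)[OF t])
            then show ?thesis by eventually_elim (use 1 True in simp)
          next
            case 2
            then have "\<forall>\<^sub>F n in sequentially. ts n < r" by (rule order_tendstoD(2)[OF t])
            then show ?thesis by eventually_elim (use 2 True in simp)
          qed
        qed
        then show ?thesis by (intro tendsto_mult slice_tendsto[OF F True x t])
      qed simp
    qed
  qed measurable
  then show "(\<lambda>n. drift F (fst (zs n)) (snd (zs n))) \<longlonglongrightarrow> drift F (fst z) (snd z)"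
    by (simp add: xs_def ts_def)
qed

text \<open>In space-time form, \<open>drift F\<close> is the drift of the mild equations with \<open>b(y,s) = y F(y,s)\<close>,
  divided by \<open>x\<close>.\<close>

lemma heat_drift:
  assumes Fm[measurable]: "F \<in> borel_measurable borel" and F: "\<And>z. \<bar>F z\<bar> \<le> A" and t: "t \<le> T"
  shows "set_integrable lborel ({0<..<L} \<times> {0..<t}) (\<lambda>(y, s). heat_green_y \<alpha> L x y (t - s) * (y * F (y, s)))"
    and "set_lebesgue_integral lborel ({0<..<L} \<times> {0..<t}) (\<lambda>(y, s). heat_green_y \<alpha> L x y (t - s) * (y * F (y, s))) = x * drift F x t"
proof -
  define Q where "Q = {0<..<L} \<times> {0..<t}"
  have Q[measurable]: "Q \<in> sets (borel \<Otimes>\<^sub>M borel)" unfolding Q_def by (intro pair_measureI) auto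
  have A0: "0 \<le> A" using F[of 0] by linarith
  define f where "f = (\<lambda>z. indicator Q z * (x * (fst z * kap x (fst z) (t - snd z) * F z)))"
  have fe: "indicator Q z *\<^sub>R (case z of (y, s) \<Rightarrow> heat_green_y \<alpha> L x y (t - s) * (y * F (y, s))) = f z" for z
    by (cases z) (auto simp: f_def Q_def indicator_def heat_green_y_eq)
  have fm[measurable]: "f \<in> borel_measurable (lborel \<Otimes>\<^sub>M lborel)"
    unfolding f_def by (measurable, simp_all add: borel_prod)
  have inner: "(\<integral>\<^sup>+y. ennreal (norm (f (y, s))) \<partial>lborel) \<le> ennreal (\<bar>x\<bar> * A * kap_const * (indicator {0<..T} (t - s) * (t - s) powr (-(7/8))))" for s
  proof (cases "s \<in> {0..<t}")
    case True
    have "(\<integral>\<^sup>+y. ennreal (norm (f (y, s))) \<partial>lborel) \<le> (\<integral>\<^sup>+y. ennreal \<bar>x\<bar> * ennreal \<bar>indicator {0..L} y * (y * kap x y (t - s) * F (y, t - (t - s)))\<bar> \<partial>lborel)"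
      by (intro nn_integral_mono) (auto simp: f_def Q_def indicator_def abs_mult ennreal_mult)
    also have "\<dots> = ennreal \<bar>x\<bar> * (\<integral>\<^sup>+y. ennreal \<bar>indicator {0..L} y * (y * kap x y (t - s) * F (y, t - (t - s)))\<bar> \<partial>lborel)"
      by (rule nn_integral_cmult) measurable
    also have "\<dots> \<le> ennreal \<bar>x\<bar> * ennreal (A * (kap_const * (t - s) powr (-(7/8))))"
      by (intro mult_left_mono slice_nn_bound A0 F) (use True t in auto)
    also have "\<dots> = ennreal (\<bar>x\<bar> * A * kap_const * (indicator {0<..T} (t - s) * (t - s) powr (-(7/8))))"
      using True t A0 kap_const(1) by (simp add: ennreal_mult[symmetric] mult_ac)
    finally show ?thesis .
  next
    case False
    then have "f (y, s) = 0" for y by (simp add: f_def Q_def)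
    then show ?thesis by simp
  qed
  \<comment> \<open>Reflection about \<open>t\<close> of the integrable singularity, needed because
    the mild equation integrates in \<open>s\<close>.\<close>
  have sub: "integrable lborel (\<lambda>s. indicator {0<..T} (t - s) * (t - s) powr (-(7/8)))"
    using lborel_integrable_real_affine[OF powr_integrable, of "-1" t] by simp
  have fi: "integrable (lborel \<Otimes>\<^sub>M lborel) f"
  proof (rule integrableI_bounded)
    have "(\<integral>\<^sup>+z. ennreal (norm (f z)) \<partial>(lborel \<Otimes>\<^sub>M lborel)) = (\<integral>\<^sup>+s. \<integral>\<^sup>+y. ennreal (norm (f (y, s))) \<partial>lborel \<partial>lborel)"
      by (rule lborel_pair.nn_integral_snd[symmetric]) measurable
    also have "\<dots> \<le> (\<integral>\<^sup>+s. ennreal (\<bar>x\<bar> * A * kap_const * (indicator {0<..T} (t - s) * (t - s) powr (-(7/8)))) \<partial>lborel)"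
      by (intro nn_integral_mono inner)
    also have "\<dots> = ennreal (\<integral>s. \<bar>x\<bar> * A * kap_const * (indicator {0<..T} (t - s) * (t - s) powr (-(7/8))) \<partial>lborel)"
      using A0 kap_const(1) by (intro nn_integral_eq_integral integrable_mult_right sub) auto
    also have "\<dots> < \<infinity>" by simp
    finally show "(\<integral>\<^sup>+z. ennreal (norm (f z)) \<partial>(lborel \<Otimes>\<^sub>M lborel)) < \<infinity>" .
  qed (rule fm)
  then have fi': "integrable lborel f" by (simp add: lborel_prod)
  show "set_integrable lborel ({0<..<L} \<times> {0..<t}) (\<lambda>(y, s). heat_green_y \<alpha> L x y (t - s) * (y * F (y, s)))"
    unfolding set_integrable_def Q_def[symmetric] fe by (rule fi')
  have "set_lebesgue_integral lborel Q (\<lambda>(y, s). heat_green_y \<alpha> L x y (t - s) * (y * F (y, s))) = (\<integral>z. f z \<partial>(lborel \<Otimes>\<^sub>M lborel))"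
    unfolding set_lebesgue_integral_def fe by (simp add: lborel_prod)
  also have "\<dots> = (\<integral>s. (\<integral>y. f (y, s) \<partial>lborel) \<partial>lborel)"
    using lborel_pair.integral_snd[of "\<lambda>y s. f (y, s)"] fi by simp
  also have "\<dots> = (\<integral>r. (\<integral>y. f (y, t + (-1) * r) \<partial>lborel) \<partial>lborel)"
    by (subst lborel_integral_real_affine[of "-1" _ t]) auto
  also have "\<dots> = (\<integral>r. x * (indicator {0<..t} r * slice F x t r) \<partial>lborel)"
  proof (intro Bochner_Integration.integral_cong refl)
    fix r
    have "(\<integral>y. f (y, t + (-1) * r) \<partial>lborel) = (\<integral>y. (x * indicator {0<..t} r) * (indicator {0..L} y * (y * kap x y r * F (y, t - r))) \<partial>lborel)"
    proof (rule integral_cong_AE)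
      \<comment> \<open>The mild equation uses the open interval in \<open>y\<close>,
        \<open>slice\<close> the closed one; they differ by two points.\<close>
      have "AE y in lborel. y \<noteq> 0" "AE y in lborel. y \<noteq> L" by (rule AE_lborel_singleton)+
      then show "AE y in lborel. f (y, t + (-1) * r) = (x * indicator {0<..t} r) * (indicator {0..L} y * (y * kap x y r * F (y, t - r)))"
        by eventually_elim (auto simp: f_def Q_def indicator_def)
      show "(\<lambda>y. f (y, t + (-1) * r)) \<in> borel_measurable lborel" by measurable
    qed measurable
    then show "(\<integral>y. f (y, t + (-1) * r) \<partial>lborel) = x * (indicator {0<..t} r * slice F x t r)"
      by (simp add: slice_def)
  qed
  also have "\<dots> = x * drift F x t" by (simp add: drift_def)
  finally show "set_lebesgue_integral lborel ({0<..<L} \<times> {0..<t}) (\<lambda>(y, s). heat_green_y \<alpha> L x y (t - s) * (y * F (y, s))) = x * drift F x t"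
    by (simp only: Q_def)
qed

text \<open>A Gronwall argument by iteration: each substitution of the equation into itself halves
  the bound in the weighted norm, so the bound tends to 0.\<close>

lemma drift_eq_zero:
  assumes W: "W \<in> borel_measurable borel" and G[measurable]: "G \<in> borel_measurable borel"
    and bd: "\<And>x s. x \<in> {0..L} \<Longrightarrow> s \<in> {0..T} \<Longrightarrow> \<bar>W (x, s)\<bar> \<le> B"
    and eq: "\<And>x s. x \<in> {0..L} \<Longrightarrow> s \<in> {0..T} \<Longrightarrow> W (x, s) = drift G x s"
    and lip: "\<And>x s. x \<in> {0..L} \<Longrightarrow> s \<in> {0..T} \<Longrightarrow> \<bar>G (x, s)\<bar> \<le> c * \<bar>W (x, s)\<bar>" and c: "c \<ge> 0"
    and x: "x \<in> {0..L}" and t: "t \<in> {0..T}"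
  shows "W (x, t) = 0"
proof -
  \<comment> \<open>This makes \<open>c * weight l\<close> at most 1/2; the denominator contains
    \<open>c + 1\<close> so that \<open>c = 0\<close> is covered.\<close>
  obtain l where l: "l \<ge> 0" "weight l < 1 / (2 * (c + 1))" using weight_small[of "1 / (2 * (c + 1))"] c by auto
  have step: "\<forall>x\<in>{0..L}. \<forall>s\<in>{0..T}. \<bar>W (x, s)\<bar> \<le> B * (1/2) ^ n * exp (l * s)" for n :: nat
  proof (induction n)
    case 0
    show ?case
    proof (intro ballI)
      fix x s assume "x \<in> {0..L}" "s \<in> {0..T}"
      then have "\<bar>W (x, s)\<bar> \<le> B * 1" "0 \<le> B" "1 \<le> exp (l * s)" using bd[of x s] l by auto
      then show "\<bar>W (x, s)\<bar> \<le> B * (1/2) ^ 0 * exp (l * s)"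
        using mult_left_mono[of 1 "exp (l * s)" B] by simp
    qed
  next
    case (Suc n)
    show ?case
    proof (intro ballI)
      fix x s assume xs: "x \<in> {0..L}" "s \<in> {0..T}"
      have B: "0 \<le> B" using bd[OF xs] by linarith
      have "\<bar>W (x, s)\<bar> = \<bar>drift G x s\<bar>" using eq[OF xs] by simp
      also have "\<dots> \<le> (c * (B * (1/2) ^ n)) * exp (l * s) * weight l"
      proof (rule drift_bound[OF G _ l(1)])
        fix y s' assume y: "y \<in> {0..L}" "s' \<in> {0..s}"
        have "\<bar>G (y, s')\<bar> \<le> c * \<bar>W (y, s')\<bar>" using lip y xs by auto
        also have "\<dots> \<le> c * (B * (1/2) ^ n * exp (l * s'))"
          using Suc y xs c by (intro mult_left_mono) auto
        finally show "\<bar>G (y, s')\<bar> \<le> c * (B * (1/2) ^ n) * exp (l * s')" by (simp only: mult.assoc)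
      qed (use xs B c in auto)
      also have "\<dots> \<le> (c * (B * (1/2) ^ n)) * exp (l * s) * (1 / (2 * (c + 1)))"
        using l B c by (intro mult_left_mono) auto
      also have "\<dots> = (B * (1/2) ^ Suc n * exp (l * s)) * (c / (c + 1))" by simp
      also have "\<dots> \<le> (B * (1/2) ^ Suc n * exp (l * s)) * 1"
        using B c by (intro mult_left_mono) auto
      finally show "\<bar>W (x, s)\<bar> \<le> B * (1/2) ^ Suc n * exp (l * s)" by simp
    qed
  qed
  have "(\<lambda>n. B * (1/2) ^ n * exp (l * t)) \<longlonglongrightarrow> B * 0 * exp (l * t)"
    by (intro tendsto_mult tendsto_const LIMSEQ_realpow_zero) auto
  then have "\<bar>W (x, t)\<bar> \<le> B * 0 * exp (l * t)"
    by (rule LIMSEQ_le_const) (use step x t in auto)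
  then show ?thesis by simp
qed

text \<open>Projection onto the rectangle. Functions composed with it are continuous and bounded on
  the whole plane, which spares side conditions about the domain.\<close>

definition clamp_x :: "real \<Rightarrow> real" where "clamp_x x = max 0 (min L x)"
definition clamp_t :: "real \<Rightarrow> real" where "clamp_t t = max 0 (min T t)"

lemma clamp: "clamp_x x \<in> {0..L}" "clamp_t t \<in> {0..T}" "x \<in> {0..L} \<Longrightarrow> clamp_x x = x" "t \<in> {0..T} \<Longrightarrow> clamp_t t = t"
  using L T by (auto simp: clamp_x_def clamp_t_def)

lemma clamp_continuous[continuous_intros]:
  "continuous_on S f \<Longrightarrow> continuous_on S (\<lambda>z. clamp_x (f z))"
  "continuous_on S f \<Longrightarrow> continuous_on S (\<lambda>z. clamp_t (f z))"
  unfolding clamp_x_def clamp_t_def by (intro continuous_intros; assumption)+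

text \<open>Picard iterates. An explicit sequence is used so that the fixed point is a pointwise
  limit and inherits measurability in the sample point.\<close>

primrec iter :: "(real \<times> real \<Rightarrow> real) \<Rightarrow> (real \<times> real \<Rightarrow> real \<Rightarrow> real) \<Rightarrow> nat \<Rightarrow> real \<times> real \<Rightarrow> real" where
  "iter U N 0 = U"
| "iter U N (Suc j) = (\<lambda>z. U z + drift (\<lambda>z. N z (iter U N j z)) (clamp_x (fst z)) (clamp_t (snd z)))"

definition fp :: "(real \<times> real \<Rightarrow> real) \<Rightarrow> (real \<times> real \<Rightarrow> real \<Rightarrow> real) \<Rightarrow> real \<times> real \<Rightarrow> real" where
  "fp U N z = lim (\<lambda>j. iter U N j z)"

definition nonlinearity :: "(real \<times> real \<Rightarrow> real \<Rightarrow> real) \<Rightarrow> real \<Rightarrow> real \<Rightarrow> bool" where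
  "nonlinearity N c B \<longleftrightarrow> continuous_on UNIV (\<lambda>w. N (fst w) (snd w)) \<and> 0 \<le> c
     \<and> (\<forall>z v v'. \<bar>N z v - N z v'\<bar> \<le> c * \<bar>v - v'\<bar>) \<and> (\<forall>z. \<bar>N z 0\<bar> \<le> B)"

lemma nonlinearity_bound: "nonlinearity N c B \<Longrightarrow> \<bar>v\<bar> \<le> A \<Longrightarrow> \<bar>N z v\<bar> \<le> c * A + B"
proof -
  assume n: "nonlinearity N c B" and v: "\<bar>v\<bar> \<le> A"
  have "\<bar>N z v - N z 0\<bar> \<le> c * \<bar>v - 0\<bar>" "\<bar>N z 0\<bar> \<le> B" "0 \<le> c" using n unfolding nonlinearity_def by blast+
  moreover have "c * \<bar>v\<bar> \<le> c * A" using v \<open>0 \<le> c\<close> by (rule mult_left_mono)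
  ultimately show ?thesis by simp
qed

lemma nonlinearity_continuous: "nonlinearity N c B \<Longrightarrow> continuous_on UNIV w \<Longrightarrow> continuous_on UNIV (\<lambda>z. N z (w z))"
proof -
  assume n: "nonlinearity N c B" and w: "continuous_on UNIV w"
  have "continuous_on UNIV (\<lambda>w. N (fst w) (snd w))" using n by (simp add: nonlinearity_def)
  from continuous_on_compose2[OF this continuous_on_Pair[OF continuous_on_id w]]
  show ?thesis by simp
qed

lemma drift_step:
  assumes F: "continuous_on UNIV F" "\<And>z. \<bar>F z\<bar> \<le> A"
  shows "continuous_on UNIV (\<lambda>z. drift F (clamp_x (fst z)) (clamp_t (snd z)))"
    and "\<bar>drift F (clamp_x x) (clamp_t t)\<bar> \<le> A * weight 0"
proof -
  have "continuous_on UNIV ((\<lambda>z. drift F (fst z) (snd z)) \<circ> (\<lambda>z. (clamp_x (fst z), clamp_t (snd z))))"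
  proof (rule continuous_on_compose)
    show "continuous_on UNIV (\<lambda>z. (clamp_x (fst z), clamp_t (snd z)))" by (intro continuous_intros)
    show "continuous_on (range (\<lambda>z. (clamp_x (fst z), clamp_t (snd z)))) (\<lambda>z. drift F (fst z) (snd z))"
      by (rule continuous_on_subset[OF drift_continuous[OF F]]) (use clamp(2) in auto)
  qed
  then show "continuous_on UNIV (\<lambda>z. drift F (clamp_x (fst z)) (clamp_t (snd z)))" by (simp add: o_def)
  have "F \<in> borel_measurable borel" by (rule borel_measurable_continuous_onI[OF F(1)])
  moreover have "0 \<le> A" using F(2)[of 0] by linarith
  ultimately show "\<bar>drift F (clamp_x x) (clamp_t t)\<bar> \<le> A * weight 0"
    using drift_bound[of F "clamp_t t" 0 A "clamp_x x"] F(2) clamp(2)[of t] by simp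
qed

lemma iter_continuous_bounded:
  assumes U: "continuous_on UNIV U" "\<And>z. \<bar>U z\<bar> \<le> A" and N: "nonlinearity N c B"
  shows "continuous_on UNIV (iter U N j) \<and> (\<exists>A. \<forall>z. \<bar>iter U N j z\<bar> \<le> A)"
proof (induction j)
  case 0 then show ?case using U by auto
next
  case (Suc j)
  then obtain A' where A': "\<And>z. \<bar>iter U N j z\<bar> \<le> A'" by blast
  have Nc: "continuous_on UNIV (\<lambda>z. N z (iter U N j z))" using nonlinearity_continuous[OF N] Suc by blast
  have Nb: "\<bar>N z (iter U N j z)\<bar> \<le> c * A' + B" for z by (rule nonlinearity_bound[OF N A'])
  have "\<bar>iter U N (Suc j) z\<bar> \<le> A + (c * A' + B) * weight 0" for z
    using U(2)[of z] drift_step(2)[OF Nc Nb, of "fst z" "snd z"] by simp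
  moreover have "continuous_on UNIV (iter U N (Suc j))"
    unfolding iter.simps by (intro continuous_on_add U(1) drift_step(1)[OF Nc Nb])
  ultimately show ?case by blast
qed

text \<open>The contraction principle carried out by hand in the weighted norm. Successive
  differences decay geometrically, so their telescoping series converges uniformly; the drift is
  continuous along this convergence, and the limit solves the equation.\<close>

lemma fixed_point:
  assumes U: "continuous_on UNIV U" "\<And>z. \<bar>U z\<bar> \<le> A" and N: "nonlinearity N c B"
  shows "continuous_on UNIV (fp U N)" "\<exists>A. \<forall>z. \<bar>fp U N z\<bar> \<le> A"
    "fp U N z = U z + drift (\<lambda>z. N z (fp U N z)) (clamp_x (fst z)) (clamp_t (snd z))"
    "(\<lambda>j. iter U N j z) \<longlonglongrightarrow> fp U N z"
proof -
  have c: "c \<ge> 0" and lip: "\<And>z v v'. \<bar>N z v - N z v'\<bar> \<le> c * \<bar>v - v'\<bar>" using N by (auto simp: nonlinearity_def)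
  obtain l where l: "l \<ge> 0" "weight l < 1 / (2 * (c + 1))" using weight_small[of "1 / (2 * (c + 1))"] c by auto
  define q where "q = c * weight l"
  have w0: "0 \<le> weight l" unfolding weight_def using kap_const(1) by (intro integral_nonneg_AE) auto
  have q: "0 \<le> q" "q \<le> 1/2"
  proof -
    show "0 \<le> q" using c w0 by (simp add: q_def)
    have "q \<le> c * (1 / (2 * (c + 1)))" unfolding q_def using c l by (intro mult_left_mono) auto
    also have "\<dots> \<le> 1/2" using c by (simp add: field_simps)
    finally show "q \<le> 1/2" .
  qed
  note ic = iter_continuous_bounded[OF U N]
  have Nm: "(\<lambda>z. N z (w z)) \<in> borel_measurable borel" if "continuous_on UNIV w" for w
    by (rule borel_measurable_continuous_onI[OF nonlinearity_continuous[OF N that]])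
  \<comment> \<open>One application of the drift multiplies a weighted distance by
    \<open>q <= 1/2\<close>.\<close>
  have contr: "\<bar>drift (\<lambda>z. N z (w z)) (clamp_x x) (clamp_t t) - drift (\<lambda>z. N z (w' z)) (clamp_x x) (clamp_t t)\<bar> \<le> D * q * exp (l * clamp_t t)"
    if w: "continuous_on UNIV w" "\<exists>A. \<forall>z. \<bar>w z\<bar> \<le> A" and w': "continuous_on UNIV w'" "\<exists>A. \<forall>z. \<bar>w' z\<bar> \<le> A"
      and d: "\<And>x t. \<bar>w (x, t) - w' (x, t)\<bar> \<le> D * exp (l * clamp_t t)" and D: "D \<ge> 0" for w w' x t D
  proof -
    obtain A1 where A1: "\<And>z. \<bar>w z\<bar> \<le> A1" using w by blast
    obtain A2 where A2: "\<And>z. \<bar>w' z\<bar> \<le> A2" using w' by blast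
    have "drift (\<lambda>z. N z (w z)) (clamp_x x) (clamp_t t) - drift (\<lambda>z. N z (w' z)) (clamp_x x) (clamp_t t)
       = drift (\<lambda>z. N z (w z) - N z (w' z)) (clamp_x x) (clamp_t t)"
      by (rule drift_diff[symmetric, OF Nm[OF w(1)] Nm[OF w'(1)] _ nonlinearity_bound[OF N A1] nonlinearity_bound[OF N A2]])
        (use clamp(2)[of t] in simp)
    also have "\<bar>\<dots>\<bar> \<le> (c * D) * exp (l * clamp_t t) * weight l"
    proof (rule drift_bound[OF _ _ l(1)])
      show "(\<lambda>z. N z (w z) - N z (w' z)) \<in> borel_measurable borel" using Nm[OF w(1)] Nm[OF w'(1)] by measurable
      fix y s assume ys: "y \<in> {0..L}" "s \<in> {0..clamp_t t}"
      then have s: "clamp_t s = s" using clamp(2)[of t] by (intro clamp(4)) auto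
      have "\<bar>N (y, s) (w (y, s)) - N (y, s) (w' (y, s))\<bar> \<le> c * \<bar>w (y, s) - w' (y, s)\<bar>" by (rule lip)
      also have "\<dots> \<le> c * (D * exp (l * s))" using d[of y s] c s by (intro mult_left_mono) auto
      finally show "\<bar>N (y, s) (w (y, s)) - N (y, s) (w' (y, s))\<bar> \<le> c * D * exp (l * s)" by (simp only: mult.assoc)
    qed (use clamp(2)[of t] c D in auto)
    finally show ?thesis by (simp add: q_def mult_ac)
  qed
  obtain A1 where A1: "\<And>z. \<bar>iter U N 1 z - iter U N 0 z\<bar> \<le> A1"
  proof -
    obtain a b where "\<And>z. \<bar>iter U N 1 z\<bar> \<le> a" "\<And>z. \<bar>iter U N 0 z\<bar> \<le> b" using ic by blast
    then have "\<bar>iter U N 1 z - iter U N 0 z\<bar> \<le> a + b" for z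
      using abs_triangle_ineq4[of "iter U N 1 z" "iter U N 0 z"] by (meson add_mono order_trans)
    then show thesis by (rule that)
  qed
  have A10: "A1 \<ge> 0" using A1[of 0] by linarith
  have step: "\<bar>iter U N (Suc j) (x, t) - iter U N j (x, t)\<bar> \<le> A1 * (1/2) ^ j * exp (l * clamp_t t)" for j x t
  proof (induction j arbitrary: x t)
    case 0
    have "1 \<le> exp (l * clamp_t t)" using l clamp(2)[of t] by simp
    then have "A1 * 1 \<le> A1 * exp (l * clamp_t t)" using A10 by (rule mult_left_mono)
    then show ?case using A1[of "(x, t)"] by simp
  next
    case (Suc j)
    have "iter U N (Suc (Suc j)) (x, t) - iter U N (Suc j) (x, t)
        = drift (\<lambda>z. N z (iter U N (Suc j) z)) (clamp_x x) (clamp_t t) - drift (\<lambda>z. N z (iter U N j z)) (clamp_x x) (clamp_t t)"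
      by (simp only: iter.simps fst_conv snd_conv add_diff_cancel_left)
    then have "\<bar>iter U N (Suc (Suc j)) (x, t) - iter U N (Suc j) (x, t)\<bar> \<le> (A1 * (1/2) ^ j) * q * exp (l * clamp_t t)"
      using contr[OF conjunct1[OF ic] conjunct2[OF ic] conjunct1[OF ic] conjunct2[OF ic] Suc] A10 by simp
    also have "\<dots> \<le> (A1 * (1/2) ^ j) * (1/2) * exp (l * clamp_t t)"
      using A10 q by (intro mult_left_mono mult_right_mono) auto
    finally show ?case by simp
  qed
  \<comment> \<open>The weight lies between 1 and \<open>E\<close>, so geometric decay in the
    weighted norm gives a uniform majorant for the Weierstrass test.\<close>
  define E where "E = exp (l * T)"
  have E: "exp (l * clamp_t t) \<le> E" for t using l clamp(2)[of t] by (simp add: E_def mult_left_mono)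
  have step': "norm (iter U N (Suc j) z - iter U N j z) \<le> A1 * E * (1/2) ^ j" for j z
  proof -
    have "\<bar>iter U N (Suc j) z - iter U N j z\<bar> \<le> A1 * (1/2) ^ j * exp (l * clamp_t (snd z))"
      using step[of j "fst z" "snd z"] by simp
    also have "\<dots> \<le> A1 * (1/2) ^ j * E" using A10 by (intro mult_left_mono E) auto
    finally show ?thesis by (simp add: mult_ac)
  qed
  have ul: "uniform_limit UNIV (\<lambda>n z. \<Sum>j<n. iter U N (Suc j) z - iter U N j z) (\<lambda>z. \<Sum>j. iter U N (Suc j) z - iter U N j z) sequentially"
    by (rule Weierstrass_m_test[OF step']) (intro summable_mult summable_geometric, simp)
  define S where "S = (\<lambda>z. U z + (\<Sum>j. iter U N (Suc j) z - iter U N j z))"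
  have tel: "iter U N n z = U z + (\<Sum>j<n. iter U N (Suc j) z - iter U N j z)" for n z
    using sum_lessThan_telescope[of "\<lambda>j. iter U N j z" n] by (simp only: iter.simps(1))
  have ul': "uniform_limit UNIV (iter U N) S sequentially"
  proof -
    have "uniform_limit UNIV (\<lambda>n z. U z + (\<Sum>j<n. iter U N (Suc j) z - iter U N j z)) S sequentially"
      unfolding S_def by (intro uniform_limit_add[OF uniform_limit_const ul])
    moreover have "iter U N = (\<lambda>n z. U z + (\<Sum>j<n. iter U N (Suc j) z - iter U N j z))" using tel by (intro ext)
    ultimately show ?thesis by (simp only:)
  qed
  have lim: "(\<lambda>j. iter U N j z) \<longlonglongrightarrow> S z" for z by (rule tendsto_uniform_limitI[OF ul']) simp
  have fpS: "fp U N = S" using lim by (auto simp: fp_def fun_eq_iff intro: limI)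
  show "(\<lambda>j. iter U N j z) \<longlonglongrightarrow> fp U N z" using lim by (simp add: fpS)
  have Sc: "continuous_on UNIV S" by (rule uniform_limit_theorem[OF _ ul']) (use ic in auto)
  then show "continuous_on UNIV (fp U N)" by (simp add: fpS)
  have Sb: "\<exists>A. \<forall>z. \<bar>S z\<bar> \<le> A"
  proof -
    have "\<forall>\<^sub>F n in sequentially. \<forall>z\<in>UNIV. dist (iter U N n z) (S z) < 1" by (rule uniform_limitD[OF ul']) simp
    then obtain n where n: "\<And>z. dist (iter U N n z) (S z) < 1" by (auto simp: eventually_sequentially)
    obtain a where a: "\<And>z. \<bar>iter U N n z\<bar> \<le> a" using ic by blast
    have "\<bar>S z\<bar> \<le> a + 1" for z using n[of z] a[of z] by (simp add: dist_real_def)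
    then show ?thesis by blast
  qed
  then show "\<exists>A. \<forall>z. \<bar>fp U N z\<bar> \<le> A" by (simp add: fpS)
  have "(\<lambda>j. drift (\<lambda>z. N z (iter U N j z)) (clamp_x (fst z)) (clamp_t (snd z))) \<longlonglongrightarrow> drift (\<lambda>z. N z (S z)) (clamp_x (fst z)) (clamp_t (snd z))"
  proof (rule tendstoI)
    fix e :: real assume e: "e > 0"
    define d where "d = e / E"
    have Ep: "E > 0" by (simp add: E_def)
    have d: "d > 0" using e Ep by (simp add: d_def)
    have "\<forall>\<^sub>F n in sequentially. \<forall>z\<in>UNIV. dist (iter U N n z) (S z) < d" by (rule uniform_limitD[OF ul' d])
    then show "\<forall>\<^sub>F j in sequentially. dist (drift (\<lambda>z. N z (iter U N j z)) (clamp_x (fst z)) (clamp_t (snd z))) (drift (\<lambda>z. N z (S z)) (clamp_x (fst z)) (clamp_t (snd z))) < e"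
    proof eventually_elim
      case (elim j)
      have "\<bar>iter U N j (x, t) - S (x, t)\<bar> \<le> d * exp (l * clamp_t t)" for x t
      proof -
        have "1 \<le> exp (l * clamp_t t)" using l clamp(2)[of t] by simp
        then have "d * 1 \<le> d * exp (l * clamp_t t)" using d by (intro mult_left_mono) auto
        then show ?thesis using elim[rule_format, of "(x, t)"] by (simp add: dist_real_def)
      qed
      then have "\<bar>drift (\<lambda>z. N z (iter U N j z)) (clamp_x (fst z)) (clamp_t (snd z)) - drift (\<lambda>z. N z (S z)) (clamp_x (fst z)) (clamp_t (snd z))\<bar> \<le> d * q * exp (l * clamp_t (snd z))"
        using d by (intro contr[OF conjunct1[OF ic] conjunct2[OF ic] Sc Sb]) auto
      also have "\<dots> \<le> d * (1/2) * E" using d q E by (intro mult_mono) auto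
      also have "\<dots> < e" using e Ep by (simp add: d_def)
      finally show ?case by (simp add: dist_real_def)
    qed
  qed
  then have "(\<lambda>j. iter U N (Suc j) z) \<longlonglongrightarrow> U z + drift (\<lambda>z. N z (S z)) (clamp_x (fst z)) (clamp_t (snd z))"
    unfolding iter.simps by (intro tendsto_add tendsto_const)
  moreover have "(\<lambda>j. iter U N (Suc j) z) \<longlonglongrightarrow> S z" by (rule LIMSEQ_Suc[OF lim])
  ultimately show "fp U N z = U z + drift (\<lambda>z. N z (fp U N z)) (clamp_x (fst z)) (clamp_t (snd z))"
    unfolding fpS by (metis LIMSEQ_unique)
qed

end

section \<open>Paths in \<open>H\<close> and the exit time\<close>

text \<open>The quotient \<open>v / x\<close>, completed at \<open>x = 0\<close> by the slope, so
  that \<open>ux0\<close> becomes a boundary value and \<open>H_norm\<close> a supremum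
  norm.\<close>

definition quotient :: "(real \<Rightarrow> real \<Rightarrow> real) \<Rightarrow> real \<times> real \<Rightarrow> real" where
  "quotient v z = (if fst z = 0 then Lim (at_right 0) (\<lambda>x. v x (snd z) / x) else v (fst z) (snd z) / fst z)"

lemma ux0_quotient: "ux0 u t \<omega> = quotient (\<lambda>x t. u x t \<omega>) (0, t)"
  by (simp add: ux0_def quotient_def)

lemma H_space_quotient_limit:
  assumes "L > 0" "f \<in> H_space L" shows "((\<lambda>x. f x / x) \<longlongrightarrow> Lim (at_right 0) (\<lambda>x. f x / x)) (at_right 0)"
proof -
  have "f differentiable (at 0 within {0..L})" "f 0 = 0" using assms by (auto simp: H_space_def)
  then obtain D where "(f has_real_derivative D) (at 0 within {0..L})" by (auto simp: real_differentiable_def)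
  then have "((\<lambda>x. f x / x) \<longlongrightarrow> D) (at 0 within {0..L})"
    using \<open>f 0 = 0\<close> by (simp add: has_field_derivative_iff)
  then have l: "((\<lambda>x. f x / x) \<longlongrightarrow> D) (at_right 0)" using assms(1) by (simp add: at_within_Icc_at_right)
  then have "Lim (at_right 0) (\<lambda>x. f x / x) = D" by (intro tendsto_Lim) simp_all
  with l show ?thesis by simp
qed

lemma quotient_slice_continuous:
  assumes L: "L > 0" and f: "(\<lambda>x. v x t) \<in> H_space L"
  shows "continuous_on {0..L} (\<lambda>x. quotient v (x, t))"
proof -
  have "continuous (at x within {0..L}) (\<lambda>x. quotient v (x, t))" if x: "x \<in> {0..L}" for x
  proof (cases "x = 0")
    case True
    have "((\<lambda>x. v x t / x) \<longlongrightarrow> quotient v (0, t)) (at_right 0)"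
      using H_space_quotient_limit[OF L f] by (simp add: quotient_def)
    then have "((\<lambda>x. quotient v (x, t)) \<longlongrightarrow> quotient v (0, t)) (at_right 0)"
      by (rule Lim_transform_eventually) (auto simp: eventually_at_filter quotient_def)
    then show ?thesis using L True by (simp add: continuous_within at_within_Icc_at_right)
  next
    case False
    have "continuous_on {0..L} (\<lambda>x. v x t)" using f by (simp add: H_space_def)
    then have "continuous (at x within {0..L}) (\<lambda>x. v x t)" using x by (simp add: continuous_on_eq_continuous_within)
    then have "((\<lambda>x. v x t / x) \<longlongrightarrow> v x t / x) (at x within {0..L})"
      unfolding continuous_within using False by (intro tendsto_divide tendsto_ident_at) auto
    moreover have "\<forall>\<^sub>F y in at x within {0..L}. v y t / y = quotient v (y, t)"
    proof -
      have "\<forall>\<^sub>F y in nhds x. y \<noteq> 0" using t1_space_nhds[OF False] .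
      then have "\<forall>\<^sub>F y in at x within {0..L}. y \<noteq> 0" by (simp add: eventually_at_filter eventually_mono)
      then show ?thesis by eventually_elim (simp add: quotient_def)
    qed
    ultimately have "((\<lambda>x. quotient v (x, t)) \<longlongrightarrow> v x t / x) (at x within {0..L})"
      by (rule Lim_transform_eventually)
    then show ?thesis using False by (simp add: continuous_within quotient_def)
  qed
  then show ?thesis by (simp add: continuous_on_eq_continuous_within)
qed

text \<open>\<open>H_norm\<close> sees only the open interval; continuity of the quotients carries
  its bound to both end points, in particular to the slopes.\<close>

lemma quotient_diff_le:
  assumes L: "L > 0" and s: "(\<lambda>x. v x s) \<in> H_space L" and t: "(\<lambda>x. v x t) \<in> H_space L"
    and e: "H_norm L (\<lambda>x. v x s - v x t) \<le> ennreal e" "e \<ge> 0" and x: "x \<in> {0..L}"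
  shows "\<bar>quotient v (x, s) - quotient v (x, t)\<bar> \<le> e"
proof -
  have inner: "\<bar>quotient v (x, s) - quotient v (x, t)\<bar> \<le> e" if x: "x \<in> {0<..<L}" for x
  proof -
    have "ennreal \<bar>(v x s - v x t) / x\<bar> \<le> ennreal e"
      using e(1) x unfolding H_norm_def by (meson SUP_le_iff)
    then show ?thesis using e(2) x by (simp add: quotient_def diff_divide_distrib)
  qed
  have c: "continuous_on {0..L} (\<lambda>x. \<bar>quotient v (x, s) - quotient v (x, t)\<bar>)"
    by (intro continuous_intros quotient_slice_continuous L s t)
  have "closure {0<..<L} = {0..L}" using L by (rule closure_greaterThanLessThan)
  then show ?thesis
    using continuous_le_on_closure[of "{0<..<L}" "\<lambda>x. \<bar>quotient v (x, s) - quotient v (x, t)\<bar>" x e] c x inner by simp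
qed

text \<open>The increment is split at \<open>(xs n, t)\<close>: the change in time is small
  uniformly in space by continuity in the \<open>H\<close> norm, and the change in space is
  continuity of one slice.\<close>

lemma quotient_continuous:
  assumes L: "L > 0" and v: "v \<in> H_paths L \<zeta>"
  shows "continuous_on ({0..L} \<times> {t. 0 \<le> t \<and> ereal t < \<zeta>}) (quotient v)"
proof (rule continuous_on_sequentiallyI)
  fix zs z assume zs: "\<forall>n. zs n \<in> {0..L} \<times> {t. 0 \<le> t \<and> ereal t < \<zeta>}"
    and z: "z \<in> {0..L} \<times> {t. 0 \<le> t \<and> ereal t < \<zeta>}" and lim: "zs \<longlonglongrightarrow> z"
  define x t where "x = fst z" and "t = snd z"
  define xs ts where "xs = (\<lambda>n. fst (zs n))" and "ts = (\<lambda>n. snd (zs n))"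
  have xl: "xs \<longlonglongrightarrow> x" and tl: "ts \<longlonglongrightarrow> t" using lim by (auto simp: xs_def ts_def x_def t_def intro: tendsto_intros)
  let ?I = "{t. 0 \<le> t \<and> ereal t < \<zeta>}"
  have t: "t \<in> ?I" and x: "x \<in> {0..L}" using z by (auto simp: x_def t_def)
  have ts: "ts n \<in> ?I" and xs: "xs n \<in> {0..L}" for n using zs by (auto simp: xs_def ts_def mem_Times_iff)
  have H: "(\<lambda>x. v x s) \<in> H_space L" if "s \<in> ?I" for s using v that by (simp add: H_paths_def)
  have Hl: "((\<lambda>s. H_norm L (\<lambda>x. v x s - v x t)) \<longlongrightarrow> 0) (at t within ?I)"
    using v t by (simp add: H_paths_def)
  have d: "(\<lambda>n. quotient v (xs n, ts n) - quotient v (xs n, t)) \<longlonglongrightarrow> 0"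
  proof (rule tendstoI)
    fix e :: real assume e: "e > 0"
    have "\<forall>\<^sub>F s in at t within ?I. H_norm L (\<lambda>x. v x s - v x t) < ennreal (e / 2)"
      by (rule order_tendstoD(2)[OF Hl]) (use e in simp)
    then have "\<forall>\<^sub>F s in nhds t. s \<in> ?I \<longrightarrow> H_norm L (\<lambda>x. v x s - v x t) \<le> ennreal (e / 2)"
    proof -
      \<comment> \<open>The limit filter omits the time \<open>t\<close> itself, but
        \<open>ts n\<close> may equal \<open>t\<close>.\<close>
      have "H_norm L (\<lambda>x. v x t - v x t) \<le> ennreal (e / 2)" by (simp add: H_norm_def SUP_le_iff)
      with \<open>\<forall>\<^sub>F s in at t within ?I. H_norm L (\<lambda>x. v x s - v x t) < ennreal (e / 2)\<close> show ?thesis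
        unfolding eventually_at_filter by (auto elim!: eventually_mono intro: less_imp_le)
    qed
    then have "\<forall>\<^sub>F n in sequentially. ts n \<in> ?I \<longrightarrow> H_norm L (\<lambda>x. v x (ts n) - v x t) \<le> ennreal (e / 2)"
      by (rule eventually_compose_filterlim[OF _ tl])
    then show "\<forall>\<^sub>F n in sequentially. dist (quotient v (xs n, ts n) - quotient v (xs n, t)) 0 < e"
    proof eventually_elim
      case (elim n)
      then have "\<bar>quotient v (xs n, ts n) - quotient v (xs n, t)\<bar> \<le> e / 2"
        using e ts[of n] by (intro quotient_diff_le[where v=v and s="ts n" and t=t, OF L H[OF ts] H[OF t] _ _ xs]) auto
      then show ?case using e by simp
    qed
  qed
  have "(\<lambda>n. quotient v (xs n, t)) \<longlonglongrightarrow> quotient v (x, t)"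
    by (rule continuous_on_tendsto_compose[OF quotient_slice_continuous[where v=v and t=t, OF L H[OF t]] xl x]) (use xs in auto)
  from tendsto_add[OF d this] have "(\<lambda>n. quotient v (xs n, ts n)) \<longlonglongrightarrow> quotient v (x, t)" by simp
  then show "(\<lambda>n. quotient v (zs n)) \<longlonglongrightarrow> quotient v z" by (simp add: xs_def ts_def x_def t_def)
qed

text \<open>The converse passage: uniform continuity on the compact rectangle gives continuity in
  time in the \<open>H\<close> norm, and the slope at 0 is \<open>w (0, t)\<close>.\<close>

lemma H_paths_of_quotient:
  assumes L: "L > 0" and w: "continuous_on ({0..L} \<times> {0..T}) w" and wL: "\<And>t. t \<in> {0..T} \<Longrightarrow> w (L, t) = 0"
  shows "(\<lambda>x t. x * w (x, t)) \<in> H_paths L (ereal T)"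
proof -
  have sl: "continuous_on {0..L} (\<lambda>x. w (x, t))" if "t \<in> {0..T}" for t
    by (rule continuous_on_compose2[OF w continuous_on_Pair[OF continuous_on_id continuous_on_const]]) (use that in auto)
  have H: "(\<lambda>x. x * w (x, t)) \<in> H_space L" if t: "t \<in> {0..T}" for t
  proof -
    have "((\<lambda>x. w (x, t)) \<longlongrightarrow> w (0, t)) (at 0 within {0..L})"
      using sl[OF t] L by (auto simp: continuous_on_def)
    then have "((\<lambda>x. (x * w (x, t) - 0 * w (0, t)) / (x - 0)) \<longlongrightarrow> w (0, t)) (at 0 within {0..L})"
      by (rule Lim_transform_eventually) (auto simp: eventually_at_filter)
    then have "((\<lambda>x. x * w (x, t)) has_real_derivative w (0, t)) (at 0 within {0..L})"
      by (simp only: has_field_derivative_iff)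
    then have "(\<lambda>x. x * w (x, t)) differentiable (at 0 within {0..L})" by (auto simp: real_differentiable_def)
    then show ?thesis using sl[OF t] wL[OF t] by (auto simp: H_space_def intro!: continuous_intros)
  qed
  have "((\<lambda>s. H_norm L (\<lambda>x. x * w (x, s) - x * w (x, t))) \<longlongrightarrow> 0) (at t within {s. 0 \<le> s \<and> ereal s < ereal T})"
    if t: "t \<in> {0..T}" for t
  proof (rule order_tendstoI)
    fix a :: ennreal assume "0 < a"
    then obtain b where b: "0 < b" "b < a" using dense by blast
    then obtain e where "b = ennreal e" by (cases b) auto
    with b have e: "0 < e" "ennreal e < a" by auto
    have "uniformly_continuous_on ({0..L} \<times> {0..T}) w"
      by (rule compact_uniformly_continuous[OF w]) (intro compact_Times compact_Icc)
    then have "\<exists>d>0. \<forall>z\<in>{0..L} \<times> {0..T}. \<forall>z'\<in>{0..L} \<times> {0..T}. dist z' z < d \<longrightarrow> dist (w z') (w z) < e"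
      using e(1) by (simp only: uniformly_continuous_on_def)
    then obtain d where d: "d > 0" "\<And>z z'. z \<in> {0..L} \<times> {0..T} \<Longrightarrow> z' \<in> {0..L} \<times> {0..T} \<Longrightarrow> dist z' z < d \<Longrightarrow> dist (w z') (w z) < e"
      by metis
    have "H_norm L (\<lambda>x. x * w (x, s) - x * w (x, t)) < a" if s: "s \<in> {0..T}" "dist s t < d" for s
    proof -
      have "H_norm L (\<lambda>x. x * w (x, s) - x * w (x, t)) \<le> ennreal e" unfolding H_norm_def
      proof (rule SUP_least)
        fix x assume x: "x \<in> {0<..<L}"
        have "dist (x, s) (x, t) < d" using s by (simp add: dist_Pair_Pair)
        then have "dist (w (x, s)) (w (x, t)) < e" using d(2)[of "(x, t)" "(x, s)"] x s t by auto
        moreover have "(x * w (x, s) - x * w (x, t)) / x = w (x, s) - w (x, t)" using x by (simp add: diff_divide_distrib)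
        ultimately show "ennreal \<bar>(x * w (x, s) - x * w (x, t)) / x\<bar> \<le> ennreal e" by (simp add: dist_real_def ennreal_leI)
      qed
      then show ?thesis using e(2) by (rule le_less_trans)
    qed
    then show "\<forall>\<^sub>F s in at t within {s. 0 \<le> s \<and> ereal s < ereal T}. H_norm L (\<lambda>x. x * w (x, s) - x * w (x, t)) < a"
      unfolding eventually_at using d(1) by (intro exI[of _ d]) auto
  qed simp
  then show ?thesis unfolding H_paths_def using H by (intro CollectI allI impI conjI) simp_all
qed

text \<open>The strict inequality in \<open>Omega_M\<close> excludes an exit by time
  \<open>T\<close>. If the exit time were some \<open>t0 <= T\<close>, the slope would be bounded
  before \<open>t0\<close> by some \<open>m < M\<close>, hence by continuity would stay below a
  level \<open>m' < M\<close> slightly beyond \<open>t0\<close>, and the infimum could not be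
  \<open>t0\<close>.\<close>

lemma stopped_time_eq:
  fixes \<omega> :: 'a
  assumes L: "L > 0" and T: "T > 0" and M: "M > 0"
    and path: "(\<lambda>x t. u x t \<omega>) \<in> H_paths L (\<zeta> \<omega>)"
    and zeta: "\<zeta> \<omega> = (SUP M \<in> {0<..}. exit_time u \<zeta> M \<omega>)"
    and zero: "0 < \<zeta> \<omega> \<Longrightarrow> ux0 u 0 \<omega> = 0"
    and om: "sup_ux0 u \<zeta> (stopped_time u \<zeta> T M \<omega>) \<omega> < ereal M"
  shows "stopped_time u \<zeta> T M \<omega> = ereal T" "ereal T < \<zeta> \<omega>" "t \<in> {0..T} \<Longrightarrow> \<bar>ux0 u t \<omega>\<bar> \<le> M"
proof -
  define a where "a = (\<lambda>r. ux0 u r \<omega>)"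
  define \<tau> where "\<tau> = exit_time u \<zeta> M \<omega>"
  let ?I = "{t. 0 \<le> t \<and> ereal t < \<zeta> \<omega>}"
  have ac: "continuous_on ?I a"
    unfolding a_def ux0_quotient
    by (rule continuous_on_compose2[OF quotient_continuous[OF L path]]) (use L in \<open>auto intro!: continuous_intros\<close>)
  have sup_le: "sup_ux0 u \<zeta> S \<omega> \<le> ereal m" if "\<And>r. 0 \<le> r \<Longrightarrow> ereal r < S \<Longrightarrow> ereal r < \<zeta> \<omega> \<Longrightarrow> \<bar>a r\<bar> \<le> m" for S m
    unfolding sup_ux0_def by (rule SUP_least) (use that in \<open>auto simp: a_def\<close>)
  have le_sup: "ereal \<bar>a r\<bar> \<le> sup_ux0 u \<zeta> S \<omega>" if "0 \<le> r" "ereal r < S" "ereal r < \<zeta> \<omega>" for r S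
    unfolding sup_ux0_def a_def by (rule SUP_upper) (use that in auto)
  have tau_gt: "ereal T < \<tau>"
  proof (rule ccontr)
    assume "\<not> ereal T < \<tau>"
    then have le: "\<tau> \<le> ereal T" by simp
    have "0 \<le> \<tau>" unfolding \<tau>_def exit_time_def by (rule Inf_greatest) auto
    with le obtain t0 where t0: "\<tau> = ereal t0" "0 \<le> t0" by (cases \<tau>) auto
    have st: "stopped_time u \<zeta> T M \<omega> = ereal t0" using le t0 by (simp add: stopped_time_def \<tau>_def[symmetric] min_def)
    have less: "sup_ux0 u \<zeta> (ereal t0) \<omega> < ereal M" using om st by simp
    obtain m where m: "sup_ux0 u \<zeta> (ereal t0) \<omega> \<le> ereal m" "m < M" "0 \<le> m"
    proof -
      obtain z where z: "sup_ux0 u \<zeta> (ereal t0) \<omega> < z" "z < ereal M" using dense[OF less] by blast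
      show thesis
      proof (rule that[of "max 0 (real_of_ereal z)"])
        have "z \<noteq> \<infinity>" using z(2) by auto
        moreover have "z \<noteq> -\<infinity>" using z(1) by auto
        ultimately obtain r where r: "z = ereal r" by (cases z) auto
        then show "sup_ux0 u \<zeta> (ereal t0) \<omega> \<le> ereal (max 0 (real_of_ereal z))"
          using z(1) by (auto intro: order_trans[OF less_imp_le])
        show "max 0 (real_of_ereal z) < M" using z(2) r M by simp
      qed simp
    qed
    \<comment> \<open>If the path ends by time \<open>t0\<close>, no later slope is counted and the
      old bound persists. Otherwise the slope at \<open>t0\<close> exists and is controlled by
      continuity.\<close>
    have exit: "\<exists>m<M. \<exists>d>0. \<forall>S. S < t0 + d \<longrightarrow> sup_ux0 u \<zeta> (ereal S) \<omega> \<le> ereal m"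
    proof (cases "\<zeta> \<omega> \<le> ereal t0")
      case True
      have "sup_ux0 u \<zeta> (ereal S) \<omega> \<le> ereal m" for S
      proof (rule sup_le)
        fix r assume r: "0 \<le> r" "ereal r < ereal S" "ereal r < \<zeta> \<omega>"
        have "ereal r < ereal t0" using r(3) True by (rule less_le_trans)
        from order_trans[OF le_sup[OF r(1) this r(3)] m(1)] show "\<bar>a r\<bar> \<le> m" by simp
      qed
      then show ?thesis using m(2) by (intro exI[of _ m] conjI exI[of _ 1]) auto
    next
      case False
      then have t0I: "t0 \<in> ?I" using t0 by simp
      have "\<bar>a t0\<bar> < M"
      \<comment> \<open>For \<open>t0 = 0\<close> the supremum ranges over the empty set and says
        nothing about the slope at that time; the vanishing initial slope is used instead.\<close>
      proof (cases "t0 = 0")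
        case True
        then show ?thesis using zero t0I M by (simp add: a_def zero_ereal_def)
      next
        case False
        have "continuous_on {0..t0} a"
          by (rule continuous_on_subset[OF ac]) (use t0I in \<open>auto intro: le_less_trans[of "ereal _" "ereal t0"]\<close>)
        then have "continuous_on {0..t0} (\<lambda>r. \<bar>a r\<bar>)" by (intro continuous_intros)
        moreover have "closure {0<..<t0} = {0..t0}" using False t0 by (intro closure_greaterThanLessThan) auto
        moreover have "\<bar>a r\<bar> \<le> m" if "r \<in> {0<..<t0}" for r
        proof -
          have "ereal r < \<zeta> \<omega>" using that t0I by (auto intro: less_trans[of "ereal r" "ereal t0"])
          from order_trans[OF le_sup[of r "ereal t0"] m(1)] this that show ?thesis by simp
        qed
        ultimately have "\<bar>a t0\<bar> \<le> m"
          using continuous_le_on_closure[of "{0<..<t0}" "\<lambda>r. \<bar>a r\<bar>" t0 m] t0 by simp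
        then show ?thesis using m(2) by simp
      qed
      define m' where "m' = (max m \<bar>a t0\<bar> + M) / 2"
      have m': "m < m'" "\<bar>a t0\<bar> < m'" "m' < M" using m(2) \<open>\<bar>a t0\<bar> < M\<close> by (auto simp: m'_def)
      have "continuous (at t0 within ?I) a" using ac t0I by (simp add: continuous_on_eq_continuous_within)
      then have "\<forall>e>0. \<exists>d>0. \<forall>r\<in>?I. dist r t0 < d \<longrightarrow> dist (a r) (a t0) < e"
        by (simp add: continuous_within_eps_delta)
      moreover have "0 < m' - \<bar>a t0\<bar>" using m'(2) by simp
      ultimately obtain d where d: "d > 0" "\<And>r. r \<in> ?I \<Longrightarrow> dist r t0 < d \<Longrightarrow> dist (a r) (a t0) < m' - \<bar>a t0\<bar>" by blast
      have "sup_ux0 u \<zeta> (ereal S) \<omega> \<le> ereal m'" if S: "S < t0 + d" for S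
      proof (rule sup_le)
        fix r assume r: "0 \<le> r" "ereal r < ereal S" "ereal r < \<zeta> \<omega>"
        show "\<bar>a r\<bar> \<le> m'"
        proof (cases "r < t0")
          case True
          then have "ereal \<bar>a r\<bar> \<le> ereal m" using order_trans[OF le_sup[of r "ereal t0"] m(1)] r by simp
          then show ?thesis using m'(1) by simp
        next
          case False
          then have "dist (a r) (a t0) < m' - \<bar>a t0\<bar>" using d(2)[of r] r S by (auto simp: dist_real_def)
          then show ?thesis by (simp add: dist_real_def)
        qed
      qed
      then show ?thesis using m'(3) d(1) by (intro exI[of _ m'] conjI exI[of _ d]) auto
    qed
    then obtain m2 d where md: "m2 < M" "d > 0" "\<And>S. S < t0 + d \<Longrightarrow> sup_ux0 u \<zeta> (ereal S) \<omega> \<le> ereal m2" by blast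
    have "ereal (t0 + d) \<le> \<tau>" unfolding \<tau>_def exit_time_def
    proof (rule Inf_greatest)
      fix z assume "z \<in> {ereal S |S. 0 \<le> S \<and> ereal M \<le> sup_ux0 u \<zeta> (ereal S) \<omega>}"
      then obtain S where S: "z = ereal S" "ereal M \<le> sup_ux0 u \<zeta> (ereal S) \<omega>" by blast
      have "\<not> S < t0 + d"
      proof
        assume "S < t0 + d"
        from order_trans[OF S(2) md(3)[OF this]] md(1) show False by simp
      qed
      then show "ereal (t0 + d) \<le> z" by (simp add: S)
    qed
    then show False using t0 md(2) by simp
  qed
  then show st: "stopped_time u \<zeta> T M \<omega> = ereal T"
    unfolding stopped_time_def \<tau>_def[symmetric] by (intro min_absorb1 less_imp_le)
  have "\<tau> \<le> \<zeta> \<omega>" unfolding \<tau>_def zeta by (rule SUP_upper) (use M in simp)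
  with tau_gt show Tz: "ereal T < \<zeta> \<omega>" by (rule less_le_trans)
  assume t: "t \<in> {0..T}"
  have "continuous_on {0..T} a"
    by (rule continuous_on_subset[OF ac]) (use Tz in \<open>auto intro: le_less_trans[of "ereal _" "ereal T"]\<close>)
  then have "continuous_on {0..T} (\<lambda>r. \<bar>a r\<bar>)" by (intro continuous_intros)
  moreover have "closure {0<..<T} = {0..T}" using T by (intro closure_greaterThanLessThan) auto
  moreover have "\<bar>a r\<bar> \<le> M" if r: "r \<in> {0<..<T}" for r
  proof -
    have "ereal r < \<zeta> \<omega>" using r Tz by (auto intro: less_trans[of "ereal r" "ereal T"])
    then have "ereal \<bar>a r\<bar> \<le> sup_ux0 u \<zeta> (ereal T) \<omega>" using r by (intro le_sup) auto
    also have "\<dots> < ereal M" using om st by simp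
    finally show ?thesis by simp
  qed
  ultimately have "\<bar>a t\<bar> \<le> M"
    using continuous_le_on_closure[of "{0<..<T}" "\<lambda>r. \<bar>a r\<bar>" t M] t by simp
  then show "\<bar>ux0 u t \<omega>\<bar> \<le> M" by (simp add: a_def)
qed

section \<open>Measurability and the cut-off\<close>

text \<open>Rounding the point down to the grid of mesh \<open>1 / (k + 1)\<close> leaves countably
  many values in the second argument, so joint measurability is clear there; continuity in that
  argument gives the limit.\<close>

lemma caratheodory_measurable:
  fixes f :: "'a \<Rightarrow> real \<times> real \<Rightarrow> real"
  assumes m: "\<And>z. (\<lambda>w. f w z) \<in> borel_measurable M" and c: "\<And>w. continuous_on UNIV (f w)"
  shows "(\<lambda>p. f (fst p) (snd p)) \<in> borel_measurable (M \<Otimes>\<^sub>M borel)"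
proof (rule borel_measurable_LIMSEQ_real)
  define g where "g = (\<lambda>k p. f (fst p) (of_int \<lfloor>real (Suc k) * fst (snd p)\<rfloor> / real (Suc k), of_int \<lfloor>real (Suc k) * snd (snd p)\<rfloor> / real (Suc k)))"
  show "(\<lambda>p. g k p) \<in> borel_measurable (M \<Otimes>\<^sub>M borel)" for k
  proof -
    have f: "fst \<in> borel_measurable (borel :: (real \<times> real) measure)" "snd \<in> borel_measurable (borel :: (real \<times> real) measure)"
      by (intro borel_measurable_continuous_onI continuous_intros)+
    have fs: "(\<lambda>p. fst (snd p)) \<in> borel_measurable (M \<Otimes>\<^sub>M (borel :: (real \<times> real) measure))"
      "(\<lambda>p. snd (snd p)) \<in> borel_measurable (M \<Otimes>\<^sub>M (borel :: (real \<times> real) measure))"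
      by (rule measurable_compose[OF measurable_snd f(1)], rule measurable_compose[OF measurable_snd f(2)])
    have fl: "(\<lambda>p. \<lfloor>real (Suc k) * h p\<rfloor>) \<in> measurable (M \<Otimes>\<^sub>M borel) (count_space UNIV)"
      if [measurable]: "h \<in> borel_measurable (M \<Otimes>\<^sub>M borel)" for h :: "'a \<times> real \<times> real \<Rightarrow> real" by measurable
    have 0: "(\<lambda>p. f (fst p) z) \<in> borel_measurable (M \<Otimes>\<^sub>M (borel :: (real \<times> real) measure))" for z
      using measurable_compose[OF measurable_fst m] .
    have 1: "(\<lambda>p. f (fst p) (of_int \<lfloor>real (Suc k) * fst (snd p)\<rfloor> / real (Suc k), of_int j / real (Suc k))) \<in> borel_measurable (M \<Otimes>\<^sub>M (borel :: (real \<times> real) measure))" for j :: int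
      
      by (rule measurable_compose_countable[where f="\<lambda>i p. f (fst p) (of_int i / real (Suc k), of_int j / real (Suc k))"
        and g="\<lambda>p. \<lfloor>real (Suc k) * fst (snd p)\<rfloor>", OF 0 fl[OF fs(1)]])
    show ?thesis unfolding g_def
      
      by (rule measurable_compose_countable[where f="\<lambda>j p. f (fst p) (of_int \<lfloor>real (Suc k) * fst (snd p)\<rfloor> / real (Suc k), of_int j / real (Suc k))"
        and g="\<lambda>p. \<lfloor>real (Suc k) * snd (snd p)\<rfloor>", OF 1 fl[OF fs(2)]])
  qed
  have fl: "(\<lambda>k. of_int \<lfloor>real (Suc k) * x\<rfloor> / real (Suc k)) \<longlonglongrightarrow> x" for x :: real
  proof (rule Lim_null[THEN iffD2], rule Lim_null_comparison)
    show "\<forall>\<^sub>F k in sequentially. norm (of_int \<lfloor>real (Suc k) * x\<rfloor> / real (Suc k) - x) \<le> inverse (real (Suc k))"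
    proof (intro always_eventually allI)
      fix k
      have "of_int \<lfloor>real (Suc k) * x\<rfloor> / real (Suc k) - x = (of_int \<lfloor>real (Suc k) * x\<rfloor> - real (Suc k) * x) / real (Suc k)"
        by (simp add: diff_divide_distrib del: of_nat_Suc)
      moreover have "\<bar>of_int \<lfloor>real (Suc k) * x\<rfloor> - real (Suc k) * x\<bar> \<le> 1"
        using floor_correct[of "real (Suc k) * x"] by linarith
      ultimately show "norm (of_int \<lfloor>real (Suc k) * x\<rfloor> / real (Suc k) - x) \<le> inverse (real (Suc k))"
        by (simp add: divide_inverse abs_mult mult_left_le_one_le del: of_nat_Suc)
    qed
    show "(\<lambda>k. inverse (real (Suc k))) \<longlonglongrightarrow> 0" by (rule LIMSEQ_inverse_real_of_nat)
  qed
  fix p :: "'a \<times> real \<times> real"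
  have "(\<lambda>k. g k p) \<longlonglongrightarrow> f (fst p) (fst (snd p), snd (snd p))" unfolding g_def
    by (rule continuous_on_tendsto_compose[OF c tendsto_Pair[OF fl fl]]) simp_all
  then show "(\<lambda>k. g k p) \<longlonglongrightarrow> f (fst p) (snd p)" by simp
qed

context heat_horizon
begin

lemma drift_measurable:
  fixes F :: "'a \<Rightarrow> real \<times> real \<Rightarrow> real"
  assumes F: "(\<lambda>p. F (fst p) (snd p)) \<in> borel_measurable (M \<Otimes>\<^sub>M borel)"
  shows "(\<lambda>w. drift (F w) x t) \<in> borel_measurable M"
proof -
  have [measurable]: "(\<lambda>q. F (fst (fst q)) (snd q, t - snd (fst q))) \<in> borel_measurable ((M \<Otimes>\<^sub>M borel) \<Otimes>\<^sub>M borel)"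
  proof -
    have "(\<lambda>q. (fst (fst q), (snd q, t - snd (fst q)))) \<in> measurable ((M \<Otimes>\<^sub>M borel) \<Otimes>\<^sub>M borel) (M \<Otimes>\<^sub>M (borel \<Otimes>\<^sub>M borel))"
      by measurable
    from measurable_compose[OF this, of "\<lambda>p. F (fst p) (snd p)"] F show ?thesis by (simp add: borel_prod)
  qed
  have [measurable]: "(\<lambda>p. slice (F (fst p)) x t (snd p)) \<in> borel_measurable (M \<Otimes>\<^sub>M borel)"
    unfolding slice_def
    by (rule lborel.borel_measurable_lebesgue_integral) (simp add: split_beta', measurable)
  show ?thesis unfolding drift_def
    by (rule lborel.borel_measurable_lebesgue_integral) (simp add: split_beta', measurable)
qed

lemma iter_measurable:
  assumes U: "\<And>z. (\<lambda>w. U w z) \<in> borel_measurable M" "\<And>w. continuous_on UNIV (U w)" "\<And>w. \<exists>A. \<forall>z. \<bar>U w z\<bar> \<le> A"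
    and N: "\<And>w. \<exists>c B. nonlinearity (N w) c B"
    and Nm: "\<And>h z. h \<in> borel_measurable M \<Longrightarrow> (\<lambda>w. N w z (h w)) \<in> borel_measurable M"
  shows "(\<lambda>w. iter (U w) (N w) j z) \<in> borel_measurable M"
proof (induction j arbitrary: z)
  case 0
  then show ?case by (simp add: U)
next
  case (Suc j)
  have "continuous_on UNIV (\<lambda>z. N w z (iter (U w) (N w) j z))" for w
  proof -
    obtain c B A where n: "nonlinearity (N w) c B" and A: "\<And>z. \<bar>U w z\<bar> \<le> A" using N[of w] U(3)[of w] by blast
    from nonlinearity_continuous[OF n] iter_continuous_bounded[OF U(2) A n, of j] show ?thesis by blast
  qed
  then have "(\<lambda>w. drift (\<lambda>z. N w z (iter (U w) (N w) j z)) x t) \<in> borel_measurable M" for x t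
    by (intro drift_measurable caratheodory_measurable Nm Suc)
  then show ?case using U(1) by simp
qed

lemma fp_measurable:
  assumes U: "\<And>z. (\<lambda>w. U w z) \<in> borel_measurable M" "\<And>w. continuous_on UNIV (U w)" "\<And>w. \<exists>A. \<forall>z. \<bar>U w z\<bar> \<le> A"
    and N: "\<And>w. \<exists>c B. nonlinearity (N w) c B"
    and Nm: "\<And>h z. h \<in> borel_measurable M \<Longrightarrow> (\<lambda>w. N w z (h w)) \<in> borel_measurable M"
  shows "(\<lambda>w. fp (U w) (N w) z) \<in> borel_measurable M"
proof (rule borel_measurable_LIMSEQ_real[OF _ iter_measurable[OF assms]])
  fix w
  obtain c B A where n: "nonlinearity (N w) c B" and A: "\<And>z. \<bar>U w z\<bar> \<le> A" using N[of w] U(3)[of w] by blast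
  show "(\<lambda>j. iter (U w) (N w) j z) \<longlonglongrightarrow> fp (U w) (N w) z"
    by (rule fixed_point(4)[OF U(2) A n])
qed

text \<open>Every sine in the kernel vanishes at \<open>x = L\<close>. This preserves the Dirichlet
  condition at the right end under the Picard map.\<close>

lemma drift_right_end: "drift F L t = 0"
proof -
  have "quot j L = 0" for j using L by (simp add: quot_def mu_def)
  then have "kap L y r = 0" for y r by (simp add: kap_def coef_def)
  then show ?thesis by (simp add: drift_def slice_def)
qed

end

text \<open>The derivative \<open>H' v + H\<close> is at most \<open>2 * (n + 1) + 1\<close> in
  absolute value for \<open>|v| <= n + 1\<close> and vanishes beyond, where \<open>H\<close> is
  locally zero; the mean value theorem gives the Lipschitz constant.\<close>

lemma cutoff_T_bounds:
  assumes H: "cutoff_function n H"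
  shows "\<bar>cutoff_T H v - cutoff_T H v'\<bar> \<le> (2 * real n + 3) * \<bar>v - v'\<bar>"
    and "\<bar>cutoff_T H v\<bar> \<le> real n + 1" and "continuous_on UNIV (cutoff_T H)"
proof -
  have diff: "H differentiable (at v)" for v
    using H by (auto simp: cutoff_function_def C1_differentiable_on_eq)
  have H01: "0 \<le> H v" "H v \<le> 1" "\<bar>deriv H v\<bar> \<le> 2" and H0: "\<bar>v\<bar> > real n + 1 \<Longrightarrow> H v = 0" for v
    using H by (auto simp: cutoff_function_def)
  have DH: "(H has_real_derivative deriv H v) (at v)" for v
    using diff DERIV_deriv_iff_real_differentiable by blast
  have D: "(cutoff_T H has_real_derivative deriv H v * v + H v) (at v)" for v
    unfolding cutoff_T_def[abs_def] using DERIV_mult[OF DH DERIV_ident, of v] by (simp add: mult.commute)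
  have bd: "norm (deriv H v * v + H v) \<le> 2 * real n + 3" for v
  proof (cases "\<bar>v\<bar> \<le> real n + 1")
    case True
    have "\<bar>deriv H v * v + H v\<bar> \<le> \<bar>deriv H v\<bar> * \<bar>v\<bar> + \<bar>H v\<bar>" by (metis abs_mult abs_triangle_ineq)
    also have "\<dots> \<le> 2 * (real n + 1) + 1" using True H01[of v] by (intro add_mono mult_mono) auto
    finally show ?thesis by simp
  next
    case False
    have "open {v. \<bar>v\<bar> > real n + 1}" by (intro open_Collect_less continuous_intros)
    then have "eventually (\<lambda>v. \<bar>v\<bar> > real n + 1) (nhds v)"
      using False by (intro eventually_nhds_in_open[of "{v. \<bar>v\<bar> > real n + 1}", simplified]) auto
    then have "eventually (\<lambda>v. H v = 0) (nhds v)" by eventually_elim (rule H0)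
    then have "deriv H v = deriv (\<lambda>_. 0) v" by (rule deriv_cong_ev) simp
    then show ?thesis using False H0[of v] by simp
  qed
  have "norm (cutoff_T H v - cutoff_T H v') \<le> (2 * real n + 3) * norm (v - v')"
    by (rule field_differentiable_bound[OF convex_UNIV _ bd]) (use D in auto)
  then show "\<bar>cutoff_T H v - cutoff_T H v'\<bar> \<le> (2 * real n + 3) * \<bar>v - v'\<bar>" by simp
  show "\<bar>cutoff_T H v\<bar> \<le> real n + 1"
  proof (cases "\<bar>v\<bar> \<le> real n + 1")
    case True
    have "\<bar>H v\<bar> * \<bar>v\<bar> \<le> 1 * (real n + 1)" using True H01[of v] by (intro mult_mono) auto
    then show ?thesis by (simp add: cutoff_T_def abs_mult)
  qed (simp add: cutoff_T_def H0)
  show "continuous_on UNIV (cutoff_T H)" using D by (intro DERIV_continuous_on) auto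
qed

text \<open>The defining predicates coincide, so the choice operator returns the same
  representative: equality holds everywhere, not only almost surely.\<close>

lemma wiener_integral_cong:
  assumes "\<And>z. z \<in> S \<Longrightarrow> f z = g z" shows "wiener_integral P W S f = wiener_integral P W S g"
proof -
  have "(\<integral>\<^sup>+z\<in>S. ennreal ((h z - f z)\<^sup>2) \<partial>lborel) = (\<integral>\<^sup>+z\<in>S. ennreal ((h z - g z)\<^sup>2) \<partial>lborel)" for h
    by (intro nn_integral_cong) (auto simp: indicator_def assms)
  then have "has_wiener_integral P W S f = has_wiener_integral P W S g"
    unfolding has_wiener_integral_def by (intro ext) simp
  then show ?thesis by (simp add: wiener_integral_def)
qed

text \<open>One set \<open>D\<close> serves all boxes, so that the points fixed for the horizon
  \<open>T\<close> stay dense in the shorter rectangles of the uniqueness proof.\<close>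

lemma countable_dense_box:
  obtains D :: "(real \<times> real) set" where "countable D"
    "\<And>L T. L > 0 \<Longrightarrow> T > 0 \<Longrightarrow> closure (D \<inter> ({0<..<L} \<times> {0<..<T})) = {0..L} \<times> {0..T}"
proof -
  obtain D :: "(real \<times> real) set" where D: "countable D" "\<And>X. open X \<Longrightarrow> X \<noteq> {} \<Longrightarrow> \<exists>d\<in>D. d \<in> X"
    by (rule countable_dense_setE) blast
  have cl: "closure D = UNIV"
  proof (rule ccontr)
    assume "closure D \<noteq> UNIV"
    then have "open (- closure D)" "- closure D \<noteq> {}" by auto
    then obtain d where "d \<in> D" "d \<in> - closure D" using D(2) by blast
    then show False using closure_subset by auto
  qed
  have "closure (D \<inter> ({0<..<L} \<times> {0<..<T})) = {0..L} \<times> {0..T}" if "L > 0" "T > 0" for L T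
  proof -
    let ?O = "{0<..<L} \<times> {0<..<T}"
    have "open ?O" by (intro open_Times) auto
    from open_Int_closure_subset[OF this, of D] have "?O \<subseteq> closure (D \<inter> ?O)" by (simp add: cl Int_commute)
    then have "closure ?O \<subseteq> closure (D \<inter> ?O)" using closure_minimal closed_closure by blast
    moreover have "closure (D \<inter> ?O) \<subseteq> closure ?O" by (rule closure_mono) auto
    moreover have "closure ?O = {0..L} \<times> {0..T}" using that by (simp add: closure_Times closure_greaterThanLessThan)
    ultimately show ?thesis by blast
  qed
  with D(1) show thesis by (rule that)
qed

section \<open>The cut-off problem\<close>

lemma ennpowr_mono: "p > 0 \<Longrightarrow> a \<le> b \<Longrightarrow> ennpowr a p \<le> ennpowr b p"
  by (cases a; cases b) (auto simp: ennpowr_def top_unique intro!: ennreal_leI powr_mono2)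

lemma ennpowr_ennreal: "x \<ge> 0 \<Longrightarrow> ennpowr (ennreal x) p = ennreal (x powr p)"
  by (simp add: ennpowr_def)

lemma Linf_norm_le_H_norm:
  assumes L: "L > 0" and f: "f \<in> H_space L"
  shows "Linf_norm L f \<le> ennreal L * H_norm L f"
proof -
  let ?R = "restrict_space lborel {0<..<L}"
  have "continuous_on {0<..<L} f" using f by (auto simp: H_space_def intro: continuous_on_subset)
  then have fm: "f \<in> borel_measurable (restrict_space borel {0<..<L})" by (rule borel_measurable_continuous_on_restrict)
  have "sets ?R = sets (restrict_space borel {0<..<L})" by (simp add: sets_restrict_space)
  then have fm: "f \<in> borel_measurable ?R" using fm by (simp cong: measurable_cong_sets)
  show ?thesis unfolding Linf_norm_def
  proof (rule esssup_I)
    show "(\<lambda>x. ennreal \<bar>f x\<bar>) \<in> borel_measurable ?R" using fm by measurable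
    show "AE x in ?R. ennreal \<bar>f x\<bar> \<le> ennreal L * H_norm L f"
    proof (rule AE_I2)
      fix x assume "x \<in> space ?R"
      then have x: "x \<in> {0<..<L}" by (simp add: space_restrict_space)
      have "\<bar>f x\<bar> = \<bar>x\<bar> * \<bar>f x / x\<bar>" using x by (simp add: abs_mult[symmetric])
      also have "\<dots> \<le> L * \<bar>f x / x\<bar>" using x by (intro mult_right_mono) auto
      finally have "ennreal \<bar>f x\<bar> \<le> ennreal L * ennreal \<bar>f x / x\<bar>" using L by (simp add: ennreal_mult[symmetric] ennreal_leI)
      also have "\<dots> \<le> ennreal L * H_norm L f" unfolding H_norm_def using x by (intro mult_left_mono SUP_upper) auto
      finally show "ennreal \<bar>f x\<bar> \<le> ennreal L * H_norm L f" .
    qed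
  qed
qed

lemma ennpowr_mult: "L > 0 \<Longrightarrow> p > 0 \<Longrightarrow> ennpowr (ennreal L * a) p = ennreal (L powr p) * ennpowr a p"
  by (cases a) (auto simp: ennpowr_def ennreal_mult_top ennreal_mult[symmetric] powr_mult)

locale cutoff_setting = white_noise P L W + heat_horizon \<alpha> L T
  for P :: "'a measure" and L :: real and W :: "(real \<times> real) set \<Rightarrow> 'a \<Rightarrow> real" and \<alpha> T :: real +
  fixes \<sigma> u0 H :: "real \<Rightarrow> real" and \<zeta> :: "'a \<Rightarrow> ereal" and u :: "real \<Rightarrow> real \<Rightarrow> 'a \<Rightarrow> real"
    and M p :: real and n :: nat
  assumes sigma: "admissible_noise_coeff L \<sigma>" and init: "admissible_initial L u0"
    and maximal: "maximal_solution P W \<alpha> L \<sigma> u0 \<zeta> u"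
    and M: "M > 0" and Om: "Omega_M P u \<zeta> T M \<in> sets P" and Om_pos: "measure P (Omega_M P u \<zeta> T M) > 0"
    and cutoff: "cutoff_function n H" and p: "p \<ge> 2"
begin

abbreviation "\<Omega>M \<equiv> Omega_M P u \<zeta> T M"
abbreviation "Q \<equiv> P_M P u \<zeta> T M"
abbreviation "\<tau> \<equiv> stopped_time u \<zeta> T M"
abbreviation "Tc \<equiv> cutoff_T H"

definition noise :: "real \<Rightarrow> real \<Rightarrow> 'a \<Rightarrow> real" where
  "noise x t = wiener_integral P W ({0<..<L} \<times> {0..<t}) (\<lambda>(y, s). heat_green \<alpha> L x y (t - s) * \<sigma> y)"

section \<open>Reduction to a measurable set of well-behaved paths\<close>

definition dense_pts :: "(real \<times> real) set" where
  "dense_pts = (SOME D. countable D \<and> (\<forall>L>0. \<forall>T>0. closure (D \<inter> ({0<..<L} \<times> {0<..<T})) = {0..L} \<times> {0..T}))"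

lemma dense_pts: "countable dense_pts"
  "L' > 0 \<Longrightarrow> T' > 0 \<Longrightarrow> closure (dense_pts \<inter> ({0<..<L'} \<times> {0<..<T'})) = {0..L'} \<times> {0..T'}"
proof -
  have "\<exists>D :: (real \<times> real) set. countable D \<and> (\<forall>L>0. \<forall>T>0. closure (D \<inter> ({0<..<L} \<times> {0<..<T})) = {0..L} \<times> {0..T})"
    by (rule countable_dense_box) blast
  from someI_ex[OF this, folded dense_pts_def] show "countable dense_pts"
    "L' > 0 \<Longrightarrow> T' > 0 \<Longrightarrow> closure (dense_pts \<inter> ({0<..<L'} \<times> {0<..<T'})) = {0..L'} \<times> {0..T'}" by blast+
qed

text \<open>The points lie in the open box: there division by \<open>x\<close> is harmless and
  \<open>t < T\<close> lies inside the half-open stopped interval. The closure is nevertheless the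
  whole rectangle.\<close>

definition pts :: "(real \<times> real) set" where "pts = dense_pts \<inter> ({0<..<L} \<times> {0<..<T})"
definition pt :: "nat \<Rightarrow> real \<times> real" where "pt = from_nat_into pts"

lemma pts: "range pt = pts" "closure pts = {0..L} \<times> {0..T}" "pt i \<in> {0<..<L} \<times> {0<..<T}"
proof -
  show cl: "closure pts = {0..L} \<times> {0..T}" unfolding pts_def by (rule dense_pts(2)[OF L T])
  have "(0, 0) \<in> closure pts" using cl L T by simp
  then have "pts \<noteq> {}" by auto
  then show r: "range pt = pts" unfolding pt_def
    by (intro range_from_nat_into) (auto simp: pts_def intro: countable_Int1 dense_pts(1))
  show "pt i \<in> {0<..<L} \<times> {0<..<T}" using r by (auto simp: pts_def)
qed

definition u_equation :: "'a \<Rightarrow> real \<Rightarrow> real \<Rightarrow> bool" where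
  "u_equation \<omega> x t \<longleftrightarrow> (ereal t < \<zeta> \<omega> \<longrightarrow> u x t \<omega> = heat_initial \<alpha> L u0 x t
     + set_lebesgue_integral lborel ({0<..<L} \<times> {0..<t}) (\<lambda>(y, s). heat_green_y \<alpha> L x y (t - s) * (ux0 u s \<omega> * u y s \<omega>))
     + noise x t \<omega>)"

lemma AE_u_equation: "x \<in> {0<..<L} \<Longrightarrow> t \<ge> 0 \<Longrightarrow> AE \<omega> in P. u_equation \<omega> x t"
proof -
  assume xt: "x \<in> {0<..<L}" "t \<ge> 0"
  have "mild_equation P P W \<alpha> L \<sigma> u0 \<zeta> (\<lambda>y s \<omega>. ux0 u s \<omega> * u y s \<omega>) u"
    using maximal by (simp only: maximal_solution_def)
  note this[unfolded mild_equation_def, rule_format, OF xt]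
  then show ?thesis by (rule eventually_mono) (unfold u_equation_def noise_def, blast)
qed

text \<open>Everything the path-by-path arguments use about \<open>u\<close>. Each clause holds
  almost surely, and there are only countably many.\<close>

definition good :: "'a \<Rightarrow> bool" where
  "good \<omega> \<longleftrightarrow> (\<lambda>x t. u x t \<omega>) \<in> H_paths L (\<zeta> \<omega>) \<and> \<zeta> \<omega> = (SUP M \<in> {0<..}. exit_time u \<zeta> M \<omega>)
    \<and> (0 < \<zeta> \<omega> \<longrightarrow> ux0 u 0 \<omega> = 0) \<and> (\<forall>i. u_equation \<omega> (fst (pt i)) (snd (pt i)))"

text \<open>At time 0 the drift integral is over the empty set and the noise is almost surely 0, so
  \<open>u\<close> equals \<open>u0\<close> at each of the points \<open>L / (k + 2)\<close>. These
  tend to 0, and \<open>u0\<close> vanishes near 0 by compact support.\<close>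

lemma AE_initial_slope: "AE \<omega> in P. (\<lambda>x t. u x t \<omega>) \<in> H_paths L (\<zeta> \<omega>) \<and> 0 < \<zeta> \<omega> \<longrightarrow> ux0 u 0 \<omega> = 0"
proof -
  define x where "x = (\<lambda>k. L / real (k + 2))"
  have x: "x k \<in> {0<..<L}" for k
  proof -
    have "L / real (k + 2) < L / 1" using L by (intro divide_strict_left_mono) auto
    then show ?thesis using L by (simp add: x_def)
  qed
  have xl: "filterlim x (at_right 0) sequentially"
  proof (rule tendsto_imp_filterlim_at_right)
    have "(\<lambda>k. L * inverse (real (k + 2))) \<longlonglongrightarrow> L * 0"
      by (intro tendsto_mult tendsto_const LIMSEQ_ignore_initial_segment[OF LIMSEQ_inverse_real_of_nat[THEN LIMSEQ_imp_Suc]])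
    then show "x \<longlonglongrightarrow> 0" by (simp add: x_def divide_inverse)
  qed (use x in auto)
  obtain K where K: "compact K" "K \<subseteq> {0<..<L}" "\<And>x. x \<in> {0..L} - K \<Longrightarrow> u0 x = 0"
    using init by (auto simp: admissible_initial_def)
  have "\<forall>\<^sub>F y in nhds 0. y \<notin> K"
  proof -
    have "open (- K)" "0 \<in> - K" using K by (auto simp: compact_imp_closed)
    from eventually_nhds_in_open[OF this] show ?thesis by simp
  qed
  then have "\<forall>\<^sub>F k in sequentially. x k \<notin> K"
    by (rule eventually_compose_filterlim) (rule filterlim_mono[OF xl], auto simp: at_within_def)
  then have ev: "\<forall>\<^sub>F k in sequentially. u0 (x k) = 0"
  proof eventually_elim
    case (elim k)
    show ?case using K(3)[of "x k"] x[of k] elim by simp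
  qed
  have "AE \<omega> in P. u_equation \<omega> (x k) 0" for k by (rule AE_u_equation[OF x]) simp
  moreover have "AE \<omega> in P. noise (x k) 0 \<omega> = 0" for k
    unfolding noise_def using wiener_integral_empty[of "\<lambda>(y, s). heat_green \<alpha> L (x k) y (0 - s) * \<sigma> y"] by simp
  ultimately have "AE \<omega> in P. \<forall>k. u_equation \<omega> (x k) 0 \<and> noise (x k) 0 \<omega> = 0"
    by (simp add: AE_all_countable)
  then show ?thesis
  proof eventually_elim
    case (elim \<omega>)
    show ?case
    proof
      assume a: "(\<lambda>x t. u x t \<omega>) \<in> H_paths L (\<zeta> \<omega>) \<and> 0 < \<zeta> \<omega>"
      then have z: "ereal 0 < \<zeta> \<omega>" by (simp add: zero_ereal_def)
      have "u (x k) 0 \<omega> = u0 (x k)" for k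
        using elim z by (simp add: u_equation_def heat_initial_def set_lebesgue_integral_def)
      with ev have e0: "\<forall>\<^sub>F k in sequentially. u (x k) 0 \<omega> / x k = 0" by (auto elim!: eventually_mono)
      have "(\<lambda>x. u x 0 \<omega>) \<in> H_space L" using a z by (auto simp: H_paths_def)
      from filterlim_compose[OF H_space_quotient_limit[OF L this] xl]
      have "(\<lambda>k. u (x k) 0 \<omega> / x k) \<longlonglongrightarrow> ux0 u 0 \<omega>" by (simp add: ux0_def)
      moreover have "(\<lambda>k. u (x k) 0 \<omega> / x k) \<longlonglongrightarrow> 0" by (rule tendsto_eventually[OF e0])
      ultimately show "ux0 u 0 \<omega> = 0" by (rule LIMSEQ_unique)
    qed
  qed
qed

lemma AE_good: "AE \<omega> in P. good \<omega>"
proof -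
  have "AE \<omega> in P. (\<lambda>x t. u x t \<omega>) \<in> H_paths L (\<zeta> \<omega>)" "AE \<omega> in P. \<zeta> \<omega> = (SUP M \<in> {0<..}. exit_time u \<zeta> M \<omega>)"
    using maximal by (simp_all add: maximal_solution_def H_process_def)
  moreover have "AE \<omega> in P. u_equation \<omega> (fst (pt i)) (snd (pt i))" for i
    by (rule AE_u_equation) (use pts(3)[of i] in auto)
  then have "AE \<omega> in P. \<forall>i. u_equation \<omega> (fst (pt i)) (snd (pt i))" by (simp add: AE_all_countable)
  ultimately show ?thesis using AE_initial_slope by eventually_elim (auto simp: good_def)
qed

lemma AE_Q: "AE \<omega> in P. \<phi> \<omega> \<Longrightarrow> AE \<omega> in Q. \<phi> \<omega>"
  unfolding P_M_def by (rule AE_uniform_measureI[OF Om]) (auto elim: eventually_mono)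

text \<open>Measurability of \<open>good\<close> is not at hand. Removing from
  \<open>Omega_M\<close> a measurable null set that contains all bad points gives a measurable event
  of the same positive probability.\<close>

lemma good_set_exists:
  "\<exists>G. G \<in> sets P \<and> G \<subseteq> \<Omega>M \<and> measure P G > 0 \<and> (AE \<omega> in Q. \<omega> \<in> G) \<and> (\<forall>\<omega>\<in>G. good \<omega>)"
proof -
  obtain N where N: "{\<omega>\<in>space P. \<not> good \<omega>} \<subseteq> N" "emeasure P N = 0" "N \<in> sets P" using AE_good by (rule AE_E)
  have "AE \<omega> in P. \<omega> \<notin> N" using N by (intro AE_not_in) (auto simp: null_sets_def)
  then have "AE \<omega> in P. \<omega> \<in> \<Omega>M \<longrightarrow> \<omega> \<in> \<Omega>M - N" by eventually_elim simp
  then have "AE \<omega> in Q. \<omega> \<in> \<Omega>M - N" unfolding P_M_def by (rule AE_uniform_measureI[OF Om])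
  moreover have "measure P (\<Omega>M - N) = measure P \<Omega>M"
    using N by (intro measure_Diff_null_set) (auto simp: null_sets_def Om)
  moreover have "good \<omega>" if "\<omega> \<in> \<Omega>M - N" for \<omega> using that N(1) sets.sets_into_space[OF Om] by blast
  ultimately show ?thesis using N(3) Om Om_pos by (intro exI[of _ "\<Omega>M - N"]) auto
qed

definition GG :: "'a set" where
  "GG = (SOME G. G \<in> sets P \<and> G \<subseteq> \<Omega>M \<and> measure P G > 0 \<and> (AE \<omega> in Q. \<omega> \<in> G) \<and> (\<forall>\<omega>\<in>G. good \<omega>))"

lemma GG: "GG \<in> sets P" "GG \<subseteq> \<Omega>M" "measure P GG > 0" "AE \<omega> in Q. \<omega> \<in> GG" "\<omega> \<in> GG \<Longrightarrow> good \<omega>"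
  using someI_ex[OF good_set_exists, folded GG_def] by blast+

lemma GG_path: "\<omega> \<in> GG \<Longrightarrow> (\<lambda>x t. u x t \<omega>) \<in> H_paths L (\<zeta> \<omega>)"
  by (drule GG(5), unfold good_def) (rule conjunct1)

lemma GG_stopped:
  assumes w: "\<omega> \<in> GG"
  shows "\<tau> \<omega> = ereal T" "ereal T < \<zeta> \<omega>" "t \<in> {0..T} \<Longrightarrow> \<bar>ux0 u t \<omega>\<bar> \<le> M"
proof -
  have g: "good \<omega>" and O: "\<omega> \<in> \<Omega>M" using GG(2,5) w by auto
  have *: "(\<lambda>x t. u x t \<omega>) \<in> H_paths L (\<zeta> \<omega>)" "\<zeta> \<omega> = (SUP M \<in> {0<..}. exit_time u \<zeta> M \<omega>)" "0 < \<zeta> \<omega> \<Longrightarrow> ux0 u 0 \<omega> = 0"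
    using g unfolding good_def by blast+
  have o: "sup_ux0 u \<zeta> (\<tau> \<omega>) \<omega> < ereal M" using O by (simp add: Omega_M_def)
  show "\<tau> \<omega> = ereal T" "ereal T < \<zeta> \<omega>" "t \<in> {0..T} \<Longrightarrow> \<bar>ux0 u t \<omega>\<bar> \<le> M"
    using stopped_time_eq[where u=u and \<omega>=\<omega> and \<zeta>=\<zeta>, OF L T M *(1,2) _ o] *(3) by blast+
qed

lemma GG_H_space: "\<omega> \<in> GG \<Longrightarrow> t \<in> {0..T} \<Longrightarrow> (\<lambda>x. u x t \<omega>) \<in> H_space L"
proof -
  assume w: "\<omega> \<in> GG" and t: "t \<in> {0..T}"
  have "ereal t < \<zeta> \<omega>" using t GG_stopped(2)[OF w] by (intro le_less_trans[of "ereal t" "ereal T"]) auto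
  then show ?thesis using GG_path[OF w] t by (simp add: H_paths_def)
qed

text \<open>Set to 0 off \<open>GG\<close> and clamped, so that continuity and boundedness hold for
  every sample point and the fixed-point construction can be performed without exception
  sets.\<close>

definition U :: "'a \<Rightarrow> real \<times> real \<Rightarrow> real" where
  "U \<omega> z = (if \<omega> \<in> GG then quotient (\<lambda>x t. u x t \<omega>) (clamp_x (fst z), clamp_t (snd z)) else 0)"

definition a :: "'a \<Rightarrow> real \<Rightarrow> real" where "a \<omega> t = U \<omega> (0, t)"

lemma clamp_idem: "clamp_x (clamp_x x) = clamp_x x" "clamp_t (clamp_t t) = clamp_t t"
  by (rule clamp(3)[OF clamp(1)], rule clamp(4)[OF clamp(2)])

lemma U_continuous: "continuous_on UNIV (U \<omega>)"
proof (cases "\<omega> \<in> GG")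
  case True
  have "continuous_on UNIV (\<lambda>z. quotient (\<lambda>x t. u x t \<omega>) (clamp_x (fst z), clamp_t (snd z)))"
  proof (rule continuous_on_compose2[OF quotient_continuous[OF L GG_path[OF True]]])
    show "continuous_on UNIV (\<lambda>z. (clamp_x (fst z), clamp_t (snd z)))" by (intro continuous_intros)
    have "ereal (clamp_t t) < \<zeta> \<omega>" for t
      using clamp(2)[of t] GG_stopped(2)[OF True] by (auto intro: le_less_trans[of "ereal _" "ereal T"])
    then show "range (\<lambda>z. (clamp_x (fst z), clamp_t (snd z))) \<subseteq> {0..L} \<times> {t. 0 \<le> t \<and> ereal t < \<zeta> \<omega>}"
      using clamp(1,2) by auto
  qed
  then show ?thesis using True by (simp add: U_def[abs_def])
qed (simp add: U_def[abs_def])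

lemma U_bounded: "\<exists>A. \<forall>z. \<bar>U \<omega> z\<bar> \<le> A"
proof -
  have "compact (U \<omega> ` ({0..L} \<times> {0..T}))"
    by (intro compact_continuous_image continuous_on_subset[OF U_continuous] compact_Times compact_Icc) auto
  then have "bounded (U \<omega> ` ({0..L} \<times> {0..T}))" by (rule compact_imp_bounded)
  then obtain A where "\<forall>y\<in>U \<omega> ` ({0..L} \<times> {0..T}). \<bar>y\<bar> \<le> A"
    by (simp only: bounded_real) (elim exE)
  then have A: "\<bar>U \<omega> z\<bar> \<le> A" if "z \<in> {0..L} \<times> {0..T}" for z using that by blast
  have "U \<omega> z = U \<omega> (clamp_x (fst z), clamp_t (snd z))" for z by (simp add: U_def clamp_idem)
  then have "\<bar>U \<omega> z\<bar> \<le> A" for z using A[of "(clamp_x (fst z), clamp_t (snd z))"] clamp(1,2) by simp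
  then show ?thesis by blast
qed

lemma U_eq: "\<omega> \<in> GG \<Longrightarrow> x \<in> {0<..L} \<Longrightarrow> t \<in> {0..T} \<Longrightarrow> U \<omega> (x, t) = u x t \<omega> / x"
  by (simp add: U_def clamp quotient_def)

lemma a_eq: "\<omega> \<in> GG \<Longrightarrow> t \<in> {0..T} \<Longrightarrow> a \<omega> t = ux0 u t \<omega>"
  using L by (simp add: a_def U_def clamp ux0_quotient)

lemma a_bound: "\<bar>a \<omega> t\<bar> \<le> M"
proof (cases "\<omega> \<in> GG")
  case True
  have "a \<omega> t = ux0 u (clamp_t t) \<omega>" using True L by (simp add: a_def U_def clamp ux0_quotient)
  then show ?thesis using GG_stopped(3)[OF True clamp(2)] by simp
qed (use M in \<open>simp add: a_def U_def\<close>)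

lemma a_continuous: "continuous_on UNIV (\<lambda>z. a \<omega> (snd z))"
  unfolding a_def by (rule continuous_on_compose2[OF U_continuous]) (auto intro!: continuous_intros)

text \<open>Measurability of \<open>u\<close> is assumed for \<open>x\<close> in the open interval
  only. Boundary values, among them the slope at 0, are limits along points moved towards the
  midpoint \<open>L / 2\<close>.\<close>

lemma U_measurable: "(\<lambda>\<omega>. U \<omega> z) \<in> borel_measurable P"
proof -
  note GG(1)[measurable]
  have inner: "(\<lambda>\<omega>. U \<omega> (x, t)) \<in> borel_measurable P" if x: "x \<in> {0<..<L}" and t: "t \<in> {0..T}" for x t
  proof -
    have [measurable]: "(\<lambda>\<omega>. if ereal t < \<zeta> \<omega> then u x t \<omega> else 0) \<in> borel_measurable P"
      using maximal x t by (simp add: maximal_solution_def H_process_def)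
    have "U \<omega> (x, t) = (if \<omega> \<in> GG then (if ereal t < \<zeta> \<omega> then u x t \<omega> else 0) / x else 0)" for \<omega>
    proof (cases "\<omega> \<in> GG")
      case True
      have "ereal t < \<zeta> \<omega>" using GG_stopped(2)[OF True] t by (auto intro: le_less_trans[of "ereal t" "ereal T"])
      then show ?thesis using True x t by (simp add: U_eq)
    qed (simp add: U_def)
    then show ?thesis by simp
  qed
  have x0: "(\<lambda>\<omega>. U \<omega> (x, t)) \<in> borel_measurable P" if x: "x \<in> {0..L}" and t: "t \<in> {0..T}" for x t
  proof (rule borel_measurable_LIMSEQ_real)
    define c where "c = (\<lambda>k. x + (L / 2 - x) * inverse (real (Suc k)))"
    have "c k \<in> {0<..<L}" if k: "k > 0" for k
    proof -
      define r where "r = inverse (real (Suc k))"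
      have r: "0 < r" "r < 1" using k by (auto simp: r_def inverse_less_1_iff)
      have "c k = (1 - r) * x + r * (L / 2)" by (simp add: c_def r_def algebra_simps)
      moreover have "0 \<le> (1 - r) * x" "(1 - r) * x \<le> (1 - r) * L" using x r by (auto intro: mult_left_mono)
      moreover have "0 < r * L" using r L by simp
      ultimately show ?thesis by (simp add: algebra_simps)
    qed
    then show "(\<lambda>\<omega>. U \<omega> (c (Suc k), t)) \<in> borel_measurable P" for k using inner t by simp
    fix \<omega>
    have "c \<longlonglongrightarrow> x + (L / 2 - x) * 0" unfolding c_def
      by (intro tendsto_add tendsto_mult tendsto_const LIMSEQ_inverse_real_of_nat)
    then have "(\<lambda>k. c (Suc k)) \<longlonglongrightarrow> x" by (intro LIMSEQ_Suc) simp
    then show "(\<lambda>k. U \<omega> (c (Suc k), t)) \<longlonglongrightarrow> U \<omega> (x, t)"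
      by (intro continuous_on_tendsto_compose[OF U_continuous] tendsto_Pair tendsto_const) auto
  qed
  have "U \<omega> z = U \<omega> (clamp_x (fst z), clamp_t (snd z))" for \<omega> by (simp add: U_def clamp_idem)
  then show ?thesis using x0[OF clamp(1,2)] by simp
qed

definition nl :: "'a \<Rightarrow> real \<times> real \<Rightarrow> real \<Rightarrow> real" where
  "nl \<omega> z v = a \<omega> (snd z) * (Tc v - U \<omega> z)"

lemma nl_nonlinearity: "\<exists>c B. nonlinearity (nl \<omega>) c B"
proof -
  obtain A where A: "\<And>z. \<bar>U \<omega> z\<bar> \<le> A" using U_bounded by blast
  have "nonlinearity (nl \<omega>) (M * (2 * real n + 3)) (M * (real n + 1 + A))"
    unfolding nonlinearity_def
  proof (intro conjI allI)
    show "continuous_on UNIV (\<lambda>w. nl \<omega> (fst w) (snd w))" unfolding nl_def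
      by (intro continuous_intros continuous_on_compose2[OF a_continuous] continuous_on_compose2[OF U_continuous]
        continuous_on_compose2[OF cutoff_T_bounds(3)[OF cutoff]]) auto
    show "\<bar>nl \<omega> z v - nl \<omega> z v'\<bar> \<le> M * (2 * real n + 3) * \<bar>v - v'\<bar>" for z v v'
    proof -
      have "\<bar>nl \<omega> z v - nl \<omega> z v'\<bar> = \<bar>a \<omega> (snd z)\<bar> * \<bar>Tc v - Tc v'\<bar>"
        by (simp add: nl_def abs_mult[symmetric] algebra_simps)
      also have "\<dots> \<le> M * ((2 * real n + 3) * \<bar>v - v'\<bar>)"
        using M by (intro mult_mono a_bound cutoff_T_bounds(1)[OF cutoff]) auto
      finally show ?thesis by (simp only: mult.assoc)
    qed
    show "\<bar>nl \<omega> z 0\<bar> \<le> M * (real n + 1 + A)" for z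
      unfolding nl_def abs_mult using M cutoff_T_bounds(2)[OF cutoff, of 0] A[of z]
      by (intro mult_mono a_bound order_trans[OF abs_triangle_ineq4] add_mono) auto
  qed (use M in auto)
  then show ?thesis by blast
qed

definition w :: "'a \<Rightarrow> real \<times> real \<Rightarrow> real" where "w \<omega> = fp (U \<omega>) (nl \<omega>)"

definition un :: "real \<Rightarrow> real \<Rightarrow> 'a \<Rightarrow> real" where "un x t \<omega> = (if \<omega> \<in> GG then x * w \<omega> (x, t) else 0)"

lemma w: "continuous_on UNIV (w \<omega>)" "\<exists>A. \<forall>z. \<bar>w \<omega> z\<bar> \<le> A"
    "w \<omega> z = U \<omega> z + drift (\<lambda>z. nl \<omega> z (w \<omega> z)) (clamp_x (fst z)) (clamp_t (snd z))"
    "(\<lambda>\<omega>. w \<omega> z) \<in> borel_measurable P"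
proof -
  obtain A where A: "\<And>z. \<bar>U \<omega> z\<bar> \<le> A" using U_bounded by blast
  obtain c B where n: "nonlinearity (nl \<omega>) c B" using nl_nonlinearity by blast
  show "continuous_on UNIV (w \<omega>)" unfolding w_def by (rule fixed_point(1)[OF U_continuous A n])
  show "\<exists>A. \<forall>z. \<bar>w \<omega> z\<bar> \<le> A" unfolding w_def by (rule fixed_point(2)[OF U_continuous A n])
  show "w \<omega> z = U \<omega> z + drift (\<lambda>z. nl \<omega> z (w \<omega> z)) (clamp_x (fst z)) (clamp_t (snd z))"
    unfolding w_def by (rule fixed_point(3)[OF U_continuous A n])
  have [measurable]: "Tc \<in> borel_measurable borel" by (rule borel_measurable_continuous_onI[OF cutoff_T_bounds(3)[OF cutoff]])
  have [measurable]: "(\<lambda>\<omega>. U \<omega> z) \<in> borel_measurable P" "(\<lambda>\<omega>. a \<omega> t) \<in> borel_measurable P" for z t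
    using U_measurable by (auto simp: a_def)
  show "(\<lambda>\<omega>. w \<omega> z) \<in> borel_measurable P" unfolding w_def
    by (rule fp_measurable[OF U_measurable U_continuous U_bounded nl_nonlinearity]) (simp add: nl_def)
qed

end

text \<open>Stated for arbitrary \<open>f\<close> because a supremum over uncountably many times, as in the norm of
  \<open>L\<^sup>p(\<Omega>; C([0,\<zeta>); H))\<close>, is not known to be measurable.\<close>

lemma nn_integral_cmult_le:
  assumes c: "(c::real) > 0" shows "(\<integral>\<^sup>+x. ennreal c * f x \<partial>M) \<le> ennreal c * (\<integral>\<^sup>+x. f x \<partial>M)"
  unfolding nn_integral_def[of M "\<lambda>x. ennreal c * f x"]
proof (rule SUP_least)
  fix g assume "g \<in> {g. simple_function M g \<and> g \<le> (\<lambda>x. ennreal c * f x)}"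
  then have g: "simple_function M g" "\<And>x. g x \<le> ennreal c * f x" by (auto simp: le_fun_def)
  define h where "h = (\<lambda>x. ennreal (1 / c) * g x)"
  have gh: "g x = ennreal c * h x" for x
    using c by (simp add: h_def mult.assoc[symmetric] ennreal_mult[symmetric])
  have hf: "h x \<le> f x" for x
  proof -
    have "h x \<le> ennreal (1 / c) * (ennreal c * f x)" unfolding h_def by (intro mult_left_mono g) simp
    then show ?thesis using c by (simp add: mult.assoc[symmetric] ennreal_mult[symmetric])
  qed
  have hm: "h \<in> borel_measurable M" unfolding h_def using borel_measurable_simple_function[OF g(1)] by measurable
  have "integral\<^sup>S M g = (\<integral>\<^sup>+x. g x \<partial>M)" by (rule nn_integral_eq_simple_integral[symmetric, OF g(1)])
  also have "\<dots> = ennreal c * (\<integral>\<^sup>+x. h x \<partial>M)" unfolding gh by (rule nn_integral_cmult[OF hm])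
  also have "\<dots> \<le> ennreal c * (\<integral>\<^sup>+x. f x \<partial>M)" by (intro mult_left_mono nn_integral_mono hf) simp
  finally show "integral\<^sup>S M g \<le> ennreal c * (\<integral>\<^sup>+x. f x \<partial>M)" .
qed

section \<open>Existence of the cut-off solution\<close>

context cutoff_setting
begin

lemma drift_integral:
  assumes F: "continuous_on UNIV F" "\<And>z. \<bar>F z\<bar> \<le> A" and t: "t \<in> {0..T}"
    and b: "\<And>y s. y \<in> {0<..<L} \<Longrightarrow> s \<in> {0..<t} \<Longrightarrow> b y s = y * F (y, s)"
  shows "set_integrable lborel ({0<..<L} \<times> {0..<t}) (\<lambda>(y, s). heat_green_y \<alpha> L x y (t - s) * b y s)"
    and "set_lebesgue_integral lborel ({0<..<L} \<times> {0..<t}) (\<lambda>(y, s). heat_green_y \<alpha> L x y (t - s) * b y s) = x * drift F x t"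
proof -
  have e: "(\<lambda>z. indicator ({0<..<L} \<times> {0..<t}) z *\<^sub>R (case z of (y, s) \<Rightarrow> heat_green_y \<alpha> L x y (t - s) * b y s))
     = (\<lambda>z. indicator ({0<..<L} \<times> {0..<t}) z *\<^sub>R (case z of (y, s) \<Rightarrow> heat_green_y \<alpha> L x y (t - s) * (y * F (y, s))))"
  proof
    fix z :: "real \<times> real"
    show "indicator ({0<..<L} \<times> {0..<t}) z *\<^sub>R (case z of (y, s) \<Rightarrow> heat_green_y \<alpha> L x y (t - s) * b y s)
     = indicator ({0<..<L} \<times> {0..<t}) z *\<^sub>R (case z of (y, s) \<Rightarrow> heat_green_y \<alpha> L x y (t - s) * (y * F (y, s)))"
      by (cases "z \<in> {0<..<L} \<times> {0..<t}"; cases z) (simp_all add: b)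
  qed
  have "F \<in> borel_measurable borel" by (rule borel_measurable_continuous_onI[OF F(1)])
  from heat_drift[OF this F(2), of t x] t
  show "set_integrable lborel ({0<..<L} \<times> {0..<t}) (\<lambda>(y, s). heat_green_y \<alpha> L x y (t - s) * b y s)"
    and "set_lebesgue_integral lborel ({0<..<L} \<times> {0..<t}) (\<lambda>(y, s). heat_green_y \<alpha> L x y (t - s) * b y s) = x * drift F x t"
    unfolding set_integrable_def set_lebesgue_integral_def e by auto
qed

text \<open>\<open>F1\<close> and \<open>F2\<close> are the drift densities of \<open>u\<close> and
  of the cut-off solution. The bound on \<open>F1\<close> depends on the path, that on
  \<open>F2\<close> is deterministic; the moment estimate therefore keeps the drift of
  \<open>F1\<close> together with \<open>U\<close>.\<close>

definition F1 :: "'a \<Rightarrow> real \<times> real \<Rightarrow> real" where "F1 \<omega> z = a \<omega> (snd z) * U \<omega> z"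
definition F2 :: "'a \<Rightarrow> real \<times> real \<Rightarrow> real" where "F2 \<omega> z = a \<omega> (snd z) * Tc (w \<omega> z)"

lemma F1: "continuous_on UNIV (F1 \<omega>)" "\<exists>A. \<forall>z. \<bar>F1 \<omega> z\<bar> \<le> A"
proof -
  show "continuous_on UNIV (F1 \<omega>)" unfolding F1_def[abs_def] by (intro continuous_on_mult a_continuous U_continuous)
  obtain A where A: "\<And>z. \<bar>U \<omega> z\<bar> \<le> A" using U_bounded by blast
  have "\<bar>F1 \<omega> z\<bar> \<le> M * A" for z unfolding F1_def abs_mult using M by (intro mult_mono a_bound A) auto
  then show "\<exists>A. \<forall>z. \<bar>F1 \<omega> z\<bar> \<le> A" by blast
qed

lemma F2: "continuous_on UNIV (F2 \<omega>)" "\<bar>F2 \<omega> z\<bar> \<le> M * (real n + 1)"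
proof -
  show "continuous_on UNIV (F2 \<omega>)" unfolding F2_def[abs_def]
    by (intro continuous_on_mult a_continuous continuous_on_compose2[OF cutoff_T_bounds(3)[OF cutoff] w(1)]) auto
  show "\<bar>F2 \<omega> z\<bar> \<le> M * (real n + 1)" unfolding F2_def abs_mult
    using M by (intro mult_mono a_bound cutoff_T_bounds(2)[OF cutoff]) auto
qed

lemma w_eq:
  assumes x: "x \<in> {0..L}" and t: "t \<in> {0..T}"
  shows "w \<omega> (x, t) = U \<omega> (x, t) + (drift (F2 \<omega>) x t - drift (F1 \<omega>) x t)"
proof -
  obtain A where A: "\<And>z. \<bar>F1 \<omega> z\<bar> \<le> A" using F1(2) by blast
  have m: "F1 \<omega> \<in> borel_measurable borel" "F2 \<omega> \<in> borel_measurable borel"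
    by (auto intro: borel_measurable_continuous_onI F1 F2)
  have "(\<lambda>z. nl \<omega> z (w \<omega> z)) = (\<lambda>z. F2 \<omega> z - F1 \<omega> z)" by (simp add: nl_def F1_def F2_def fun_eq_iff right_diff_distrib)
  moreover have "drift (\<lambda>z. F2 \<omega> z - F1 \<omega> z) x t = drift (F2 \<omega>) x t - drift (F1 \<omega>) x t"
    by (rule drift_diff[OF m(2,1) _ F2(2) A]) (use t in simp)
  ultimately show ?thesis using w(3)[of \<omega> "(x, t)"] clamp(3)[OF x] clamp(4)[OF t] by simp
qed

lemma u_identity:
  assumes \<omega>: "\<omega> \<in> GG" and eq: "u_equation \<omega> x t" and x: "x \<in> {0<..<L}" and t: "t \<in> {0..T}"
  shows "x * U \<omega> (x, t) = heat_initial \<alpha> L u0 x t + x * drift (F1 \<omega>) x t + noise x t \<omega>"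
proof -
  obtain A where A: "\<And>z. \<bar>F1 \<omega> z\<bar> \<le> A" using F1(2) by blast
  have i: "set_lebesgue_integral lborel ({0<..<L} \<times> {0..<t}) (\<lambda>(y, s). heat_green_y \<alpha> L x y (t - s) * (ux0 u s \<omega> * u y s \<omega>)) = x * drift (F1 \<omega>) x t"
  proof (rule drift_integral(2)[OF F1(1) A t])
    fix y s assume y: "y \<in> {0<..<L}" and s: "s \<in> {0..<t}"
    have s': "s \<in> {0..T}" and y': "y \<in> {0<..L}" using s t y by auto
    show "ux0 u s \<omega> * u y s \<omega> = y * F1 \<omega> (y, s)"
      unfolding F1_def snd_conv U_eq[OF \<omega> y' s'] a_eq[OF \<omega> s'] using y by simp
  qed
  have "ereal t < \<zeta> \<omega>" using t GG_stopped(2)[OF \<omega>] by (intro le_less_trans[of "ereal t" "ereal T"]) auto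
  then have "u x t \<omega> = heat_initial \<alpha> L u0 x t + x * drift (F1 \<omega>) x t + noise x t \<omega>"
    using eq i by (simp only: u_equation_def simp_thms)
  moreover have "x * U \<omega> (x, t) = u x t \<omega>" using x U_eq[OF \<omega> _ t, of x] by simp
  ultimately show ?thesis by simp
qed

text \<open>By \<open>w_eq\<close> the candidate is \<open>x\<close> times \<open>U\<close> plus the
  drift of \<open>F2\<close> minus the drift of \<open>F1\<close>. Inserting the equation of
  \<open>u\<close> for \<open>x * U\<close> cancels the drift of \<open>F1\<close> and leaves the
  initial and noise terms together with the cut-off drift.\<close>

lemma un_mild: "mild_equation Q P W \<alpha> L \<sigma> u0 \<tau> (\<lambda>y s \<omega>. ux0 u s \<omega> * y * Tc (un y s \<omega> / y)) un"
  unfolding mild_equation_def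
proof (intro ballI allI impI)
  fix x t assume x: "x \<in> {0<..<L}" and t: "(0::real) \<le> t"
  have "AE \<omega> in Q. u_equation \<omega> x t" by (rule AE_Q[OF AE_u_equation[OF x t]])
  with GG(4) show "AE \<omega> in Q. ereal t < \<tau> \<omega> \<longrightarrow>
        set_integrable lborel ({0<..<L} \<times> {0..<t}) (\<lambda>(y, s). heat_green_y \<alpha> L x y (t - s) * (ux0 u s \<omega> * y * Tc (un y s \<omega> / y))) \<and>
        un x t \<omega> = heat_initial \<alpha> L u0 x t
          + set_lebesgue_integral lborel ({0<..<L} \<times> {0..<t}) (\<lambda>(y, s). heat_green_y \<alpha> L x y (t - s) * (ux0 u s \<omega> * y * Tc (un y s \<omega> / y)))
          + wiener_integral P W ({0<..<L} \<times> {0..<t}) (\<lambda>(y, s). heat_green \<alpha> L x y (t - s) * \<sigma> y) \<omega>"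
  proof eventually_elim
    case (elim \<omega>)
    note \<omega> = elim(1)
    show ?case
    proof
      assume "ereal t < \<tau> \<omega>"
      then have t': "t \<in> {0..T}" using t GG_stopped(1)[OF \<omega>] by simp
      have b: "ux0 u s \<omega> * y * Tc (un y s \<omega> / y) = y * F2 \<omega> (y, s)" if y: "y \<in> {0<..<L}" and s: "s \<in> {0..<t}" for y s
      proof -
        have s': "s \<in> {0..T}" using s t' by auto
        have "un y s \<omega> / y = w \<omega> (y, s)" using \<omega> y by (simp add: un_def)
        then show ?thesis unfolding F2_def snd_conv a_eq[OF \<omega> s'] by simp
      qed
      note di = drift_integral[OF F2 t' b, of x]
      have x': "x \<in> {0..L}" using x by simp
      have "un x t \<omega> = x * U \<omega> (x, t) + x * drift (F2 \<omega>) x t - x * drift (F1 \<omega>) x t"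
        using \<omega> unfolding un_def w_eq[OF x' t'] by (simp add: algebra_simps)
      also have "\<dots> = heat_initial \<alpha> L u0 x t + x * drift (F2 \<omega>) x t + noise x t \<omega>"
        using u_identity[OF \<omega> elim(2) x t'] by simp
      finally show "set_integrable lborel ({0<..<L} \<times> {0..<t}) (\<lambda>(y, s). heat_green_y \<alpha> L x y (t - s) * (ux0 u s \<omega> * y * Tc (un y s \<omega> / y))) \<and>
        un x t \<omega> = heat_initial \<alpha> L u0 x t
          + set_lebesgue_integral lborel ({0<..<L} \<times> {0..<t}) (\<lambda>(y, s). heat_green_y \<alpha> L x y (t - s) * (ux0 u s \<omega> * y * Tc (un y s \<omega> / y)))
          + wiener_integral P W ({0<..<L} \<times> {0..<t}) (\<lambda>(y, s). heat_green \<alpha> L x y (t - s) * \<sigma> y) \<omega>"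
        using di by (simp only: noise_def simp_thms)
    qed
  qed
qed

lemma un_process: "H_process Q L \<tau> un"
  unfolding H_process_def
proof (intro conjI ballI allI impI)
  fix x t assume x: "x \<in> {0<..<L}" and t: "(0::real) \<le> t"
  note GG(1)[measurable] w(4)[measurable]
  have "(\<lambda>\<omega>. if ereal t < \<tau> \<omega> then un x t \<omega> else 0) = (\<lambda>\<omega>. if \<omega> \<in> GG then (if t < T then x * w \<omega> (x, t) else 0) else 0)"
    by (auto simp: fun_eq_iff un_def GG_stopped(1))
  then show "(\<lambda>\<omega>. if ereal t < \<tau> \<omega> then un x t \<omega> else 0) \<in> borel_measurable Q"
    by (simp add: P_M_def)
next
  show "AE \<omega> in Q. (\<lambda>x t. un x t \<omega>) \<in> H_paths L (\<tau> \<omega>)"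
    using GG(4)
  proof eventually_elim
    case (elim \<omega>)
    \<comment> \<open>The boundary condition at \<open>L\<close> comes from \<open>u\<close> for the
      first term and from the vanishing kernel for the drifts.\<close>
    have "w \<omega> (L, t) = 0" if t: "t \<in> {0..T}" for t
    proof -
      have "U \<omega> (L, t) = 0" using elim L t GG_H_space[OF elim t] by (simp add: U_def clamp quotient_def H_space_def)
      then show ?thesis using w_eq[of L t \<omega>] t L by (simp add: drift_right_end)
    qed
    then have "(\<lambda>x t. x * w \<omega> (x, t)) \<in> H_paths L (ereal T)"
      by (intro H_paths_of_quotient L continuous_on_subset[OF w(1)]) auto
    then show ?case using elim by (simp add: un_def GG_stopped(1))
  qed
qed

section \<open>Moments of the solution through its Gaussian part\<close>

definition mean :: "nat \<Rightarrow> real" where "mean i = heat_initial \<alpha> L u0 (fst (pt i)) (snd (pt i)) / fst (pt i)"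
definition gauss :: "nat \<Rightarrow> 'a \<Rightarrow> real" where "gauss i \<omega> = 1 / fst (pt i) * noise (fst (pt i)) (snd (pt i)) \<omega>"

text \<open>Each variable is a Wiener integral whose integrand is square integrable by
  \<open>heat_green_L2\<close> and boundedness of the continuous coefficient on
  \<open>[0,L]\<close>.\<close>

lemma gauss_family: "\<exists>C. gaussian_family P gauss C"
proof -
  define S where "S = (\<lambda>i. {0<..<L} \<times> {0..<snd (pt i)})"
  \<comment> \<open>Clamping extends the coefficient, continuous on \<open>[0,L]\<close>, to a Borel
    function on the plane without changing it on the region of integration.\<close>
  define f where "f = (\<lambda>i z. heat_green \<alpha> L (fst (pt i)) (fst z) (snd (pt i) - snd z) * \<sigma> (clamp_x (fst z)))"
  have sc: "continuous_on {0..L} \<sigma>" using sigma by (simp add: admissible_noise_coeff_def)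
  have "continuous_on UNIV (\<lambda>z::real \<times> real. \<sigma> (clamp_x (fst z)))"
    by (rule continuous_on_compose2[OF sc]) (use clamp(1) in \<open>auto intro!: continuous_intros\<close>)
  then have sm[measurable]: "(\<lambda>z::real \<times> real. \<sigma> (clamp_x (fst z))) \<in> borel_measurable borel"
    by (rule borel_measurable_continuous_onI)
  have "bounded (\<sigma> ` {0..L})" by (intro compact_imp_bounded compact_continuous_image sc) simp
  then obtain B where "\<forall>y\<in>\<sigma> ` {0..L}. \<bar>y\<bar> \<le> B" by (simp only: bounded_real) (elim exE)
  then have B: "\<bar>\<sigma> x\<bar> \<le> B" if "x \<in> {0..L}" for x using that by blast
  have fs: "(\<lambda>z::real \<times> real. fst z) \<in> borel_measurable borel" "(\<lambda>z::real \<times> real. snd z) \<in> borel_measurable borel"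
    by (intro borel_measurable_continuous_onI continuous_intros)+
  note fs[measurable]
  have fm: "f i \<in> borel_measurable borel" for i unfolding f_def by measurable
  have Sm: "S i \<in> sets borel" for i unfolding S_def by (intro borel_Times) auto
  have SQ: "S i \<subseteq> {0<..<L} \<times> {0..}" for i by (auto simp: S_def)
  have Sf: "emeasure lborel (S i) < \<infinity>" for i unfolding S_def
    by (intro emeasure_bounded_finite bounded_Times) auto
  have L2: "(\<integral>\<^sup>+z\<in>S i. ennreal ((f i z)\<^sup>2) \<partial>lborel) < \<infinity>" for i
  proof -
    note Sm[measurable]
    have "(\<integral>\<^sup>+z\<in>S i. ennreal ((f i z)\<^sup>2) \<partial>lborel)
       \<le> (\<integral>\<^sup>+z. ennreal (B\<^sup>2) * (ennreal ((heat_green \<alpha> L (fst (pt i)) (fst z) (snd (pt i) - snd z))\<^sup>2) * indicator (S i) z) \<partial>lborel)"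
    proof (rule nn_integral_mono)
      fix z
      let ?h = "heat_green \<alpha> L (fst (pt i)) (fst z) (snd (pt i) - snd z)"
      have "(\<sigma> (clamp_x (fst z)))\<^sup>2 \<le> B\<^sup>2" using B[OF clamp(1)[of "fst z"]] by (metis abs_ge_zero power2_abs power_mono)
      then have "(f i z)\<^sup>2 \<le> B\<^sup>2 * ?h\<^sup>2" unfolding f_def power_mult_distrib by (simp add: mult.commute mult_right_mono)
      then have "ennreal ((f i z)\<^sup>2) \<le> ennreal (B\<^sup>2) * ennreal (?h\<^sup>2)" by (simp add: ennreal_mult[symmetric] ennreal_leI)
      then show "ennreal ((f i z)\<^sup>2) * indicator (S i) z \<le> ennreal (B\<^sup>2) * (ennreal (?h\<^sup>2) * indicator (S i) z)"
        by (simp add: mult.assoc[symmetric] mult_right_mono)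
    qed
    also have "\<dots> = ennreal (B\<^sup>2) * (\<integral>\<^sup>+z\<in>S i. ennreal ((heat_green \<alpha> L (fst (pt i)) (fst z) (snd (pt i) - snd z))\<^sup>2) \<partial>lborel)"
      by (rule nn_integral_cmult) measurable
    also have "\<dots> < \<infinity>" using heat_green_L2[of "snd (pt i)" "fst (pt i)"] pts(3)[of i]
      by (auto simp: S_def ennreal_mult_less_top)
    finally show ?thesis .
  qed
  have "gauss i = (\<lambda>\<omega>. (1 / fst (pt i)) * wiener_integral P W (S i) (f i) \<omega>)" for i
  proof -
    have "wiener_integral P W (S i) (\<lambda>(y, s). heat_green \<alpha> L (fst (pt i)) y (snd (pt i) - s) * \<sigma> y) = wiener_integral P W (S i) (f i)"
      by (rule wiener_integral_cong) (auto simp: S_def f_def clamp)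
    then show ?thesis by (simp add: gauss_def noise_def S_def fun_eq_iff)
  qed
  then have e: "gauss = (\<lambda>i \<omega>. (1 / fst (pt i)) * wiener_integral P W (S i) (f i) \<omega>)" by (rule ext)
  show ?thesis unfolding e
    by (rule exI, rule wiener_integral_gaussian_family[where S=S and f=f and c="\<lambda>i. 1 / fst (pt i)", OF Sm SQ Sf fm L2])
qed

text \<open>This pathwise representation holds on \<open>GG\<close>, whereas \<open>gauss\<close> is
  Gaussian under the whole of \<open>P\<close>. It is the bridge from continuity of \<open>u\<close>
  to boundedness of the Gaussian field on an event of positive probability.\<close>

lemma mean_gauss:
  assumes \<omega>: "\<omega> \<in> GG"
  shows "mean i + gauss i \<omega> = U \<omega> (pt i) - drift (F1 \<omega>) (fst (pt i)) (snd (pt i))"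
proof -
  obtain x t where xt: "pt i = (x, t)" by (cases "pt i")
  have x: "x \<in> {0<..<L}" and t: "t \<in> {0..T}" using pts(3)[of i] xt by auto
  have "u_equation \<omega> x t" using GG(5)[OF \<omega>] xt unfolding good_def by (metis fst_conv snd_conv)
  from u_identity[OF \<omega> this x t]
  have "heat_initial \<alpha> L u0 x t + noise x t \<omega> = x * (U \<omega> (x, t) - drift (F1 \<omega>) x t)" by (simp add: algebra_simps)
  then show ?thesis using x by (simp add: mean_def gauss_def xt add_divide_distrib[symmetric])
qed

lemma drift_F_bound: "t \<in> {0..T} \<Longrightarrow> continuous_on UNIV F \<Longrightarrow> (\<And>z. \<bar>F z\<bar> \<le> A) \<Longrightarrow> x \<in> {0..L} \<Longrightarrow> \<bar>drift F x t\<bar> \<le> A * weight 0"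
  using drift_step(2)[of F A x t] by (simp add: clamp)

text \<open>On \<open>GG\<close> the field \<open>mean + gauss\<close> is bounded path by path, so
  \<open>shifted_moments\<close> applies with \<open>A = GG\<close>. At the dense points
  \<open>w\<close> differs from this field only by the drift of \<open>F2\<close>, at most the
  deterministic \<open>c\<close>, and continuity extends the bound to the rectangle.\<close>

lemma un_moment:
  "(\<integral>\<^sup>+\<omega>. (SUP t \<in> {t. 0 \<le> t \<and> ereal t < \<tau> \<omega>}. ennpowr (H_norm L (\<lambda>x. un x t \<omega>)) p) \<partial>Q) < \<infinity>"
proof -
  obtain C where "gaussian_family P gauss C" using gauss_family by blast
  then interpret g: gaussian_family P gauss C .
  have p0: "p > 0" using p by simp
  define S where "S = (\<lambda>\<omega>. SUP i. ennreal (\<bar>mean i + gauss i \<omega>\<bar> powr p))"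
  have S[measurable]: "S \<in> borel_measurable P" unfolding S_def by measurable
  define c where "c = M * (real n + 1) * weight 0"
  have w0: "0 \<le> weight 0" unfolding weight_def using kap_const(1) by (intro integral_nonneg_AE) auto
  have c: "0 \<le> c" using w0 M by (simp add: c_def)
  have bdd: "\<exists>K. \<forall>i. \<bar>mean i + gauss i \<omega>\<bar> \<le> K" if \<omega>: "\<omega> \<in> GG" for \<omega>
  proof -
    obtain A where A: "\<And>z. \<bar>U \<omega> z\<bar> \<le> A" using U_bounded by blast
    obtain A' where A': "\<And>z. \<bar>F1 \<omega> z\<bar> \<le> A'" using F1(2) by blast
    have "\<bar>mean i + gauss i \<omega>\<bar> \<le> A + A' * weight 0" for i
    proof -
      have "\<bar>drift (F1 \<omega>) (fst (pt i)) (snd (pt i))\<bar> \<le> A' * weight 0"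
        by (rule drift_F_bound[OF _ F1(1) A']) (use pts(3)[of i] in auto)
      then show ?thesis unfolding mean_gauss[OF \<omega>] using A[of "pt i"] by linarith
    qed
    then show ?thesis by blast
  qed
  have mom: "(\<integral>\<^sup>+\<omega>. S \<omega> \<partial>P) < \<infinity>" unfolding S_def
    by (rule g.shifted_moments[OF GG(1,3) p0 bdd])
  define B where "B = (\<lambda>\<omega>. ennreal (2 powr p) * S \<omega> + ennreal ((2 * c) powr p))"
  have bound: "ennpowr (H_norm L (\<lambda>x. un x t \<omega>)) p \<le> B \<omega>" if \<omega>: "\<omega> \<in> GG" and t: "0 \<le> t" "ereal t < \<tau> \<omega>" for \<omega> t
  proof -
    obtain K where K: "\<And>i. \<bar>mean i + gauss i \<omega>\<bar> \<le> K" using bdd[OF \<omega>] by blast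
    have t': "t \<in> {0..T}" using t GG_stopped(1)[OF \<omega>] by simp
    have "S \<omega> \<le> ennreal (K powr p)" unfolding S_def
      using K p0 by (intro SUP_least ennreal_leI powr_mono2) auto
    then obtain q where q: "S \<omega> = ennreal q" "q \<ge> 0" by (cases "S \<omega>") (auto simp: top_unique)
    \<comment> \<open>The real supremum of the field, recovered from the supremum of its
      \<open>p\<close>-th powers.\<close>
    define s where "s = q powr (1 / p)"
    have sp: "s powr p = q" using p0 q by (simp add: s_def powr_powr)
    have s0: "s \<ge> 0" by (simp add: s_def)
    have mg: "\<bar>mean i + gauss i \<omega>\<bar> \<le> s" for i
    proof -
      have "ennreal (\<bar>mean i + gauss i \<omega>\<bar> powr p) \<le> ennreal q" unfolding q(1)[symmetric] S_def by (rule SUP_upper) simp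
      then have "\<bar>mean i + gauss i \<omega>\<bar> powr p \<le> q" using q by simp
      then have "(\<bar>mean i + gauss i \<omega>\<bar> powr p) powr (1 / p) \<le> q powr (1 / p)" using p0 by (intro powr_mono2) auto
      then show ?thesis using p0 by (simp add: powr_powr s_def)
    qed
    have wp: "\<bar>w \<omega> z\<bar> \<le> s + c" if "z \<in> pts" for z
    proof -
      have "z \<in> range pt" using that by (simp only: pts(1))
      then obtain i where i: "z = pt i" by blast
      obtain x r where xr: "pt i = (x, r)" by (cases "pt i")
      have x: "x \<in> {0..L}" and r: "r \<in> {0..T}" using pts(3)[of i] xr by auto
      have "w \<omega> (x, r) = (mean i + gauss i \<omega>) + drift (F2 \<omega>) x r"
        using mean_gauss[OF \<omega>, of i] w_eq[OF x r, of \<omega>] by (simp add: xr)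
      moreover have "\<bar>drift (F2 \<omega>) x r\<bar> \<le> c" unfolding c_def by (rule drift_F_bound[OF r F2 x])
      ultimately show ?thesis using mg[of i] i xr by simp
    qed
    have "\<bar>w \<omega> z\<bar> \<le> s + c" if "z \<in> {0..L} \<times> {0..T}" for z
    proof -
      have wc: "continuous_on (closure pts) (\<lambda>z. \<bar>w \<omega> z\<bar>)" by (intro continuous_on_rabs continuous_on_subset[OF w(1)]) simp
      have zc: "z \<in> closure pts" using that by (simp only: pts(2))
      show ?thesis by (rule continuous_le_on_closure[OF wc zc wp])
    qed
    then have "H_norm L (\<lambda>x. un x t \<omega>) \<le> ennreal (s + c)"
      unfolding H_norm_def using \<omega> t' by (intro SUP_least ennreal_leI) (auto simp: un_def)
    then have "ennpowr (H_norm L (\<lambda>x. un x t \<omega>)) p \<le> ennpowr (ennreal (s + c)) p" by (rule ennpowr_mono[OF p0])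
    also have "\<dots> = ennreal ((s + c) powr p)" using s0 c by (intro ennpowr_ennreal) simp
    also have "\<dots> \<le> ennreal (2 powr p * q + (2 * c) powr p)"
    proof (rule ennreal_leI)
      \<comment> \<open>The sum is at most twice the larger summand, whichever it is.\<close>
      have "(s + c) powr p \<le> (2 * s) powr p + (2 * c) powr p"
      proof (cases "s \<le> c")
        case True
        then have "(s + c) powr p \<le> (2 * c) powr p" using s0 c p0 by (intro powr_mono2) auto
        then show ?thesis by (simp add: add_increasing)
      next
        case False
        then have "(s + c) powr p \<le> (2 * s) powr p" using s0 c p0 by (intro powr_mono2) auto
        then show ?thesis by (simp add: add_increasing2)
      qed
      then show "(s + c) powr p \<le> 2 powr p * q + (2 * c) powr p" using s0 by (simp add: powr_mult sp)
    qed
    also have "\<dots> = B \<omega>" using q by (simp add: B_def ennreal_mult)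
    finally show ?thesis .
  qed
  have "AE \<omega> in Q. (SUP t \<in> {t. 0 \<le> t \<and> ereal t < \<tau> \<omega>}. ennpowr (H_norm L (\<lambda>x. un x t \<omega>)) p) \<le> B \<omega>"
    using GG(4)
  proof eventually_elim
    case (elim \<omega>)
    show ?case by (rule SUP_least) (use bound[OF elim] in blast)
  qed
  then have "(\<integral>\<^sup>+\<omega>. (SUP t \<in> {t. 0 \<le> t \<and> ereal t < \<tau> \<omega>}. ennpowr (H_norm L (\<lambda>x. un x t \<omega>)) p) \<partial>Q) \<le> (\<integral>\<^sup>+\<omega>. B \<omega> \<partial>Q)"
    by (rule nn_integral_mono_AE)
  \<comment> \<open>Conditioning on \<open>Omega_M\<close> costs the factor
    \<open>1 / P(Omega_M)\<close>, finite because the event has positive probability.\<close>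
  also have "\<dots> = (\<integral>\<^sup>+\<omega>. B \<omega> * indicator \<Omega>M \<omega> \<partial>P) / emeasure P \<Omega>M"
    unfolding P_M_def by (rule nn_integral_uniform_measure[OF _ Om]) (unfold B_def, measurable)
  also have "\<dots> \<le> (\<integral>\<^sup>+\<omega>. B \<omega> \<partial>P) / emeasure P \<Omega>M"
    by (intro divide_right_mono_ennreal nn_integral_mono) (auto simp: indicator_def)
  also have "\<dots> < \<infinity>"
  proof -
    have "(\<integral>\<^sup>+\<omega>. B \<omega> \<partial>P) = ennreal (2 powr p) * (\<integral>\<^sup>+\<omega>. S \<omega> \<partial>P) + ennreal ((2 * c) powr p)"
      unfolding B_def by (simp add: nn_integral_add nn_integral_cmult emeasure_space_1)
    then have "(\<integral>\<^sup>+\<omega>. B \<omega> \<partial>P) < \<infinity>" using mom by (simp add: ennreal_mult_less_top)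
    moreover have "emeasure P \<Omega>M \<noteq> 0" using Om_pos by (simp add: emeasure_eq_measure)
    ultimately show ?thesis by (auto simp: less_top[symmetric] ennreal_divide_eq_top_iff)
  qed
  finally show ?thesis .
qed

lemma existence: "cutoff_solution P W \<alpha> L \<sigma> u0 \<zeta> u T M H p un"
  unfolding cutoff_solution_def in_Lp_C_H_def using un_process un_moment un_mild by blast

section \<open>Uniqueness, and moments of an arbitrary solution\<close>

lemma solution_path_equation:
  assumes v: "cutoff_solution P W \<alpha> L \<sigma> u0 \<zeta> u T M H p v"
  shows "AE \<omega> in Q. \<omega> \<in> GG \<and> (\<lambda>x t. v x t \<omega>) \<in> H_paths L (ereal T) \<and>
    (\<forall>i. v (fst (pt i)) (snd (pt i)) \<omega> = heat_initial \<alpha> L u0 (fst (pt i)) (snd (pt i))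
      + set_lebesgue_integral lborel ({0<..<L} \<times> {0..<snd (pt i)})
          (\<lambda>(y, s). heat_green_y \<alpha> L (fst (pt i)) y (snd (pt i) - s) * (ux0 u s \<omega> * y * Tc (v y s \<omega> / y)))
      + noise (fst (pt i)) (snd (pt i)) \<omega>)"
proof -
  have m: "mild_equation Q P W \<alpha> L \<sigma> u0 \<tau> (\<lambda>y s \<omega>. ux0 u s \<omega> * y * Tc (v y s \<omega> / y)) v"
    and pa: "AE \<omega> in Q. (\<lambda>x t. v x t \<omega>) \<in> H_paths L (\<tau> \<omega>)"
    using v by (simp_all only: cutoff_solution_def in_Lp_C_H_def H_process_def)
  have "AE \<omega> in Q. ereal (snd (pt i)) < \<tau> \<omega> \<longrightarrow> v (fst (pt i)) (snd (pt i)) \<omega> = heat_initial \<alpha> L u0 (fst (pt i)) (snd (pt i))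
      + set_lebesgue_integral lborel ({0<..<L} \<times> {0..<snd (pt i)})
          (\<lambda>(y, s). heat_green_y \<alpha> L (fst (pt i)) y (snd (pt i) - s) * (ux0 u s \<omega> * y * Tc (v y s \<omega> / y)))
      + noise (fst (pt i)) (snd (pt i)) \<omega>" for i
  proof -
    have xt: "fst (pt i) \<in> {0<..<L}" "snd (pt i) \<ge> 0" using pts(3)[of i] by auto
    show ?thesis using m[unfolded mild_equation_def, rule_format, OF xt]
      by (rule eventually_mono) (unfold noise_def, blast)
  qed
  then have "AE \<omega> in Q. \<forall>i. ereal (snd (pt i)) < \<tau> \<omega> \<longrightarrow> v (fst (pt i)) (snd (pt i)) \<omega> = heat_initial \<alpha> L u0 (fst (pt i)) (snd (pt i))
      + set_lebesgue_integral lborel ({0<..<L} \<times> {0..<snd (pt i)})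
          (\<lambda>(y, s). heat_green_y \<alpha> L (fst (pt i)) y (snd (pt i) - s) * (ux0 u s \<omega> * y * Tc (v y s \<omega> / y)))
      + noise (fst (pt i)) (snd (pt i)) \<omega>"
    unfolding AE_all_countable by (rule allI)
  with GG(4) pa show ?thesis
  proof eventually_elim
    case (elim \<omega>)
    have "ereal (snd (pt i)) < \<tau> \<omega>" for i using pts(3)[of i] GG_stopped(1)[OF elim(1)] by auto
    then show ?case using elim unfolding GG_stopped(1)[OF elim(1)] by blast
  qed
qed

text \<open>The difference of two solution paths, divided by \<open>x\<close>, solves a homogeneous linear equation on
  every \<open>[0,T']\<close> with \<open>T' < T\<close>; near \<open>T\<close> a path need not stay bounded.\<close>

lemma path_unique:
  fixes v v' :: "real \<Rightarrow> real \<Rightarrow> real"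
  assumes \<omega>: "\<omega> \<in> GG" and v: "v \<in> H_paths L (ereal T)" and v': "v' \<in> H_paths L (ereal T)"
    and eq: "\<And>i. v (fst (pt i)) (snd (pt i)) = R i + set_lebesgue_integral lborel ({0<..<L} \<times> {0..<snd (pt i)})
          (\<lambda>(y, s). heat_green_y \<alpha> L (fst (pt i)) y (snd (pt i) - s) * (ux0 u s \<omega> * y * Tc (v y s / y))) + N i"
    and eq': "\<And>i. v' (fst (pt i)) (snd (pt i)) = R i + set_lebesgue_integral lborel ({0<..<L} \<times> {0..<snd (pt i)})
          (\<lambda>(y, s). heat_green_y \<alpha> L (fst (pt i)) y (snd (pt i) - s) * (ux0 u s \<omega> * y * Tc (v' y s / y))) + N i"
    and t: "0 \<le> t" "t < T" and x: "x \<in> {0..L}"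
  shows "v x t = v' x t"
proof -
  define T' where "T' = (t + T) / 2"
  have T': "0 < T'" "t < T'" "T' < T" using t by (auto simp: T'_def)
  \<comment> \<open>Only the clamping in time and the bounds depend on the horizon;
    \<open>drift\<close> is the same operator for \<open>T'\<close> and for
    \<open>T\<close>.\<close>
  interpret h: heat_horizon \<alpha> L T' by unfold_locales (rule T'(1))
  define q where "q = (\<lambda>v z. quotient v (clamp_x (fst z), h.clamp_t (snd z)))"
  have qc: "continuous_on UNIV (q v)" if "v \<in> H_paths L (ereal T)" for v
    unfolding q_def
  proof (rule continuous_on_compose2[OF quotient_continuous[OF L that]])
    show "continuous_on UNIV (\<lambda>z. (clamp_x (fst z), h.clamp_t (snd z)))"
      by (intro continuous_intros clamp_continuous h.clamp_continuous)
    show "range (\<lambda>z. (clamp_x (fst z), h.clamp_t (snd z))) \<subseteq> {0..L} \<times> {t. 0 \<le> t \<and> ereal t < ereal T}"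
    proof
      fix z assume "z \<in> range (\<lambda>z. (clamp_x (fst z), h.clamp_t (snd z)))"
      then obtain z' where z': "z = (clamp_x (fst z'), h.clamp_t (snd z'))" by blast
      show "z \<in> {0..L} \<times> {t. 0 \<le> t \<and> ereal t < ereal T}"
        using clamp(1)[of "fst z'"] h.clamp(2)[of "snd z'"] T'(3) unfolding z' by simp
    qed
  qed
  have q_eq: "q v (y, s) = v y s / y" if "y \<in> {0<..L}" "s \<in> {0..T'}" for v y s
    using that by (simp add: q_def clamp h.clamp quotient_def)
  define G where "G = (\<lambda>v z. a \<omega> (snd z) * Tc (q v z))"
  have Gc: "continuous_on UNIV (G v)" if "v \<in> H_paths L (ereal T)" for v
    unfolding G_def by (intro continuous_on_mult a_continuous continuous_on_compose2[OF cutoff_T_bounds(3)[OF cutoff] qc[OF that]]) auto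
  have Gb: "\<bar>G v z\<bar> \<le> M * (real n + 1)" for v z unfolding G_def abs_mult
    using M by (intro mult_mono a_bound cutoff_T_bounds(2)[OF cutoff]) auto
  define D where "D = (\<lambda>z. G v z - G v' z)"
  have Dc: "continuous_on UNIV D" unfolding D_def by (intro continuous_on_diff Gc v v')
  have Db: "\<bar>D z\<bar> \<le> M * (real n + 1) + M * (real n + 1)" for z
    unfolding D_def by (intro order_trans[OF abs_triangle_ineq4] add_mono Gb)
  define V where "V = (\<lambda>z. q v z - q v' z)"
  have Vc: "continuous_on UNIV V" unfolding V_def by (intro continuous_on_diff qc v v')
  have Gm: "G v \<in> borel_measurable borel" "G v' \<in> borel_measurable borel"
    by (intro borel_measurable_continuous_onI Gc v v')+
  define S where "S = dense_pts \<inter> ({0<..<L} \<times> {0<..<T'})"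
  have clS: "closure S = {0..L} \<times> {0..T'}" unfolding S_def by (rule dense_pts(2)[OF L T'(1)])
  \<comment> \<open>At the dense points the initial and noise terms of the two equations cancel; by
    continuity the homogeneous equation then holds on the closed rectangle.\<close>
  have onS: "V z - drift D (fst z) (snd z) = 0" if z: "z \<in> S" for z
  proof -
    have "z \<in> pts" using z T'(3) by (auto simp: S_def pts_def)
    then have "z \<in> range pt" by (simp only: pts(1))
    then obtain i where i: "z = pt i" by blast
    obtain y r where yr: "pt i = (y, r)" by (cases "pt i")
    have y: "y \<in> {0<..<L}" "y \<in> {0<..L}" and r: "r \<in> {0..T'}" "r \<in> {0..T}" using z i yr T'(3) by (auto simp: S_def)
    have b: "ux0 u s \<omega> * y * Tc (v y s / y) = y * G v (y, s)" if "y \<in> {0<..<L}" "s \<in> {0..<r}" for v y s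
    proof -
      have "s \<in> {0..T}" "s \<in> {0..T'}" "y \<in> {0<..L}" using that r by auto
      then show ?thesis using a_eq[OF \<omega>, of s] q_eq[of y s v] by (simp add: G_def)
    qed
    have "v y r = R i + y * drift (G v) y r + N i"
      using eq[of i] drift_integral(2)[OF Gc[OF v] Gb r(2) b, of y] by (simp only: yr fst_conv snd_conv)
    moreover have "v' y r = R i + y * drift (G v') y r + N i"
      using eq'[of i] drift_integral(2)[OF Gc[OF v'] Gb r(2) b, of y] by (simp only: yr fst_conv snd_conv)
    ultimately have "v y r - v' y r = y * (drift (G v) y r - drift (G v') y r)" by (simp add: right_diff_distrib)
    also have "drift (G v) y r - drift (G v') y r = drift D y r"
      unfolding D_def by (rule drift_diff[symmetric, OF Gm _ Gb Gb]) (use r in simp)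
    finally have "V (y, r) = drift D y r" using y r by (simp add: V_def q_eq diff_divide_distrib[symmetric])
    then show ?thesis by (simp add: i yr)
  qed
  have cont: "continuous_on (closure S) (\<lambda>z. V z - drift D (fst z) (snd z))"
    unfolding clS by (intro continuous_on_diff continuous_on_subset[OF Vc] continuous_on_subset[OF drift_continuous[OF Dc Db]])
      (use T'(3) in auto)
  have Veq: "V (y, s) = drift D y s" if "y \<in> {0..L}" "s \<in> {0..T'}" for y s
    using continuous_constant_on_closure[OF cont, of 0 "(y, s)"] onS that unfolding clS by simp
  have "bounded (V ` ({0..L} \<times> {0..T'}))"
    by (intro compact_imp_bounded compact_continuous_image continuous_on_subset[OF Vc] compact_Times compact_Icc) auto
  then obtain B where "\<forall>y\<in>V ` ({0..L} \<times> {0..T'}). \<bar>y\<bar> \<le> B" by (simp only: bounded_real) (elim exE)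
  then have B: "\<bar>V (y, s)\<bar> \<le> B" if "y \<in> {0..L}" "s \<in> {0..T'}" for y s using that by blast
  have lip: "\<bar>D (y, s)\<bar> \<le> M * (2 * real n + 3) * \<bar>V (y, s)\<bar>" for y s
  proof -
    have "\<bar>D (y, s)\<bar> = \<bar>a \<omega> s\<bar> * \<bar>Tc (q v (y, s)) - Tc (q v' (y, s))\<bar>"
      by (simp add: D_def G_def abs_mult[symmetric] right_diff_distrib)
    also have "\<dots> \<le> M * ((2 * real n + 3) * \<bar>V (y, s)\<bar>)"
      unfolding V_def using M by (intro mult_mono a_bound cutoff_T_bounds(1)[OF cutoff]) auto
    finally show ?thesis by (simp only: mult.assoc)
  qed
  have "V (x, t) = 0"
    by (rule h.drift_eq_zero[OF borel_measurable_continuous_onI[OF Vc] borel_measurable_continuous_onI[OF Dc] B Veq lip _ x])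
      (use T' t M in auto)
  \<comment> \<open>The quotients determine the paths for \<open>x > 0\<close> only; at
    \<open>x = 0\<close> both vanish because they lie in \<open>H\<close>.\<close>
  moreover have "v 0 t = 0" "v' 0 t = 0" using v v' t by (auto simp: H_paths_def H_space_def)
  ultimately show ?thesis using x t T' q_eq[of x t v] q_eq[of x t v'] by (cases "x = 0") (auto simp: V_def)
qed

lemma uniqueness:
  assumes v: "cutoff_solution P W \<alpha> L \<sigma> u0 \<zeta> u T M H p v" and v': "cutoff_solution P W \<alpha> L \<sigma> u0 \<zeta> u T M H p v'"
  shows "AE \<omega> in Q. \<forall>t x. 0 \<le> t \<and> ereal t < \<tau> \<omega> \<and> x \<in> {0..L} \<longrightarrow> v x t \<omega> = v' x t \<omega>"
  using solution_path_equation[OF v] solution_path_equation[OF v']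
proof eventually_elim
  case (elim \<omega>)
  show ?case
  proof (intro allI impI)
    fix t x assume tx: "0 \<le> t \<and> ereal t < \<tau> \<omega> \<and> x \<in> {0..L}"
    then have t: "0 \<le> t" "t < T" and x: "x \<in> {0..L}" using elim GG_stopped(1) by auto
    show "v x t \<omega> = v' x t \<omega>"
      by (rule path_unique[where \<omega>=\<omega> and v="\<lambda>x t. v x t \<omega>" and v'="\<lambda>x t. v' x t \<omega>", OF _ _ _ _ _ t x])
        (use elim in blast)+
  qed
qed

text \<open>Since \<open>|f| <= L * |f / x|\<close> on the interval, the moment at a fixed time is
  at most \<open>L powr p\<close> times the moment of the pathwise supremum, which membership in the
  solution space makes finite. Only times that precede the stopped time almost surely occur.\<close>

lemma sup_norm_moment:
  assumes v: "cutoff_solution P W \<alpha> L \<sigma> u0 \<zeta> u T M H p v"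
  shows "(SUP t \<in> {t. 0 \<le> t \<and> (AE \<omega> in Q. ereal t < \<tau> \<omega>)}. \<integral>\<^sup>+ \<omega>. ennpowr (Linf_norm L (\<lambda>x. v x t \<omega>)) p \<partial>Q) < \<infinity>"
proof -
  have p0: "p > 0" using p by simp
  define E where "E = (\<integral>\<^sup>+ \<omega>. (SUP t \<in> {t. 0 \<le> t \<and> ereal t < \<tau> \<omega>}. ennpowr (H_norm L (\<lambda>x. v x t \<omega>)) p) \<partial>Q)"
  have E: "E < \<infinity>" and pa: "AE \<omega> in Q. (\<lambda>x t. v x t \<omega>) \<in> H_paths L (\<tau> \<omega>)"
    using v by (simp_all only: cutoff_solution_def in_Lp_C_H_def H_process_def E_def)
  define X where "X = (\<integral>\<^sup>+ \<omega>. ennreal (L powr p) * (SUP t \<in> {t. 0 \<le> t \<and> ereal t < \<tau> \<omega>}. ennpowr (H_norm L (\<lambda>x. v x t \<omega>)) p) \<partial>Q)"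
  have "(SUP t \<in> {t. 0 \<le> t \<and> (AE \<omega> in Q. ereal t < \<tau> \<omega>)}. \<integral>\<^sup>+ \<omega>. ennpowr (Linf_norm L (\<lambda>x. v x t \<omega>)) p \<partial>Q) \<le> X"
  proof (rule SUP_least)
    fix t assume "t \<in> {t. 0 \<le> t \<and> (AE \<omega> in Q. ereal t < \<tau> \<omega>)}"
    then have t: "0 \<le> t" and ae: "AE \<omega> in Q. ereal t < \<tau> \<omega>" by auto
    have "AE \<omega> in Q. ennpowr (Linf_norm L (\<lambda>x. v x t \<omega>)) p \<le> ennreal (L powr p) * (SUP t \<in> {t. 0 \<le> t \<and> ereal t < \<tau> \<omega>}. ennpowr (H_norm L (\<lambda>x. v x t \<omega>)) p)"
      using ae pa
    proof eventually_elim
      case (elim \<omega>)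
      have "(\<lambda>x. v x t \<omega>) \<in> H_space L" using elim t by (simp add: H_paths_def)
      then have "ennpowr (Linf_norm L (\<lambda>x. v x t \<omega>)) p \<le> ennpowr (ennreal L * H_norm L (\<lambda>x. v x t \<omega>)) p"
        by (intro ennpowr_mono p0 Linf_norm_le_H_norm L)
      also have "\<dots> = ennreal (L powr p) * ennpowr (H_norm L (\<lambda>x. v x t \<omega>)) p" by (rule ennpowr_mult[OF L p0])
      also have "\<dots> \<le> ennreal (L powr p) * (SUP t \<in> {t. 0 \<le> t \<and> ereal t < \<tau> \<omega>}. ennpowr (H_norm L (\<lambda>x. v x t \<omega>)) p)"
        by (intro mult_left_mono SUP_upper) (use t elim in auto)
      finally show ?case .
    qed
    then show "(\<integral>\<^sup>+ \<omega>. ennpowr (Linf_norm L (\<lambda>x. v x t \<omega>)) p \<partial>Q) \<le> X" unfolding X_def by (rule nn_integral_mono_AE)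
  qed
  also have "X \<le> ennreal (L powr p) * E" unfolding X_def E_def
    by (rule nn_integral_cmult_le) (use L in simp)
  also have "\<dots> < \<infinity>" using E by (simp add: ennreal_mult_less_top)
  finally show ?thesis .
qed

end

theorem theorem3p6:
  fixes P :: "'a measure"
    and W :: "(real \<times> real) set \<Rightarrow> 'a \<Rightarrow> real"
    and u :: "real \<Rightarrow> real \<Rightarrow> 'a \<Rightarrow> real"
    and \<zeta> :: "'a \<Rightarrow> ereal"
    and \<sigma> u0 H :: "real \<Rightarrow> real"
    and \<alpha> L T M p :: real
    and n :: nat
  assumes "\<alpha> > 0" and "L > 0"
    and "prob_space P"
    and "space_time_white_noise P L W"
    and "admissible_noise_coeff L \<sigma>"
    and "admissible_initial L u0"
    and "maximal_solution P W \<alpha> L \<sigma> u0 \<zeta> u"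
    and "T > 0" and "M > 0"
    and "Omega_M P u \<zeta> T M \<in> sets P" and "measure P (Omega_M P u \<zeta> T M) > 0"
    and "cutoff_function n H"
    and "p \<ge> 2"
  shows "(\<exists>un. cutoff_solution P W \<alpha> L \<sigma> u0 \<zeta> u T M H p un)
    \<and> (\<forall>un vn. cutoff_solution P W \<alpha> L \<sigma> u0 \<zeta> u T M H p un
              \<and> cutoff_solution P W \<alpha> L \<sigma> u0 \<zeta> u T M H p vn \<longrightarrow>
          (AE \<omega> in P_M P u \<zeta> T M.
             \<forall>t x. 0 \<le> t \<and> ereal t < stopped_time u \<zeta> T M \<omega> \<and> x \<in> {0..L} \<longrightarrow>
                   un x t \<omega> = vn x t \<omega>))
    \<and> (\<forall>un. cutoff_solution P W \<alpha> L \<sigma> u0 \<zeta> u T M H p un \<longrightarrow>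
          (SUP t \<in> {t. 0 \<le> t \<and> (AE \<omega> in P_M P u \<zeta> T M. ereal t < stopped_time u \<zeta> T M \<omega>)}.
             \<integral>\<^sup>+ \<omega>. ennpowr (Linf_norm L (\<lambda>x. un x t \<omega>)) p \<partial>P_M P u \<zeta> T M) < \<infinity>)"
proof -
  interpret cutoff_setting P L W \<alpha> T \<sigma> u0 H \<zeta> u M p n
    by (intro cutoff_setting.intro white_noise.intro white_noise_axioms.intro heat_horizon.intro
      dirichlet_heat.intro heat_horizon_axioms.intro cutoff_setting_axioms.intro) (fact assms)+
  show ?thesis
  proof (intro conjI allI impI)
    show "\<exists>un. cutoff_solution P W \<alpha> L \<sigma> u0 \<zeta> u T M H p un" by (rule exI) (rule existence)
  next
    fix un vn
    assume "cutoff_solution P W \<alpha> L \<sigma> u0 \<zeta> u T M H p un \<and> cutoff_solution P W \<alpha> L \<sigma> u0 \<zeta> u T M H p vn"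
    then show "AE \<omega> in P_M P u \<zeta> T M. \<forall>t x. 0 \<le> t \<and> ereal t < stopped_time u \<zeta> T M \<omega> \<and> x \<in> {0..L} \<longrightarrow>
                   un x t \<omega> = vn x t \<omega>"
      by (elim conjE) (rule uniqueness)
  next
    fix un assume "cutoff_solution P W \<alpha> L \<sigma> u0 \<zeta> u T M H p un"
    then show "(SUP t \<in> {t. 0 \<le> t \<and> (AE \<omega> in P_M P u \<zeta> T M. ereal t < stopped_time u \<zeta> T M \<omega>)}.
             \<integral>\<^sup>+ \<omega>. ennpowr (Linf_norm L (\<lambda>x. un x t \<omega>)) p \<partial>P_M P u \<zeta> T M) < \<infinity>"
      by (rule sup_norm_moment)
  qed
qed

end
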